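(* Let $E_2,E_3\subset\mathbb{R}$ be measurable sets of finite measure and $f_2,f_3$ functions with $|f_2|\le1_{E_2}$, $|f_3|\le1_{E_3}$. Let $\mathbb{P}$ and $\mathbb{Q}$ be as in a $\Lambda_2$-model, let $\mathbb{P}^0\subset\mathbb{P}$ be a subcollection such that the tiles $\{P_2:\vec P\in\mathbb{P}^0\}$ are pairwise disjoint (as subsets of the time–frequency plane $I_{\vec P}\times\omega_{P_2}$), and let $\tilde{\mathbb{Q}}\subset\mathbb{Q}$. For $\mathfrak b\in\mathbb{Z}$ let $$\mathbb{P}^0_{\mathfrak b}(\tilde{\mathbb{Q}})=\Big\{\vec P\in\mathbb{P}^0:\ 2^{-\mathfrak b-1}<|I_{\vec P}|^{-1/2}\Big|\Big\langle\int_0^1BHT^{\alpha,\tilde{\mathbb{Q}}}_{\omega_{P_2}}(f_2,f_3)\,d\alpha,\ \Phi_{P_2,0}\Big\rangle\Big|\le2^{-\mathfrak b}\Big\}.$$ Then for every $0<\tilde\epsilon<1$, $$\sum_{\vec P\in\mathbb{P}^0_{\mathfrak b}(\tilde{\mathbb{Q}})}|I_{\vec P}|\le C_{\tilde\epsilon}\,2^{\frac{\mathfrak b}{1-\tilde\epsilon}}|E_2|^{1/2}|E_3|^{1/2},$$ with $C_{\tilde\epsilon}$ independent of $\mathfrak b$, $E_2,E_3$, the collections and the wave packets.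
   Context: Tiles, tri-tiles, wave packets, adapted, rank-1, $\subset\subset$ as follows. For $\sigma\in\{0,\frac13,\frac23\}$, $D_\sigma=\{2^j(k+[0,1)+(-1)^j\sigma)\}$. A tile is $P=(I_P,\omega_P)$ with $I_P\in D_0$, $\omega_P\in D_\sigma$, $|I_P||\omega_P|=1$; a tri-tile is a triple of tiles sharing the time interval $I_{\vec P}$. $\chi_I(x)=(1+|x-c_I|/|I|)^{-1}$. A wave packet on $P$ is $\Phi_P$ with $\mathrm{supp}\hat\Phi_P\subset\frac9{10}\omega_P$ and $|\frac{d^k}{dx^k}[e^{-2\pi ic_{\omega_P}x}\Phi_P(x)]|\le C_k|I_P|^{-1/2-k}\chi_{I_P}^L(x)$, $0\le k\le K$ ($K,L$ large fixed). $\vec P$ adapted to $\Gamma$: $\mathrm{dist}(\omega_{\vec P},\Gamma)\simeq|I_{\vec P}|^{-1}$. Orders: $P'\le P$ iff $P'=P$ or ($I_{P'}\subsetneq I_P$ and $3\omega_P\subseteq3\omega_{P'}$); $P'\lesssim P$ iff $I_{P'}\subseteq I_P$ and $10^7\omega_P\subseteq10^7\omega_{P'}$; $P'\lesssim'P$ iff $P'\lesssim P$ and not $P'\le P$. Rank-1 collection: distinct tri-tiles differ in every component; $P'_j\le P_j$ for some $j$ implies $P'_i\lesssim P_i$ for all $i$, and if also $|I_{\vec P'}|>10^9|I_{\vec P}|$ then $P'_i\lesssim'P_i$ for $i\ne j$. $\omega_1\subset\subset\omega_2$: $|\omega_1|\le c|\omega_2|$ (fixed small $c$) and $\omega_1\subset\frac9{10}\omega_2$.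 $BHT^{\alpha,\tilde{\mathbb{Q}}}_\omega(f_2,f_3)=\sum_{\vec Q\in\tilde{\mathbb{Q}}:\omega_{Q_3}\subset\subset\omega}|I_{\vec Q}|^{-1/2}\langle f_2,\Phi^\alpha_{Q_1,2}\rangle\langle f_3,\Phi^\alpha_{Q_2,3}\rangle\Phi^\alpha_{Q_3,5}$ with wave packets $\Phi^\alpha_{Q_k,j}$ on $Q_k$, $\alpha\in[0,1]$. In a $\Lambda_2$-model, $\mathbb{P}$ is a finite collection of tri-tiles $(P_1,P_2,P_4)$ adapted to $\{\xi_1=-\xi_2,\xi_3=0\}$ with wave packets $\Phi_{P_2,0}$ on $P_2$, and $\mathbb{Q}$ is a finite rank-1 collection of tri-tiles adapted to $\{\xi_1=-\xi_2/2=-\xi_3\}$; both collections are assumed sparse: all tri-tiles have the same shift and for distinct frequency cubes $Q\ne Q'$, $|Q|<|Q'|$ implies $|10^9Q|<|Q'|$ and $|Q|=|Q'|$ implies $10^9Q\cap10^9Q'=\emptyset$.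
   Formalization: In the rank-1 definition the condition |I_{P'}|>10^9|I_P|, which can never hold when P'_j≤P_j, is replaced by |I_P|>10^9|I_{P'}|; the wave packets are also assumed jointly measurable in (α,x) so that the integral over α is defined. *)

theory Defs
  imports "HOL-Analysis.Analysis"
begin

text \<open>An interval is encoded by its left endpoint and its length; it stands for the
half-open interval [a, a+l).\<close>
type_synonym ivl = "real \<times> real"

definition ivl_set :: "ivl \<Rightarrow> real set" where
  "ivl_set J = {fst J ..< fst J + snd J}"

definition len :: "ivl \<Rightarrow> real" where
  "len J = snd J"

definition ctr :: "ivl \<Rightarrow> real" where
  "ctr J = fst J + snd J / 2"

definition dil :: "real \<Rightarrow> ivl \<Rightarrow> ivl" where
  "dil t J = (ctr J - t * len J / 2, t * len J)"

definition in_D :: "real \<Rightarrow> ivl \<Rightarrow> bool" where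
  "in_D \<sigma> J \<longleftrightarrow> (\<exists>j k :: int. snd J = 2 powr j \<and>
      fst J = 2 powr j * (real_of_int k + (if even j then \<sigma> else - \<sigma>)))"

definition shifts :: "real set" where
  "shifts = {0, 1/3, 2/3}"

text \<open>A tile is a pair (I, omega).\<close>
type_synonym tile = "ivl \<times> ivl"

definition is_tile :: "tile \<Rightarrow> bool" where
  "is_tile P \<longleftrightarrow> in_D 0 (fst P) \<and> (\<exists>\<sigma>\<in>shifts. in_D \<sigma> (snd P))
      \<and> len (fst P) * len (snd P) = 1"

text \<open>A tri-tile is encoded as (I, omega_1, omega_2, omega_3): three tiles sharing the time
interval I. For the collection P of a Lambda_2-model, whose tri-tiles are written
(P_1,P_2,P_4), the positions 1,2,3 correspond to P_1,P_2,P_4.\<close>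
type_synonym tritile = "ivl \<times> ivl \<times> ivl \<times> ivl"

definition tI :: "tritile \<Rightarrow> ivl" where
  "tI T = fst T"

definition tw :: "tritile \<Rightarrow> nat \<Rightarrow> ivl" where
  "tw T i = (case T of (I, w1, w2, w3) \<Rightarrow> if i = 1 then w1 else if i = 2 then w2 else w3)"

definition comp :: "tritile \<Rightarrow> nat \<Rightarrow> tile" where
  "comp T i = (tI T, tw T i)"

definition is_tritile :: "tritile \<Rightarrow> bool" where
  "is_tritile T \<longleftrightarrow> (\<forall>i\<in>{1,2,3}. is_tile (comp T i))"

definition fcube :: "tritile \<Rightarrow> (real \<times> real \<times> real) set" where
  "fcube T = ivl_set (tw T 1) \<times> ivl_set (tw T 2) \<times> ivl_set (tw T 3)"

definition dil_fcube :: "real \<Rightarrow> tritile \<Rightarrow> (real \<times> real \<times> real) set" where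
  "dil_fcube t T = ivl_set (dil t (tw T 1)) \<times> ivl_set (dil t (tw T 2)) \<times> ivl_set (dil t (tw T 3))"

definition adapted :: "real \<Rightarrow> real \<Rightarrow> (real \<times> real \<times> real) set \<Rightarrow> tritile \<Rightarrow> bool" where
  "adapted a1 a2 \<Gamma> T \<longleftrightarrow>
     a1 / len (tI T) \<le> setdist (fcube T) \<Gamma> \<and> setdist (fcube T) \<Gamma> \<le> a2 / len (tI T)"

definition Gamma_P :: "(real \<times> real \<times> real) set" where
  "Gamma_P = {(x, y, z). x = - y \<and> z = 0}"

definition Gamma_Q :: "(real \<times> real \<times> real) set" where
  "Gamma_Q = {(x, y, z). x = - y / 2 \<and> - y / 2 = - z}"

definition tile_le :: "tile \<Rightarrow> tile \<Rightarrow> bool" where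
  "tile_le P' P \<longleftrightarrow> P' = P \<or>
     (ivl_set (fst P') \<subset> ivl_set (fst P) \<and> ivl_set (dil 3 (snd P)) \<subseteq> ivl_set (dil 3 (snd P')))"

definition tile_lesssim :: "tile \<Rightarrow> tile \<Rightarrow> bool" where
  "tile_lesssim P' P \<longleftrightarrow>
     ivl_set (fst P') \<subseteq> ivl_set (fst P) \<and> ivl_set (dil (10^7) (snd P)) \<subseteq> ivl_set (dil (10^7) (snd P'))"

definition tile_lesssim' :: "tile \<Rightarrow> tile \<Rightarrow> bool" where
  "tile_lesssim' P' P \<longleftrightarrow> tile_lesssim P' P \<and> \<not> tile_le P' P"

definition rank1 :: "tritile set \<Rightarrow> bool" where
  "rank1 S \<longleftrightarrow>
     (\<forall>T\<in>S. \<forall>T'\<in>S. T \<noteq> T' \<longrightarrow> (\<forall>i\<in>{1,2,3}. comp T i \<noteq> comp T' i)) \<and>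
     (\<forall>T\<in>S. \<forall>T'\<in>S. \<forall>j\<in>{1,2,3}. tile_le (comp T' j) (comp T j) \<longrightarrow>
        (\<forall>i\<in>{1,2,3}. tile_lesssim (comp T' i) (comp T i)) \<and>
        (len (tI T) > 10^9 * len (tI T') \<longrightarrow>
           (\<forall>i\<in>{1,2,3}. i \<noteq> j \<longrightarrow> tile_lesssim' (comp T' i) (comp T i))))"

text \<open>Sparseness: common shift, and separation of distinct frequency cubes
(size of a cube = its side length).\<close>
definition sparse :: "tritile set \<Rightarrow> bool" where
  "sparse S \<longleftrightarrow>
     (\<exists>\<sigma> :: nat \<Rightarrow> real. (\<forall>i\<in>{1,2,3}. \<sigma> i \<in> shifts) \<and>
        (\<forall>T\<in>S. \<forall>i\<in>{1,2,3}. in_D (\<sigma> i) (tw T i))) \<and>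
     (\<forall>T\<in>S. \<forall>T'\<in>S. fcube T \<noteq> fcube T' \<longrightarrow>
        (len (tw T 1) < len (tw T' 1) \<longrightarrow> 10^9 * len (tw T 1) < len (tw T' 1)) \<and>
        (len (tw T 1) = len (tw T' 1) \<longrightarrow> dil_fcube (10^9) T \<inter> dil_fcube (10^9) T' = {}))"

definition fourier :: "(real \<Rightarrow> complex) \<Rightarrow> real \<Rightarrow> complex" where
  "fourier f \<xi> = integral\<^sup>L lborel (\<lambda>x. f x * cis (- 2 * pi * x * \<xi>))"

definition vderiv :: "(real \<Rightarrow> complex) \<Rightarrow> real \<Rightarrow> complex" where
  "vderiv g = (\<lambda>x. vector_derivative g (at x))"

definition chi :: "ivl \<Rightarrow> real \<Rightarrow> real" where
  "chi I x = 1 / (1 + \<bar>x - ctr I\<bar> / len I)"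

text \<open>Phi is a wave packet on the tile P (with regularity parameters K, L and constants Ck).
Support of the Fourier transform in (9/10) omega_P is expressed as vanishing of the Fourier
transform outside the closed interval (9/10) omega_P.\<close>
definition wave_packet :: "nat \<Rightarrow> nat \<Rightarrow> (nat \<Rightarrow> real) \<Rightarrow> tile \<Rightarrow> (real \<Rightarrow> complex) \<Rightarrow> bool" where
  "wave_packet K L Ck P \<Phi> \<longleftrightarrow>
     (\<forall>\<xi>. \<bar>\<xi> - ctr (snd P)\<bar> > (9/10) * len (snd P) / 2 \<longrightarrow> fourier \<Phi> \<xi> = 0) \<and>
     (let g = (\<lambda>x. cis (- 2 * pi * ctr (snd P) * x) * \<Phi> x) in
       (\<forall>k<K. \<forall>x. ((vderiv ^^ k) g) differentiable (at x)) \<and>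
       (\<forall>k\<le>K. \<forall>x. norm ((vderiv ^^ k) g x)
            \<le> Ck k * len (fst P) powr (- 1/2 - real k) * chi (fst P) x ^ L))"

definition inner_L2 :: "(real \<Rightarrow> complex) \<Rightarrow> (real \<Rightarrow> complex) \<Rightarrow> complex" where
  "inner_L2 f g = integral\<^sup>L lebesgue (\<lambda>x. f x * cnj (g x))"

definition cc_sub :: "real \<Rightarrow> ivl \<Rightarrow> ivl \<Rightarrow> bool" where
  "cc_sub c w1 w2 \<longleftrightarrow> len w1 \<le> c * len w2 \<and> ivl_set w1 \<subseteq> ivl_set (dil (9/10) w2)"

text \<open>PhiQ alpha k Q is the wave packet Phi^alpha_{Q_k, j} (j = 2, 3, 5 for k = 1, 2, 3).\<close>
definition BHT :: "real \<Rightarrow> tritile set \<Rightarrow> (real \<Rightarrow> nat \<Rightarrow> tritile \<Rightarrow> real \<Rightarrow> complex)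
    \<Rightarrow> real \<Rightarrow> ivl \<Rightarrow> (real \<Rightarrow> complex) \<Rightarrow> (real \<Rightarrow> complex) \<Rightarrow> real \<Rightarrow> complex" where
  "BHT c Qt PhiQ \<alpha> \<omega> f2 f3 x =
     (\<Sum>Q\<in>{Q\<in>Qt. cc_sub c (tw Q 3) \<omega>}.
        complex_of_real (len (tI Q) powr (- 1/2)) * inner_L2 f2 (PhiQ \<alpha> 1 Q)
          * inner_L2 f3 (PhiQ \<alpha> 2 Q) * PhiQ \<alpha> 3 Q x)"

definition BHT_avg :: "real \<Rightarrow> tritile set \<Rightarrow> (real \<Rightarrow> nat \<Rightarrow> tritile \<Rightarrow> real \<Rightarrow> complex)
    \<Rightarrow> ivl \<Rightarrow> (real \<Rightarrow> complex) \<Rightarrow> (real \<Rightarrow> complex) \<Rightarrow> real \<Rightarrow> complex" where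
  "BHT_avg c Qt PhiQ \<omega> f2 f3 x = (LINT \<alpha>:{0..1}|lborel. BHT c Qt PhiQ \<alpha> \<omega> f2 f3 x)"

definition Pb :: "real \<Rightarrow> tritile set \<Rightarrow> (real \<Rightarrow> nat \<Rightarrow> tritile \<Rightarrow> real \<Rightarrow> complex)
    \<Rightarrow> (tritile \<Rightarrow> real \<Rightarrow> complex) \<Rightarrow> (real \<Rightarrow> complex) \<Rightarrow> (real \<Rightarrow> complex)
    \<Rightarrow> tritile set \<Rightarrow> int \<Rightarrow> tritile set" where
  "Pb c Qt PhiQ Phi0 f2 f3 P0 b =
     {P\<in>P0. let v = len (tI P) powr (- 1/2) *
                  norm (inner_L2 (BHT_avg c Qt PhiQ (tw P 2) f2 f3) (Phi0 P)) in
        2 powr (- real_of_int b - 1) < v \<and> v \<le> 2 powr (- real_of_int b)}"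

end

theory Submission
  imports Defs "HOL-Probability.Sinc_Integral" "HOL-Probability.Characteristic_Functions"
begin

text \<open>Choosing phases for the pairings with the wave packets of the level set, the claim reduces to a bound
  for the trilinear form \<open>\<Sum>\<^sub>Q |I\<^sub>Q|\<^bsup>-1/2\<^esup> a\<^sub>1 a\<^sub>2 a\<^sub>3\<close>, uniformly in alpha; here \<open>a\<^sub>1\<close>, \<open>a\<^sub>2\<close> are
  coefficients of \<open>f\<^sub>2\<close>, \<open>f\<^sub>3\<close>, and \<open>a\<^sub>3\<close> is the coefficient of the sum of the \<open>\<gamma>\<^sub>P \<Phi>\<^sub>P\<close> over those P with
  \<open>\<omega>\<^bsub>Q,3\<^esub>\<close> well inside \<open>\<omega>\<^sub>P\<close>. With \<open>S = \<Sum>|I\<^sub>P|\<close>, a bound \<open>C S\<^bsup>\<epsilon>\<^esup> (|E\<^sub>2||E\<^sub>3|)\<^bsup>(1-\<epsilon>)/2\<^esup>\<close> for the form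
  can be compared with the lower bound \<open>2\<^bsup>-b-1\<^esup> S\<close> coming from the level set.

  The form is estimated by selecting trees according to size and energy. The point is to sort the Q by the
  density \<open>\<delta>\<close> of the time intervals of the P around \<open>I\<^sub>Q\<close>: at density \<open>\<delta>\<close> the third size is \<open>O(\<delta>)\<close>, while the
  energies of \<open>f\<^sub>2\<close>, \<open>f\<^sub>3\<close>, localised by a Vitali covering, are \<open>O(min(|E\<^sub>i|, S/\<delta>))\<close>. Interpolation leaves a
  positive power of \<open>\<delta>\<close>, so the density levels sum up. Almost orthogonality comes from disjoint Fourier
  supports; multiplication by a polynomial weight keeps these supports and localises in time.\<close>

abbreviation (input) lenI :: "tritile => real" where "lenI Q \<equiv> len (tI Q)"
abbreviation (input) ctrI :: "tritile => real" where "ctrI Q \<equiv> ctr (tI Q)"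
abbreviation (input) setI :: "tritile => real set" where "setI Q \<equiv> ivl_set (tI Q)"
abbreviation (input) chiI :: "tritile => real => real" where "chiI Q \<equiv> chi (tI Q)"
abbreviation (input) lenw :: "tritile => nat => real" where "lenw Q i \<equiv> len (tw Q i)"
abbreviation (input) ctrw :: "tritile => nat => real" where "ctrw Q i \<equiv> ctr (tw Q i)"
abbreviation (input) setw :: "tritile => nat => real set" where "setw Q i \<equiv> ivl_set (tw Q i)"

subsection \<open>Dyadic grids\<close>

lemma in_D_pos: "in_D \<sigma> J ==> 0 < len J"
 by (auto simp: in_D_def len_def)

lemma iv_subset_iff:
 "0 < len J ==> ivl_set J \<subseteq> ivl_set J' \<longleftrightarrow> fst J' <= fst J \<and> fst J + len J <= fst J' + len J'"
 by (auto simp: ivl_set_def len_def ivl_subset)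

lemma mem_iv: "x \<in> ivl_set J \<longleftrightarrow> fst J <= x \<and> x < fst J + len J"
 by (auto simp: ivl_set_def len_def)

lemma mem_iv_ctr: "x \<in> ivl_set J \<longleftrightarrow> ctr J - len J / 2 <= x \<and> x < ctr J + len J / 2"
 by (auto simp: ivl_set_def len_def ctr_def)

lemma ctr_mem: "0 < len J ==> ctr J \<in> ivl_set J"
 by (auto simp: mem_iv_ctr)

lemma dil_simps [simp]: "len (dil t J) = t * len J" "ctr (dil t J) = ctr J"
 by (auto simp: dil_def len_def ctr_def)

lemma fst_eq_ctr: "fst J = ctr J - len J / 2"
 by (simp add: ctr_def len_def)

lemma iv_subset_ctr:
 "0 < len J ==> ivl_set J \<subseteq> ivl_set J' \<longleftrightarrow> \<bar>ctr J' - ctr J\<bar> <= (len J' - len J) / 2"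
 unfolding iv_subset_iff fst_eq_ctr abs_le_iff by (auto simp: field_simps)

lemma ivl_eqI: "fst I = fst J ==> len I = len J ==> I = J"
 by (auto simp: len_def prod_eq_iff)

lemma ivl_eq_iv: "0 < len I ==> 0 < len J ==> ivl_set I = ivl_set J \<longleftrightarrow> I = J"
 using iv_subset_iff[of I J] iv_subset_iff[of J I] by (auto intro!: ivl_eqI)

lemma shift_int:
 assumes "\<sigma> \<in> shifts"
 shows "\<exists>z::int. 2 ^ n * (if even (j + int n) then \<sigma> else - \<sigma>) - (if even j then \<sigma> else - \<sigma>) = real_of_int z"
proof (induction n)
 case 0
 then show ?case by (auto intro: exI[of _ 0])
next
 case (Suc n)
 then obtain z :: int where z: "2 ^ n * (if even (j + int n) then \<sigma> else - \<sigma>) - (if even j then \<sigma> else - \<sigma>) = real_of_int z"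
  by blast
 define s where "s = (if even j then \<sigma> else - \<sigma>)"
 obtain w :: int where w: "3 * s = real_of_int w"
 proof -
  have "s \<in> {0, 1/3, 2/3, -1/3, -2/3}" using assms by (auto simp: shifts_def s_def)
  then have "3 * s \<in> real_of_int ` {0, 1, 2, -1, -2}" by auto
  then show ?thesis using that by blast
 qed
 have "2 ^ Suc n * (if even (j + int (Suc n)) then \<sigma> else - \<sigma>) =
   - 2 * (2 ^ n * (if even (j + int n) then \<sigma> else - \<sigma>))"
  by auto
 also have "... = - 2 * (s + z)"
  using z by (simp add: s_def)
 finally have "2 ^ Suc n * (if even (j + int (Suc n)) then \<sigma> else - \<sigma>) - s = real_of_int (- w - 2 * z)"
  using w by simp
 then show ?case unfolding s_def by blast
qed

lemma grid_rel:
 assumes "\<sigma> \<in> shifts" "in_D \<sigma> J" "in_D \<sigma> J'" "len J <= len J'"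
 obtains z :: int and n :: nat where "fst J' = fst J + len J * z" "len J' = len J * 2 ^ n"
proof -
 obtain j k :: int where j: "snd J = 2 powr j" "fst J = 2 powr j * (real_of_int k + (if even j then \<sigma> else - \<sigma>))"
  using assms(2) unfolding in_D_def by blast
 obtain j' k' :: int where j': "snd J' = 2 powr j'" "fst J' = 2 powr j' * (real_of_int k' + (if even j' then \<sigma> else - \<sigma>))"
  using assms(3) unfolding in_D_def by blast
 have "j <= j'" using assms(4) j(1) j'(1) by (simp add: len_def)
 then obtain n where n: "j' = j + int n" using zle_iff_zadd by blast
 have p: "2 powr real_of_int j' = 2 powr j * 2 ^ n"
  by (simp add: n powr_add powr_realpow)
 obtain z :: int where z: "2 ^ n * (if even (j + int n) then \<sigma> else - \<sigma>) - (if even j then \<sigma> else - \<sigma>) = real_of_int z"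
  using shift_int[OF assms(1), of n j] by blast
 have "fst J' = 2 powr j * (2 ^ n * k' + 2 ^ n * (if even (j + int n) then \<sigma> else - \<sigma>))"
  unfolding j'(2) p unfolding n
  by (simp only: distrib_left mult.assoc of_int_mult of_int_power of_int_numeral)
 also have "... = 2 powr j * (2 ^ n * k' + z + (if even j then \<sigma> else - \<sigma>))"
  using z by (simp add: algebra_simps)
 also have "... = fst J + len J * real_of_int (2 ^ n * k' + z - k)"
  unfolding j(2) len_def j(1) by (simp add: algebra_simps)
 finally show ?thesis
  using p j(1) j'(1) by (intro that[of "2 ^ n * k' + z - k" n]) (auto simp: len_def)
qed

lemma grid_nest:
 assumes "\<sigma> \<in> shifts" "in_D \<sigma> J" "in_D \<sigma> J'" "len J <= len J'" "ivl_set J \<inter> ivl_set J' \<noteq> {}"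
 shows "ivl_set J \<subseteq> ivl_set J'"
proof -
 obtain z n where z: "fst J' = fst J + len J * real_of_int z" "len J' = len J * 2 ^ n"
  using grid_rel[OF assms(1-4)] by blast
 have p: "0 < len J" using in_D_pos assms by blast
 obtain x where x: "fst J <= x" "x < fst J + len J" "fst J' <= x" "x < fst J' + len J'"
  using assms(5) by (auto simp: mem_iv)
 have "len J * real_of_int z < len J * 1" using x z by linarith
 then have "real_of_int z < 1" using mult_less_cancel_left_pos[OF p] by blast
 then have "z <= 0" by linarith
 moreover have "len J * 0 < len J * (real_of_int z + 2 ^ n)" using x z by (simp add: algebra_simps)
 then have "0 < real_of_int z + 2 ^ n" using mult_less_cancel_left_pos[OF p] by blast
 then have "0 < real_of_int (z + 2 ^ n)" by simp
 then have "1 <= z + 2 ^ n" by linarith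
 then have "1 <= real_of_int (z + 2 ^ n)" by linarith
 then have "len J * 1 <= len J * (real_of_int z + 2 ^ n)" using p by (intro mult_left_mono) auto
 ultimately show ?thesis using z p
  by (subst iv_subset_iff) (auto simp: algebra_simps mult_nonneg_nonpos)
qed

lemma grid_len2:
 assumes "\<sigma> \<in> shifts" "in_D \<sigma> J" "in_D \<sigma> J'" "len J < len J'"
 shows "2 * len J <= len J'"
proof -
 obtain z n where z: "fst J' = fst J + len J * real_of_int z" "len J' = len J * 2 ^ n"
  using grid_rel[OF assms(1-3)] assms(4) by (metis less_imp_le)
 have p: "0 < len J" using in_D_pos assms by blast
 have "n \<noteq> 0" using z assms(4) by (intro notI) simp
 then have "(2::real) ^ 1 <= 2 ^ n" by (intro power_increasing) auto
 then show ?thesis using z p by simp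
qed

lemma grid_same:
 assumes "\<sigma> \<in> shifts" "in_D \<sigma> J" "in_D \<sigma> J'" "len J = len J'" "ivl_set J \<inter> ivl_set J' \<noteq> {}"
 shows "J = J'"
proof -
 have "ivl_set J \<subseteq> ivl_set J'" "ivl_set J' \<subseteq> ivl_set J"
  using grid_nest[OF assms(1,2,3)] grid_nest[OF assms(1,3,2)] assms(4,5) by auto
 then show ?thesis using in_D_pos[OF assms(2)] in_D_pos[OF assms(3)] by (simp add: ivl_eq_iv[symmetric])
qed

lemma zero_shift: "0 \<in> shifts" by (simp add: shifts_def)

lemma dyadic_parent:
 assumes "in_D 0 J"
 obtains J' where "in_D 0 J'" "len J' = 2 * len J" "ivl_set J \<subseteq> ivl_set J'"
proof -
 obtain j k :: int where j: "snd J = 2 powr j" "fst J = 2 powr j * real_of_int k"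
  using assms unfolding in_D_def by auto
 define J' where "J' = (2 powr (real_of_int (j + 1)) * real_of_int (k div 2), 2 powr (real_of_int (j + 1)))"
 have e: "2 powr (real_of_int (j + 1)) = 2 * 2 powr (real_of_int j)"
 proof -
  have 1: "2 powr (real_of_int j + 1) = 2 powr real_of_int j * 2 powr (1::real)" by (rule powr_add)
  have 2: "2 powr (1::real) = 2" by simp
  show ?thesis unfolding of_int_add of_int_1 1 2 by (rule mult.commute)
 qed
 have 1: "in_D 0 J'" unfolding in_D_def J'_def by (rule exI[of _ "j+1"], rule exI[of _ "k div 2"]) simp
 have e': "2 powr (real_of_int j + 1) = 2 * 2 powr (real_of_int j)" using e by simp
 have 2: "len J' = 2 * len J" by (simp add: J'_def len_def j e')
 have k: "real_of_int k = 2 * real_of_int (k div 2) + real_of_int (k mod 2)"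
  by (metis mult_div_mod_eq of_int_add of_int_mult of_int_numeral)
 have k2: "0 <= real_of_int (k mod 2)" "real_of_int (k mod 2) <= 1" by auto
 have "ivl_set J \<subseteq> ivl_set J'"
 proof -
  define p d m where "p = 2 powr (real_of_int j)" and "d = real_of_int (k div 2)" and "m = real_of_int (k mod 2)"
  have f: "fst J' = 2 * p * d" "len J' = 2 * p" "fst J = p * (2 * d + m)" "len J = p"
   using j k e by (simp_all add: J'_def len_def p_def d_def m_def)
  have "0 <= p * m" "p * m <= p * 1" using k2 by (auto simp: p_def m_def intro!: mult_left_mono)
  then show ?thesis using in_D_pos[OF assms] by (subst iv_subset_iff) (auto simp: f algebra_simps)
 qed
 then show ?thesis using that 1 2 by blast
qed

lemma dyadic_anc:
 assumes "in_D 0 J"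
 shows "\<exists>J'. in_D 0 J' \<and> len J' = 2 ^ n * len J \<and> ivl_set J \<subseteq> ivl_set J'"
proof (induction n)
 case 0 then show ?case using assms by (intro exI[of _ J]) auto
next
 case (Suc n)
 then obtain J' where J': "in_D 0 J'" "len J' = 2 ^ n * len J" "ivl_set J \<subseteq> ivl_set J'" by blast
 from dyadic_parent[OF J'(1)] obtain J'' where "in_D 0 J''" "len J'' = 2 * len J'" "ivl_set J' \<subseteq> ivl_set J''" .
 then show ?case using J' by (intro exI[of _ J'']) auto
qed

lemma pow2_between:
 assumes "0 < (l::real)" "l <= r"
 shows "\<exists>n. r <= 2 ^ n * l \<and> 2 ^ n * l < 2 * r"
proof -
 define n where "n = (LEAST n. r <= 2 ^ n * l)"
 have ex: "\<exists>n. r <= 2 ^ n * l"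
 proof -
  obtain n where "r / l < 2 ^ n" using real_arch_pow[of 2 "r / l"] by auto
  then show ?thesis using assms by (intro exI[of _ n]) (simp add: field_simps)
 qed
 have 1: "r <= 2 ^ n * l" unfolding n_def using ex by (rule LeastI_ex)
 have "2 ^ n * l < 2 * r"
 proof (cases n)
  case 0 then show ?thesis using assms by auto
 next
  case (Suc m)
  then have "\<not> r <= 2 ^ m * l" using not_less_Least[of m "\<lambda>n. r <= 2 ^ n * l"] n_def by auto
  then show ?thesis using Suc by simp
 qed
 then show ?thesis using 1 by blast
qed

lemma dyadic_anc_len:
 assumes "in_D 0 J" "len J <= r"
 obtains J' where "in_D 0 J'" "r <= len J'" "len J' < 2 * r" "ivl_set J \<subseteq> ivl_set J'"
 using pow2_between[OF in_D_pos[OF assms(1)] assms(2)] dyadic_anc[OF assms(1)] that by metis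

lemma sum_pow2_le:
 assumes "finite F" "\<And>x. x \<in> F ==> 0 < (x::real)"
  "\<And>x y. x \<in> F ==> y \<in> F ==> x < y ==> 2 * x <= y" "\<And>x. x \<in> F ==> x <= B" "0 <= B"
 shows "(\<Sum>x\<in>F. x) <= 2 * B"
 using assms
proof (induction F arbitrary: B rule: finite_linorder_max_induct)
 case empty then show ?case by simp
next
 case (insert b A)
 have "(\<Sum>x\<in>A. x) <= 2 * (b / 2)"
 proof (rule insert.IH)
  show "x <= b / 2" if "x \<in> A" for x using insert.prems(2)[of x b] insert.hyps(2) that by auto
  show "0 <= b / 2" using insert.prems(1)[of b] by simp
 qed (use insert.prems in auto)
 then have "(\<Sum>x\<in>insert b A. x) <= 2 * b" using insert.hyps by (subst sum.insert) auto
 then show ?case using insert.prems(3)[of b] by simp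
qed

lemma sum_pow2_inv_le:
 assumes "finite F" "\<And>x. x \<in> F ==> 0 < (x::real)"
  "\<And>x y. x \<in> F ==> y \<in> F ==> x < y ==> 2 * x <= y" "\<And>x. x \<in> F ==> B <= x" "0 < B"
 shows "(\<Sum>x\<in>F. 1 / x) <= 2 / B"
proof -
 have inj: "inj_on (\<lambda>x::real. 1 / x) F" by (auto simp: inj_on_def)
 have "(\<Sum>x\<in>F. 1 / x) = (\<Sum>x\<in>(\<lambda>x. 1 / x) ` F. x)"
  by (simp add: sum.reindex[OF inj])
 also have "... <= 2 * (1 / B)"
 proof (rule sum_pow2_le)
  fix x y assume "x \<in> (\<lambda>x. 1 / x) ` F" "y \<in> (\<lambda>x. 1 / x) ` F" "x < y"
  then obtain u v where u: "u \<in> F" "v \<in> F" "x = 1 / u" "y = 1 / v" by auto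
  have p: "0 < u" "0 < v" using u assms(2) by auto
  have "v < u" using \<open>x < y\<close> u p by (simp add: field_simps)
  then have "2 * v <= u" using assms(3) u by auto
  then show "2 * x <= y" unfolding u(3,4) using p by (simp add: divide_simps)
 next
  fix x assume "x \<in> (\<lambda>x. 1 / x) ` F"
  then show "x <= 1 / B" using assms(2,4,5) by (auto simp: frac_le)
 qed (use assms in auto)
 finally show ?thesis by simp
qed

subsection \<open>Integrals of the weights chi\<close>

lemma chi_nonneg: "0 <= len I ==> 0 <= chi I x"
 by (auto simp: chi_def)

lemma chi_pos: "0 < len I ==> 0 < chi I x"
 by (auto simp: chi_def intro!: divide_pos_pos add_pos_nonneg)

lemma chi_le1: "0 <= len I ==> chi I x <= 1"
 by (auto simp: chi_def divide_le_eq_1)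

lemma chi_measurable [measurable]: "chi I \<in> borel_measurable borel"
 unfolding chi_def by measurable

lemma chi_pow_mono: "0 < len I ==> m <= n ==> chi I x ^ n <= chi I x ^ m"
 by (intro power_decreasing chi_nonneg chi_le1) auto

lemma chi_inv: "0 < len I ==> inverse (chi I x) = 1 + \<bar>x - ctr I\<bar> / len I"
 by (simp add: chi_def)

lemma integrable_base: "integrable lborel (\<lambda>x::real. inverse (1 + x\<^sup>2))"
 and integral_base: "(LINT x|lborel. inverse (1 + x\<^sup>2)) = pi"
 using integrable_inverse_1_plus_square LBINT_inverse_1_plus_square
 by (auto simp: set_integrable_def interval_lebesgue_integral_def set_lebesgue_integral_def)

lemma integrable_cauchy: "0 < l ==> integrable lborel (\<lambda>x::real. inverse (1 + ((x - c) / l)\<^sup>2))"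
proof -
 assume l: "0 < l"
 have eq: "- c / l + 1 / l * x = (x - c) / l" for x by (simp add: diff_divide_distrib)
 show ?thesis using lborel_integrable_real_affine[OF integrable_base, of "1/l" "-c/l"] l unfolding eq by simp
qed

lemma integral_cauchy: "0 < l ==> (LINT x|lborel. inverse (1 + ((x - c) / l)\<^sup>2)) = pi * l"
proof -
 assume l: "0 < l"
 have eq: "- c / l + 1 / l * x = (x - c) / l" for x by (simp add: diff_divide_distrib)
 have "(LINT x|lborel. inverse (1 + x\<^sup>2)) = \<bar>1 / l\<bar> *\<^sub>R (LINT x|lborel. inverse (1 + ((x - c) / l)\<^sup>2))"
  using lborel_integral_real_affine[of "1/l" "\<lambda>x. inverse (1 + x\<^sup>2)" "-c/l"] l unfolding eq by simp
 then have "pi = 1 / l * (LINT x|lborel. inverse (1 + ((x - c) / l)\<^sup>2))" using l by (simp add: integral_base)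
 then show ?thesis using l by (simp add: field_simps)
qed

lemma chi_sq_le: "0 < len I ==> (chi I x)\<^sup>2 <= inverse (1 + ((x - ctr I) / len I)\<^sup>2)"
proof -
 assume "0 < len I"
 then have "1 + ((x - ctr I) / len I)\<^sup>2 <= (1 + \<bar>x - ctr I\<bar> / len I)\<^sup>2"
  by (simp add: power2_sum power_divide)
 then show ?thesis
  using \<open>0 < len I\<close> by (simp add: chi_def power_divide inverse_eq_divide frac_le add_pos_nonneg)
qed

lemma integrable_chi:
 assumes "0 < len I" "2 <= m"
 shows "integrable lborel (\<lambda>x. chi I x ^ m)"
proof (rule Bochner_Integration.integrable_bound[OF integrable_cauchy[OF assms(1), of "ctr I"]])
 have "chi I x ^ m <= inverse (1 + ((x - ctr I) / len I)\<^sup>2)" for x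
  using chi_pow_mono[OF assms, of x] chi_sq_le[OF assms(1), of x] by simp
 then show "AE x in lborel. norm (chi I x ^ m) <= norm (inverse (1 + ((x - ctr I) / len I)\<^sup>2))"
  using chi_nonneg[of I] assms by (auto intro!: AE_I2)
qed auto

lemma integral_chi_le:
 assumes "0 < len I" "2 <= m"
 shows "(LINT x|lborel. chi I x ^ m) <= 4 * len I"
proof -
 have "(LINT x|lborel. chi I x ^ m) <= (LINT x|lborel. inverse (1 + ((x - ctr I) / len I)\<^sup>2))"
  using assms chi_pow_mono[OF assms] chi_sq_le[OF assms(1)]
  by (intro integral_mono integrable_chi integrable_cauchy) (auto intro: order_trans)
 also have "... = pi * len I" by (rule integral_cauchy[OF assms(1)])
 also have "... <= 4 * len I" using assms pi_less_4 by (intro mult_right_mono) auto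
 finally show ?thesis .
qed

lemma chi_prod_le:
 assumes "0 < len I" "0 < len I'" "len I' <= R * len I" "1 <= R"
 shows "chi I x * chi I' x <= R * chi I (ctr I')"
proof -
 let ?u = "\<bar>x - ctr I\<bar> / len I" and ?v = "\<bar>x - ctr I'\<bar> / len I'"
 have uv: "0 <= ?u" "0 <= ?v" using assms by auto
 have "\<bar>x - ctr I'\<bar> / len I <= R * ?v"
 proof -
  have "\<bar>x - ctr I'\<bar> * len I' <= \<bar>x - ctr I'\<bar> * (R * len I)" using assms by (intro mult_left_mono) auto
  then show ?thesis using assms by (simp add: field_simps)
 qed
 moreover have "\<bar>ctr I' - ctr I\<bar> / len I <= (\<bar>x - ctr I\<bar> + \<bar>x - ctr I'\<bar>) / len I"
  using assms by (intro divide_right_mono) auto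
 ultimately have "1 + \<bar>ctr I' - ctr I\<bar> / len I <= 1 + ?u + R * ?v" by (simp add: add_divide_distrib)
 also have "... <= R * ((1 + ?u) * (1 + ?v))"
 proof -
  have "1 * ?u <= R * ?u" by (rule mult_right_mono[OF assms(4) uv(1)])
  moreover have "1 <= R" "0 <= R * (?u * ?v)"
   using assms uv by (auto intro!: mult_nonneg_nonneg simp del: times_divide_eq_right)
  moreover have "R * ((1 + ?u) * (1 + ?v)) = R + R * ?u + R * ?v + R * (?u * ?v)" by algebra
  ultimately show ?thesis by linarith
 qed
 finally have *: "1 + \<bar>ctr I' - ctr I\<bar> / len I <= R * ((1 + ?u) * (1 + ?v))" .
 define a b c where "a = 1 + \<bar>ctr I' - ctr I\<bar> / len I" and "b = 1 + ?u" and "c = 1 + ?v"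
 have "0 < a" "0 < b" "0 < c" using assms by (auto simp: a_def b_def c_def intro: add_pos_nonneg)
 moreover have "a <= R * (b * c)" using * by (simp only: a_def b_def c_def)
 ultimately have "1 / b * (1 / c) <= R * (1 / a)" by (simp add: field_simps)
 then show ?thesis by (simp only: chi_def a_def b_def c_def)
qed

definition kap :: "nat => ivl => ivl => real" where
 "kap m I I' = (LINT x|lborel. chi I x ^ m * chi I' x ^ m)"

lemma kap_commute: "kap m I I' = kap m I' I"
 by (simp add: kap_def mult.commute)

lemma integrable_kap:
 assumes "0 < len I" "0 < len I'" "2 <= m"
 shows "integrable lborel (\<lambda>x. chi I x ^ m * chi I' x ^ m)"
proof (rule Bochner_Integration.integrable_bound[OF integrable_chi[OF assms(1,3)]])
 have "chi I x ^ m * chi I' x ^ m <= chi I x ^ m" for x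
  using assms chi_nonneg[of I x] chi_nonneg[of I' x] chi_le1[of I' x]
  by (intro mult_left_le power_le_one) auto
 then show "AE x in lborel. norm (chi I x ^ m * chi I' x ^ m) <= norm (chi I x ^ m)"
  using chi_nonneg[of I] chi_nonneg[of I'] assms by (auto intro!: AE_I2)
qed auto

lemma kap_nonneg: "0 < len I ==> 0 < len I' ==> 0 <= kap m I I'"
 unfolding kap_def by (intro integral_nonneg_AE AE_I2 mult_nonneg_nonneg zero_le_power chi_nonneg) auto

lemma kap_le_pt:
 assumes "0 < len I" "0 < len I'" "len I' <= R * len I" "1 <= R"
 shows "kap (m + 2) I I' <= 4 * R ^ m * len I' * chi I (ctr I') ^ m"
proof -
 have "kap (m + 2) I I' <= (LINT x|lborel. (R * chi I (ctr I')) ^ m * chi I' x ^ 2)"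
  unfolding kap_def
 proof (intro integral_mono integrable_kap Bochner_Integration.integrable_mult_right integrable_chi)
  fix x
  have "chi I x ^ (m + 2) * chi I' x ^ (m + 2) = (chi I x * chi I' x) ^ m * ((chi I x)\<^sup>2 * (chi I' x)\<^sup>2)"
   by (simp add: power_mult_distrib power_add power2_eq_square)
  also have "... <= (R * chi I (ctr I')) ^ m * (1 * (chi I' x)\<^sup>2)"
  proof (rule mult_mono)
   show "(chi I x * chi I' x) ^ m <= (R * chi I (ctr I')) ^ m"
    using assms chi_nonneg[of I x] chi_nonneg[of I' x] chi_prod_le[OF assms, of x]
    by (intro power_mono) auto
   show "(chi I x)\<^sup>2 * (chi I' x)\<^sup>2 <= 1 * (chi I' x)\<^sup>2"
    using assms chi_nonneg[of I x] chi_le1[of I x] by (intro mult_right_mono power_le_one) auto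
   show "0 <= (R * chi I (ctr I')) ^ m"
    using assms chi_nonneg[of I "ctr I'"] by simp
  qed simp
  finally show "chi I x ^ (m + 2) * chi I' x ^ (m + 2) <= (R * chi I (ctr I')) ^ m * chi I' x ^ 2" by simp
 qed (use assms in auto)
 also have "... = (R * chi I (ctr I')) ^ m * (LINT x|lborel. chi I' x ^ 2)" by simp
 also have "... <= (R * chi I (ctr I')) ^ m * (4 * len I')"
  using assms by (intro mult_left_mono integral_chi_le zero_le_power mult_nonneg_nonneg chi_nonneg) auto
 finally show ?thesis by (simp add: power_mult_distrib mult_ac)
qed

lemma iv_measurable [measurable]: "ivl_set I \<in> sets borel"
 by (simp add: ivl_set_def)

lemma integral_indicator_iv:
 "0 <= len I ==> (LINT x|lborel. indicator (ivl_set I) x * c) = len I * (c::real)"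
 by (simp add: ivl_set_def len_def)

lemma integrable_indicator_const_iv: "integrable lborel (\<lambda>x. indicator (ivl_set I) x * (c::real))"
 by (cases "0 <= snd I") (auto simp: ivl_set_def intro!: integrable_mult_left integrable_real_indicator)

lemma integrable_indicator_mult:
 "A \<in> sets borel ==> integrable lborel f ==> integrable lborel (\<lambda>x. indicator A x * (f x :: real))"
 using integrable_mult_indicator[of A lborel f] by simp

lemma chi_near:
 assumes "0 < len I" "0 < r" "\<bar>x - y\<bar> <= r * len I"
 shows "chi I y <= (1 + r) * chi I x"
proof -
 have "\<bar>x - ctr I\<bar> <= \<bar>y - ctr I\<bar> + r * len I" using assms by linarith
 then have "\<bar>x - ctr I\<bar> / len I <= (\<bar>y - ctr I\<bar> + r * len I) / len I"
  using assms by (intro divide_right_mono) auto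
 then have "1 + \<bar>x - ctr I\<bar> / len I <= 1 + \<bar>y - ctr I\<bar> / len I + r" using assms by (simp add: add_divide_distrib)
 also have "... <= (1 + r) * (1 + \<bar>y - ctr I\<bar> / len I)"
 proof -
  have "0 <= r * (\<bar>y - ctr I\<bar> / len I)" using assms by (intro mult_nonneg_nonneg) auto
  moreover have "(1 + r) * (1 + \<bar>y - ctr I\<bar> / len I) = 1 + \<bar>y - ctr I\<bar> / len I + r + r * (\<bar>y - ctr I\<bar> / len I)" by algebra
  ultimately show ?thesis by linarith
 qed
 finally have *: "1 + \<bar>x - ctr I\<bar> / len I <= (1 + r) * (1 + \<bar>y - ctr I\<bar> / len I)" .
 have "0 < 1 + \<bar>x - ctr I\<bar> / len I" "0 < 1 + \<bar>y - ctr I\<bar> / len I" using assms by (auto intro: add_pos_nonneg)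
 then show ?thesis using * by (simp add: chi_def field_simps)
qed

lemma len_chi_le:
 assumes "0 < len I" "0 < len I'" "len I' <= R * len I" "1 <= R" "2 <= m"
 shows "len I' * chi I (ctr I') ^ m <= (1 + R) ^ m * (LINT x|lborel. indicator (ivl_set I') x * chi I x ^ m)"
proof -
 have "len I' * chi I (ctr I') ^ m = (LINT x|lborel. indicator (ivl_set I') x * chi I (ctr I') ^ m)"
  using assms by (subst integral_indicator_iv) auto
 also have "... <= (LINT x|lborel. (1 + R) ^ m * (indicator (ivl_set I') x * chi I x ^ m))"
 proof (rule integral_mono)
  show "integrable lborel (\<lambda>x. indicator (ivl_set I') x * chi I (ctr I') ^ m)"
   by (rule integrable_indicator_const_iv)
  show "integrable lborel (\<lambda>x. (1 + R) ^ m * (indicator (ivl_set I') x * chi I x ^ m))"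
   using assms by (intro integrable_indicator_mult Bochner_Integration.integrable_mult_right integrable_chi) auto
  fix x
  show "indicator (ivl_set I') x * chi I (ctr I') ^ m <= (1 + R) ^ m * (indicator (ivl_set I') x * chi I x ^ m)"
  proof (cases "x \<in> ivl_set I'")
   case True
   then have "\<bar>x - ctr I'\<bar> <= len I' / 2" unfolding mem_iv_ctr by linarith
   also have "... <= R * len I" using assms by auto
   finally have "chi I (ctr I') <= (1 + R) * chi I x" using chi_near[of I R x "ctr I'"] assms by auto
   then have "chi I (ctr I') ^ m <= ((1 + R) * chi I x) ^ m" using assms chi_nonneg by (intro power_mono) auto
   then show ?thesis using True by (simp add: power_mult_distrib)
  qed simp
 qed
 finally show ?thesis by simp
qed

lemma sum_indicator_disjoint:
 assumes "finite F" "\<And>Q Q'. Q \<in> F ==> Q' \<in> F ==> Q \<noteq> Q' ==> A Q \<inter> A Q' = {}" "\<And>Q. Q \<in> F ==> A Q \<subseteq> B"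
 shows "(\<Sum>Q\<in>F. indicator (A Q) x) <= (indicator B x :: real)"
proof -
 have "disjoint_family_on A F" using assms(2) by (auto simp: disjoint_family_on_def)
 then have "(\<Sum>Q\<in>F. indicator (A Q) x) = (indicator (\<Union>Q\<in>F. A Q) x :: real)"
  by (rule indicator_UN_disjoint[OF assms(1), symmetric])
 also have "... <= indicator B x" using assms(3) by (auto simp: indicator_def)
 finally show ?thesis .
qed

lemma sum_integral_disjoint_le:
 fixes f :: "real => real" and A :: "'a => real set" and B :: "real set"
 assumes "finite F" "\<And>Q Q'. Q \<in> F ==> Q' \<in> F ==> Q \<noteq> Q' ==> A Q \<inter> A Q' = {}" "\<And>Q. Q \<in> F ==> A Q \<subseteq> B"
  and m: "\<And>Q. Q \<in> F ==> A Q \<in> sets borel" "B \<in> sets borel"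
  and f: "integrable lborel f" "\<And>x. 0 <= f x"
 shows "(\<Sum>Q\<in>F. LINT x|lborel. indicator (A Q) x * f x) <= (LINT x|lborel. indicator B x * f x)"
proof -
 have "(\<Sum>Q\<in>F. LINT x|lborel. indicator (A Q) x * f x) = (LINT x|lborel. (\<Sum>Q\<in>F. indicator (A Q) x * f x))"
  using f by (intro Bochner_Integration.integral_sum[symmetric] integrable_indicator_mult assms)
 also have "... <= (LINT x|lborel. indicator B x * f x)"
 proof (intro integral_mono Bochner_Integration.integrable_sum integrable_indicator_mult assms)
  fix x
  show "(\<Sum>Q\<in>F. indicator (A Q) x * f x) <= indicator B x * f x"
   using sum_indicator_disjoint[OF assms(1-3), where x = x] f(2)[of x]
   by (simp add: sum_distrib_right[symmetric] mult_right_mono)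
 qed auto
 finally show ?thesis .
qed

lemma sum_kap_disjoint:
 fixes J :: "'a => ivl"
 assumes F: "finite F" "\<And>Q Q'. Q \<in> F ==> Q' \<in> F ==> Q \<noteq> Q' ==> ivl_set (J Q) \<inter> ivl_set (J Q') = {}"
  "\<And>Q. Q \<in> F ==> ivl_set (J Q) \<subseteq> B" "\<And>Q. Q \<in> F ==> 0 < len (J Q)" "\<And>Q. Q \<in> F ==> len (J Q) <= R * len I"
  and "1 <= R" "0 < len I" "2 <= m" and B: "B \<in> sets borel"
 shows "(\<Sum>Q\<in>F. kap (m + 2) I (J Q)) <= 4 * (R * (1 + R)) ^ m * (LINT x|lborel. indicator B x * chi I x ^ m)"
  and "(\<Sum>Q\<in>F. len (J Q) * chi I (ctr (J Q)) ^ m) <= (1 + R) ^ m * (LINT x|lborel. indicator B x * chi I x ^ m)"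
proof -
 have d: "(\<Sum>Q\<in>F. LINT x|lborel. indicator (ivl_set (J Q)) x * chi I x ^ m) <= (LINT x|lborel. indicator B x * chi I x ^ m)"
  using assms by (intro sum_integral_disjoint_le integrable_chi) (auto intro!: chi_nonneg zero_le_power)
 have "(\<Sum>Q\<in>F. len (J Q) * chi I (ctr (J Q)) ^ m) <= (\<Sum>Q\<in>F. (1 + R) ^ m * (LINT x|lborel. indicator (ivl_set (J Q)) x * chi I x ^ m))"
  using assms by (intro sum_mono len_chi_le) auto
 also have "... <= (1 + R) ^ m * (LINT x|lborel. indicator B x * chi I x ^ m)"
  using d assms by (subst sum_distrib_left[symmetric]) (intro mult_left_mono, auto)
 finally show 2: "(\<Sum>Q\<in>F. len (J Q) * chi I (ctr (J Q)) ^ m) <= (1 + R) ^ m * (LINT x|lborel. indicator B x * chi I x ^ m)" .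
 have "(\<Sum>Q\<in>F. kap (m + 2) I (J Q)) <= (\<Sum>Q\<in>F. (4 * R ^ m) * (len (J Q) * chi I (ctr (J Q)) ^ m))"
  using assms kap_le_pt[of I _ R m] by (intro sum_mono) (auto simp: mult_ac)
 also have "... <= (4 * R ^ m) * ((1 + R) ^ m * (LINT x|lborel. indicator B x * chi I x ^ m))"
  using 2 assms by (subst sum_distrib_left[symmetric]) (intro mult_left_mono, auto)
 finally show "(\<Sum>Q\<in>F. kap (m + 2) I (J Q)) <= 4 * (R * (1 + R)) ^ m * (LINT x|lborel. indicator B x * chi I x ^ m)"
  by (simp add: power_mult_distrib mult_ac)
qed

lemma sum_chi_scale:
 fixes J :: "'a => ivl"
 assumes F: "finite F" "\<And>Q Q'. Q \<in> F ==> Q' \<in> F ==> Q \<noteq> Q' ==> ivl_set (J Q) \<inter> ivl_set (J Q') = {}"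
  "\<And>Q. Q \<in> F ==> len (J Q) = l" and l: "0 < l"
 shows "(\<Sum>Q\<in>F. (chi (J Q) x)\<^sup>2) <= 16"
proof -
 define X where "X = (x - l / 2, l)"
 have X: "len X = l" "ctr X = x" by (auto simp: X_def len_def ctr_def)
 have "l * (\<Sum>Q\<in>F. (chi (J Q) x)\<^sup>2) = (\<Sum>Q\<in>F. len (J Q) * (chi X (ctr (J Q)))\<^sup>2)"
  using assms(3) by (auto simp: sum_distrib_left chi_def X abs_minus_commute intro!: sum.cong)
 also have "... <= (1 + 1)\<^sup>2 * (LINT x|lborel. indicator UNIV x * chi X x ^ 2)"
  using assms X by (intro sum_kap_disjoint(2)) auto
 also have "... <= 4 * (4 * l)" using integral_chi_le[of X 2] X l by simp
 finally show ?thesis using l by simp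
qed

subsection \<open>Fourier support and orthogonality\<close>

lemma integrable_norm_cis:
 assumes "integrable lborel \<Phi>"
 shows "integrable lborel (\<lambda>x. \<Phi> x * cis (a * x + b))"
proof (rule Bochner_Integration.integrable_bound[OF assms])
 have "(\<lambda>x. cis (a * x + b)) \<in> borel_measurable borel"
  by (intro borel_measurable_continuous_onI continuous_intros)
 then show "(\<lambda>x. \<Phi> x * cis (a * x + b)) \<in> borel_measurable lborel"
  using assms by (auto intro!: borel_measurable_times borel_measurable_integrable)
qed (auto simp: norm_mult)

lemma cis_minus1_le: "norm (cis a - 1) <= \<bar>a\<bar>"
 using iexp_approx1[of a 0] by (simp add: cis_conv_exp)

lemma cis_approx2: "norm (cis a - 1 - \<i> * a) <= a\<^sup>2 / 2"
 using iexp_approx1[of a 1] by (simp add: cis_conv_exp numeral_2_eq_2 diff_diff_eq)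

lemma fourier_mult_x:
 fixes \<Phi> :: "real => complex"
 assumes \<Phi>: "integrable lborel \<Phi>" "integrable lborel (\<lambda>x. x * \<Phi> x)" "\<Phi> \<in> borel_measurable borel"
  and A: "closed A" "\<And>\<xi>. \<xi> \<notin> A ==> fourier \<Phi> \<xi> = 0" and \<xi>: "\<xi> \<notin> A"
 shows "fourier (\<lambda>x. x * \<Phi> x) \<xi> = 0"
proof -
 define h where "h n = 1 / real (Suc n)" for n
 have h: "h n > 0" for n by (simp add: h_def)
 have hlim: "h \<longlonglongrightarrow> 0" unfolding h_def by (rule LIMSEQ_Suc) (rule lim_1_over_n)
 define F where "F n x = \<Phi> x * cis (- 2 * pi * x * \<xi>) * ((cis (- 2 * pi * x * h n) - 1) / h n)" for n x
 define G where "G x = \<Phi> x * cis (- 2 * pi * x * \<xi>) * (\<i> * (- 2 * pi * x))" for x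
 have m [measurable]: "\<Phi> \<in> borel_measurable borel" by fact
 have mc [measurable]: "(\<lambda>x. cis (- 2 * pi * x * t)) \<in> borel_measurable borel" for t
  by (intro borel_measurable_continuous_onI continuous_intros)
 have "(\<lambda>n. integral\<^sup>L lborel (F n)) \<longlonglongrightarrow> integral\<^sup>L lborel G"
 proof (rule integral_dominated_convergence[where w = "\<lambda>x. 2 * pi * norm (x * \<Phi> x)"])
  show "integrable lborel (\<lambda>x. 2 * pi * norm (complex_of_real x * \<Phi> x))"
   using \<Phi>(2) by (intro integrable_mult_right integrable_norm)
  show "AE x in lborel. norm (F n x) <= 2 * pi * norm (complex_of_real x * \<Phi> x)" for n
  proof (rule AE_I2)
   fix x
   have "norm ((cis (- 2 * pi * x * h n) - 1) / h n) <= \<bar>- 2 * pi * x * h n\<bar> / h n"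
    unfolding norm_divide norm_of_real using cis_minus1_le[of "- 2 * pi * x * h n"] h[of n]
    by (simp only: abs_of_pos) (intro divide_right_mono, simp_all only: less_imp_le)
   also have "... = 2 * pi * \<bar>x\<bar>" using h[of n] by (simp add: abs_mult)
   finally have *: "norm (\<Phi> x) * norm ((cis (- 2 * pi * x * h n) - 1) / h n) <= norm (\<Phi> x) * (2 * pi * \<bar>x\<bar>)"
    by (intro mult_left_mono) auto
   show "norm (F n x) <= 2 * pi * norm (complex_of_real x * \<Phi> x)"
   proof -
    have "norm (F n x) = norm (\<Phi> x) * norm ((cis (- 2 * pi * x * h n) - 1) / h n)"
     by (simp only: F_def norm_mult norm_cis mult_1_right)
    moreover have "norm (\<Phi> x) * (2 * pi * \<bar>x\<bar>) = 2 * pi * norm (complex_of_real x * \<Phi> x)"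
     by (simp add: norm_mult)
    ultimately show ?thesis using * by (simp only:)
   qed
  qed
  show "AE x in lborel. (\<lambda>n. F n x) \<longlonglongrightarrow> G x"
  proof (rule AE_I2)
   fix x
   define t where "t = - 2 * pi * x"
   have "(\<lambda>n. (cis (t * h n) - 1) / h n - \<i> * t) \<longlonglongrightarrow> 0"
   proof (rule Lim_null_comparison)
    show "\<forall>\<^sub>F n in sequentially. norm ((cis (t * h n) - 1) / h n - \<i> * t) <= t\<^sup>2 / 2 * h n"
    proof (intro always_eventually allI)
     fix n
     have "(cis (t * h n) - 1) / h n - \<i> * t = (cis (t * h n) - 1 - \<i> * complex_of_real (t * h n)) / h n"
      using h[of n] by (simp add: field_simps)
     then have "norm ((cis (t * h n) - 1) / h n - \<i> * t) <= (t * h n)\<^sup>2 / 2 / h n"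
      using divide_right_mono[OF cis_approx2[of "t * h n"], of "h n"] h[of n]
      by (simp only: norm_divide norm_of_real abs_of_pos less_imp_le)
     also have "... = t\<^sup>2 / 2 * h n" using h[of n] by (simp add: power2_eq_square)
     finally show "norm ((cis (t * h n) - 1) / h n - \<i> * t) <= t\<^sup>2 / 2 * h n" .
    qed
    show "(\<lambda>n. t\<^sup>2 / 2 * h n) \<longlonglongrightarrow> 0" using tendsto_mult_right_zero[OF hlim] by simp
   qed
   then have "(\<lambda>n. (cis (t * h n) - 1) / h n) \<longlonglongrightarrow> \<i> * t" by (simp add: LIM_zero_iff)
   then show "(\<lambda>n. F n x) \<longlonglongrightarrow> G x"
    unfolding F_def G_def t_def by (intro tendsto_mult tendsto_const) (simp add: mult_ac)
  qed
  have mc': "(\<lambda>x. complex_of_real (a * x)) \<in> borel_measurable borel" for a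
   by (intro borel_measurable_continuous_onI continuous_intros)
  show "G \<in> borel_measurable lborel" unfolding G_def
   by (intro borel_measurable_times borel_measurable_const) (simp_all only: measurable_lborel2 m mc mc')
  show "F n \<in> borel_measurable lborel" for n unfolding F_def
   by (intro borel_measurable_times borel_measurable_divide borel_measurable_diff borel_measurable_const)
    (simp_all only: measurable_lborel2 m mc)
 qed
 moreover have "\<forall>\<^sub>F n in sequentially. integral\<^sup>L lborel (F n) = 0"
 proof -
  have "open (- A)" using A by auto
  then have "\<forall>\<^sub>F n in sequentially. \<xi> + h n \<in> - A"
   using \<xi> hlim by (intro topological_tendstoD[where l = "\<xi> + 0"] tendsto_add tendsto_const) auto
  then show ?thesis
  proof eventually_elim
   case (elim n)
   have c: "cis (- 2 * pi * x * (\<xi> + h n)) = cis (- 2 * pi * x * \<xi>) * cis (- 2 * pi * x * h n)" for x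
    by (simp add: cis_mult algebra_simps)
   have i: "integrable lborel (\<lambda>x. \<Phi> x * cis (- 2 * pi * x * t))" for t
    using integrable_norm_cis[OF \<Phi>(1), of "- 2 * pi * t" 0] by (simp add: mult_ac)
   have "F n = (\<lambda>x. (\<Phi> x * cis (- 2 * pi * x * (\<xi> + h n)) - \<Phi> x * cis (- 2 * pi * x * \<xi>)) / h n)"
    unfolding F_def c by (auto simp: algebra_simps diff_divide_distrib)
   then have "integral\<^sup>L lborel (F n) = (fourier \<Phi> (\<xi> + h n) - fourier \<Phi> \<xi>) / h n"
    unfolding fourier_def using i by simp
   then show ?case using A(2) elim \<xi> by auto
  qed
 qed
 then have "(\<lambda>n. integral\<^sup>L lborel (F n)) \<longlonglongrightarrow> 0" by (rule tendsto_eventually)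
 ultimately have "integral\<^sup>L lborel G = 0" using LIMSEQ_unique by blast
 moreover have "G = (\<lambda>x. (- 2 * pi * \<i>) * (x * \<Phi> x * cis (- 2 * pi * x * \<xi>)))"
  by (auto simp: G_def)
 ultimately have "(- 2 * pi * \<i>) * fourier (\<lambda>x. x * \<Phi> x) \<xi> = 0"
  unfolding fourier_def by (subst integral_mult_right_zero[symmetric]) simp
 then show ?thesis by simp
qed

text \<open>Plancherel for disjointly supported Fourier transforms, by Gaussian regularisation: the Gaussian average
 of the vanishing product of the transforms is a smoothed version of the inner product.\<close>

lemma fourier_orthogonal:
 assumes \<Phi>: "integrable lborel \<Phi>" and \<Psi>: "integrable lborel \<Psi>"
  and bd: "\<And>x. norm (\<Psi> x) <= B" and cont: "continuous_on UNIV \<Psi>"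
  and orth: "\<And>\<xi>. fourier \<Phi> \<xi> = 0 \<or> fourier \<Psi> \<xi> = 0"
 shows "(LINT x|lborel. \<Phi> x * cnj (\<Psi> x)) = 0"
proof -
 define M where "M = std_normal_distribution"
 interpret M: real_distribution M unfolding M_def by (rule real_dist_normal_dist)
 interpret P: pair_sigma_finite M lborel ..
 have sM [measurable_cong]: "sets M = sets borel" by simp
 have m\<Phi> [measurable]: "\<Phi> \<in> borel_measurable borel" using \<Phi> by auto
 have m\<Psi> [measurable]: "\<Psi> \<in> borel_measurable borel" using \<Psi> by auto
 have mcis [measurable]: "cis \<in> borel_measurable borel"
  by (intro borel_measurable_continuous_onI continuous_intros)
 have mcnj [measurable]: "cnj \<in> borel_measurable borel"
  by (intro borel_measurable_continuous_onI continuous_intros)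
 define E where "E v = exp (- ((2 * pi * v)\<^sup>2) / 2)" for v :: real
 have Echar: "(CLINT s|M. cis (2 * pi * v * s)) = E v" for v
 proof -
  have "(CLINT s|M. cis (2 * pi * v * s)) = char M (2 * pi * v)"
   unfolding char_def by (simp add: cis_conv_exp)
  then show ?thesis unfolding M_def char_std_normal_distribution E_def by simp
 qed
 have [measurable]: "E \<in> borel_measurable borel" unfolding E_def by measurable
 have Eint: "integrable lborel E"
 proof -
  have "integrable lborel (\<lambda>x. sqrt (2 * pi) * std_normal_density x)"
   by (intro integrable_mult_right) simp
  then have "integrable lborel (\<lambda>x. sqrt (2 * pi) * std_normal_density (0 + (2 * pi) * x))"
   by (rule lborel_integrable_real_affine[where t = 0 and c = "2 * pi"]) simp
  moreover have "(\<lambda>x. sqrt (2 * pi) * std_normal_density (0 + (2 * pi) * x)) = E"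
   by (auto simp: std_normal_density_def E_def)
  ultimately show ?thesis by (simp only:)
 qed
 have Epos: "0 < E v" for v by (simp add: E_def)
 define g where "g R x = (CLINT v|lborel. cnj (\<Psi> (x + R * v)) * E v)" for R x
 have key: "(CLINT x|lborel. \<Phi> x * g R x) = 0" if R: "R > 0" for R
 proof -
  have "(CLINT s|M. fourier \<Phi> (s / R) * cnj (fourier \<Psi> (s / R))) = 0"
   using orth by (intro integral_eq_zero_AE AE_I2) auto
  moreover have "(CLINT s|M. fourier \<Phi> (s / R) * cnj (fourier \<Psi> (s / R)))
    = (CLINT s|M. CLINT x|lborel. \<Phi> x * cis (- 2 * pi * x * (s / R)) * cnj (fourier \<Psi> (s / R)))"
   unfolding fourier_def by (subst integral_mult_left_zero[symmetric]) simp
  moreover have "... = (CLINT x|lborel. CLINT s|M. \<Phi> x * cis (- 2 * pi * x * (s / R)) * cnj (fourier \<Psi> (s / R)))"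
  proof (rule P.Fubini_integral[symmetric])
   have 1: "norm (fourier \<Psi> t) <= (LINT x|lborel. norm (\<Psi> x))" for t
    unfolding fourier_def by (rule order_trans[OF integral_norm_bound]) (simp add: norm_mult)
   have [measurable]: "(\<lambda>t. fourier \<Psi> t) \<in> borel_measurable borel" unfolding fourier_def by measurable
   have i: "integrable (M \<Otimes>\<^sub>M lborel) (\<lambda>p. (LINT x|lborel. norm (\<Psi> x)) * norm (\<Phi> (snd p)))"
    using P.Fubini_integrable[of "\<lambda>p. (LINT x|lborel. norm (\<Psi> x)) * norm (\<Phi> (snd p))"] \<Phi>
    by (simp add: case_prod_unfold)
   show "integrable (M \<Otimes>\<^sub>M lborel) (\<lambda>(s, x). \<Phi> x * cis (- 2 * pi * x * (s / R)) * cnj (fourier \<Psi> (s / R)))"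
    by (rule Bochner_Integration.integrable_bound[OF i])
     (auto simp: norm_mult mult.commute case_prod_unfold intro!: AE_I2 mult_left_mono order_trans[OF 1] abs_ge_self)
  qed
  moreover have "(CLINT s|M. \<Phi> x * cis (- 2 * pi * x * (s / R)) * cnj (fourier \<Psi> (s / R))) = \<Phi> x * (R * g R x)" for x
  proof -
   have "(CLINT s|M. cis (- 2 * pi * x * (s / R)) * cnj (fourier \<Psi> (s / R)))
     = (CLINT s|M. CLINT y|lborel. cnj (\<Psi> y) * cis (2 * pi * ((y - x) / R) * s))"
   proof (rule Bochner_Integration.integral_cong[OF refl])
    fix s
    have "cis (- 2 * pi * x * (s / R)) * cnj (fourier \<Psi> (s / R))
      = (CLINT y|lborel. cis (- 2 * pi * x * (s / R)) * cnj (\<Psi> y * cis (- 2 * pi * y * (s / R))))"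
     unfolding fourier_def by (simp add: integral_cnj[symmetric] del: complex_cnj_mult)
    also have "... = (CLINT y|lborel. cnj (\<Psi> y) * cis (2 * pi * ((y - x) / R) * s))"
    proof (rule Bochner_Integration.integral_cong[OF refl])
     fix y
     have "cis (- 2 * pi * x * (s / R)) * cis (2 * pi * y * (s / R)) = cis (2 * pi * ((y - x) / R) * s)"
      unfolding cis_mult by (rule arg_cong[where f = cis]) (simp add: diff_divide_distrib algebra_simps)
     then show "cis (- 2 * pi * x * (s / R)) * cnj (\<Psi> y * cis (- 2 * pi * y * (s / R))) = cnj (\<Psi> y) * cis (2 * pi * ((y - x) / R) * s)"
      by (simp add: cis_cnj mult_ac)
    qed
    finally show "cis (- 2 * pi * x * (s / R)) * cnj (fourier \<Psi> (s / R)) = (CLINT y|lborel. cnj (\<Psi> y) * cis (2 * pi * ((y - x) / R) * s))" .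
   qed
   also have "... = (CLINT y|lborel. CLINT s|M. cnj (\<Psi> y) * cis (2 * pi * ((y - x) / R) * s))"
   proof (rule P.Fubini_integral[symmetric])
    have i: "integrable (M \<Otimes>\<^sub>M lborel) (\<lambda>p. norm (\<Psi> (snd p)))"
     using P.Fubini_integrable[of "\<lambda>p. norm (\<Psi> (snd p))"] \<Psi> by (simp add: case_prod_unfold)
    show "integrable (M \<Otimes>\<^sub>M lborel) (\<lambda>(s, y). cnj (\<Psi> y) * cis (2 * pi * ((y - x) / R) * s))"
     by (rule Bochner_Integration.integrable_bound[OF i]) (auto simp: norm_mult case_prod_unfold)
   qed
   also have "... = (CLINT y|lborel. cnj (\<Psi> y) * E ((y - x) / R))"
    by (simp only: integral_mult_right_zero Echar)
   also have "... = \<bar>R\<bar> *\<^sub>R (CLINT v|lborel. cnj (\<Psi> (x + R * v)) * E ((x + R * v - x) / R))"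
    using R by (intro lborel_integral_real_affine) simp
   also have "... = R * g R x" using R by (simp add: g_def scaleR_conv_of_real)
   finally have "(CLINT s|M. cis (- 2 * pi * x * (s / R)) * cnj (fourier \<Psi> (s / R))) = R * g R x" .
   then show ?thesis by (simp add: mult.assoc)
  qed
  ultimately have "(CLINT x|lborel. \<Phi> x * (R * g R x)) = 0" by simp
  then have "(CLINT x|lborel. R * (\<Phi> x * g R x)) = 0" by (simp add: mult_ac)
  then show ?thesis using R by simp
 qed
 define h where "h n = 1 / real (Suc n)" for n
 have h: "h n > 0" for n by (simp add: h_def)
 have hlim: "h \<longlonglongrightarrow> 0" unfolding h_def by (rule LIMSEQ_Suc) (rule lim_1_over_n)
 define e where "e = (LINT v|lborel. E v)"
 have glim: "(\<lambda>n. g (h n) x) \<longlonglongrightarrow> (CLINT v|lborel. cnj (\<Psi> x) * E v)" for x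
  unfolding g_def
 proof (rule integral_dominated_convergence[where w = "\<lambda>v. B * E v"])
  show "AE v in lborel. (\<lambda>n. cnj (\<Psi> (x + h n * v)) * E v) \<longlonglongrightarrow> cnj (\<Psi> x) * E v"
  proof (rule AE_I2)
   fix v
   have "(\<lambda>n. x + h n * v) \<longlonglongrightarrow> x + 0 * v" by (intro tendsto_intros hlim)
   then have "(\<lambda>n. \<Psi> (x + h n * v)) \<longlonglongrightarrow> \<Psi> x"
    using continuous_on_tendsto_compose[OF cont, of "\<lambda>n. x + h n * v" x] by simp
   then show "(\<lambda>n. cnj (\<Psi> (x + h n * v)) * E v) \<longlonglongrightarrow> cnj (\<Psi> x) * E v" by (intro tendsto_intros)
  qed
  show "AE v in lborel. norm (cnj (\<Psi> (x + h n * v)) * complex_of_real (E v)) <= B * E v" for n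
   using bd Epos by (auto simp: norm_mult less_imp_le intro!: mult_mono order_trans[OF norm_ge_zero bd])
 qed (use Eint in auto)
 have gbd: "norm (g R x) <= B * e" for R x
  unfolding g_def e_def
 proof (rule order_trans[OF integral_norm_bound])
  have "(LINT v|lborel. norm (cnj (\<Psi> (x + R * v)) * complex_of_real (E v))) <= (LINT v|lborel. B * E v)"
  proof (rule integral_mono_AE')
   show "AE v in lborel. norm (cnj (\<Psi> (x + R * v)) * complex_of_real (E v)) <= B * E v"
    using bd Epos by (auto simp: norm_mult less_imp_le intro!: mult_mono order_trans[OF norm_ge_zero bd])
   show "AE v in lborel. 0 <= B * E v"
    using order_trans[OF norm_ge_zero bd] Epos by (auto intro!: mult_nonneg_nonneg simp: less_imp_le)
  qed (use Eint in auto)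
  then show "(LINT v|lborel. norm (cnj (\<Psi> (x + R * v)) * complex_of_real (E v))) <= B * (LINT v|lborel. E v)" by simp
 qed
 have mg: "(\<lambda>x. g R x) \<in> borel_measurable borel" for R unfolding g_def by measurable
 have "(\<lambda>n. CLINT x|lborel. \<Phi> x * g (h n) x) \<longlonglongrightarrow> (CLINT x|lborel. \<Phi> x * (CLINT v|lborel. cnj (\<Psi> x) * E v))"
 proof (rule integral_dominated_convergence[where w = "\<lambda>x. norm (\<Phi> x) * (B * e)"])
  show "AE x in lborel. norm (\<Phi> x * g (h n) x) <= norm (\<Phi> x) * (B * e)" for n
   using gbd by (auto simp: norm_mult intro!: mult_left_mono)
  show "(\<lambda>x. \<Phi> x * (CLINT v|lborel. cnj (\<Psi> x) * E v)) \<in> borel_measurable lborel" by measurable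
  show "(\<lambda>x. \<Phi> x * g (h n) x) \<in> borel_measurable lborel" for n using mg by measurable
 qed (use \<Phi> glim in \<open>auto intro!: tendsto_mult tendsto_const\<close>)
 then have "(CLINT x|lborel. \<Phi> x * (CLINT v|lborel. cnj (\<Psi> x) * E v)) = 0"
  using key[OF h] by (simp add: LIMSEQ_const_iff)
 moreover have "(CLINT v|lborel. cnj (\<Psi> x) * E v) = cnj (\<Psi> x) * e" for x
  unfolding e_def by (simp del: of_real_eq_0_iff)
 ultimately have "(CLINT x|lborel. (\<Phi> x * cnj (\<Psi> x)) * e) = 0" by (simp only: mult.assoc)
 then have "(CLINT x|lborel. \<Phi> x * cnj (\<Psi> x)) * e = 0" by simp
 moreover have "e \<noteq> 0"
 proof
  assume "e = 0"
  then have "AE v in lborel. E v = 0"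
   using integral_nonneg_eq_0_iff_AE[OF Eint] Epos by (simp add: e_def less_imp_le)
  then have "AE v::real in lborel. False"
   by (rule eventually_mono) (use Epos in \<open>metis less_irrefl\<close>)
  then show False using ae_filter_eq_bot_iff[of "lborel::real measure"] by (simp add: trivial_limit_def)
 qed
 ultimately show ?thesis by simp
qed

definition decays :: "nat => ivl => (real => complex) => bool" where
 "decays m I \<Phi> \<longleftrightarrow> continuous_on UNIV \<Phi> \<and> (\<exists>B. \<forall>x. norm (\<Phi> x) <= B * chi I x ^ m)"

definition fsupp :: "(real => complex) => real set => bool" where
 "fsupp \<Phi> A \<longleftrightarrow> closed A \<and> (\<forall>\<xi>. \<xi> \<notin> A \<longrightarrow> fourier \<Phi> \<xi> = 0)"

lemma decays_measurable: "decays m I \<Phi> ==> \<Phi> \<in> borel_measurable borel"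
 by (auto simp: decays_def intro: borel_measurable_continuous_onI)

lemma decays_integrable:
 assumes "decays m I \<Phi>" "0 < len I" "2 <= m"
 shows "integrable lborel \<Phi>"
proof -
 obtain B where B: "\<And>x. norm (\<Phi> x) <= B * chi I x ^ m" using assms by (auto simp: decays_def)
 have m: "\<Phi> \<in> borel_measurable lborel" using decays_measurable[OF assms(1)] by simp
 have "integrable lborel (\<lambda>x. B * chi I x ^ m)" using assms by (intro integrable_mult_right integrable_chi) auto
 then show ?thesis
  by (rule Bochner_Integration.integrable_bound[OF _ m]) (auto intro: order_trans[OF B] abs_ge_self)
qed

lemma decays_bounded:
 assumes "decays m I \<Phi>" "0 < len I"
 shows "\<exists>B. \<forall>x. norm (\<Phi> x) <= B"
proof -
 obtain B where B: "\<And>x. norm (\<Phi> x) <= B * chi I x ^ m" using assms by (auto simp: decays_def)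
 have "norm (\<Phi> x) <= \<bar>B\<bar>" for x
 proof -
  have "B * chi I x ^ m <= \<bar>B\<bar> * 1"
   using assms chi_nonneg[of I x] chi_le1[of I x] by (intro mult_mono power_le_one) auto
  then show ?thesis using B[of x] by simp
 qed
 then show ?thesis by blast
qed

lemma decays_mono: "decays m I \<Phi> ==> 0 < len I ==> n <= m ==> decays n I \<Phi>"
proof -
 assume a: "decays m I \<Phi>" "0 < len I" "n <= m"
 obtain B where B: "\<And>x. norm (\<Phi> x) <= B * chi I x ^ m" using a by (auto simp: decays_def)
 have "norm (\<Phi> x) <= \<bar>B\<bar> * chi I x ^ n" for x
 proof -
  have "B * chi I x ^ m <= \<bar>B\<bar> * chi I x ^ n"
   using a chi_nonneg[of I x] chi_pow_mono[OF a(2,3)] by (intro mult_mono) auto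
  then show ?thesis using B[of x] by simp
 qed
 then show "decays n I \<Phi>" using a by (auto simp: decays_def)
qed

lemma decays_mult_x:
 fixes \<Phi> :: "real => complex"
 assumes "decays (Suc m) I \<Phi>" "0 < len I"
 shows "decays m I (\<lambda>x. x * \<Phi> x)"
proof -
 obtain B where B: "\<And>x. norm (\<Phi> x) <= B * chi I x ^ Suc m" using assms by (auto simp: decays_def)
 have "norm (x * \<Phi> x) <= ((\<bar>ctr I\<bar> + len I) * \<bar>B\<bar>) * chi I x ^ m" for x
 proof -
  have "\<bar>x\<bar> <= (\<bar>ctr I\<bar> + len I) * (1 + \<bar>x - ctr I\<bar> / len I)"
  proof -
   have "\<bar>x\<bar> <= \<bar>ctr I\<bar> + len I * (\<bar>x - ctr I\<bar> / len I)" using assms(2) by simp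
   also have "... <= (\<bar>ctr I\<bar> + len I) * (1 + \<bar>x - ctr I\<bar> / len I)"
   proof -
    have "0 <= \<bar>ctr I\<bar> * (\<bar>x - ctr I\<bar> / len I)" using assms(2) by simp
    moreover have "(\<bar>ctr I\<bar> + len I) * (1 + \<bar>x - ctr I\<bar> / len I)
     = \<bar>ctr I\<bar> + len I + len I * (\<bar>x - ctr I\<bar> / len I) + \<bar>ctr I\<bar> * (\<bar>x - ctr I\<bar> / len I)" by algebra
    ultimately show ?thesis using assms(2) by linarith
   qed
   finally show ?thesis .
  qed
  then have "\<bar>x\<bar> * chi I x <= (\<bar>ctr I\<bar> + len I) * (1 + \<bar>x - ctr I\<bar> / len I) * chi I x"
   using assms by (intro mult_right_mono chi_nonneg) auto
  also have "... = \<bar>ctr I\<bar> + len I"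
   using assms(2) by (simp add: chi_def add_pos_nonneg less_imp_neq[symmetric])
  finally have x: "\<bar>x\<bar> * chi I x <= \<bar>ctr I\<bar> + len I" .
  have "norm (x * \<Phi> x) <= \<bar>x\<bar> * (\<bar>B\<bar> * chi I x ^ Suc m)"
   using B[of x] assms chi_nonneg[of I x] abs_ge_self[of B]
   by (auto simp: norm_mult intro!: mult_left_mono order_trans[OF B] mult_right_mono)
  also have "... = (\<bar>x\<bar> * chi I x) * (\<bar>B\<bar> * chi I x ^ m)" by simp
  also have "... <= (\<bar>ctr I\<bar> + len I) * (\<bar>B\<bar> * chi I x ^ m)"
   using x chi_nonneg[of I x] assms by (intro mult_right_mono) auto
  finally show ?thesis by simp
 qed
 then show ?thesis using assms by (auto simp: decays_def intro!: continuous_intros)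
qed

lemma decays_lin:
 assumes "decays m I \<Phi>" "decays m I \<Psi>" "0 < len I"
 shows "decays m I (\<lambda>x. a * \<Phi> x + b * \<Psi> x)"
proof -
 obtain B B' where B: "\<And>x. norm (\<Phi> x) <= B * chi I x ^ m" "\<And>x. norm (\<Psi> x) <= B' * chi I x ^ m"
  using assms by (auto simp: decays_def)
 have "norm (a * \<Phi> x + b * \<Psi> x) <= (norm a * B + norm b * B') * chi I x ^ m" for x
 proof -
  have "norm (a * \<Phi> x + b * \<Psi> x) <= norm a * norm (\<Phi> x) + norm b * norm (\<Psi> x)"
   by (rule order_trans[OF norm_triangle_ineq]) (simp add: norm_mult)
  also have "... <= norm a * (B * chi I x ^ m) + norm b * (B' * chi I x ^ m)"
   using B by (intro add_mono mult_left_mono) auto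
  finally show ?thesis by (simp add: algebra_simps)
 qed
 then show ?thesis using assms by (auto simp: decays_def intro!: continuous_intros)
qed

lemma fsupp_lin:
 assumes "fsupp \<Phi> A" "fsupp \<Psi> A" "integrable lborel \<Phi>" "integrable lborel \<Psi>"
 shows "fsupp (\<lambda>x. a * \<Phi> x + b * \<Psi> x) A"
proof -
 have i: "integrable lborel (\<lambda>x. \<Theta> x * cis (- 2 * pi * x * t))" if "integrable lborel \<Theta>" for t and \<Theta> :: "real => complex"
  using integrable_norm_cis[OF that, of "- 2 * pi * t" 0] by (simp add: mult_ac)
 have "fourier (\<lambda>x. a * \<Phi> x + b * \<Psi> x) \<xi> = a * fourier \<Phi> \<xi> + b * fourier \<Psi> \<xi>" for \<xi>
 proof -
  have "fourier (\<lambda>x. a * \<Phi> x + b * \<Psi> x) \<xi> =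
   (LINT x|lborel. a * (\<Phi> x * cis (- 2 * pi * x * \<xi>)) + b * (\<Psi> x * cis (- 2 * pi * x * \<xi>)))"
   unfolding fourier_def by (simp only: distrib_right mult.assoc)
  then show ?thesis unfolding fourier_def using i assms by simp
 qed
 then show ?thesis using assms by (auto simp: fsupp_def)
qed

lemma fsupp_mult_x:
 fixes \<Phi> :: "real => complex"
 assumes "fsupp \<Phi> A" "decays (Suc m) I \<Phi>" "0 < len I" "2 <= m"
 shows "fsupp (\<lambda>x. x * \<Phi> x) A"
 using assms fourier_mult_x[of \<Phi> A] decays_integrable[OF decays_mult_x[OF assms(2,3)] assms(3,4)]
  decays_integrable[OF assms(2,3)] decays_measurable[OF assms(2)]
 by (auto simp: fsupp_def)

definition wgt :: "real => real => real => real" where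
 "wgt \<beta> c x = 1 + (\<beta> * (x - c))\<^sup>2"

lemma wgt_ge1: "1 <= wgt \<beta> c x" by (simp add: wgt_def)

lemma wgt_continuous [continuous_intros]: "continuous_on A (wgt \<beta> c)"
 unfolding wgt_def by (intro continuous_intros)

lemma wgt_measurable [measurable]: "wgt \<beta> c \<in> borel_measurable borel"
 unfolding wgt_def by measurable

lemma wgt_fsupp:
 fixes \<Phi> :: "real => complex"
 assumes "fsupp \<Phi> A" "decays (m + 2) I \<Phi>" "0 < len I" "2 <= m"
 shows "fsupp (\<lambda>x. wgt \<beta> c x * \<Phi> x) A \<and> decays m I (\<lambda>x. wgt \<beta> c x * \<Phi> x)"
proof -
 define \<Phi>1 where "\<Phi>1 x = complex_of_real x * \<Phi> x" for x :: real
 define \<Phi>2 where "\<Phi>2 x = complex_of_real x * \<Phi>1 x" for x :: real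
 have d: "decays (Suc (Suc m)) I \<Phi>" using assms(2) by simp
 have d1: "decays (Suc m) I \<Phi>1" unfolding \<Phi>1_def by (rule decays_mult_x[OF d assms(3)])
 have d2: "decays m I \<Phi>2" unfolding \<Phi>2_def by (rule decays_mult_x[OF d1 assms(3)])
 have f1: "fsupp \<Phi>1 A" unfolding \<Phi>1_def by (rule fsupp_mult_x[OF assms(1) d assms(3)]) (use assms in auto)
 have f2: "fsupp \<Phi>2 A" unfolding \<Phi>2_def by (rule fsupp_mult_x[OF f1 d1 assms(3,4)])
 have d0: "decays m I \<Phi>" "decays m I \<Phi>1" using decays_mono[OF d assms(3)] decays_mono[OF d1 assms(3)] by auto
 have i: "integrable lborel \<Phi>" "integrable lborel \<Phi>1" "integrable lborel \<Phi>2"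
  using decays_integrable[OF d0(1) assms(3,4)] decays_integrable[OF d0(2) assms(3,4)]
   decays_integrable[OF d2 assms(3,4)] by auto
 define \<Theta> where "\<Theta> x = complex_of_real (1 + \<beta>\<^sup>2 * c\<^sup>2) * \<Phi> x + complex_of_real (- 2 * \<beta>\<^sup>2 * c) * \<Phi>1 x" for x
 have t: "fsupp \<Theta> A" "decays m I \<Theta>"
  unfolding \<Theta>_def by (rule fsupp_lin[OF assms(1) f1 i(1,2)], rule decays_lin[OF d0 assms(3)])
 have t3: "integrable lborel \<Theta>" by (rule decays_integrable[OF t(2) assms(3,4)])
 have e: "(\<lambda>x. wgt \<beta> c x * \<Phi> x) = (\<lambda>x. 1 * \<Theta> x + complex_of_real (\<beta>\<^sup>2) * \<Phi>2 x)"
  unfolding \<Theta>_def \<Phi>2_def \<Phi>1_def wgt_def by (auto simp: power2_eq_square algebra_simps)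
 show ?thesis unfolding e by (intro conjI fsupp_lin[OF t(1) f2 t3 i(3)] decays_lin[OF t(2) d2 assms(3)])
qed

lemma wgt_orthogonal:
 fixes \<Phi> \<Psi> :: "real => complex"
 assumes "fsupp \<Phi> A" "decays m I \<Phi>" "fsupp \<Psi> A'" "decays m I' \<Psi>" "0 < len I" "0 < len I'" "4 <= m" "A \<inter> A' = {}"
 shows "(LINT x|lborel. (wgt \<beta> c x * \<Phi> x) * cnj (wgt \<beta> c x * \<Psi> x)) = 0"
proof -
 obtain k where k: "m = k + 2" "2 <= k" using assms(7) by (metis add_leD2 le_Suc_ex le_add_diff_inverse2 numeral_Bit0 nat_add_left_cancel_le add.commute add.assoc)
 have 1: "fsupp (\<lambda>x. wgt \<beta> c x * \<Phi> x) A" "decays k I (\<lambda>x. wgt \<beta> c x * \<Phi> x)"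
  using wgt_fsupp[of \<Phi> A k I] assms k by auto
 have 2: "fsupp (\<lambda>x. wgt \<beta> c x * \<Psi> x) A'" "decays k I' (\<lambda>x. wgt \<beta> c x * \<Psi> x)"
  using wgt_fsupp[of \<Psi> A' k I'] assms k by auto
 obtain B where B: "\<And>x. norm (wgt \<beta> c x * \<Psi> x) <= B" using decays_bounded[OF 2(2)] assms by auto
 show ?thesis
 proof (rule fourier_orthogonal[OF decays_integrable[OF 1(2)] decays_integrable[OF 2(2)] B])
  show "continuous_on UNIV (\<lambda>x. wgt \<beta> c x * \<Psi> x)" using 2(2) by (simp add: decays_def)
  show "fourier (\<lambda>x. wgt \<beta> c x * \<Phi> x) \<xi> = 0 \<or> fourier (\<lambda>x. wgt \<beta> c x * \<Psi> x) \<xi> = 0" for \<xi>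
   using 1(1) 2(1) assms(8) by (auto simp: fsupp_def)
 qed (use assms k in auto)
qed

lemma decays_orthogonal:
 assumes "fsupp \<Phi> A" "decays m I \<Phi>" "fsupp \<Psi> A'" "decays m I' \<Psi>" "0 < len I" "0 < len I'" "4 <= m" "A \<inter> A' = {}"
 shows "(LINT x|lborel. \<Phi> x * cnj (\<Psi> x)) = 0"
 using wgt_orthogonal[OF assms, of 0 0] by (simp add: wgt_def)

subsection \<open>Wave packets\<close>

definition wpk :: "real => nat => ivl => ivl => (real => complex) => bool" where
 "wpk B m I w \<Phi> \<longleftrightarrow> continuous_on UNIV \<Phi> \<and> (\<forall>x. norm (\<Phi> x) <= B * len I powr (-1/2) * chi I x ^ m) \<and>
   fsupp \<Phi> {ctr w - (9/20) * len w .. ctr w + (9/20) * len w}"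

lemma wpk_decays: "wpk B m I w \<Phi> ==> decays m I \<Phi>"
 by (auto simp: wpk_def decays_def)

lemma wave_packet_wpk:
 assumes "wave_packet K L Ck (I, w) \<Phi>" "1 <= K" "m <= L" "0 < len I"
 shows "wpk \<bar>Ck 0\<bar> m I w \<Phi>"
proof -
 define g where "g = (\<lambda>x. cis (- 2 * pi * ctr w * x) * \<Phi> x)"
 have w: "\<forall>k<K. \<forall>x. ((vderiv ^^ k) g) differentiable (at x)"
  "\<forall>k\<le>K. \<forall>x. norm ((vderiv ^^ k) g x) <= Ck k * len I powr (- 1/2 - real k) * chi I x ^ L"
  using assms(1) unfolding wave_packet_def Let_def g_def by auto
 have d: "\<And>x. g differentiable (at x)" using w(1)[rule_format, of 0] assms(2) by simp
 have b: "\<And>x. norm (g x) <= Ck 0 * len I powr (- 1/2) * chi I x ^ L"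
  using w(2)[rule_format, of 0] by simp
 have z: "\<And>\<xi>. \<bar>\<xi> - ctr w\<bar> > (9/10) * len w / 2 ==> fourier \<Phi> \<xi> = 0"
  using assms(1) unfolding wave_packet_def by auto
 have cg: "continuous_on UNIV g"
  using d by (intro continuous_at_imp_continuous_on ballI differentiable_imp_continuous_within)
 have eq: "\<Phi> = (\<lambda>x. cis (2 * pi * ctr w * x) * g x)"
  by (auto simp: g_def mult.assoc[symmetric] cis_mult)
 have "norm (\<Phi> x) <= \<bar>Ck 0\<bar> * len I powr (-1/2) * chi I x ^ m" for x
 proof -
  have "norm (\<Phi> x) = norm (g x)" unfolding g_def by (simp add: norm_mult)
  also have "... <= Ck 0 * len I powr (- 1/2) * chi I x ^ L" by (rule b)
  also have "... <= \<bar>Ck 0\<bar> * len I powr (-1/2) * chi I x ^ m"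
   using chi_pow_mono[OF assms(4,3), of x] chi_nonneg[of I x] assms(4)
   by (intro mult_mono) auto
  finally show ?thesis .
 qed
 moreover have "continuous_on UNIV \<Phi>"
  by (subst eq) (intro continuous_intros cg)
 moreover have "fsupp \<Phi> {ctr w - (9/20) * len w .. ctr w + (9/20) * len w}"
  unfolding fsupp_def
 proof (intro conjI allI impI z)
  fix \<xi> assume "\<xi> \<notin> {ctr w - 9 / 20 * len w..ctr w + 9 / 20 * len w}"
  then show "9 / 10 * len w / 2 < \<bar>\<xi> - ctr w\<bar>" unfolding atLeastAtMost_iff by linarith
 qed simp
 ultimately show ?thesis by (simp add: wpk_def)
qed

subsection \<open>Strongly disjoint families of trees\<close>

definition family :: "nat => tritile set => (tritile => tritile) => bool" where
 "family i D \<tau> \<longleftrightarrow> finite D \<and> (\<exists>\<sigma>\<in>shifts. \<forall>Q\<in>D. in_D \<sigma> (tw Q i)) \<and>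
   (\<forall>Q\<in>D. in_D 0 (tI Q) \<and> in_D 0 (tI (\<tau> Q)) \<and> lenI Q * lenw Q i = 1 \<and>
    setI Q \<subseteq> setI (\<tau> Q)) \<and>
   inj_on (\<lambda>Q. comp Q i) D \<and>
   (\<forall>Q\<in>D. \<forall>Q'\<in>D. setw Q i \<subset> setw Q' i \<longrightarrow> setI Q' \<inter> setI (\<tau> Q) = {}) \<and>
   (\<forall>Q\<in>D. \<forall>Q'\<in>D. \<tau> Q = \<tau> Q' \<and> tI Q = tI Q' \<longrightarrow> Q = Q')"

lemma familyD:
 assumes "family i D \<tau>"
 shows "finite D" "Q \<in> D ==> in_D 0 (tI Q)" "Q \<in> D ==> in_D 0 (tI (\<tau> Q))"
  "Q \<in> D ==> lenI Q * lenw Q i = 1" "Q \<in> D ==> setI Q \<subseteq> setI (\<tau> Q)"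
  "Q \<in> D ==> 0 < lenI Q" "Q \<in> D ==> 0 < lenI (\<tau> Q)" "Q \<in> D ==> 0 < lenw Q i"
  "Q \<in> D ==> Q' \<in> D ==> setw Q i \<subset> setw Q' i ==> setI Q' \<inter> setI (\<tau> Q) = {}"
  "Q \<in> D ==> Q' \<in> D ==> \<tau> Q = \<tau> Q' ==> tI Q = tI Q' ==> Q = Q'"
proof -
 show "finite D" "Q \<in> D ==> in_D 0 (tI Q)" "Q \<in> D ==> in_D 0 (tI (\<tau> Q))"
  "Q \<in> D ==> lenI Q * lenw Q i = 1" "Q \<in> D ==> setI Q \<subseteq> setI (\<tau> Q)"
  "Q \<in> D ==> Q' \<in> D ==> setw Q i \<subset> setw Q' i ==> setI Q' \<inter> setI (\<tau> Q) = {}"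
  "Q \<in> D ==> Q' \<in> D ==> \<tau> Q = \<tau> Q' ==> tI Q = tI Q' ==> Q = Q'"
  using assms unfolding family_def by meson+
 show "Q \<in> D ==> 0 < lenI Q" "Q \<in> D ==> 0 < lenI (\<tau> Q)" "Q \<in> D ==> 0 < lenw Q i"
  using assms unfolding family_def by (meson in_D_pos)+
qed

lemma family_len:
 assumes "family i D \<tau>" "Q \<in> D"
 shows "lenw Q i = 1 / lenI Q"
 using familyD(4)[OF assms] familyD(6)[OF assms] by (simp add: field_simps)

lemma family_subset:
 assumes "family i D \<tau>" "D' \<subseteq> D"
 shows "family i D' \<tau>"
proof -
 have D: "\<And>Q. Q \<in> D' ==> Q \<in> D" using assms(2) by blast
 obtain \<sigma> where s: "\<sigma> \<in> shifts" "\<forall>Q\<in>D. in_D \<sigma> (tw Q i)"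
  using assms(1) unfolding family_def by auto
 have i: "inj_on (\<lambda>Q. comp Q i) D" using assms(1) unfolding family_def by auto
 show ?thesis
  unfolding family_def
 proof (intro conjI ballI impI)
  show "finite D'" using familyD(1)[OF assms(1)] assms(2) by (rule finite_subset[rotated])
  show "\<exists>\<sigma>\<in>shifts. \<forall>Q\<in>D'. in_D \<sigma> (tw Q i)" using s D by blast
  show "inj_on (\<lambda>Q. comp Q i) D'" using i assms(2) by (rule inj_on_subset)
  show "setI Q' \<inter> setI (\<tau> Q) = {}"
   if "Q \<in> D'" "Q' \<in> D'" "setw Q i \<subset> setw Q' i" for Q Q'
   using familyD(9)[OF assms(1) D D] that by simp
  show "Q = Q'" if "Q \<in> D'" "Q' \<in> D'" "\<tau> Q = \<tau> Q' \<and> tI Q = tI Q'" for Q Q'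
   using familyD(10)[OF assms(1) D D] that by simp
 qed (use familyD(2-5)[OF assms(1) D] in auto)
qed

lemma family_nested:
 assumes "family i D \<tau>" "Q \<in> D" "Q' \<in> D" "setw Q i \<inter> setw Q' i \<noteq> {}"
 shows "setw Q i \<subseteq> setw Q' i \<or> setw Q' i \<subseteq> setw Q i"
proof -
 obtain \<sigma> where s: "\<sigma> \<in> shifts" "in_D \<sigma> (tw Q i)" "in_D \<sigma> (tw Q' i)"
  using assms(1-3) unfolding family_def by meson
 show ?thesis
  using grid_nest[OF s] grid_nest[OF s(1,3,2)] assms(4) by (metis inf_commute le_cases)
qed

lemma family_len_mono:
 assumes "family i D \<tau>" "Q \<in> D" "Q' \<in> D" "setw Q i \<subseteq> setw Q' i"
 shows "lenI Q' <= lenI Q"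
proof -
 have "lenw Q i <= lenw Q' i" using iv_subset_iff[OF familyD(8)[OF assms(1,2)]] assms(4) by auto
 then show ?thesis using family_len[OF assms(1)] assms familyD(6)[OF assms(1)] by (simp add: field_simps)
qed

lemma family_disjoint:
 assumes "family i D \<tau>" "Q \<in> D" "Q' \<in> D" "Q \<noteq> Q'" "setw Q i \<inter> setw Q' i \<noteq> {}"
 shows "setI Q \<inter> setI Q' = {}"
proof -
 have *: "setI Q \<inter> setI Q' = {}"
  if "Q \<in> D" "Q' \<in> D" "Q \<noteq> Q'" "setw Q i \<subseteq> setw Q' i" for Q Q'
 proof (cases "setw Q i = setw Q' i")
  case True
  then have w: "tw Q i = tw Q' i" using ivl_eq_iv familyD(8)[OF assms(1)] that by blast
  have l: "lenI Q = lenI Q'" using familyD(4)[OF assms(1)] w that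
   by (metis mult_right_cancel mult_zero_right zero_neq_one)
  have "comp Q i \<noteq> comp Q' i" using that assms(1) unfolding family_def by (meson inj_onD)
  then have "tI Q \<noteq> tI Q'" using w by (simp add: comp_def)
  then show ?thesis
   using grid_same[OF zero_shift _ _ l] familyD(2)[OF assms(1)] that by blast
 next
  case False
  then show ?thesis using that familyD(5,9)[OF assms(1)] by blast
 qed
 show ?thesis
  using family_nested[OF assms(1,2,3,5)] *[OF assms(2,3,4)] *[OF assms(3,2) assms(4)[symmetric]] by blast
qed

definition rs :: "tritile => real" where "rs Q = lenI Q powr (-1/2)"

lemma rs_mult: "0 < lenI Q ==> rs Q * rs Q = 1 / lenI Q"
 by (simp add: rs_def powr_add[symmetric] powr_minus_divide)

lemma rs_pos: "0 < lenI Q ==> 0 < rs Q" by (simp add: rs_def)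

lemma rs_sq: "0 < lenI Q ==> (rs Q)\<^sup>2 = 1 / lenI Q"
 using rs_mult by (simp add: power2_eq_square)

definition pb :: "nat => tritile set => (tritile => real) => real" where
 "pb i D a = (\<Sum>Q\<in>D. \<Sum>Q'\<in>{Q'\<in>D. setw Q i \<subseteq> setw Q' i}.
   a Q * a Q' * (rs Q * rs Q') * kap 6 (tI Q) (tI Q'))"

lemma tail_tree:
 fixes J :: "'a => ivl"
 assumes F: "finite F" "inj_on J F" "\<And>Q. Q \<in> F ==> in_D 0 (J Q)" "\<And>Q. Q \<in> F ==> ivl_set (J Q) \<subseteq> ivl_set T" and T: "0 < len T"
 shows "(\<Sum>Q\<in>F. LINT x|lborel. indicator (- ivl_set T) x * chi (J Q) x ^ 4) <= 256 * len T"
proof -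
 define G where "G Q = (LINT x|lborel. indicator (- ivl_set T) x * chi (J Q) x ^ 4)" for Q
 define L where "L = (\<lambda>Q. len (J Q)) ` F"
 have pos: "Q \<in> F ==> 0 < len (J Q)" for Q using F(3) in_D_pos by blast
 have inner: "(\<Sum>Q\<in>{Q\<in>F. len (J Q) = l}. G Q) <= 128 * l" if l: "l \<in> L" for l
 proof -
  have l0: "0 < l" using l pos by (auto simp: L_def)
  define Fl where "Fl = {Q\<in>F. len (J Q) = l}"
  define Xa where "Xa = (fst T - l / 2, l)"
  define Xb where "Xb = (fst T + len T - l / 2, l)"
  have X: "len Xa = l" "len Xb = l" "ctr Xa = fst T" "ctr Xb = fst T + len T"
   by (auto simp: Xa_def Xb_def len_def ctr_def)
  have fin: "finite Fl" using F by (simp add: Fl_def)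
  have dis: "ivl_set (J Q) \<inter> ivl_set (J Q') = {}" if "Q \<in> Fl" "Q' \<in> Fl" "Q \<noteq> Q'" for Q Q'
   using grid_same[OF zero_shift F(3) F(3), of Q Q'] that F(2) by (auto simp: Fl_def inj_on_def)
  have int: "integrable lborel (\<lambda>x. indicator (- ivl_set T) x * chi (J Q) x ^ 4)" if "Q \<in> Fl" for Q
   using that pos by (intro integrable_indicator_mult integrable_chi) (auto simp: Fl_def)
  have intX: "integrable lborel (\<lambda>x. (chi Xa x)\<^sup>2)" "integrable lborel (\<lambda>x. (chi Xb x)\<^sup>2)"
   using X l0 by (auto intro!: integrable_chi)
  have "(\<Sum>Q\<in>Fl. G Q) = (LINT x|lborel. (\<Sum>Q\<in>Fl. indicator (- ivl_set T) x * chi (J Q) x ^ 4))"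
   unfolding G_def using int by (intro Bochner_Integration.integral_sum[symmetric])
  also have "... <= (LINT x|lborel. 16 * ((chi Xa x)\<^sup>2 + (chi Xb x)\<^sup>2))"
  proof (rule integral_mono)
   show "integrable lborel (\<lambda>x. \<Sum>Q\<in>Fl. indicat_real (- ivl_set T) x * chi (J Q) x ^ 4)"
    using int by (intro Bochner_Integration.integrable_sum)
   show "integrable lborel (\<lambda>x. 16 * ((chi Xa x)\<^sup>2 + (chi Xb x)\<^sup>2))"
    using intX by (intro integrable_mult_right Bochner_Integration.integrable_add)
   fix x
   define M where "M = (chi Xa x)\<^sup>2 + (chi Xb x)\<^sup>2"
   have M0: "0 <= M" by (simp add: M_def)
   show "(\<Sum>Q\<in>Fl. indicator (- ivl_set T) x * chi (J Q) x ^ 4) <= 16 * ((chi Xa x)\<^sup>2 + (chi Xb x)\<^sup>2)"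
   proof (cases "x \<in> ivl_set T")
    case True
    then show ?thesis using M0 by (simp add: M_def)
   next
    case False
    have "chi (J Q) x ^ 4 <= M * (chi (J Q) x)\<^sup>2" if Q: "Q \<in> Fl" for Q
    proof -
     have lQ: "len (J Q) = l" "Q \<in> F" using Q by (auto simp: Fl_def)
     have "ctr (J Q) \<in> ivl_set T" using ctr_mem[OF pos[OF lQ(2)]] F(4)[OF lQ(2)] by blast
     then have c: "fst T <= ctr (J Q)" "ctr (J Q) < fst T + len T" by (auto simp: mem_iv)
     have "x < fst T \<or> fst T + len T <= x" using False by (auto simp: mem_iv)
     then have "(chi (J Q) x)\<^sup>2 <= M"
     proof
      assume "x < fst T"
      then have "chi (J Q) x <= chi Xa x"
       using c l0 unfolding chi_def X lQ by (intro divide_left_mono add_mono divide_right_mono mult_pos_pos add_pos_nonneg) auto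
      then have "(chi (J Q) x)\<^sup>2 <= (chi Xa x)\<^sup>2" using chi_nonneg[of "J Q" x] lQ l0 by (intro power_mono) auto
      then show ?thesis by (simp add: M_def add_increasing2)
     next
      assume "fst T + len T <= x"
      then have "chi (J Q) x <= chi Xb x"
       using c l0 unfolding chi_def X lQ by (intro divide_left_mono add_mono divide_right_mono mult_pos_pos add_pos_nonneg) auto
      then have "(chi (J Q) x)\<^sup>2 <= (chi Xb x)\<^sup>2" using chi_nonneg[of "J Q" x] lQ l0 by (intro power_mono) auto
      then show ?thesis by (simp add: M_def add_increasing)
     qed
     then have "(chi (J Q) x)\<^sup>2 * (chi (J Q) x)\<^sup>2 <= M * (chi (J Q) x)\<^sup>2" by (intro mult_right_mono) auto
     then show ?thesis by (simp add: power_add[symmetric])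
    qed
    then have "(\<Sum>Q\<in>Fl. chi (J Q) x ^ 4) <= (\<Sum>Q\<in>Fl. M * (chi (J Q) x)\<^sup>2)" by (rule sum_mono)
    also have "... <= M * 16"
    proof -
     have "(\<Sum>Q\<in>Fl. (chi (J Q) x)\<^sup>2) <= 16"
      by (rule sum_chi_scale[OF fin dis _ l0]) (simp_all add: Fl_def)
     then show ?thesis using M0 by (subst sum_distrib_left[symmetric]) (rule mult_left_mono)
    qed
    finally show ?thesis using False by (simp add: M_def)
   qed
  qed
  also have "... = 16 * ((LINT x|lborel. (chi Xa x)\<^sup>2) + (LINT x|lborel. (chi Xb x)\<^sup>2))"
   using intX by simp
  also have "... <= 16 * (4 * l + 4 * l)"
   using integral_chi_le[of Xa 2] integral_chi_le[of Xb 2] X l0 by simp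
  finally show ?thesis by (simp add: Fl_def)
 qed
 have "(\<Sum>Q\<in>F. G Q) = (\<Sum>l\<in>L. \<Sum>Q\<in>{Q\<in>F. len (J Q) = l}. G Q)"
  unfolding L_def by (rule sum.image_gen[OF F(1)])
 also have "... <= (\<Sum>l\<in>L. 128 * l)" using inner by (rule sum_mono)
 also have "... = 128 * (\<Sum>l\<in>L. l)" by (simp add: sum_distrib_left)
 also have "(\<Sum>l\<in>L. l) <= 2 * len T"
 proof (rule sum_pow2_le)
  show "finite L" using F by (simp add: L_def)
  show "\<And>x. x \<in> L ==> 0 < x" using pos by (auto simp: L_def)
  show "2 * x <= y" if "x \<in> L" "y \<in> L" "x < y" for x y
   using that grid_len2[OF zero_shift F(3) F(3)] by (auto simp: L_def)
  show "x <= len T" if "x \<in> L" for x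
  proof -
   obtain Q where "Q \<in> F" "x = len (J Q)" using \<open>x \<in> L\<close> by (auto simp: L_def)
   then show ?thesis using iv_subset_iff[OF pos, of Q T] F(4)[of Q] by auto
  qed
 qed (use T in auto)
 finally show ?thesis by (simp add: G_def)
qed

lemma pb_le:
 assumes fam: "family i D \<tau>" and a: "\<And>Q. Q \<in> D ==> 0 <= a Q" "\<And>Q. Q \<in> D ==> a Q * rs Q <= A"
 shows "pb i D a <= 16384 * ((\<Sum>Q\<in>D. (a Q)\<^sup>2) + A\<^sup>2 * (\<Sum>T\<in>\<tau> ` D. lenI T))"
proof -
 note fin = familyD(1)[OF fam] and pos = familyD(6)[OF fam] and posT = familyD(7)[OF fam]
 define W where "W Q = setw Q i" for Q
 define t where "t Q Q' = a Q * a Q' * (rs Q * rs Q') * kap 6 (tI Q) (tI Q')" for Q Q'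
 have t0: "0 <= t Q Q'" if "Q \<in> D" "Q' \<in> D" for Q Q'
  unfolding t_def using that a pos rs_pos by (intro mult_nonneg_nonneg kap_nonneg) (auto simp: less_imp_le)
 have split: "(\<Sum>Q'\<in>{Q'\<in>D. W Q \<subseteq> W Q'}. t Q Q') = (\<Sum>Q'\<in>{Q'\<in>D. W Q = W Q'}. t Q Q') + (\<Sum>Q'\<in>{Q'\<in>D. W Q \<subset> W Q'}. t Q Q')" for Q
  using fin by (subst sum.union_disjoint[symmetric]) (auto intro!: sum.cong)
 have same: "(\<Sum>Q\<in>D. \<Sum>Q'\<in>{Q'\<in>D. W Q = W Q'}. t Q Q') <= (\<Sum>Q\<in>D. (a Q)\<^sup>2 * 256)"
 proof -
  define g where "g Q Q' = (if W Q = W Q' then (a Q)\<^sup>2 * (1 / lenI Q) * kap 6 (tI Q) (tI Q') else 0)" for Q Q'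
  have tg: "(if W Q = W Q' then t Q Q' else 0) <= g Q Q' / 2 + g Q' Q / 2" if "Q \<in> D" "Q' \<in> D" for Q Q'
  proof (cases "W Q = W Q'")
   case True
   then have "tw Q i = tw Q' i" using ivl_eq_iv familyD(8)[OF fam] that unfolding W_def by blast
   then have l: "lenI Q = lenI Q'" using familyD(4)[OF fam] that
    by (metis mult_right_cancel mult_zero_right zero_neq_one)
   then have r: "rs Q * rs Q' = 1 / lenI Q" using rs_mult[OF pos[OF that(1)]] by (simp add: rs_def)
   have "a Q * a Q' <= (a Q)\<^sup>2 / 2 + (a Q')\<^sup>2 / 2"
    using sum_squares_bound[of "a Q" "a Q'"] by simp
   then have "a Q * a Q' * (1 / lenI Q * kap 6 (tI Q) (tI Q')) <= ((a Q)\<^sup>2 / 2 + (a Q')\<^sup>2 / 2) * (1 / lenI Q * kap 6 (tI Q) (tI Q'))"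
    using pos that by (intro mult_right_mono mult_nonneg_nonneg kap_nonneg) (auto simp: less_imp_le)
   moreover have "t Q Q' = a Q * a Q' * (1 / lenI Q * kap 6 (tI Q) (tI Q'))"
    by (simp only: t_def r mult.assoc)
   ultimately show ?thesis using True by (simp add: g_def l kap_commute[of _ "tI Q'"] algebra_simps)
  qed (simp add: g_def)
  have "(\<Sum>Q\<in>D. \<Sum>Q'\<in>{Q'\<in>D. W Q = W Q'}. t Q Q') = (\<Sum>Q\<in>D. \<Sum>Q'\<in>D. if W Q = W Q' then t Q Q' else 0)"
   using fin by (intro sum.cong refl sum.mono_neutral_cong_left) auto
  also have "... <= (\<Sum>Q\<in>D. \<Sum>Q'\<in>D. g Q Q' / 2 + g Q' Q / 2)"
   using tg by (intro sum_mono) auto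
  also have "... = (\<Sum>Q\<in>D. \<Sum>Q'\<in>D. g Q Q' / 2) + (\<Sum>Q\<in>D. \<Sum>Q'\<in>D. g Q' Q / 2)"
   by (simp add: sum.distrib)
  also have "(\<Sum>Q\<in>D. \<Sum>Q'\<in>D. g Q' Q / 2) = (\<Sum>Q\<in>D. \<Sum>Q'\<in>D. g Q Q' / 2)"
   by (rule sum.swap)
  also have "(\<Sum>Q\<in>D. \<Sum>Q'\<in>D. g Q Q' / 2) + (\<Sum>Q\<in>D. \<Sum>Q'\<in>D. g Q Q' / 2) = (\<Sum>Q\<in>D. \<Sum>Q'\<in>D. g Q Q')"
   by (simp add: sum_divide_distrib[symmetric])
  also have "... <= (\<Sum>Q\<in>D. (a Q)\<^sup>2 * 256)"
  proof (rule sum_mono)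
   fix Q assume Q: "Q \<in> D"
   have "(\<Sum>Q'\<in>D. g Q Q') = (\<Sum>Q'\<in>{Q'\<in>D. W Q = W Q'}. (a Q)\<^sup>2 * (1 / lenI Q) * kap 6 (tI Q) (tI Q'))"
    unfolding g_def using fin by (intro sum.mono_neutral_cong_right) auto
   also have "... = (a Q)\<^sup>2 * (1 / lenI Q) * (\<Sum>Q'\<in>{Q'\<in>D. W Q = W Q'}. kap (4 + 2) (tI Q) (tI Q'))"
    by (simp add: sum_distrib_left)
   finally have gQ: "(\<Sum>Q'\<in>D. g Q Q') = (a Q)\<^sup>2 * (1 / lenI Q) * (\<Sum>Q'\<in>{Q'\<in>D. W Q = W Q'}. kap (4 + 2) (tI Q) (tI Q'))" .
   have "(\<Sum>Q'\<in>{Q'\<in>D. W Q = W Q'}. kap (4 + 2) (tI Q) (tI Q'))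
     <= 4 * (1 * (1 + 1)) ^ 4 * (LINT x|lborel. indicator UNIV x * chiI Q x ^ 4)"
   proof (rule sum_kap_disjoint(1))
    fix Q1 Q2 assume 1: "Q1 \<in> {Q' \<in> D. W Q = W Q'}" "Q2 \<in> {Q' \<in> D. W Q = W Q'}" "Q1 \<noteq> Q2"
    have "ctrw Q i \<in> W Q" using ctr_mem[OF familyD(8)[OF fam Q]] by (simp add: W_def)
    then show "setI Q1 \<inter> setI Q2 = {}"
     using 1 by (intro family_disjoint[OF fam]) (auto simp: W_def)
   next
    fix Q1 assume 1: "Q1 \<in> {Q' \<in> D. W Q = W Q'}"
    then show "lenI Q1 <= 1 * lenI Q" using family_len_mono[OF fam Q, of Q1] by (simp add: W_def)
   qed (use fin pos Q in auto)
   also have "... <= 64 * (4 * lenI Q)" using integral_chi_le[of "tI Q" 4] pos[OF Q] by simp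
   finally have "(\<Sum>Q'\<in>D. g Q Q') <= (a Q)\<^sup>2 * (1 / lenI Q) * (64 * (4 * lenI Q))"
    unfolding gQ using pos[OF Q] by (intro mult_left_mono) auto
   then show "(\<Sum>Q'\<in>D. g Q Q') <= (a Q)\<^sup>2 * 256" using pos[OF Q] by simp
  qed
  finally show ?thesis .
 qed
 have cross1: "(\<Sum>Q'\<in>{Q'\<in>D. W Q \<subset> W Q'}. t Q Q')
   <= A\<^sup>2 * (64 * (LINT x|lborel. indicator (- setI (\<tau> Q)) x * chiI Q x ^ 4))" if Q: "Q \<in> D" for Q
 proof -
  have "(\<Sum>Q'\<in>{Q'\<in>D. W Q \<subset> W Q'}. t Q Q') <= (\<Sum>Q'\<in>{Q'\<in>D. W Q \<subset> W Q'}. A\<^sup>2 * kap (4 + 2) (tI Q) (tI Q'))"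
  proof (rule sum_mono)
   fix Q' assume Q': "Q' \<in> {Q'\<in>D. W Q \<subset> W Q'}"
   have Q'': "Q' \<in> D" using Q' by blast
   have 0: "0 <= a Q * rs Q" "0 <= a Q' * rs Q'"
    using a(1)[OF Q] a(1)[OF Q''] rs_pos[OF pos[OF Q]] rs_pos[OF pos[OF Q'']] by simp_all
   have "(a Q * rs Q) * (a Q' * rs Q') <= A * A"
    using 0 a(2)[OF Q] a(2)[OF Q''] by (intro mult_mono) linarith+
   then have "((a Q * rs Q) * (a Q' * rs Q')) * kap 6 (tI Q) (tI Q') <= A\<^sup>2 * kap 6 (tI Q) (tI Q')"
    using pos Q Q' by (intro mult_right_mono kap_nonneg) (auto simp: power2_eq_square)
   then show "t Q Q' <= A\<^sup>2 * kap (4 + 2) (tI Q) (tI Q')" by (simp add: t_def mult_ac)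
  qed
  also have "... = A\<^sup>2 * (\<Sum>Q'\<in>{Q'\<in>D. W Q \<subset> W Q'}. kap (4 + 2) (tI Q) (tI Q'))" by (simp only: sum_distrib_left)
  also have "... <= A\<^sup>2 * (4 * (1 * (1 + 1)) ^ 4 * (LINT x|lborel. indicator (- setI (\<tau> Q)) x * chiI Q x ^ 4))"
  proof (intro mult_left_mono sum_kap_disjoint(1))
   fix Q1 Q2 assume 1: "Q1 \<in> {Q'\<in>D. W Q \<subset> W Q'}" "Q2 \<in> {Q'\<in>D. W Q \<subset> W Q'}" "Q1 \<noteq> Q2"
   have "ctrw Q i \<in> W Q" using ctr_mem[OF familyD(8)[OF fam Q]] by (simp add: W_def)
   then show "setI Q1 \<inter> setI Q2 = {}"
    using 1 by (intro family_disjoint[OF fam]) (auto simp: W_def)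
  next
   fix Q1 assume 1: "Q1 \<in> {Q'\<in>D. W Q \<subset> W Q'}"
   then show "lenI Q1 <= 1 * lenI Q" using family_len_mono[OF fam Q, of Q1] by (auto simp: W_def)
   show "setI Q1 \<subseteq> - setI (\<tau> Q)" using 1 familyD(9)[OF fam Q, of Q1] by (auto simp: W_def)
  qed (use fin pos Q in auto)
  finally show ?thesis by simp
 qed
 have "(\<Sum>Q\<in>D. \<Sum>Q'\<in>{Q'\<in>D. W Q \<subset> W Q'}. t Q Q')
   <= (\<Sum>Q\<in>D. A\<^sup>2 * 64 * (LINT x|lborel. indicator (- setI (\<tau> Q)) x * chiI Q x ^ 4))"
  using cross1 by (intro sum_mono) (auto simp: mult_ac)
 also have "... = A\<^sup>2 * 64 * (\<Sum>Q\<in>D. LINT x|lborel. indicator (- setI (\<tau> Q)) x * chiI Q x ^ 4)"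
  by (simp add: sum_distrib_left)
 also have "(\<Sum>Q\<in>D. LINT x|lborel. indicator (- setI (\<tau> Q)) x * chiI Q x ^ 4)
   = (\<Sum>T\<in>\<tau> ` D. \<Sum>Q\<in>{Q\<in>D. \<tau> Q = T}. LINT x|lborel. indicator (- setI (\<tau> Q)) x * chiI Q x ^ 4)"
  by (rule sum.image_gen[OF fin])
 also have "... <= (\<Sum>T\<in>\<tau> ` D. 256 * lenI T)"
 proof (rule sum_mono)
  fix T assume T: "T \<in> \<tau> ` D"
  have "(\<Sum>Q\<in>{Q\<in>D. \<tau> Q = T}. LINT x|lborel. indicator (- setI (\<tau> Q)) x * chiI Q x ^ 4)
    = (\<Sum>Q\<in>{Q\<in>D. \<tau> Q = T}. LINT x|lborel. indicator (- setI T) x * chiI Q x ^ 4)"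
   by (rule sum.cong) auto
  also have "... <= 256 * lenI T"
  proof (rule tail_tree)
   show "inj_on tI {Q \<in> D. \<tau> Q = T}" using familyD(10)[OF fam] unfolding inj_on_def by blast
   show "finite {Q \<in> D. \<tau> Q = T}" using fin by simp
   show "0 < lenI T" using T posT by blast
   show "in_D 0 (tI Q)" "setI Q \<subseteq> setI T" if "Q \<in> {Q \<in> D. \<tau> Q = T}" for Q
    using familyD(2,5)[OF fam, of Q] that by simp_all
  qed
  finally show "(\<Sum>Q\<in>{Q\<in>D. \<tau> Q = T}. LINT x|lborel. indicator (- setI (\<tau> Q)) x * chiI Q x ^ 4) <= 256 * lenI T" .
 qed
 finally have cross: "(\<Sum>Q\<in>D. \<Sum>Q'\<in>{Q'\<in>D. W Q \<subset> W Q'}. t Q Q') <= 16384 * (A\<^sup>2 * (\<Sum>T\<in>\<tau> ` D. lenI T))"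
  by (simp add: mult_left_mono sum_distrib_left[symmetric])
 have "pb i D a = (\<Sum>Q\<in>D. \<Sum>Q'\<in>{Q'\<in>D. W Q = W Q'}. t Q Q') + (\<Sum>Q\<in>D. \<Sum>Q'\<in>{Q'\<in>D. W Q \<subset> W Q'}. t Q Q')"
  unfolding pb_def W_def[symmetric] t_def[symmetric] split by (simp add: sum.distrib)
 also have "... <= (\<Sum>Q\<in>D. (a Q)\<^sup>2) * 256 + 16384 * (A\<^sup>2 * (\<Sum>T\<in>\<tau> ` D. lenI T))"
  using same cross by (simp add: sum_distrib_right)
 also have "... <= 16384 * ((\<Sum>Q\<in>D. (a Q)\<^sup>2) + A\<^sup>2 * (\<Sum>T\<in>\<tau> ` D. lenI T))"
  using sum_nonneg[of D "\<lambda>Q. (a Q)\<^sup>2"] by simp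
 finally show ?thesis .
qed

lemma wgt_chi_le:
 assumes "0 < len I" "0 <= \<beta>" "\<beta> * len I <= 1" "\<beta> * \<bar>ctr I - c\<bar> <= 1"
 shows "wgt \<beta> c x * (chi I x)\<^sup>2 <= 2"
proof -
 have "\<beta> * \<bar>x - c\<bar> <= \<beta> * (\<bar>x - ctr I\<bar> + \<bar>ctr I - c\<bar>)" using assms by (intro mult_left_mono) auto
 also have "... <= \<bar>x - ctr I\<bar> / len I + 1"
 proof -
  have "\<bar>x - ctr I\<bar> * (\<beta> * len I) <= \<bar>x - ctr I\<bar> * 1" using assms by (intro mult_left_mono) auto
  then have "\<beta> * \<bar>x - ctr I\<bar> <= \<bar>x - ctr I\<bar> / len I" using assms by (simp add: field_simps)
  then show ?thesis using assms by (simp add: distrib_left)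
 qed
 finally have "\<beta> * \<bar>x - c\<bar> * chi I x <= (\<bar>x - ctr I\<bar> / len I + 1) * chi I x"
  using assms by (intro mult_right_mono chi_nonneg) auto
 also have "... = 1" using assms by (simp add: chi_def add_pos_nonneg less_imp_neq[symmetric] add.commute)
 finally have "(\<beta> * \<bar>x - c\<bar> * chi I x)\<^sup>2 <= 1"
  using assms chi_nonneg[of I x] by (intro power_le_one) auto
 moreover have "(chi I x)\<^sup>2 <= 1" using assms chi_nonneg[of I x] chi_le1[of I x] by (intro power_le_one) auto
 moreover have "wgt \<beta> c x * (chi I x)\<^sup>2 = (chi I x)\<^sup>2 + (\<beta> * \<bar>x - c\<bar> * chi I x)\<^sup>2"
  by (simp add: wgt_def power_mult_distrib distrib_right)
 ultimately show ?thesis by linarith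
qed

lemma wpk_wgt_bound:
 fixes \<Phi> :: "real => complex"
 assumes "wpk B m I w \<Phi>" "8 <= m" "0 < len I" "0 <= \<beta>" "\<beta> * len I <= 1" "\<beta> * \<bar>ctr I - c\<bar> <= 1" "0 <= B"
 shows "norm (wgt \<beta> c x * \<Phi> x) <= 2 * B * len I powr (-1/2) * chi I x ^ 6"
proof -
 have "norm (\<Phi> x) <= B * len I powr (-1/2) * chi I x ^ m" using assms(1) by (simp add: wpk_def)
 also have "... <= B * len I powr (-1/2) * chi I x ^ 8" using assms by (intro mult_left_mono chi_pow_mono) auto
 finally have "wgt \<beta> c x * norm (\<Phi> x) <= wgt \<beta> c x * (B * len I powr (-1/2) * chi I x ^ 8)"
  using wgt_ge1[of \<beta> c x] by (intro mult_left_mono) auto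
 also have "... = (wgt \<beta> c x * (chi I x)\<^sup>2) * (B * len I powr (-1/2) * chi I x ^ 6)"
  by (simp add: power_add[symmetric] mult_ac)
 also have "... <= 2 * (B * len I powr (-1/2) * chi I x ^ 6)"
  using assms wgt_chi_le[OF assms(3-6), of x] chi_nonneg[of I x] by (intro mult_right_mono) auto
 finally show ?thesis using wgt_ge1[of \<beta> c x] by (simp add: norm_mult mult_ac)
qed

lemma inner_kap_le:
 assumes "\<And>x. norm (f x) <= A * chi I x ^ m" "\<And>x. norm (g x) <= A' * chi I' x ^ m" "0 < len I" "0 < len I'" "2 <= m" "0 <= A" "0 <= A'"
 shows "norm (LINT x|lborel. f x * cnj (g x :: complex)) <= A * A' * kap m I I'"
proof -
 have "norm (LINT x|lborel. f x * cnj (g x)) <= (LINT x|lborel. norm (f x * cnj (g x)))" by (rule integral_norm_bound)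
 also have "... <= (LINT x|lborel. A * A' * (chi I x ^ m * chi I' x ^ m))"
 proof (rule integral_mono_AE')
  show "integrable lborel (\<lambda>x. A * A' * (chi I x ^ m * chi I' x ^ m))"
   using integrable_kap[OF assms(3-5)] by (rule integrable_mult_right)
  have "norm (f x * cnj (g x)) <= A * A' * (chi I x ^ m * chi I' x ^ m)" for x
  proof -
   have "norm (f x) * norm (g x) <= (A * chi I x ^ m) * (A' * chi I' x ^ m)"
    using assms by (intro mult_mono) (auto intro!: mult_nonneg_nonneg zero_le_power chi_nonneg)
   then show ?thesis by (simp add: norm_mult mult_ac)
  qed
  then show "AE x in lborel. norm (f x * cnj (g x)) <= A * A' * (chi I x ^ m * chi I' x ^ m)" by (intro AE_I2)
  then show "AE x in lborel. 0 <= A * A' * (chi I x ^ m * chi I' x ^ m)" by (auto elim!: eventually_mono intro: order_trans[OF norm_ge_zero])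
 qed
 finally show ?thesis by (simp add: kap_def)
qed

lemma dual_le:
 assumes fam: "family i D \<tau>" and \<Phi>: "\<And>Q. Q \<in> D ==> wpk B m (tI Q) (tw Q i) (\<Phi> Q)" and m: "8 <= m" and B: "0 <= B"
  and \<beta>: "0 <= \<beta>" "\<And>Q. Q \<in> D ==> \<beta> * lenI Q <= 1" "\<And>Q. Q \<in> D ==> \<beta> * \<bar>ctrI Q - c\<bar> <= 1"
  and b: "\<And>Q. Q \<in> D ==> norm (b Q) * rs Q <= A"
 defines "G \<equiv> \<lambda>x. \<Sum>Q\<in>D. b Q * \<Phi> Q x"
 shows "(LINT x|lborel. (wgt \<beta> c x)\<^sup>2 * (norm (G x))\<^sup>2)
    <= 131072 * B\<^sup>2 * ((\<Sum>Q\<in>D. (norm (b Q))\<^sup>2) + A\<^sup>2 * (\<Sum>T\<in>\<tau> ` D. lenI T))" (is "?L <= _")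
  and "integrable lborel (\<lambda>x. (wgt \<beta> c x)\<^sup>2 * (norm (G x))\<^sup>2)"
proof -
 note fin = familyD(1)[OF fam] and pos = familyD(6)[OF fam]
 define F where "F Q x = complex_of_real (wgt \<beta> c x) * \<Phi> Q x" for Q x
 have Fb: "norm (F Q x) <= (2 * B * rs Q) * chiI Q x ^ 6" if "Q \<in> D" for Q x
  unfolding F_def rs_def using wpk_wgt_bound[OF \<Phi>[OF that] m pos[OF that] \<beta>(1) \<beta>(2,3)[OF that] B] .
 have Fc: "continuous_on UNIV (F Q)" if "Q \<in> D" for Q
  using \<Phi>[OF that] unfolding F_def wpk_def by (intro continuous_intros) auto
 have Fd: "decays 6 (tI Q) (F Q)" if "Q \<in> D" for Q
  unfolding decays_def using Fc[OF that] Fb[OF that] by blast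
 define ip where "ip Q Q' = (LINT x|lborel. F Q x * cnj (F Q' x))" for Q Q'
 have ii: "integrable lborel (\<lambda>x. F Q x * cnj (F Q' x))" if "Q \<in> D" "Q' \<in> D" for Q Q'
 proof (rule Bochner_Integration.integrable_bound)
  show "integrable lborel (\<lambda>x. (2 * B * rs Q') * norm (F Q x))"
   using decays_integrable[OF Fd[OF that(1)] pos[OF that(1)]] by (intro integrable_mult_right integrable_norm) auto
  show "(\<lambda>x. F Q x * cnj (F Q' x)) \<in> borel_measurable lborel"
   using Fc that by (simp, intro borel_measurable_continuous_onI continuous_intros) auto
  have "norm (F Q' x) <= 2 * B * rs Q'" for x
  proof -
   have "(2 * B * rs Q') * chiI Q' x ^ 6 <= (2 * B * rs Q') * 1"
    using B rs_pos[OF pos[OF that(2)]] pos[OF that(2)] chi_nonneg[of "tI Q'" x] chi_le1[of "tI Q'" x]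
    by (intro mult_left_mono power_le_one mult_nonneg_nonneg) auto
   then show ?thesis using Fb[OF that(2), of x] by linarith
  qed
  then have "norm (F Q x * cnj (F Q' x)) <= norm ((2 * B * rs Q') * norm (F Q x))" for x
   using B rs_pos[OF pos[OF that(2)]] by (simp add: norm_mult abs_mult mult.commute[of "norm (F Q x)"] mult_right_mono)
  then show "AE x in lborel. norm (F Q x * cnj (F Q' x)) <= norm ((2 * B * rs Q') * norm (F Q x))"
   by (intro AE_I2)
 qed
 have eq: "complex_of_real ((wgt \<beta> c x)\<^sup>2 * (norm (G x))\<^sup>2) = (\<Sum>Q\<in>D. \<Sum>Q'\<in>D. (b Q * cnj (b Q')) * (F Q x * cnj (F Q' x)))" for x
 proof -
  have "complex_of_real ((wgt \<beta> c x)\<^sup>2 * (norm (G x))\<^sup>2) = (wgt \<beta> c x * G x) * cnj (wgt \<beta> c x * G x)"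
   using complex_norm_square[of "G x"] by (simp add: power2_eq_square mult_ac)
  also have "wgt \<beta> c x * G x = (\<Sum>Q\<in>D. b Q * F Q x)"
   unfolding G_def F_def by (simp add: sum_distrib_left mult_ac)
  also have "... * cnj ... = (\<Sum>Q\<in>D. \<Sum>Q'\<in>D. (b Q * cnj (b Q')) * (F Q x * cnj (F Q' x)))"
   by (simp add: sum_product mult_ac)
  finally show ?thesis .
 qed
 have int: "integrable lborel (\<lambda>x. complex_of_real ((wgt \<beta> c x)\<^sup>2 * (norm (G x))\<^sup>2))"
  unfolding eq using ii by (intro Bochner_Integration.integrable_sum integrable_mult_right)
 show "integrable lborel (\<lambda>x. (wgt \<beta> c x)\<^sup>2 * (norm (G x))\<^sup>2)"
  using integrable_Re[OF int] by simp
 have "complex_of_real ?L = (\<Sum>Q\<in>D. \<Sum>Q'\<in>D. (b Q * cnj (b Q')) * ip Q Q')"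
 proof -
  have "complex_of_real ?L = (LINT x|lborel. complex_of_real ((wgt \<beta> c x)\<^sup>2 * (norm (G x))\<^sup>2))"
   by (rule integral_complex_of_real[symmetric])
  also have "... = (LINT x|lborel. (\<Sum>Q\<in>D. \<Sum>Q'\<in>D. (b Q * cnj (b Q')) * (F Q x * cnj (F Q' x))))"
   by (simp only: eq)
  also have "... = (\<Sum>Q\<in>D. LINT x|lborel. (\<Sum>Q'\<in>D. (b Q * cnj (b Q')) * (F Q x * cnj (F Q' x))))"
   using ii by (intro Bochner_Integration.integral_sum Bochner_Integration.integrable_sum integrable_mult_right)
  also have "... = (\<Sum>Q\<in>D. \<Sum>Q'\<in>D. LINT x|lborel. (b Q * cnj (b Q')) * (F Q x * cnj (F Q' x)))"
   using ii by (intro sum.cong refl Bochner_Integration.integral_sum integrable_mult_right)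
  finally show ?thesis by (simp only: integral_mult_right_zero ip_def)
 qed
 then have "norm (complex_of_real ?L) = norm (\<Sum>Q\<in>D. \<Sum>Q'\<in>D. (b Q * cnj (b Q')) * ip Q Q')"
  by (rule arg_cong)
 then have "?L <= norm (\<Sum>Q\<in>D. \<Sum>Q'\<in>D. (b Q * cnj (b Q')) * ip Q Q')"
  unfolding norm_of_real using abs_ge_self[of ?L] by (rule ord_le_eq_trans[rotated])
 also have "... <= (\<Sum>Q\<in>D. \<Sum>Q'\<in>D. norm (b Q) * norm (b Q') * norm (ip Q Q'))"
  by (intro order_trans[OF norm_sum] sum_mono order_trans[OF norm_sum]) (simp add: norm_mult)
 also have "... <= (\<Sum>Q\<in>D. \<Sum>Q'\<in>D. 4 * B\<^sup>2 * ((if setw Q i \<subseteq> setw Q' i then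
    norm (b Q) * norm (b Q') * (rs Q * rs Q') * kap 6 (tI Q) (tI Q') else 0)
   + (if setw Q' i \<subseteq> setw Q i then
    norm (b Q') * norm (b Q) * (rs Q' * rs Q) * kap 6 (tI Q') (tI Q) else 0)))"
 proof (intro sum_mono)
  fix Q Q' assume Q: "Q \<in> D" "Q' \<in> D"
  define k where "k = norm (b Q) * norm (b Q') * (rs Q * rs Q') * kap 6 (tI Q) (tI Q')"
  have k0: "0 <= k" unfolding k_def using pos Q rs_pos by (intro mult_nonneg_nonneg kap_nonneg) (auto simp: less_imp_le)
  have k': "norm (b Q') * norm (b Q) * (rs Q' * rs Q) * kap 6 (tI Q') (tI Q) = k"
   by (simp add: k_def kap_commute[of 6 "tI Q'"])
  have "norm (ip Q Q') <= (2 * B * rs Q) * (2 * B * rs Q') * kap 6 (tI Q) (tI Q')"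
   unfolding ip_def using Fb Q pos B rs_pos
   by (intro inner_kap_le) (auto intro!: mult_nonneg_nonneg simp: less_imp_le)
  then have "norm (b Q) * norm (b Q') * norm (ip Q Q') <= norm (b Q) * norm (b Q') * ((2 * B * rs Q) * (2 * B * rs Q') * kap 6 (tI Q) (tI Q'))"
   by (intro mult_left_mono) auto
  also have "... = 4 * B\<^sup>2 * k" by (simp add: k_def power2_eq_square mult_ac)
  finally have le: "norm (b Q) * norm (b Q') * norm (ip Q Q') <= 4 * B\<^sup>2 * k" .
  consider "setw Q i \<subseteq> setw Q' i \<or> setw Q' i \<subseteq> setw Q i"
   | "setw Q i \<inter> setw Q' i = {}"
   using family_nested[OF fam Q] by blast
  then have "norm (b Q) * norm (b Q') * norm (ip Q Q') <= 4 * B\<^sup>2 * ((if setw Q i \<subseteq> setw Q' i then k else 0)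
   + (if setw Q' i \<subseteq> setw Q i then k else 0))"
  proof cases
   case 1
   have "4 * B\<^sup>2 * k <= 4 * B\<^sup>2 * ((if setw Q i \<subseteq> setw Q' i then k else 0)
   + (if setw Q' i \<subseteq> setw Q i then k else 0))"
    using 1 k0 by (intro mult_left_mono) (simp_all split: if_split, blast)
   then show ?thesis using le by linarith
  next
   case 2
   have "ip Q Q' = 0"
    unfolding ip_def F_def
   proof (rule wgt_orthogonal)
    show "fsupp (\<Phi> Q) {ctrw Q i - (9/20) * lenw Q i .. ctrw Q i + (9/20) * lenw Q i}"
     "fsupp (\<Phi> Q') {ctrw Q' i - (9/20) * lenw Q' i .. ctrw Q' i + (9/20) * lenw Q' i}"
     using \<Phi> Q by (auto simp: wpk_def)
    show "decays m (tI Q) (\<Phi> Q)" "decays m (tI Q') (\<Phi> Q')" using \<Phi> Q wpk_decays by blast+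
    have "{ctrw Q i - (9/20) * lenw Q i .. ctrw Q i + (9/20) * lenw Q i} \<subseteq> setw Q i"
     "{ctrw Q' i - (9/20) * lenw Q' i .. ctrw Q' i + (9/20) * lenw Q' i} \<subseteq> setw Q' i"
     using familyD(8)[OF fam Q(1)] familyD(8)[OF fam Q(2)] by (intro subsetI; simp add: mem_iv_ctr)+
    then show "{ctrw Q i - (9/20) * lenw Q i .. ctrw Q i + (9/20) * lenw Q i} \<inter>
     {ctrw Q' i - (9/20) * lenw Q' i .. ctrw Q' i + (9/20) * lenw Q' i} = {}"
     using 2 by blast
   qed (use pos Q m in auto)
   then show ?thesis using B k0 by simp
  qed
  then show "norm (b Q) * norm (b Q') * norm (ip Q Q') <= 4 * B\<^sup>2 * ((if setw Q i \<subseteq> setw Q' i then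
    norm (b Q) * norm (b Q') * (rs Q * rs Q') * kap 6 (tI Q) (tI Q') else 0)
   + (if setw Q' i \<subseteq> setw Q i then
    norm (b Q') * norm (b Q) * (rs Q' * rs Q) * kap 6 (tI Q') (tI Q) else 0))"
   unfolding k' k_def[symmetric] .
 qed
 also have "... = 4 * B\<^sup>2 * (2 * pb i D (\<lambda>Q. norm (b Q)))"
 proof -
  define h where "h Q Q' = (if setw Q i \<subseteq> setw Q' i then
    norm (b Q) * norm (b Q') * (rs Q * rs Q') * kap 6 (tI Q) (tI Q') else 0)" for Q Q'
  have p: "pb i D (\<lambda>Q. norm (b Q)) = (\<Sum>Q\<in>D. \<Sum>Q'\<in>D. h Q Q')"
   unfolding pb_def h_def using fin by (intro sum.cong refl sum.mono_neutral_cong_left) auto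
  have sw: "(\<Sum>Q\<in>D. \<Sum>Q'\<in>D. h Q' Q) = (\<Sum>Q\<in>D. \<Sum>Q'\<in>D. h Q Q')" by (rule sum.swap)
  show ?thesis
   unfolding p h_def[symmetric] sum_distrib_left[symmetric] sum.distrib sw by simp
 qed
 also have "... <= 4 * B\<^sup>2 * (2 * (16384 * ((\<Sum>Q\<in>D. (norm (b Q))\<^sup>2) + A\<^sup>2 * (\<Sum>T\<in>\<tau> ` D. lenI T))))"
  using pb_le[OF fam, of "\<lambda>Q. norm (b Q)" A] b by (intro mult_left_mono) auto
 also have "... = 131072 * B\<^sup>2 * ((\<Sum>Q\<in>D. (norm (b Q))\<^sup>2) + A\<^sup>2 * (\<Sum>T\<in>\<tau> ` D. lenI T))"
  by simp
 finally show "?L <= 131072 * B\<^sup>2 * ((\<Sum>Q\<in>D. (norm (b Q))\<^sup>2) + A\<^sup>2 * (\<Sum>T\<in>\<tau> ` D. lenI T))" .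
qed

lemma integrable_lebesgue_lborel: "f \<in> borel_measurable borel ==> integrable lebesgue f \<longleftrightarrow> integrable lborel (f :: real => 'b::{banach, second_countable_topology})"
 by (rule integrable_completion) simp

lemma integral_lebesgue_lborel: "f \<in> borel_measurable borel ==> integral\<^sup>L lebesgue f = integral\<^sup>L lborel (f :: real => 'b::{banach, second_countable_topology})"
 by (rule integral_completion) simp

lemma energy_le:
 assumes fam: "family i D \<tau>" and \<Phi>: "\<And>Q. Q \<in> D ==> wpk B m (tI Q) (tw Q i) (\<Phi> Q)" and m: "8 <= m" and B: "0 <= B"
  and \<beta>: "0 <= \<beta>" "\<And>Q. Q \<in> D ==> \<beta> * lenI Q <= 1" "\<And>Q. Q \<in> D ==> \<beta> * \<bar>ctrI Q - c\<bar> <= 1"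
  and b: "\<And>Q. Q \<in> D ==> norm (inner_L2 f (\<Phi> Q)) * rs Q <= A"
  and f: "f \<in> borel_measurable lebesgue" "\<And>x. norm (f x) <= 1"
  and H: "integrable lebesgue H" "\<And>x. (norm (f x))\<^sup>2 / (wgt \<beta> c x)\<^sup>2 <= H x"
 shows "(\<Sum>Q\<in>D. (norm (inner_L2 f (\<Phi> Q)))\<^sup>2)
   <= 262144 * (B\<^sup>2 + 1) * (LINT x|lebesgue. H x) + A\<^sup>2 * (\<Sum>T\<in>\<tau> ` D. lenI T) / 2"
proof -
 note fin = familyD(1)[OF fam] and pos = familyD(6)[OF fam]
 define b where "b Q = inner_L2 f (\<Phi> Q)" for Q
 define G where "G = (\<lambda>x. \<Sum>Q\<in>D. b Q * \<Phi> Q x)"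
 define X where "X = (\<Sum>Q\<in>D. (norm (b Q))\<^sup>2)"
 define Z where "Z = A\<^sup>2 * (\<Sum>T\<in>\<tau> ` D. lenI T)"
 define C where "C = 131072 * (B\<^sup>2 + 1)"
 have C0: "0 < C" by (simp add: C_def add_nonneg_pos)
 have dec: "decays m (tI Q) (\<Phi> Q)" if "Q \<in> D" for Q using \<Phi>[OF that] by (rule wpk_decays)
 have \<Phi>c: "continuous_on UNIV (\<Phi> Q)" if "Q \<in> D" for Q using dec[OF that] by (simp add: decays_def)
 have \<Phi>m: "\<Phi> Q \<in> borel_measurable borel" if "Q \<in> D" for Q using dec[OF that] by (rule decays_measurable)
 have \<Phi>i: "integrable lebesgue (\<Phi> Q)" if "Q \<in> D" for Q
  using integrable_lebesgue_lborel[OF \<Phi>m[OF that]] decays_integrable[OF dec[OF that] pos[OF that]] m by simp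
 have Gc: "continuous_on UNIV G" unfolding G_def using \<Phi>c by (intro continuous_intros) auto
 have f\<Phi>: "integrable lebesgue (\<lambda>x. f x * cnj (\<Phi> Q x))" if "Q \<in> D" for Q
 proof (rule Bochner_Integration.integrable_bound[OF \<Phi>i[OF that]])
  have "(\<lambda>x. cnj (\<Phi> Q x)) \<in> borel_measurable lebesgue"
   using \<Phi>c[OF that] by (intro measurable_completion) (simp, intro borel_measurable_continuous_onI continuous_intros)
  then show "(\<lambda>x. f x * cnj (\<Phi> Q x)) \<in> borel_measurable lebesgue" using f(1) by (rule borel_measurable_times[rotated])
  show "AE x in lebesgue. norm (f x * cnj (\<Phi> Q x)) <= norm (\<Phi> Q x)"
   using f(2) by (intro AE_I2) (simp add: norm_mult mult_left_le_one_le)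
 qed
 have "complex_of_real X = (\<Sum>Q\<in>D. b Q * cnj (b Q))"
  unfolding X_def of_real_sum by (rule sum.cong[OF refl]) (rule complex_norm_square)
 also have "... = (\<Sum>Q\<in>D. (LINT x|lebesgue. cnj (b Q) * (f x * cnj (\<Phi> Q x))))"
  by (simp only: integral_mult_right_zero inner_L2_def[symmetric] b_def[symmetric] mult.commute[of "b _"])
 also have "... = (LINT x|lebesgue. (\<Sum>Q\<in>D. cnj (b Q) * (f x * cnj (\<Phi> Q x))))"
  using f\<Phi> by (intro Bochner_Integration.integral_sum[symmetric] integrable_mult_right)
 also have "... = (LINT x|lebesgue. f x * cnj (G x))"
  by (rule Bochner_Integration.integral_cong) (simp_all add: G_def sum_distrib_left mult_ac)
 finally have XG: "complex_of_real X = (LINT x|lebesgue. f x * cnj (G x))" .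
 have d0: "\<And>Q. Q \<in> D ==> norm (b Q) * rs Q <= A" using b unfolding b_def .
 have dual: "(LINT x|lborel. (wgt \<beta> c x)\<^sup>2 * (norm (G x))\<^sup>2) <= 131072 * B\<^sup>2 * (X + Z)"
  unfolding X_def Z_def G_def by (rule dual_le(1)[OF fam \<Phi> m B \<beta> d0])
 have dual2: "integrable lborel (\<lambda>x. (wgt \<beta> c x)\<^sup>2 * (norm (G x))\<^sup>2)"
  unfolding G_def by (rule dual_le(2)[OF fam \<Phi> m B \<beta> d0])
 have mG: "(\<lambda>x. (wgt \<beta> c x)\<^sup>2 * (norm (G x))\<^sup>2) \<in> borel_measurable borel"
  using Gc by (intro borel_measurable_continuous_onI continuous_intros)
 have XZ: "0 <= X + Z" unfolding X_def Z_def using familyD(7)[OF fam]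
  by (intro add_nonneg_nonneg sum_nonneg mult_nonneg_nonneg) (auto simp: less_imp_le)
 have "X <= norm (LINT x|lebesgue. f x * cnj (G x))" unfolding XG[symmetric] norm_of_real by (rule abs_ge_self)
 also have "... <= (LINT x|lebesgue. norm (f x * cnj (G x)))" by (rule integral_norm_bound)
 also have "... <= (LINT x|lebesgue. C * H x + 1 / (4 * C) * ((wgt \<beta> c x)\<^sup>2 * (norm (G x))\<^sup>2))"
 proof (rule integral_mono_AE')
  show "integrable lebesgue (\<lambda>x. C * H x + 1 / (4 * C) * ((wgt \<beta> c x)\<^sup>2 * (norm (G x))\<^sup>2))"
   using H(1) dual2 integrable_lebesgue_lborel[OF mG]
   by (intro Bochner_Integration.integrable_add integrable_mult_right) auto
  have *: "norm (f x * cnj (G x)) <= C * H x + 1 / (4 * C) * ((wgt \<beta> c x)\<^sup>2 * (norm (G x))\<^sup>2)" for x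
  proof -
   define u where "u = norm (f x) / wgt \<beta> c x"
   define v where "v = wgt \<beta> c x * norm (G x)"
   have w: "0 < wgt \<beta> c x" using wgt_ge1[of \<beta> c x] by linarith
   have "norm (f x * cnj (G x)) = u * v" using w by (simp add: u_def v_def norm_mult)
   also have "... <= C * u\<^sup>2 + 1 / (4 * C) * v\<^sup>2"
   proof -
    have "0 <= (2 * C * u - v)\<^sup>2" by simp
    then have "4 * C * (u * v) <= 4 * C * (C * u\<^sup>2) + v\<^sup>2" by (simp add: power2_eq_square algebra_simps)
    then show ?thesis using C0 by (simp add: field_simps)
   qed
   also have "... <= C * H x + 1 / (4 * C) * v\<^sup>2"
    using mult_left_mono[OF H(2)[of x], of C] C0 by (simp add: u_def power_divide)
   finally show ?thesis by (simp add: v_def power_mult_distrib)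
  qed
  then show "AE x in lebesgue. norm (f x * cnj (G x)) <= C * H x + 1 / (4 * C) * ((wgt \<beta> c x)\<^sup>2 * (norm (G x))\<^sup>2)" by (intro AE_I2)
  show "AE x in lebesgue. 0 <= C * H x + 1 / (4 * C) * ((wgt \<beta> c x)\<^sup>2 * (norm (G x))\<^sup>2)"
   by (intro AE_I2 order_trans[OF norm_ge_zero *])
 qed
 also have "... = C * (LINT x|lebesgue. H x) + 1 / (4 * C) * (LINT x|lborel. (wgt \<beta> c x)\<^sup>2 * (norm (G x))\<^sup>2)"
  using H(1) dual2 integrable_lebesgue_lborel[OF mG] integral_lebesgue_lborel[OF mG] by simp
 also have "... <= C * (LINT x|lebesgue. H x) + 1 / (4 * C) * (C * (X + Z))"
 proof -
  have "131072 * B\<^sup>2 * (X + Z) <= C * (X + Z)" using XZ by (intro mult_right_mono) (auto simp: C_def)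
  then have "(LINT x|lborel. (wgt \<beta> c x)\<^sup>2 * (norm (G x))\<^sup>2) <= C * (X + Z)" using dual by linarith
  then show ?thesis using C0 by (intro add_left_mono mult_left_mono) auto
 qed
 also have "... = C * (LINT x|lebesgue. H x) + (X + Z) / 4" using C0 by simp
 finally have fin1: "X <= C * (LINT x|lebesgue. H x) + (X + Z) / 4" .
 have "0 <= H x" for x using H(2)[of x] by (rule order_trans[rotated]) simp
 then have "0 <= C * (LINT x|lebesgue. H x)" using C0 by (intro mult_nonneg_nonneg integral_nonneg_AE) auto
 moreover have "0 <= Z" unfolding Z_def using familyD(7)[OF fam] by (intro mult_nonneg_nonneg sum_nonneg) (auto simp: less_imp_le)
 ultimately have "X <= 2 * (C * (LINT x|lebesgue. H x)) + Z / 2"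
  using fin1 by (simp add: field_simps)
 moreover have "2 * (C * (LINT x|lebesgue. H x)) = 262144 * (B\<^sup>2 + 1) * (LINT x|lebesgue. H x)"
  by (simp add: C_def)
 ultimately show ?thesis unfolding X_def Z_def b_def by (simp only:)
qed

subsection \<open>Energy of the composed coefficients\<close>

lemma wpk_bound8:
 assumes "wpk B m I w \<Phi>" "8 <= m" "0 < len I" "0 <= B"
 shows "norm (\<Phi> x) <= B * len I powr (-1/2) * chi I x ^ 8"
proof -
 have "norm (\<Phi> x) <= B * len I powr (-1/2) * chi I x ^ m" using assms(1) by (simp add: wpk_def)
 also have "... <= B * len I powr (-1/2) * chi I x ^ 8" using assms by (intro mult_left_mono chi_pow_mono) auto
 finally show ?thesis .
qed

definition edge :: "real => ivl => real" where "edge s w = ctr w + s * (9/20) * len w"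

locale model_pair =
 fixes D :: "tritile set" and \<tau> :: "tritile => tritile" and \<Phi> :: "tritile => real => complex"
  and PP :: "tritile set" and \<Psi> :: "tritile => real => complex" and \<gamma> :: "tritile => complex"
  and B :: real and m :: nat and c :: real
 assumes famQ: "family 3 D \<tau>" and famP: "family 2 PP (\<lambda>P. P)"
  and wQ: "\<And>Q. Q \<in> D ==> wpk B m (tI Q) (tw Q 3) (\<Phi> Q)"
  and wP: "\<And>P. P \<in> PP ==> wpk B m (tI P) (tw P 2) (\<Psi> P)"
  and m8: "8 <= m" and B0: "0 <= B" and c0: "0 < c" and c1: "c <= 1/20"
  and \<gamma>1: "\<And>P. P \<in> PP ==> norm (\<gamma> P) * rs P <= 1"
begin

lemmas finQ = familyD(1)[OF famQ] and finP = familyD(1)[OF famP]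
 and posQ = familyD(6)[OF famQ] and posP = familyD(6)[OF famP]
 and poswQ = familyD(8)[OF famQ] and poswP = familyD(8)[OF famP]
 and lenQ = family_len[OF famQ] and lenP = family_len[OF famP]

definition ip :: "tritile => tritile => complex" where
 "ip P Q = (LINT x|lborel. \<Psi> P x * cnj (\<Phi> Q x))"

definition rel :: "tritile => tritile => bool" where
 "rel Q P \<longleftrightarrow> cc_sub c (tw Q 3) (tw P 2)"

definition bc :: "tritile => complex" where
 "bc Q = (\<Sum>P\<in>{P\<in>PP. rel Q P}. \<gamma> P * ip P Q)"

definition SP :: real where "SP = (\<Sum>P\<in>PP. lenI P)"

lemma SP_nonneg: "0 <= SP" unfolding SP_def using posP by (intro sum_nonneg) (simp add: less_imp_le)

lemma integrable_ip: "P \<in> PP ==> Q \<in> D ==> integrable lborel (\<lambda>x. \<Psi> P x * cnj (\<Phi> Q x))"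
proof -
 assume PQ: "P \<in> PP" "Q \<in> D"
 have dP: "decays m (tI P) (\<Psi> P)" and dQ: "decays m (tI Q) (\<Phi> Q)" using wpk_decays wP wQ PQ by blast+
 obtain B' where B': "\<And>x. norm (\<Phi> Q x) <= B'" using decays_bounded[OF dQ posQ[OF PQ(2)]] by blast
 show ?thesis
 proof (rule Bochner_Integration.integrable_bound)
  show "integrable lborel (\<lambda>x. B' * norm (\<Psi> P x))"
   using decays_integrable[OF dP posP[OF PQ(1)]] m8 by (intro integrable_mult_right integrable_norm) auto
  show "(\<lambda>x. \<Psi> P x * cnj (\<Phi> Q x)) \<in> borel_measurable lborel"
   using dP dQ unfolding decays_def by (simp, intro borel_measurable_continuous_onI continuous_intros) auto
  have "norm (\<Psi> P x * cnj (\<Phi> Q x)) <= norm (B' * norm (\<Psi> P x))" for x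
   using B'[of x] order_trans[OF norm_ge_zero B'] by (simp add: norm_mult mult.commute mult_right_mono abs_mult)
  then show "AE x in lborel. norm (\<Psi> P x * cnj (\<Phi> Q x)) <= norm (B' * norm (\<Psi> P x))" by (intro AE_I2)
 qed
qed

lemma ip_le: "P \<in> PP ==> Q \<in> D ==> norm (ip P Q) <= B\<^sup>2 * (rs P * rs Q) * kap 8 (tI P) (tI Q)"
proof -
 assume PQ: "P \<in> PP" "Q \<in> D"
 have "norm (ip P Q) <= (B * rs P) * (B * rs Q) * kap 8 (tI P) (tI Q)"
  unfolding ip_def rs_def
  by (rule inner_kap_le[OF wpk_bound8[OF wP[OF PQ(1)] m8 posP[OF PQ(1)] B0] wpk_bound8[OF wQ[OF PQ(2)] m8 posQ[OF PQ(2)] B0]])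
   (use PQ posP posQ B0 in simp_all)
 then show ?thesis by (simp add: power2_eq_square mult_ac)
qed

lemma term_le:
 assumes "P \<in> PP" "Q \<in> D"
 shows "norm (\<gamma> P) * norm (ip P Q) <= B\<^sup>2 * rs Q * kap 8 (tI P) (tI Q)"
proof -
 have "norm (\<gamma> P) * norm (ip P Q) <= norm (\<gamma> P) * (B\<^sup>2 * (rs P * rs Q) * kap 8 (tI P) (tI Q))"
  using ip_le[OF assms] by (intro mult_left_mono) auto
 also have "... = (norm (\<gamma> P) * rs P) * (B\<^sup>2 * rs Q * kap 8 (tI P) (tI Q))" by (simp add: mult_ac)
 also have "... <= 1 * (B\<^sup>2 * rs Q * kap 8 (tI P) (tI Q))"
  using \<gamma>1[OF assms(1)] kap_nonneg[OF posP[OF assms(1)] posQ[OF assms(2)]] rs_pos[OF posQ[OF assms(2)]]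
  by (intro mult_right_mono mult_nonneg_nonneg) (simp_all add: less_imp_le)
 finally show ?thesis by simp
qed

text \<open>A pair that contributes to the full inner product but not to the truncated one either has comparable
 or reversed scales, or the small frequency interval meets an edge of the nine-tenths dilate.\<close>

lemma bad_cases:
 assumes "P \<in> PP" "Q \<in> D" "\<not> rel Q P" "ip P Q \<noteq> 0"
 obtains "c * lenw P 2 < lenw Q 3" "setw Q 3 \<inter> setw P 2 \<noteq> {}"
 | s where "s \<in> {-1, 1}" "lenw Q 3 <= c * lenw P 2" "edge s (tw P 2) \<in> setw Q 3"
proof -
 define w where "w = tw Q 3"
 define w' where "w' = tw P 2"
 have pos: "0 < len w" "0 < len w'" using poswQ poswP assms by (simp_all add: w_def w'_def)
 have "{ctr w' - (9/20) * len w' .. ctr w' + (9/20) * len w'} \<inter> {ctr w - (9/20) * len w .. ctr w + (9/20) * len w} \<noteq> {}"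
 proof
  assume e: "{ctr w' - (9/20) * len w' .. ctr w' + (9/20) * len w'} \<inter> {ctr w - (9/20) * len w .. ctr w + (9/20) * len w} = {}"
  have "ip P Q = 0" unfolding ip_def
  proof (rule decays_orthogonal[OF _ _ _ _ _ _ _ e])
   show "fsupp (\<Psi> P) {ctr w' - (9/20) * len w' .. ctr w' + (9/20) * len w'}" "fsupp (\<Phi> Q) {ctr w - (9/20) * len w .. ctr w + (9/20) * len w}"
    using wP wQ assms by (simp_all add: wpk_def w_def w'_def)
   show "decays m (tI P) (\<Psi> P)" "decays m (tI Q) (\<Phi> Q)" using wpk_decays wP wQ assms by blast+
   show "0 < lenI P" "0 < lenI Q" "4 <= m" using posP posQ assms m8 by simp_all
  qed
  then show False using assms by simp
 qed
 then obtain z where z: "ctr w' - (9/20) * len w' <= z" "z <= ctr w' + (9/20) * len w'"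
  "ctr w - (9/20) * len w <= z" "z <= ctr w + (9/20) * len w"
  unfolding ex_in_conv[symmetric] Int_iff atLeastAtMost_iff by blast
 have zw: "z \<in> ivl_set w" "z \<in> ivl_set w'" using z pos by (simp_all add: mem_iv_ctr)
 show thesis
 proof (cases "len w <= c * len w'")
  case False
  then show ?thesis using that(1) zw by (auto simp: w_def w'_def)
 next
  case True
  then have "\<not> ivl_set w \<subseteq> ivl_set (dil (9/10) w')" using assms(3) by (simp add: rel_def cc_sub_def w_def w'_def)
  then obtain y where y: "y \<in> ivl_set w" "y \<notin> ivl_set (dil (9/10) w')" by blast
  then have "y < ctr w' - (9/20) * len w' \<or> ctr w' + (9/20) * len w' <= y" by (auto simp: mem_iv_ctr)
  then show ?thesis
  proof
   assume "y < ctr w' - (9/20) * len w'"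
   then have "edge (-1) w' \<in> ivl_set w" using y(1) zw(1) z by (simp add: edge_def mem_iv)
   then show ?thesis using that(2)[of "-1"] True by (simp add: w_def w'_def)
  next
   assume "ctr w' + (9/20) * len w' <= y"
   then have "edge 1 w' \<in> ivl_set w" using y(1) zw(1) z by (simp add: edge_def mem_iv)
   then show ?thesis using that(2)[of 1] True by (simp add: w_def w'_def)
  qed
 qed
qed

lemma edge_subset:
 assumes "P \<in> PP" "Q \<in> D" "s \<in> {-1, 1}" "lenw Q 3 <= c * lenw P 2" "edge s (tw P 2) \<in> setw Q 3"
 shows "setw Q 3 \<subseteq> setw P 2"
proof
 fix x assume x: "x \<in> setw Q 3"
 have "c * lenw P 2 <= 1/20 * lenw P 2" using c1 poswP[OF assms(1)] by (intro mult_right_mono) auto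
 then have "\<bar>x - edge s (tw P 2)\<bar> < 1/20 * lenw P 2"
  using x assms(4,5) unfolding mem_iv by linarith
 moreover have "edge s (tw P 2) = ctrw P 2 + 9/20 * lenw P 2 \<or> edge s (tw P 2) = ctrw P 2 - 9/20 * lenw P 2"
  using assms(3) by (auto simp: edge_def)
 ultimately show "x \<in> setw P 2" unfolding mem_iv_ctr by linarith
qed

lemma len_I_le:
 assumes "P \<in> PP" "Q \<in> D" "lenw Q 3 <= c * lenw P 2"
 shows "lenI P <= c * lenI Q"
 using assms(3) lenQ[OF assms(2)] lenP[OF assms(1)] posQ[OF assms(2)] posP[OF assms(1)]
 by (simp add: field_simps)

lemma len_I_le1:
 assumes "P \<in> PP" "Q \<in> D" "lenw Q 3 <= c * lenw P 2"
 shows "lenI P <= lenI Q"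
proof -
 have "c * lenI Q <= 1 * lenI Q" using c1 posQ[OF assms(2)] by (intro mult_right_mono) auto
 then show ?thesis using len_I_le[OF assms] by simp
qed

lemma term_le2:
 assumes "P \<in> PP" "Q \<in> D" "lenw Q 3 <= c * lenw P 2"
 shows "norm (\<gamma> P) * norm (ip P Q) <= 4 * B\<^sup>2 * rs Q * lenI P * chiI Q (ctrI P) ^ 6"
proof -
 have "kap (6 + 2) (tI Q) (tI P) <= 4 * 1 ^ 6 * lenI P * chiI Q (ctrI P) ^ 6"
  using len_I_le1[OF assms] posQ posP assms by (intro kap_le_pt) simp_all
 then have "B\<^sup>2 * rs Q * kap 8 (tI P) (tI Q) <= B\<^sup>2 * rs Q * (4 * lenI P * chiI Q (ctrI P) ^ 6)"
  using rs_pos[OF posQ[OF assms(2)]] by (intro mult_left_mono) (simp_all add: kap_commute[of _ "tI Q"] less_imp_le)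
 then show ?thesis using term_le[OF assms(1,2)] by (simp add: mult_ac)
qed

definition bad1 :: "tritile => tritile set" where
 "bad1 P = {Q\<in>D. c * lenw P 2 < lenw Q 3 \<and> setw Q 3 \<inter> setw P 2 \<noteq> {}}"

definition bad2 :: "real => tritile => tritile set" where
 "bad2 s P = {Q\<in>D. lenw Q 3 <= c * lenw P 2 \<and> edge s (tw P 2) \<in> setw Q 3}"

lemma bad1_sum:
 assumes P: "P \<in> PP"
 shows "(\<Sum>Q\<in>bad1 P. kap 8 (tI P) (tI Q)) <= real (nat \<lceil>1/c\<rceil> + 2) * (16 * (1 / c * (1 + 1 / c)) ^ 6) * lenI P"
proof -
 define N where "N = nat \<lceil>1/c\<rceil> + 2"
 define u where "u = fst (tw P 2)"
 define L where "L = lenw P 2"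
 have L: "0 < L" using poswP[OF P] by (simp add: L_def)
 define Fk where "Fk k = {Q\<in>D. c * L < lenw Q 3 \<and> u + real k * (c * L) \<in> setw Q 3}" for k
 have cover: "bad1 P \<subseteq> (\<Union>k<N. Fk k)"
 proof
  fix Q assume Q: "Q \<in> bad1 P"
  define p where "p = fst (tw Q 3)"
  define l where "l = lenw Q 3"
  have l: "c * L < l" using Q by (simp add: bad1_def l_def L_def)
  obtain z where z: "p <= z" "z < p + l" "u <= z" "z < u + L"
   using Q by (auto simp: bad1_def mem_iv p_def l_def u_def L_def)
  have s0: "0 < c * L" using c0 L by simp
  show "Q \<in> (\<Union>k<N. Fk k)"
  proof (cases "p < u")
   case True
   have "u + real 0 * (c * L) \<in> setw Q 3"
    using True z by (simp add: mem_iv p_def[symmetric] l_def[symmetric])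
   then have "Q \<in> Fk 0" using Q by (simp add: Fk_def bad1_def L_def)
   then show ?thesis by (intro UN_I[of 0]) (simp_all add: N_def)
  next
   case False
   define k where "k = nat \<lceil>(p - u) / (c * L)\<rceil>"
   have q0: "0 <= (p - u) / (c * L)" using False s0 by simp
   have k1: "(p - u) / (c * L) <= real k" unfolding k_def by (rule real_nat_ceiling_ge)
   have k2: "real k < (p - u) / (c * L) + 1" unfolding k_def using q0 by linarith
   have 1: "p <= u + real k * (c * L)" using k1 s0 by (simp add: field_simps)
   have "real k * (c * L) < ((p - u) / (c * L) + 1) * (c * L)" using k2 s0 by (rule mult_strict_right_mono)
   also have "... = p - u + c * L" using less_imp_neq[OF s0] by (simp only: distrib_right) simp
   finally have 2: "u + real k * (c * L) < p + c * L" by linarith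
   have "u + real k * (c * L) \<in> setw Q 3"
    using 1 2 l by (simp add: mem_iv p_def[symmetric] l_def[symmetric])
   then have "Q \<in> Fk k" using Q by (simp add: Fk_def bad1_def L_def)
   moreover have "k < N"
   proof -
    have "(p - u) / (c * L) <= L / (c * L)" using z s0 by (intro divide_right_mono) auto
    then have "real k < 1 / c + 1" using k2 L by simp
    also have "... <= real (nat \<lceil>1/c\<rceil>) + 1" using real_nat_ceiling_ge[of "1/c"] by simp
    finally show ?thesis unfolding N_def by simp
   qed
   ultimately show ?thesis by blast
  qed
 qed
 have k0: "0 <= kap 8 (tI P) (tI Q)" if "Q \<in> D" for Q using posP[OF P] posQ[OF that] by (rule kap_nonneg)
 have each: "(\<Sum>Q\<in>Fk k. kap (6 + 2) (tI P) (tI Q)) <= 16 * (1 / c * (1 + 1 / c)) ^ 6 * lenI P" for k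
 proof -
  have "(\<Sum>Q\<in>Fk k. kap (6 + 2) (tI P) (tI Q)) <= 4 * (1/c * (1 + 1/c)) ^ 6 * (LINT x|lborel. indicator UNIV x * chiI P x ^ 6)"
  proof (rule sum_kap_disjoint(1))
   fix Q1 Q2 assume "Q1 \<in> Fk k" "Q2 \<in> Fk k" "Q1 \<noteq> Q2"
   then show "setI Q1 \<inter> setI Q2 = {}"
    unfolding Fk_def by (intro family_disjoint[OF famQ]) blast+
  next
   fix Q1 assume Q1: "Q1 \<in> Fk k"
   then have Q1D: "Q1 \<in> D" by (simp add: Fk_def)
   have "c * L < lenw Q1 3" using Q1 by (simp add: Fk_def)
   then show "lenI Q1 <= 1 / c * lenI P"
    using lenQ[OF Q1D] lenP[OF P] posQ[OF Q1D] posP[OF P] c0 by (simp add: L_def field_simps)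
   show "0 < lenI Q1" using posQ[OF Q1D] .
  qed (use finQ c0 c1 posP[OF P] in \<open>simp_all add: Fk_def\<close>)
  also have "... <= 4 * (1/c * (1 + 1/c)) ^ 6 * (4 * lenI P)"
   using integral_chi_le[of "tI P" 6] posP[OF P] c0 by (intro mult_left_mono) simp_all
  finally show ?thesis by simp
 qed
 have "(\<Sum>Q\<in>bad1 P. kap 8 (tI P) (tI Q)) <= (\<Sum>Q\<in>(\<Union>k<N. Fk k). kap 8 (tI P) (tI Q))"
  using cover finQ k0 by (intro sum_mono2) (simp_all add: Fk_def)
 also have "... <= (\<Sum>k<N. \<Sum>Q\<in>Fk k. kap 8 (tI P) (tI Q))"
 proof (induction N)
  case 0 then show ?case by simp
 next
  case (Suc n)
  have "(\<Sum>Q\<in>(\<Union>k<Suc n. Fk k). kap 8 (tI P) (tI Q)) = (\<Sum>Q\<in>(\<Union>k<n. Fk k) \<union> Fk n. kap 8 (tI P) (tI Q))"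
   by (rule sum.cong) (auto simp: less_Suc_eq)
  also have "... <= (\<Sum>Q\<in>(\<Union>k<n. Fk k). kap 8 (tI P) (tI Q)) + (\<Sum>Q\<in>Fk n. kap 8 (tI P) (tI Q))"
  proof -
   have "0 <= (\<Sum>Q\<in>(\<Union>k<n. Fk k) \<inter> Fk n. kap 8 (tI P) (tI Q))"
    using k0 by (intro sum_nonneg) (simp add: Fk_def)
   moreover have "finite (\<Union>k<n. Fk k)" "finite (Fk n)" using finQ by (simp_all add: Fk_def)
   ultimately show ?thesis using sum.union_inter[of "\<Union>k<n. Fk k" "Fk n" "\<lambda>Q. kap 8 (tI P) (tI Q)"] by simp
  qed
  finally show ?case using Suc by simp
 qed
 also have "... <= (\<Sum>k<N. 16 * (1 / c * (1 + 1 / c)) ^ 6 * lenI P)" using each by (intro sum_mono) simp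
 finally show ?thesis by (simp add: N_def)
qed

lemma bad2_sum:
 assumes s: "s \<in> {-1, 1}"
 defines "F \<equiv> \<lambda>P. \<Sum>Q\<in>bad2 s P. norm (bc Q) * rs Q * chiI Q (ctrI P) ^ 6"
 shows "(\<Sum>P\<in>PP. lenI P * (F P)\<^sup>2) <= 8192 * pb 3 D (\<lambda>Q. norm (bc Q))"
proof -
 define W where "W Q = setw Q 3" for Q
 define v where "v Q P = norm (bc Q) * rs Q * chiI Q (ctrI P) ^ 6" for Q P
 have v0: "0 <= v Q P" if "Q \<in> D" for Q P
  using rs_pos[OF posQ[OF that]] chi_nonneg[of "tI Q"] posQ[OF that] by (simp add: v_def)
 have sq: "(F P)\<^sup>2 <= 2 * (\<Sum>Q\<in>D. \<Sum>Q'\<in>{Q'\<in>D. W Q \<subseteq> W Q'}. if Q \<in> bad2 s P \<and> Q' \<in> bad2 s P then v Q P * v Q' P else 0)" for P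
 proof -
  define h where "h Q Q' = (if W Q \<subseteq> W Q' then (if Q \<in> bad2 s P \<and> Q' \<in> bad2 s P then v Q P * v Q' P else 0) else 0)" for Q Q'
  have h0: "0 <= h Q Q'" if "Q \<in> D" "Q' \<in> D" for Q Q' using v0 that by (simp add: h_def)
  have sub: "bad2 s P \<subseteq> D" by (auto simp: bad2_def)
  have "(F P)\<^sup>2 = (\<Sum>Q\<in>bad2 s P. \<Sum>Q'\<in>bad2 s P. v Q P * v Q' P)"
   unfolding F_def v_def[symmetric] power2_eq_square sum_product ..
  also have "... <= (\<Sum>Q\<in>bad2 s P. \<Sum>Q'\<in>bad2 s P. h Q Q' + h Q' Q)"
  proof (intro sum_mono)
   fix Q Q' assume Q: "Q \<in> bad2 s P" "Q' \<in> bad2 s P"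
   then have D: "Q \<in> D" "Q' \<in> D" using sub by blast+
   have "edge s (tw P 2) \<in> W Q \<inter> W Q'" using Q by (simp add: bad2_def W_def)
   then have "W Q \<subseteq> W Q' \<or> W Q' \<subseteq> W Q" unfolding W_def using family_nested[OF famQ D] by blast
   then show "v Q P * v Q' P <= h Q Q' + h Q' Q"
   proof
    assume "W Q \<subseteq> W Q'"
    then have "h Q Q' = v Q P * v Q' P" using Q by (simp add: h_def)
    then show ?thesis using h0[OF D(2,1)] by simp
   next
    assume "W Q' \<subseteq> W Q"
    then have "h Q' Q = v Q P * v Q' P" using Q by (simp add: h_def mult.commute)
    then show ?thesis using h0[OF D] by simp
   qed
  qed
  also have "... <= (\<Sum>Q\<in>D. \<Sum>Q'\<in>D. h Q Q' + h Q' Q)"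
  proof -
   have "(\<Sum>Q\<in>bad2 s P. \<Sum>Q'\<in>bad2 s P. h Q Q' + h Q' Q) <= (\<Sum>Q\<in>bad2 s P. \<Sum>Q'\<in>D. h Q Q' + h Q' Q)"
    using h0 sub finQ by (intro sum_mono sum_mono2) (blast intro: add_nonneg_nonneg)+
   also have "... <= (\<Sum>Q\<in>D. \<Sum>Q'\<in>D. h Q Q' + h Q' Q)"
    using h0 sub finQ by (intro sum_mono2 sum_nonneg) (blast intro: add_nonneg_nonneg)+
   finally show ?thesis .
  qed
  also have "... = 2 * (\<Sum>Q\<in>D. \<Sum>Q'\<in>D. h Q Q')"
   unfolding sum.distrib using sum.swap[of "\<lambda>Q Q'. h Q' Q" D D] by simp
  also have "(\<Sum>Q\<in>D. \<Sum>Q'\<in>D. h Q Q') = (\<Sum>Q\<in>D. \<Sum>Q'\<in>{Q'\<in>D. W Q \<subseteq> W Q'}. if Q \<in> bad2 s P \<and> Q' \<in> bad2 s P then v Q P * v Q' P else 0)"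
   unfolding h_def using finQ by (intro sum.cong refl sum.mono_neutral_cong_right) auto
  finally show ?thesis .
 qed
 have inner: "(\<Sum>P\<in>PP. lenI P * (if Q \<in> bad2 s P \<and> Q' \<in> bad2 s P then v Q P * v Q' P else 0))
   <= 4096 * (norm (bc Q) * norm (bc Q') * (rs Q * rs Q') * kap 6 (tI Q) (tI Q'))" if Q: "Q \<in> D" "Q' \<in> D" for Q Q'
 proof -
  define S where "S = {P\<in>PP. Q \<in> bad2 s P \<and> Q' \<in> bad2 s P}"
  define k where "k = norm (bc Q) * norm (bc Q') * (rs Q * rs Q')"
  have k0: "0 <= k" using rs_pos[OF posQ[OF Q(1)]] rs_pos[OF posQ[OF Q(2)]] by (simp add: k_def)
  define f where "f x = chiI Q x ^ 6 * chiI Q' x ^ 6" for x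
  have fi: "integrable lborel f" unfolding f_def using posQ Q by (intro integrable_kap) simp_all
  have f0: "0 <= f x" for x unfolding f_def using chi_nonneg posQ[OF Q(1)] posQ[OF Q(2)] by (simp add: less_imp_le)
  have "(\<Sum>P\<in>PP. lenI P * (if Q \<in> bad2 s P \<and> Q' \<in> bad2 s P then v Q P * v Q' P else 0)) = (\<Sum>P\<in>S. k * (lenI P * f (ctrI P)))"
   unfolding S_def using finP by (intro sum.mono_neutral_cong_right) (auto simp: v_def k_def f_def)
  also have "... = k * (\<Sum>P\<in>S. lenI P * f (ctrI P))" by (simp add: sum_distrib_left)
  also have "... <= k * (\<Sum>P\<in>S. 4096 * (LINT x|lborel. indicator (setI P) x * f x))"
  proof (intro mult_left_mono sum_mono k0)
   fix P assume P: "P \<in> S"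
   then have PP: "P \<in> PP" by (simp add: S_def)
   have l: "lenI P <= lenI Q" "lenI P <= lenI Q'"
    using P len_I_le1[OF PP] Q by (simp_all add: S_def bad2_def)
   have "lenI P * f (ctrI P) = (LINT x|lborel. indicator (setI P) x * f (ctrI P))"
    using posP[OF PP] by (subst integral_indicator_iv) simp_all
   also have "... <= (LINT x|lborel. 4096 * (indicator (setI P) x * f x))"
   proof (rule integral_mono)
    show "integrable lborel (\<lambda>x. indicator (setI P) x * f (ctrI P))" by (rule integrable_indicator_const_iv)
    show "integrable lborel (\<lambda>x. 4096 * (indicator (setI P) x * f x))"
     using fi by (intro integrable_mult_right integrable_indicator_mult) simp_all
    fix x
    show "indicator (setI P) x * f (ctrI P) <= 4096 * (indicator (setI P) x * f x)"
    proof (cases "x \<in> setI P")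
     case True
     then have x: "\<bar>x - ctrI P\<bar> <= lenI P" using posP[OF PP] unfolding mem_iv_ctr by linarith
     have "chiI Q (ctrI P) <= (1 + 1) * chiI Q x" "chiI Q' (ctrI P) <= (1 + 1) * chiI Q' x"
      using x l posQ Q by (intro chi_near; simp)+
     then have "chiI Q (ctrI P) ^ 6 <= (2 * chiI Q x) ^ 6" "chiI Q' (ctrI P) ^ 6 <= (2 * chiI Q' x) ^ 6"
      using posQ[OF Q(1)] posQ[OF Q(2)] by (intro power_mono chi_nonneg; simp)+
     then have "f (ctrI P) <= (2 * chiI Q x) ^ 6 * (2 * chiI Q' x) ^ 6"
      unfolding f_def using chi_nonneg[of "tI Q"] chi_nonneg[of "tI Q'"] posQ[OF Q(1)] posQ[OF Q(2)] by (intro mult_mono) simp_all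
     also have "... = 4096 * f x" by (simp add: f_def power_mult_distrib)
     finally show ?thesis using True by simp
    qed simp
   qed
   finally show "lenI P * f (ctrI P) <= 4096 * (LINT x|lborel. indicator (setI P) x * f x)" by simp
  qed
  also have "... = 4096 * (k * (\<Sum>P\<in>S. LINT x|lborel. indicator (setI P) x * f x))"
   by (simp add: sum_distrib_left mult_ac)
  also have "... <= 4096 * (k * (LINT x|lborel. indicator UNIV x * f x))"
  proof (intro mult_left_mono k0 sum_integral_disjoint_le fi f0)
   fix P P' assume P: "P \<in> S" "P' \<in> S" "P \<noteq> P'"
   have "setw Q 3 \<subseteq> setw P 2" "setw Q 3 \<subseteq> setw P' 2"
    using P Q edge_subset[OF _ Q(1) s] by (simp_all add: S_def bad2_def)
   then have "setw P 2 \<inter> setw P' 2 \<noteq> {}" using ctr_mem[OF poswQ[OF Q(1)]] by blast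
   then show "setI P \<inter> setI P' = {}" using P by (intro family_disjoint[OF famP]) (simp_all add: S_def)
  qed (use finP in \<open>simp_all add: S_def\<close>)
  finally show ?thesis by (simp add: k_def f_def kap_def)
 qed
 have "(\<Sum>P\<in>PP. lenI P * (F P)\<^sup>2) <= (\<Sum>P\<in>PP. lenI P * (2 * (\<Sum>Q\<in>D. \<Sum>Q'\<in>{Q'\<in>D. W Q \<subseteq> W Q'}. if Q \<in> bad2 s P \<and> Q' \<in> bad2 s P then v Q P * v Q' P else 0)))"
  using sq posP by (intro sum_mono mult_left_mono) (simp_all add: less_imp_le)
 also have "... = 2 * (\<Sum>P\<in>PP. \<Sum>Q\<in>D. \<Sum>Q'\<in>{Q'\<in>D. W Q \<subseteq> W Q'}. lenI P * (if Q \<in> bad2 s P \<and> Q' \<in> bad2 s P then v Q P * v Q' P else 0))"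
  unfolding sum_distrib_left by (simp only: mult.left_commute)
 also have "... = 2 * (\<Sum>Q\<in>D. \<Sum>Q'\<in>{Q'\<in>D. W Q \<subseteq> W Q'}. \<Sum>P\<in>PP. lenI P * (if Q \<in> bad2 s P \<and> Q' \<in> bad2 s P then v Q P * v Q' P else 0))"
  by (subst sum.swap) (simp only: sum.swap[of _ PP])
 also have "... <= 2 * (\<Sum>Q\<in>D. \<Sum>Q'\<in>{Q'\<in>D. W Q \<subseteq> W Q'}. 4096 * (norm (bc Q) * norm (bc Q') * (rs Q * rs Q') * kap 6 (tI Q) (tI Q')))"
  using inner by (intro mult_left_mono sum_mono) simp_all
 also have "... = 8192 * pb 3 D (\<lambda>Q. norm (bc Q))"
  unfolding pb_def W_def by (simp add: sum_distrib_left[symmetric])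
 finally show ?thesis .
qed

lemma bad_sum:
 assumes P: "P \<in> PP" and A: "\<And>Q. Q \<in> D ==> norm (bc Q) * rs Q <= A" and A0: "0 <= A"
 shows "(\<Sum>Q\<in>{Q\<in>D. \<not> rel Q P}. norm (bc Q) * (norm (\<gamma> P) * norm (ip P Q)))
  <= A * B\<^sup>2 * (real (nat \<lceil>1/c\<rceil> + 2) * (16 * (1 / c * (1 + 1 / c)) ^ 6)) * lenI P
   + 4 * B\<^sup>2 * lenI P * (\<Sum>Q\<in>bad2 (-1) P. norm (bc Q) * rs Q * chiI Q (ctrI P) ^ 6)
   + 4 * B\<^sup>2 * lenI P * (\<Sum>Q\<in>bad2 1 P. norm (bc Q) * rs Q * chiI Q (ctrI P) ^ 6)"
proof -
 define f where "f Q = norm (bc Q) * (norm (\<gamma> P) * norm (ip P Q))" for Q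
 have f0: "0 <= f Q" for Q by (simp add: f_def)
 have fin: "finite (bad1 P)" "finite (bad2 s P)" for s using finQ by (simp_all add: bad1_def bad2_def)
 have "sum f {Q\<in>D. \<not> rel Q P} = sum f {Q\<in>D. \<not> rel Q P \<and> ip P Q \<noteq> 0}"
  using finQ by (intro sum.mono_neutral_right) (auto simp: f_def)
 also have "... <= sum f (bad1 P \<union> (bad2 (-1) P \<union> bad2 1 P))"
 proof (rule sum_mono2)
  show "{Q\<in>D. \<not> rel Q P \<and> ip P Q \<noteq> 0} \<subseteq> bad1 P \<union> (bad2 (-1) P \<union> bad2 1 P)"
  proof
   fix Q assume Q: "Q \<in> {Q\<in>D. \<not> rel Q P \<and> ip P Q \<noteq> 0}"
   then have "Q \<in> D" "\<not> rel Q P" "ip P Q \<noteq> 0" by simp_all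
   from bad_cases[OF P this] Q show "Q \<in> bad1 P \<union> (bad2 (-1) P \<union> bad2 1 P)"
    unfolding bad1_def bad2_def by blast
  qed
 qed (use fin f0 in simp_all)
 also have "... <= sum f (bad1 P) + (sum f (bad2 (-1) P) + sum f (bad2 1 P))"
 proof -
  have un: "sum f (U \<union> V) <= sum f U + sum f V" if "finite U" "finite V" for U V
   using sum.union_inter[OF that, of f] sum_nonneg[of "U \<inter> V" f] f0 by simp
  show ?thesis using un[of "bad1 P" "bad2 (-1) P \<union> bad2 1 P"] un[of "bad2 (-1) P" "bad2 1 P"] fin by simp
 qed
 finally have split: "sum f {Q\<in>D. \<not> rel Q P} <= sum f (bad1 P) + (sum f (bad2 (-1) P) + sum f (bad2 1 P))" .
 have b1: "sum f (bad1 P) <= A * B\<^sup>2 * (real (nat \<lceil>1/c\<rceil> + 2) * (16 * (1 / c * (1 + 1 / c)) ^ 6)) * lenI P"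
 proof -
  have "sum f (bad1 P) <= (\<Sum>Q\<in>bad1 P. A * B\<^sup>2 * kap 8 (tI P) (tI Q))"
  proof (rule sum_mono)
   fix Q assume "Q \<in> bad1 P"
   then have Q: "Q \<in> D" by (simp add: bad1_def)
   have "f Q <= norm (bc Q) * (B\<^sup>2 * rs Q * kap 8 (tI P) (tI Q))"
    unfolding f_def using term_le[OF P Q] by (intro mult_left_mono) simp_all
   also have "... = (norm (bc Q) * rs Q) * (B\<^sup>2 * kap 8 (tI P) (tI Q))" by (simp add: mult_ac)
   also have "... <= A * (B\<^sup>2 * kap 8 (tI P) (tI Q))"
    using A[OF Q] kap_nonneg[OF posP[OF P] posQ[OF Q]] by (intro mult_right_mono) simp_all
   finally show "f Q <= A * B\<^sup>2 * kap 8 (tI P) (tI Q)" by (simp add: mult_ac)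
  qed
  also have "... = A * B\<^sup>2 * (\<Sum>Q\<in>bad1 P. kap 8 (tI P) (tI Q))" by (simp add: sum_distrib_left)
  also have "... <= A * B\<^sup>2 * (real (nat \<lceil>1/c\<rceil> + 2) * (16 * (1 / c * (1 + 1 / c)) ^ 6) * lenI P)"
   using bad1_sum[OF P] A0 by (intro mult_left_mono) simp_all
  finally show ?thesis by (simp only: mult.assoc)
 qed
 have b2: "sum f (bad2 s P) <= 4 * B\<^sup>2 * lenI P * (\<Sum>Q\<in>bad2 s P. norm (bc Q) * rs Q * chiI Q (ctrI P) ^ 6)" for s
 proof -
  have "sum f (bad2 s P) <= (\<Sum>Q\<in>bad2 s P. 4 * B\<^sup>2 * lenI P * (norm (bc Q) * rs Q * chiI Q (ctrI P) ^ 6))"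
  proof (rule sum_mono)
   fix Q assume "Q \<in> bad2 s P"
   then have Q: "Q \<in> D" "lenw Q 3 <= c * lenw P 2" by (simp_all add: bad2_def)
   have "f Q <= norm (bc Q) * (4 * B\<^sup>2 * rs Q * lenI P * chiI Q (ctrI P) ^ 6)"
    unfolding f_def using term_le2[OF P Q] by (intro mult_left_mono) simp_all
   then show "f Q <= 4 * B\<^sup>2 * lenI P * (norm (bc Q) * rs Q * chiI Q (ctrI P) ^ 6)" by (simp add: mult_ac)
  qed
  then show ?thesis by (simp only: sum_distrib_left)
 qed
 show ?thesis using split b1 b2[of 1] b2[of "-1"] unfolding f_def by linarith
qed

definition C3 :: real where
 "C3 = 8 * (131072 * (B\<^sup>2 + 1))\<^sup>2 + 16 * B\<^sup>2 * (16 * 134217728 * (B\<^sup>2 + 1))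
   + 2 * B\<^sup>2 * (real (nat \<lceil>1/c\<rceil> + 2) * (16 * (1 / c * (1 + 1 / c)) ^ 6))"

lemma energy3:
 assumes A: "\<And>Q. Q \<in> D ==> norm (bc Q) * rs Q <= A" and A0: "0 <= A"
 shows "(\<Sum>Q\<in>D. (norm (bc Q))\<^sup>2) <= C3 * (1 + A) * SP + A\<^sup>2 * (\<Sum>T\<in>\<tau> ` D. lenI T) / 2"
proof -
 let ?full = "\<Sum>Q\<in>D. \<Sum>P\<in>PP. cnj (bc Q) * (\<gamma> P * ip P Q)" and ?bad = "\<Sum>Q\<in>D. \<Sum>P\<in>{P\<in>PP. \<not> rel Q P}. cnj (bc Q) * (\<gamma> P * ip P Q)"
 define X where "X = (\<Sum>Q\<in>D. (norm (bc Q))\<^sup>2)"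
 define Z where "Z = A\<^sup>2 * (\<Sum>T\<in>\<tau> ` D. lenI T)"
 define C0 where "C0 = 131072 * (B\<^sup>2 + 1)"
 define N where "N = real (nat \<lceil>1/c\<rceil> + 2) * (16 * (1 / c * (1 + 1 / c)) ^ 6)"
 define \<kappa> :: real where "\<kappa> = 134217728"
 have C0p: "0 < C0" by (simp add: C0_def add_nonneg_pos)
 have X0: "0 <= X" unfolding X_def by (intro sum_nonneg) simp
 have "0 <= (\<Sum>T\<in>\<tau> ` D. lenI T)"
 proof (rule sum_nonneg)
  fix T assume "T \<in> \<tau> ` D"
  then show "0 <= lenI T" using familyD(7)[OF famQ] by (metis imageE less_imp_le)
 qed
 then have Z0: "0 <= Z" unfolding Z_def by simp
 define h where "h x = (\<Sum>P\<in>PP. \<gamma> P * \<Psi> P x)" for x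
 define G where "G x = (\<Sum>Q\<in>D. bc Q * \<Phi> Q x)" for x
 have w1: "wgt 0 0 x = 1" for x by (simp add: wgt_def)
 have hh: "(LINT x|lborel. (norm (h x))\<^sup>2) <= C0 * (2 * SP)" "integrable lborel (\<lambda>x. (norm (h x))\<^sup>2)"
 proof -
  have d: "(LINT x|lborel. (wgt 0 0 x)\<^sup>2 * (norm (\<Sum>P\<in>PP. \<gamma> P * \<Psi> P x))\<^sup>2)
    <= 131072 * B\<^sup>2 * ((\<Sum>Q\<in>PP. (norm (\<gamma> Q))\<^sup>2) + 1\<^sup>2 * (\<Sum>T\<in>(\<lambda>P. P) ` PP. lenI T))"
   by (rule dual_le(1)[OF famP wP m8 B0 _ _ _ \<gamma>1]) simp_all
  have d2: "integrable lborel (\<lambda>x. (wgt 0 0 x)\<^sup>2 * (norm (\<Sum>P\<in>PP. \<gamma> P * \<Psi> P x))\<^sup>2)"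
   by (rule dual_le(2)[OF famP wP m8 B0 _ _ _ \<gamma>1]) simp_all
  have "(norm (\<gamma> P))\<^sup>2 <= lenI P" if "P \<in> PP" for P
  proof -
   have "(norm (\<gamma> P) * rs P)\<^sup>2 <= 1" using \<gamma>1[OF that] rs_pos[OF posP[OF that]] by (intro power_le_one) simp_all
   then show ?thesis using posP[OF that] by (simp add: power_mult_distrib rs_sq[OF posP[OF that]])
  qed
  then have "(\<Sum>Q\<in>PP. (norm (\<gamma> Q))\<^sup>2) <= SP" unfolding SP_def by (rule sum_mono)
  then have "131072 * B\<^sup>2 * ((\<Sum>Q\<in>PP. (norm (\<gamma> Q))\<^sup>2) + 1\<^sup>2 * (\<Sum>T\<in>(\<lambda>P. P) ` PP. lenI T)) <= C0 * (2 * SP)"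
   unfolding C0_def using SP_nonneg
   by (intro mult_mono) (simp_all add: SP_def sum_nonneg)
  then show "(LINT x|lborel. (norm (h x))\<^sup>2) <= C0 * (2 * SP)" using d by (simp add: w1 h_def)
  show "integrable lborel (\<lambda>x. (norm (h x))\<^sup>2)" using d2 by (simp add: w1 h_def)
 qed
 have GG: "(LINT x|lborel. (norm (G x))\<^sup>2) <= C0 * (X + Z)" "integrable lborel (\<lambda>x. (norm (G x))\<^sup>2)"
 proof -
  have d: "(LINT x|lborel. (wgt 0 0 x)\<^sup>2 * (norm (\<Sum>Q\<in>D. bc Q * \<Phi> Q x))\<^sup>2) <= 131072 * B\<^sup>2 * (X + Z)"
   unfolding X_def Z_def by (rule dual_le(1)[OF famQ wQ m8 B0 _ _ _ A]) simp_all
  have d2: "integrable lborel (\<lambda>x. (wgt 0 0 x)\<^sup>2 * (norm (\<Sum>Q\<in>D. bc Q * \<Phi> Q x))\<^sup>2)"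
   by (rule dual_le(2)[OF famQ wQ m8 B0 _ _ _ A]) simp_all
  have "131072 * B\<^sup>2 * (X + Z) <= C0 * (X + Z)" unfolding C0_def using X0 Z0 by (intro mult_right_mono) simp_all
  then show "(LINT x|lborel. (norm (G x))\<^sup>2) <= C0 * (X + Z)" using d by (simp add: w1 G_def)
  show "integrable lborel (\<lambda>x. (norm (G x))\<^sup>2)" using d2 by (simp add: w1 G_def)
 qed
 have full: "norm ?full <= 4 * C0\<^sup>2 * SP + (X + Z) / 8"
 proof -
  have "?full = (\<Sum>Q\<in>D. \<Sum>P\<in>PP. LINT x|lborel. (cnj (bc Q) * \<gamma> P) * (\<Psi> P x * cnj (\<Phi> Q x)))"
   unfolding ip_def by (simp only: integral_mult_right_zero mult.assoc)
  also have "... = (\<Sum>Q\<in>D. LINT x|lborel. (\<Sum>P\<in>PP. (cnj (bc Q) * \<gamma> P) * (\<Psi> P x * cnj (\<Phi> Q x))))"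
   using integrable_ip by (intro sum.cong refl Bochner_Integration.integral_sum[symmetric] integrable_mult_right) simp
  also have "... = (LINT x|lborel. (\<Sum>Q\<in>D. \<Sum>P\<in>PP. (cnj (bc Q) * \<gamma> P) * (\<Psi> P x * cnj (\<Phi> Q x))))"
   using integrable_ip by (intro Bochner_Integration.integral_sum[symmetric] Bochner_Integration.integrable_sum integrable_mult_right) simp
  also have "... = (LINT x|lborel. h x * cnj (G x))"
  proof (rule Bochner_Integration.integral_cong[OF refl])
   fix x
   have "h x * cnj (G x) = (\<Sum>P\<in>PP. \<Sum>Q\<in>D. (\<gamma> P * \<Psi> P x) * cnj (bc Q * \<Phi> Q x))"
    unfolding h_def G_def by (simp add: sum_product)
   also have "... = (\<Sum>Q\<in>D. \<Sum>P\<in>PP. (\<gamma> P * \<Psi> P x) * cnj (bc Q * \<Phi> Q x))" by (rule sum.swap)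
   finally show "(\<Sum>Q\<in>D. \<Sum>P\<in>PP. (cnj (bc Q) * \<gamma> P) * (\<Psi> P x * cnj (\<Phi> Q x))) = h x * cnj (G x)"
    by (simp add: mult_ac)
  qed
  finally have eq: "?full = (LINT x|lborel. h x * cnj (G x))" .
  have "norm (LINT x|lborel. h x * cnj (G x)) <= (LINT x|lborel. norm (h x * cnj (G x)))" by (rule integral_norm_bound)
  also have "... <= (LINT x|lborel. (2 * C0) * (norm (h x))\<^sup>2 + (1 / (8 * C0)) * (norm (G x))\<^sup>2)"
  proof (rule integral_mono_AE')
   show "integrable lborel (\<lambda>x. (2 * C0) * (norm (h x))\<^sup>2 + (1 / (8 * C0)) * (norm (G x))\<^sup>2)"
    using hh(2) GG(2) by (intro Bochner_Integration.integrable_add integrable_mult_right)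
   have "u * v <= (2 * C0) * u\<^sup>2 + (1 / (8 * C0)) * v\<^sup>2" for u v :: real
   proof -
    have "0 <= (4 * C0 * u - v)\<^sup>2" by simp
    then have "8 * C0 * (u * v) <= 8 * C0 * ((2 * C0) * u\<^sup>2) + v\<^sup>2" by (simp add: power2_eq_square algebra_simps)
    then show ?thesis using C0p by (simp add: field_simps)
   qed
   then have "norm (h x * cnj (G x)) <= (2 * C0) * (norm (h x))\<^sup>2 + (1 / (8 * C0)) * (norm (G x))\<^sup>2" for x
    by (simp only: norm_mult complex_mod_cnj)
   then show "AE x in lborel. norm (h x * cnj (G x)) <= (2 * C0) * (norm (h x))\<^sup>2 + (1 / (8 * C0)) * (norm (G x))\<^sup>2" by (intro AE_I2)
   show "AE x in lborel. 0 <= (2 * C0) * (norm (h x))\<^sup>2 + (1 / (8 * C0)) * (norm (G x))\<^sup>2"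
    using C0p by (intro AE_I2 add_nonneg_nonneg mult_nonneg_nonneg) simp_all
  qed
  also have "... = (2 * C0) * (LINT x|lborel. (norm (h x))\<^sup>2) + (1 / (8 * C0)) * (LINT x|lborel. (norm (G x))\<^sup>2)"
   using hh(2) GG(2) by simp
  also have "... <= (2 * C0) * (C0 * (2 * SP)) + (1 / (8 * C0)) * (C0 * (X + Z))"
   using hh(1) GG(1) C0p by (intro add_mono mult_left_mono) simp_all
  also have "... = 4 * C0\<^sup>2 * SP + (X + Z) / 8" using C0p by (simp add: power2_eq_square)
  finally show ?thesis unfolding eq .
 qed
 define F where "F s P = (\<Sum>Q\<in>bad2 s P. norm (bc Q) * rs Q * chiI Q (ctrI P) ^ 6)" for s P
 define t where "t = 16 * \<kappa> * (B\<^sup>2 + 1)"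
 have tp: "0 < t" by (simp add: t_def \<kappa>_def add_nonneg_pos)
 have Fs: "(\<Sum>P\<in>PP. lenI P * F s P) <= t * SP + 1 / (4 * t) * (\<kappa> * (X + Z))" if s: "s \<in> {-1, 1}" for s
 proof -
  have "(\<Sum>P\<in>PP. lenI P * F s P) <= (\<Sum>P\<in>PP. t * lenI P + 1 / (4 * t) * (lenI P * (F s P)\<^sup>2))"
  proof (rule sum_mono)
   fix P assume P: "P \<in> PP"
   have "0 <= (2 * t - F s P)\<^sup>2" by simp
   then have "F s P <= t + 1 / (4 * t) * (F s P)\<^sup>2" using tp by (simp add: power2_eq_square field_simps)
   then have "lenI P * F s P <= lenI P * (t + 1 / (4 * t) * (F s P)\<^sup>2)" using posP[OF P] by (intro mult_left_mono) simp_all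
   then show "lenI P * F s P <= t * lenI P + 1 / (4 * t) * (lenI P * (F s P)\<^sup>2)" by (simp add: algebra_simps)
  qed
  also have "... = t * SP + 1 / (4 * t) * (\<Sum>P\<in>PP. lenI P * (F s P)\<^sup>2)"
   by (simp add: sum.distrib sum_distrib_left SP_def)
  also have "... <= t * SP + 1 / (4 * t) * (\<kappa> * (X + Z))"
  proof -
   have "(\<Sum>P\<in>PP. lenI P * (F s P)\<^sup>2) <= 8192 * pb 3 D (\<lambda>Q. norm (bc Q))"
    unfolding F_def by (rule bad2_sum[OF s])
   also have "... <= 8192 * (16384 * (X + Z))"
    unfolding X_def Z_def by (intro mult_left_mono pb_le[OF famQ] A) simp_all
   finally have "(\<Sum>P\<in>PP. lenI P * (F s P)\<^sup>2) <= \<kappa> * (X + Z)" by (simp add: \<kappa>_def)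
   then show ?thesis using tp by (intro add_left_mono mult_left_mono) simp_all
  qed
  finally show ?thesis .
 qed
 have bad: "(\<Sum>P\<in>PP. \<Sum>Q\<in>{Q\<in>D. \<not> rel Q P}. norm (bc Q) * (norm (\<gamma> P) * norm (ip P Q)))
   <= A * B\<^sup>2 * N * SP + 8 * B\<^sup>2 * t * SP + (X + Z) / 8"
 proof -
  have "(\<Sum>P\<in>PP. \<Sum>Q\<in>{Q\<in>D. \<not> rel Q P}. norm (bc Q) * (norm (\<gamma> P) * norm (ip P Q)))
   <= (\<Sum>P\<in>PP. A * B\<^sup>2 * N * lenI P + 4 * B\<^sup>2 * lenI P * F (-1) P + 4 * B\<^sup>2 * lenI P * F 1 P)"
   unfolding N_def F_def by (intro sum_mono bad_sum A A0)
  also have "... = A * B\<^sup>2 * N * SP + 4 * B\<^sup>2 * (\<Sum>P\<in>PP. lenI P * F (-1) P) + 4 * B\<^sup>2 * (\<Sum>P\<in>PP. lenI P * F 1 P)"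
   by (simp add: sum.distrib sum_distrib_left SP_def mult.assoc)
  also have "... <= A * B\<^sup>2 * N * SP + 4 * B\<^sup>2 * (t * SP + 1 / (4 * t) * (\<kappa> * (X + Z))) + 4 * B\<^sup>2 * (t * SP + 1 / (4 * t) * (\<kappa> * (X + Z)))"
   using Fs[of 1] Fs[of "-1"] by (intro add_mono mult_left_mono order_refl) simp_all
  also have "... = A * B\<^sup>2 * N * SP + 8 * B\<^sup>2 * t * SP + (X + Z) * (2 * B\<^sup>2 * \<kappa> / t)"
   using tp by (simp add: field_simps)
  also have "... <= A * B\<^sup>2 * N * SP + 8 * B\<^sup>2 * t * SP + (X + Z) * (1 / 8)"
  proof (intro add_left_mono mult_left_mono)
   show "2 * B\<^sup>2 * \<kappa> / t <= 1 / 8" using tp by (simp add: t_def \<kappa>_def field_simps)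
  qed (use X0 Z0 in simp)
  finally show ?thesis by simp
 qed
 have "complex_of_real X = (\<Sum>Q\<in>D. bc Q * cnj (bc Q))"
  unfolding X_def of_real_sum by (rule sum.cong[OF refl]) (rule complex_norm_square)
 also have "... = (\<Sum>Q\<in>D. \<Sum>P\<in>{P\<in>PP. rel Q P}. cnj (bc Q) * (\<gamma> P * ip P Q))"
  by (simp only: sum_distrib_left[symmetric] bc_def[symmetric] mult.commute)
 also have "... = (\<Sum>Q\<in>D. (\<Sum>P\<in>PP. cnj (bc Q) * (\<gamma> P * ip P Q)) - (\<Sum>P\<in>{P\<in>PP. \<not> rel Q P}. cnj (bc Q) * (\<gamma> P * ip P Q)))"
 proof (rule sum.cong[OF refl])
  fix Q
  have "(\<Sum>P\<in>PP. cnj (bc Q) * (\<gamma> P * ip P Q)) = (\<Sum>P\<in>{P\<in>PP. rel Q P} \<union> {P\<in>PP. \<not> rel Q P}. cnj (bc Q) * (\<gamma> P * ip P Q))"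
   by (rule sum.cong) auto
  also have "... = (\<Sum>P\<in>{P\<in>PP. rel Q P}. cnj (bc Q) * (\<gamma> P * ip P Q)) + (\<Sum>P\<in>{P\<in>PP. \<not> rel Q P}. cnj (bc Q) * (\<gamma> P * ip P Q))"
   using finP by (intro sum.union_disjoint) auto
  finally show "(\<Sum>P\<in>{P\<in>PP. rel Q P}. cnj (bc Q) * (\<gamma> P * ip P Q)) = (\<Sum>P\<in>PP. cnj (bc Q) * (\<gamma> P * ip P Q)) - (\<Sum>P\<in>{P\<in>PP. \<not> rel Q P}. cnj (bc Q) * (\<gamma> P * ip P Q))"
   by simp
 qed
 also have "... = ?full - ?bad"
  by (rule sum_subtractf)
 finally have Xeq: "complex_of_real X = ?full - ?bad" .
 have "X = norm (complex_of_real X)" using X0 by simp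
 also have "... <= norm ?full + norm ?bad"
  unfolding Xeq by (rule norm_triangle_ineq4)
 finally have X2: "X <= norm ?full + norm ?bad" .
 have "norm ?bad
   <= (\<Sum>Q\<in>D. \<Sum>P\<in>{P\<in>PP. \<not> rel Q P}. norm (bc Q) * (norm (\<gamma> P) * norm (ip P Q)))"
  by (intro order_trans[OF norm_sum] sum_mono order_trans[OF norm_sum]) (simp add: norm_mult)
 also have "... = (\<Sum>P\<in>PP. \<Sum>Q\<in>{Q\<in>D. \<not> rel Q P}. norm (bc Q) * (norm (\<gamma> P) * norm (ip P Q)))"
  by (rule sum.swap_restrict[OF finQ finP])
 finally have "X <= (4 * C0\<^sup>2 * SP + (X + Z) / 8) + (A * B\<^sup>2 * N * SP + 8 * B\<^sup>2 * t * SP + (X + Z) / 8)"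
  using X2 full bad by linarith
 then have X1: "X <= 8 * C0\<^sup>2 * SP + 2 * (A * B\<^sup>2 * N * SP) + 16 * B\<^sup>2 * t * SP + Z / 2"
  using X0 Z0 SP_nonneg by (simp add: field_simps)
 have N0: "0 <= N" unfolding N_def using c0
  by (intro mult_nonneg_nonneg of_nat_0_le_iff zero_le_power add_nonneg_nonneg) simp_all
 have p: "0 <= 8 * C0\<^sup>2 * SP * A" "0 <= 16 * B\<^sup>2 * t * SP * A" "0 <= 2 * B\<^sup>2 * N * SP"
  using C0p tp A0 SP_nonneg N0 by simp_all
 have "C3 * (1 + A) * SP = 8 * C0\<^sup>2 * SP + 16 * B\<^sup>2 * t * SP + 2 * B\<^sup>2 * N * SP
   + 8 * C0\<^sup>2 * SP * A + 16 * B\<^sup>2 * t * SP * A + 2 * (A * B\<^sup>2 * N * SP)"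
  unfolding C3_def N_def[symmetric] C0_def[symmetric] t_def \<kappa>_def by (simp add: algebra_simps)
 then show ?thesis using X1 p unfolding X_def Z_def by linarith
qed

end

subsection \<open>Lacunary trees for the composed coefficients\<close>

definition dens :: "tritile set => ivl => real" where
 "dens PP I = (\<Sum>P\<in>PP. lenI P * chi I (ctrI P) ^ 3) / len I"

lemma wave_packet_osc:
 assumes wp: "wave_packet K L Ck (I, w) \<Phi>" and "1 <= K" "5 <= L" and I: "0 < len I" "len I * len w = 1"
  and \<xi>: "\<bar>ctr w - \<xi>\<bar> <= 10^7 / 2 * len w"
 shows "norm (cis (- 2 * pi * \<xi> * x) * \<Phi> x - cis (- 2 * pi * \<xi> * y) * \<Phi> y)
  <= (4 * 10^7 * \<bar>Ck 0\<bar> + \<bar>Ck 1\<bar>) * len I powr (-1/2) * (\<bar>x - y\<bar> / len I) * (1 + \<bar>x - y\<bar> / len I) ^ 5 * chi I y ^ 5"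
proof -
 define u where "u = (\<lambda>x. cis (- 2 * pi * ctr w * x) * \<Phi> x)"
 define e where "e x = cis (2 * pi * (ctr w - \<xi>) * x)" for x
 have w: "\<forall>k<K. \<forall>x. ((vderiv ^^ k) u) differentiable (at x)"
  "\<forall>k\<le>K. \<forall>x. norm ((vderiv ^^ k) u x) <= Ck k * len I powr (- 1/2 - real k) * chi I x ^ L"
  using wp unfolding wave_packet_def Let_def u_def by auto
 have d: "u differentiable (at x)" for x using w(1)[rule_format, of 0] assms(2) by simp
 have u0: "norm (u x) <= \<bar>Ck 0\<bar> * len I powr (- 1/2) * chi I x ^ 5" for x
 proof -
  have "norm (u x) <= Ck 0 * len I powr (- 1/2) * chi I x ^ L" using w(2)[rule_format, of 0] by simp
  also have "... <= \<bar>Ck 0\<bar> * len I powr (- 1/2) * chi I x ^ 5"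
   using chi_pow_mono[OF I(1) assms(3), of x] chi_nonneg[of I x] I(1) by (intro mult_mono) auto
  finally show ?thesis .
 qed
 have u1: "norm (vderiv u x) <= \<bar>Ck 1\<bar> * (len I powr (- 1/2) / len I) * chi I x ^ 5" for x
 proof -
  have "norm (vderiv u x) <= Ck 1 * len I powr (- 1/2 - 1) * chi I x ^ L"
   using w(2)[rule_format, of 1] assms(2) by simp
  also have "len I powr (- 1/2 - 1) = len I powr (- 1/2) / len I" using I(1) by (simp only: powr_diff powr_one)
  also have "Ck 1 * (len I powr (- 1/2) / len I) * chi I x ^ L <= \<bar>Ck 1\<bar> * (len I powr (- 1/2) / len I) * chi I x ^ 5"
   using chi_pow_mono[OF I(1) assms(3), of x] chi_nonneg[of I x] I(1) by (intro mult_mono) auto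
  finally show ?thesis .
 qed
 define g where "g x = e x * u x" for x
 define g' where "g' x = e x * vderiv u x + (\<i> * (2 * pi * (ctr w - \<xi>)) * e x) * u x" for x
 have geq: "cis (- 2 * pi * \<xi> * x) * \<Phi> x = g x" for x
  unfolding g_def e_def u_def mult.assoc[symmetric] cis_mult by (simp add: algebra_simps)
 have de: "(e has_vector_derivative (\<i> * (2 * pi * (ctr w - \<xi>)) * e x)) (at x within S)" for x S
 proof -
  define a where "a = \<i> * complex_of_real (2 * pi * (ctr w - \<xi>))"
  have e: "e = (\<lambda>x. exp (a * of_real x))"
   by (rule ext) (simp add: e_def cis_conv_exp a_def mult.assoc)
  have "((\<lambda>z. exp (a * z)) has_field_derivative (a * exp (a * of_real x))) (at (of_real x))"
   by (auto intro!: derivative_eq_intros)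
  then have "((\<lambda>x. exp (a * of_real x)) has_vector_derivative (a * exp (a * of_real x))) (at x within S)"
   by (rule has_vector_derivative_real_field)
  then show ?thesis unfolding e a_def .
 qed
 have dg: "(g has_vector_derivative g' x) (at x within S)" for x S
 proof -
  have "(u has_vector_derivative vderiv u x) (at x)"
   using d[of x] unfolding vderiv_def by (simp add: vector_derivative_works)
  then have "(u has_vector_derivative vderiv u x) (at x within S)" by (rule has_vector_derivative_at_within)
  then show ?thesis unfolding g_def g'_def by (intro has_vector_derivative_mult de)
 qed
 define C where "C = 4 * 10^7 * \<bar>Ck 0\<bar> + \<bar>Ck 1\<bar>"
 have g'b: "norm (g' z) <= C * (len I powr (-1/2) / len I) * chi I z ^ 5" for z
 proof -
  have lw: "len w = 1 / len I" using I by (simp add: field_simps)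
  have ne: "norm (e z) = 1" by (simp add: e_def)
  have n1: "norm (\<i> * (2 * pi * (ctr w - \<xi>)) * e z) = 2 * pi * \<bar>ctr w - \<xi>\<bar>"
   by (simp only: norm_mult ne norm_ii norm_of_real abs_mult) simp
  have "2 * pi * \<bar>ctr w - \<xi>\<bar> <= 2 * 4 * (10^7 / 2 * len w)" using \<xi> pi_less_4 by (intro mult_mono) auto
  then have n2: "2 * pi * \<bar>ctr w - \<xi>\<bar> <= 4 * 10^7 / len I" by (simp add: lw)
  have "norm (g' z) <= norm (e z * vderiv u z) + norm ((\<i> * (2 * pi * (ctr w - \<xi>)) * e z) * u z)"
   unfolding g'_def by (rule norm_triangle_ineq)
  also have "... = norm (vderiv u z) + 2 * pi * \<bar>ctr w - \<xi>\<bar> * norm (u z)"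
   by (simp only: norm_mult[of "e z"] norm_mult[of _ "u z"] n1 ne mult_1_left)
  also have "... <= \<bar>Ck 1\<bar> * (len I powr (- 1/2) / len I) * chi I z ^ 5 + 4 * 10^7 / len I * (\<bar>Ck 0\<bar> * len I powr (- 1/2) * chi I z ^ 5)"
   using u0 u1 n2 I(1) by (intro add_mono mult_mono) auto
  also have "... = C * (len I powr (-1/2) / len I) * chi I z ^ 5" by (simp add: C_def algebra_simps)
  finally show ?thesis .
 qed
 define M where "M = C * (len I powr (-1/2) / len I) * ((1 + \<bar>x - y\<bar> / len I) * chi I y) ^ 5"
 have C0: "0 <= C" by (simp add: C_def)
 have Mb: "norm (g' z) <= M" if z: "z \<in> closed_segment x y" for z
 proof -
  have zy: "\<bar>y - z\<bar> <= \<bar>x - y\<bar>" using z segment_bound(2)[of z x y] by (auto simp: real_norm_def abs_minus_commute dest: segment_bound)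
  have "chi I z <= (1 + \<bar>x - y\<bar> / len I) * chi I y"
  proof (cases "x = y")
   case True then show ?thesis using zy by simp
  next
   case False
   then show ?thesis using chi_near[of I "\<bar>x - y\<bar> / len I" y z] zy I(1) by simp
  qed
  then have "chi I z ^ 5 <= ((1 + \<bar>x - y\<bar> / len I) * chi I y) ^ 5" using chi_nonneg[of I z] I(1) by (intro power_mono) auto
  then have "C * (len I powr (-1/2) / len I) * chi I z ^ 5 <= M"
   unfolding M_def using C0 I(1) by (intro mult_left_mono) auto
  then show ?thesis using g'b[of z] by linarith
 qed
 have "norm (g x - g y) <= M * norm (x - y)"
 proof (rule differentiable_bound[where S = "closed_segment x y" and f' = "\<lambda>z h. h *\<^sub>R g' z"])
  fix z assume z: "z \<in> closed_segment x y"
  show "(g has_derivative (\<lambda>h. h *\<^sub>R g' z)) (at z within closed_segment x y)"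
   using dg[of z "closed_segment x y"] by (simp add: has_vector_derivative_def)
  show "onorm (\<lambda>h. h *\<^sub>R g' z) <= M"
   using mult_right_mono[OF Mb[OF z] abs_ge_zero] by (intro onorm_le) (simp add: mult.commute)
 qed auto
 then show ?thesis unfolding geq M_def C_def power_mult_distrib by (simp add: mult_ac)
qed

locale tree_pair = model_pair D "\<lambda>_. T" \<Phi> PP \<Psi> \<gamma> B m c
 for D :: "tritile set" and T :: tritile and \<Phi> :: "tritile => real => complex"
  and PP :: "tritile set" and \<Psi> :: "tritile => real => complex" and \<gamma> :: "tritile => complex"
  and B :: real and m :: nat and c :: real +
 assumes cs: "c <= 1 / 10^9" and D0: "D \<noteq> {}"
  and near: "\<And>Q. Q \<in> D ==> \<bar>ctrw Q 3 - ctrw T 3\<bar> <= 10^7 / 2 * lenw Q 3"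
begin

abbreviation "l \<equiv> lenI T"

lemma lT: "0 < l" using D0 familyD(7)[OF famQ] by blast

lemma same_w: "Q \<in> D ==> Q' \<in> D ==> setw Q 3 \<inter> setw Q' 3 \<noteq> {} ==> tw Q 3 = tw Q' 3"
proof -
 assume a: "Q \<in> D" "Q' \<in> D" "setw Q 3 \<inter> setw Q' 3 \<noteq> {}"
 have no: "\<not> setw Q1 3 \<subset> setw Q2 3" if "Q1 \<in> D" "Q2 \<in> D" for Q1 Q2
 proof
  assume "setw Q1 3 \<subset> setw Q2 3"
  then have "setI Q2 \<inter> setI T = {}" using familyD(9)[OF famQ that] by simp
  moreover have "setI Q2 \<subseteq> setI T" using familyD(5)[OF famQ that(2)] by simp
  ultimately show False using ctr_mem[OF posQ[OF that(2)]] by blast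
 qed
 have "setw Q 3 = setw Q' 3" using family_nested[OF famQ a] no a by blast
 then show ?thesis using ivl_eq_iv[OF poswQ[OF a(1)] poswQ[OF a(2)]] by simp
qed

lemma subT: "Q \<in> D ==> setI Q \<subseteq> setI T" using familyD(5)[OF famQ] by simp

lemma lenQT: "Q \<in> D ==> lenI Q <= l"
 using iv_subset_iff[OF posQ, of Q "tI T"] subT[of Q] by simp

lemma ctrQT: "Q \<in> D ==> \<bar>ctrI Q - ctrI T\<bar> <= l / 2"
proof -
 assume Q: "Q \<in> D"
 then have "\<bar>ctrI T - ctrI Q\<bar> <= (l - lenI Q) / 2" using iv_subset_ctr[OF posQ[OF Q]] subT[OF Q] by simp
 then show ?thesis using posQ[OF Q] by (subst abs_minus_commute) argo
qed

lemma chi_QT: "Q \<in> D ==> chiI Q x <= 3/2 * chiI T x"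
proof -
 assume Q: "Q \<in> D"
 define a where "a = 1 + \<bar>x - ctrI T\<bar> / l"
 define b where "b = 1 + \<bar>x - ctrI Q\<bar> / lenI Q"
 have ab: "0 < a" "0 < b" using lT posQ[OF Q] by (auto simp: a_def b_def intro: add_pos_nonneg)
 have "\<bar>x - ctrI T\<bar> <= \<bar>x - ctrI Q\<bar> + \<bar>ctrI Q - ctrI T\<bar>"
  using abs_triangle_ineq[of "x - ctrI Q" "ctrI Q - ctrI T"] by simp
 then have "\<bar>x - ctrI T\<bar> / l <= (\<bar>x - ctrI Q\<bar> + l / 2) / l"
  using ctrQT[OF Q] lT by (intro divide_right_mono) simp_all
 also have "... = \<bar>x - ctrI Q\<bar> / l + 1/2" using lT by (simp add: field_simps)
 also have "\<bar>x - ctrI Q\<bar> / l <= \<bar>x - ctrI Q\<bar> / lenI Q" using lenQT[OF Q] posQ[OF Q] by (intro divide_left_mono) auto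
 finally have "a <= b + 1/2" by (simp add: a_def b_def)
 moreover have "1 <= b" using posQ[OF Q] by (simp add: b_def)
 ultimately have "a <= 3/2 * b" by simp
 then have "1 / b <= 3/2 * (1 / a)" using ab by (simp add: field_simps)
 then show ?thesis by (simp add: chi_def a_def b_def)
qed

lemma dis_scale: "Q \<in> D ==> Q' \<in> D ==> Q \<noteq> Q' ==> lenI Q = lenI Q' ==> setI Q \<inter> setI Q' = {}"
 using grid_same[OF zero_shift familyD(2)[OF famQ] familyD(2)[OF famQ], of Q Q'] familyD(10)[OF famQ, of Q Q'] by blast

lemma sum_scale:
 assumes F: "F \<subseteq> D" "\<And>Q. Q \<in> F ==> lenI Q = r" "0 < r"
 shows "(\<Sum>Q\<in>F. chiI Q x ^ 5) <= 54 * chiI T x ^ 3"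
proof -
 have "(\<Sum>Q\<in>F. chiI Q x ^ 5) <= (\<Sum>Q\<in>F. 27/8 * chiI T x ^ 3 * (chiI Q x)\<^sup>2)"
 proof (rule sum_mono)
  fix Q assume "Q \<in> F"
  then have Q: "Q \<in> D" using F by blast
  have "chiI Q x ^ 3 <= (3/2 * chiI T x) ^ 3" using chi_QT[OF Q] chi_nonneg[of "tI Q"] posQ[OF Q] by (intro power_mono) auto
  also have "... = 27/8 * chiI T x ^ 3" by (simp add: power_mult_distrib power_divide)
  finally have "chiI Q x ^ 3 * (chiI Q x)\<^sup>2 <= 27/8 * chiI T x ^ 3 * (chiI Q x)\<^sup>2" by (intro mult_right_mono) auto
  then show "chiI Q x ^ 5 <= 27/8 * chiI T x ^ 3 * (chiI Q x)\<^sup>2" by (simp add: power_add[symmetric])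
 qed
 also have "... = 27/8 * chiI T x ^ 3 * (\<Sum>Q\<in>F. (chiI Q x)\<^sup>2)" by (simp only: sum_distrib_left)
 also have "... <= 27/8 * chiI T x ^ 3 * 16"
 proof (intro mult_left_mono sum_chi_scale)
  show "finite F" using F finQ finite_subset by blast
  show "setI Q \<inter> setI Q' = {}" if "Q \<in> F" "Q' \<in> F" "Q \<noteq> Q'" for Q Q'
   using dis_scale[of Q Q'] that F by blast
  show "0 <= 27/8 * chiI T x ^ 3" using chi_nonneg[of "tI T" x] lT by simp
 qed (use F in auto)
 finally show ?thesis by simp
qed

lemma sum_scales:
 assumes F: "F \<subseteq> D" and f: "\<And>r. 0 < r ==> 0 <= f r"
 shows "(\<Sum>Q\<in>F. f (lenI Q) * chiI Q x ^ 5) <= (\<Sum>r\<in>(\<lambda>Q. lenI Q) ` F. f r) * (54 * chiI T x ^ 3)"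
proof -
 have fin: "finite F" using F finQ finite_subset by blast
 have "(\<Sum>Q\<in>F. f (lenI Q) * chiI Q x ^ 5) = (\<Sum>r\<in>(\<lambda>Q. lenI Q) ` F. \<Sum>Q\<in>{Q\<in>F. lenI Q = r}. f (lenI Q) * chiI Q x ^ 5)"
  by (rule sum.image_gen[OF fin])
 also have "... <= (\<Sum>r\<in>(\<lambda>Q. lenI Q) ` F. f r * (54 * chiI T x ^ 3))"
 proof (rule sum_mono)
  fix r assume r: "r \<in> (\<lambda>Q. lenI Q) ` F"
  then have r0: "0 < r" using posQ F by blast
  have "(\<Sum>Q\<in>{Q\<in>F. lenI Q = r}. f (lenI Q) * chiI Q x ^ 5) = f r * (\<Sum>Q\<in>{Q\<in>F. lenI Q = r}. chiI Q x ^ 5)"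
   unfolding sum_distrib_left by (rule sum.cong) simp_all
  also have "... <= f r * (54 * chiI T x ^ 3)"
   using F r0 f[OF r0] by (intro mult_left_mono sum_scale) auto
  finally show "(\<Sum>Q\<in>{Q\<in>F. lenI Q = r}. f (lenI Q) * chiI Q x ^ 5) <= f r * (54 * chiI T x ^ 3)" .
 qed
 finally show ?thesis by (simp only: sum_distrib_right)
qed

lemma scales_facts:
 assumes "F \<subseteq> D"
 shows "finite ((\<lambda>Q. lenI Q) ` F)" "x \<in> (\<lambda>Q. lenI Q) ` F ==> 0 < x"
  "x \<in> (\<lambda>Q. lenI Q) ` F ==> y \<in> (\<lambda>Q. lenI Q) ` F ==> x < y ==> 2 * x <= y"
proof -
 show "finite ((\<lambda>Q. lenI Q) ` F)" using assms finQ finite_subset by blast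
 show "x \<in> (\<lambda>Q. lenI Q) ` F ==> 0 < x" using posQ assms by blast
 show "x \<in> (\<lambda>Q. lenI Q) ` F ==> y \<in> (\<lambda>Q. lenI Q) ` F ==> x < y ==> 2 * x <= y"
  using grid_len2[OF zero_shift familyD(2)[OF famQ] familyD(2)[OF famQ]] assms by blast
qed

lemma sum_small:
 assumes F: "F \<subseteq> D" "\<And>Q. Q \<in> F ==> lenI Q <= r / 2" "\<And>Q. Q \<in> F ==> r / 4 <= \<bar>x - ctrI Q\<bar>" and r: "0 < r" and n: "6 <= n"
 shows "(\<Sum>Q\<in>F. chiI Q x ^ n) <= 216 * chiI T x ^ 3"
proof -
 have cT: "0 <= chiI T x" using chi_nonneg lT by simp
 have "(\<Sum>Q\<in>F. chiI Q x ^ n) <= (\<Sum>Q\<in>F. (4 / r * lenI Q) * chiI Q x ^ 5)"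
 proof (rule sum_mono)
  fix Q assume Q: "Q \<in> F"
  then have QD: "Q \<in> D" using F by blast
  have p: "0 < lenI Q" using posQ[OF QD] .
  have "chiI Q x <= 1 / (\<bar>x - ctrI Q\<bar> / lenI Q)"
  proof -
   have "0 < \<bar>x - ctrI Q\<bar>" using F(3)[OF Q] r by linarith
   then have "0 < \<bar>x - ctrI Q\<bar> / lenI Q" using p by (rule divide_pos_pos)
   then show ?thesis unfolding chi_def by (intro divide_left_mono mult_pos_pos) linarith+
  qed
  also have "... = lenI Q / \<bar>x - ctrI Q\<bar>" by simp
  also have "... <= lenI Q / (r / 4)" using F(3)[OF Q] r p by (intro divide_left_mono mult_pos_pos) linarith+
  finally have "chiI Q x <= 4 / r * lenI Q" by (simp add: mult.commute)
  then have "chiI Q x * chiI Q x ^ 5 <= (4 / r * lenI Q) * chiI Q x ^ 5"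
   using chi_nonneg[of "tI Q" x] p by (intro mult_right_mono) auto
  moreover have "chiI Q x ^ n <= chiI Q x ^ 6" by (rule chi_pow_mono[OF p n])
  ultimately show "chiI Q x ^ n <= (4 / r * lenI Q) * chiI Q x ^ 5" by (simp add: power_Suc[symmetric] del: power_Suc)
 qed
 also have "... <= (\<Sum>s\<in>(\<lambda>Q. lenI Q) ` F. 4 / r * s) * (54 * chiI T x ^ 3)"
  using r by (intro sum_scales[OF F(1), of "\<lambda>s. 4 / r * s"]) auto
 also have "... <= 4 * (54 * chiI T x ^ 3)"
 proof (intro mult_right_mono)
  have "(\<Sum>s\<in>(\<lambda>Q. lenI Q) ` F. s) <= 2 * (r / 2)"
   using scales_facts[OF F(1)] F(2) r by (intro sum_pow2_le) auto
  then have "4 / r * (\<Sum>s\<in>(\<lambda>Q. lenI Q) ` F. s) <= 4 / r * r" using r by (intro mult_left_mono) auto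
  then show "(\<Sum>s\<in>(\<lambda>Q. lenI Q) ` F. 4 / r * s) <= 4" using r by (simp add: sum_distrib_left)
 qed (use cT in simp)
 finally show ?thesis by simp
qed

lemma sum_big:
 assumes F: "F \<subseteq> D" "\<And>Q. Q \<in> F ==> r / 2 < lenI Q" and r: "0 < r"
 shows "(\<Sum>Q\<in>F. (r / lenI Q) * chiI Q x ^ 5) <= 216 * chiI T x ^ 3"
proof -
 have cT: "0 <= chiI T x" using chi_nonneg lT by simp
 have "(\<Sum>Q\<in>F. (r / lenI Q) * chiI Q x ^ 5) <= (\<Sum>s\<in>(\<lambda>Q. lenI Q) ` F. r / s) * (54 * chiI T x ^ 3)"
  using r by (intro sum_scales[OF F(1), of "\<lambda>s. r / s"]) auto
 also have "... <= 4 * (54 * chiI T x ^ 3)"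
 proof (intro mult_right_mono)
  have "(\<Sum>s\<in>(\<lambda>Q. lenI Q) ` F. 1 / s) <= 2 / (r / 2)"
   using scales_facts[OF F(1)] F(2) r by (intro sum_pow2_inv_le) (auto intro: less_imp_le)
  then have "r * (\<Sum>s\<in>(\<lambda>Q. lenI Q) ` F. 1 / s) <= r * (2 / (r / 2))" using r by (intro mult_left_mono) auto
  then show "(\<Sum>s\<in>(\<lambda>Q. lenI Q) ` F. r / s) <= 4" using r by (simp add: sum_distrib_left)
 qed (use cT in simp)
 finally show ?thesis by simp
qed

definition R :: "tritile set" where "R = {P\<in>PP. \<exists>Q\<in>D. rel Q P}"

lemma R_ctr: "P \<in> R ==> ctrw T 3 \<in> setw P 2"
proof -
 assume "P \<in> R"
 then obtain Q where Q: "P \<in> PP" "Q \<in> D" "rel Q P" by (auto simp: R_def)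
 define L where "L = lenw P 2"
 have L: "0 < L" using poswP[OF Q(1)] by (simp add: L_def)
 have 1: "lenw Q 3 <= c * L" "setw Q 3 \<subseteq> ivl_set (dil (9/10) (tw P 2))"
  using Q(3) by (auto simp: rel_def cc_sub_def L_def)
 have "\<bar>ctrw P 2 - ctrw Q 3\<bar> <= (9/10 * L - lenw Q 3) / 2"
  using 1(2) iv_subset_ctr[OF poswQ[OF Q(2)], of "dil (9/10) (tw P 2)"] by (simp add: L_def)
 moreover have "\<bar>ctrw Q 3 - ctrw T 3\<bar> <= 10^7 / 2 * lenw Q 3" by (rule near[OF Q(2)])
 moreover have "10^7 / 2 * lenw Q 3 <= 10^7 / 2 * (1 / 10^9 * L)"
 proof (rule mult_left_mono)
  have "c * L <= 1 / 10^9 * L" using cs L by (intro mult_right_mono) simp_all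
  then show "lenw Q 3 <= 1 / 10^9 * L" using 1(1) by linarith
 qed simp
 ultimately have "\<bar>ctrw P 2 - ctrw Q 3\<bar> <= 9/20 * L" "\<bar>ctrw Q 3 - ctrw T 3\<bar> <= 1/200 * L"
  using poswQ[OF Q(2)] by simp_all
 then show ?thesis unfolding mem_iv_ctr L_def[symmetric] abs_le_iff using L by linarith
qed

lemma R_disjoint: "P \<in> R ==> P' \<in> R ==> P \<noteq> P' ==> setI P \<inter> setI P' = {}"
 using R_ctr[of P] R_ctr[of P'] by (intro family_disjoint[OF famP]) (auto simp: R_def)

lemma R_len: "P \<in> R ==> lenI P <= l"
proof -
 assume "P \<in> R"
 then obtain Q where Q: "P \<in> PP" "Q \<in> D" "rel Q P" by (auto simp: R_def)
 then have "lenw Q 3 <= c * lenw P 2" by (simp add: rel_def cc_sub_def)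
 from len_I_le1[OF Q(1,2) this] show ?thesis using lenQT[OF Q(2)] by simp
qed

lemma bc_le_dens:
 assumes Q: "Q \<in> D" shows "norm (bc Q) * rs Q <= 4 * B\<^sup>2 * dens PP (tI Q)"
proof -
 have p: "0 < lenI Q" using posQ[OF Q] .
 have "norm (bc Q) <= (\<Sum>P\<in>{P\<in>PP. rel Q P}. norm (\<gamma> P) * norm (ip P Q))"
  unfolding bc_def by (rule order_trans[OF norm_sum]) (simp add: norm_mult)
 also have "... <= (\<Sum>P\<in>{P\<in>PP. rel Q P}. 4 * B\<^sup>2 * rs Q * (lenI P * chiI Q (ctrI P) ^ 3))"
 proof (rule sum_mono)
  fix P assume P: "P \<in> {P\<in>PP. rel Q P}"
  then have "lenw Q 3 <= c * lenw P 2" "P \<in> PP" by (auto simp: rel_def cc_sub_def)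
  then have "norm (\<gamma> P) * norm (ip P Q) <= 4 * B\<^sup>2 * rs Q * lenI P * chiI Q (ctrI P) ^ 6"
   using term_le2[OF _ Q] by blast
  also have "... <= 4 * B\<^sup>2 * rs Q * lenI P * chiI Q (ctrI P) ^ 3"
   using P posP rs_pos[OF p] by (intro mult_left_mono chi_pow_mono p mult_nonneg_nonneg) (auto simp: less_imp_le)
  finally show "norm (\<gamma> P) * norm (ip P Q) <= 4 * B\<^sup>2 * rs Q * (lenI P * chiI Q (ctrI P) ^ 3)" by (simp only: mult.assoc)
 qed
 also have "... <= (\<Sum>P\<in>PP. 4 * B\<^sup>2 * rs Q * (lenI P * chiI Q (ctrI P) ^ 3))"
 proof (rule sum_mono2)
  fix P assume "P \<in> PP - {P \<in> PP. rel Q P}"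
  then have "P \<in> PP" by blast
  then show "0 <= 4 * B\<^sup>2 * rs Q * (lenI P * chiI Q (ctrI P) ^ 3)"
   using posP[of P] rs_pos[OF p] chi_nonneg[of "tI Q" "ctrI P"] p by simp
 qed (use finP in auto)
 also have "... = 4 * B\<^sup>2 * rs Q * (\<Sum>P\<in>PP. lenI P * chiI Q (ctrI P) ^ 3)" by (simp only: sum_distrib_left)
 finally have "norm (bc Q) * rs Q <= (4 * B\<^sup>2 * rs Q * (\<Sum>P\<in>PP. lenI P * chiI Q (ctrI P) ^ 3)) * rs Q"
  using rs_pos[OF p] by (intro mult_right_mono) auto
 also have "... = 4 * B\<^sup>2 * (rs Q * rs Q) * (\<Sum>P\<in>PP. lenI P * chiI Q (ctrI P) ^ 3)" by (simp only: mult_ac)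
 finally show ?thesis using p by (simp add: dens_def rs_mult)
qed

lemma bc_le_const:
 assumes Q: "Q \<in> D" shows "norm (bc Q) * rs Q <= 1024 * B\<^sup>2"
proof -
 have p: "0 < lenI Q" using posQ[OF Q] .
 have "norm (bc Q) <= (\<Sum>P\<in>{P\<in>PP. rel Q P}. norm (\<gamma> P) * norm (ip P Q))"
  unfolding bc_def by (rule order_trans[OF norm_sum]) (simp add: norm_mult)
 also have "... <= (\<Sum>P\<in>{P\<in>PP. rel Q P}. 4 * B\<^sup>2 * rs Q * (lenI P * chiI Q (ctrI P) ^ 6))"
 proof (rule sum_mono)
  fix P assume P: "P \<in> {P\<in>PP. rel Q P}"
  then have "lenw Q 3 <= c * lenw P 2" "P \<in> PP" by (auto simp: rel_def cc_sub_def)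
  then show "norm (\<gamma> P) * norm (ip P Q) <= 4 * B\<^sup>2 * rs Q * (lenI P * chiI Q (ctrI P) ^ 6)"
   using term_le2[OF _ Q, of P] by (simp only: mult.assoc)
 qed
 also have "... = 4 * B\<^sup>2 * rs Q * (\<Sum>P\<in>{P\<in>PP. rel Q P}. lenI P * chiI Q (ctrI P) ^ 6)" by (simp only: sum_distrib_left)
 also have "(\<Sum>P\<in>{P\<in>PP. rel Q P}. lenI P * chiI Q (ctrI P) ^ 6) <= (1 + 1) ^ 6 * (LINT x|lborel. indicator UNIV x * chiI Q x ^ 6)"
 proof (rule sum_kap_disjoint(2))
  fix P P' assume P: "P \<in> {P\<in>PP. rel Q P}" "P' \<in> {P\<in>PP. rel Q P}" "P \<noteq> P'"
  then show "setI P \<inter> setI P' = {}" using Q by (intro R_disjoint) (auto simp: R_def)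
 next
  fix P assume P: "P \<in> {P\<in>PP. rel Q P}"
  then have "lenw Q 3 <= c * lenw P 2" "P \<in> PP" by (auto simp: rel_def cc_sub_def)
  then show "lenI P <= 1 * lenI Q" using len_I_le1[OF _ Q, of P] by simp
  show "0 < lenI P" using posP[of P] P by simp
 qed (use finP p in auto)
 also have "... <= 64 * (4 * lenI Q)" using integral_chi_le[of "tI Q" 6] p by simp
 finally have "norm (bc Q) <= 4 * B\<^sup>2 * rs Q * (64 * (4 * lenI Q))"
  using rs_pos[OF p] by (auto simp: mult_left_mono)
 then have "norm (bc Q) * rs Q <= (4 * B\<^sup>2 * rs Q * (64 * (4 * lenI Q))) * rs Q"
  using rs_pos[OF p] by (intro mult_right_mono) auto
 also have "... = 1024 * B\<^sup>2 * (rs Q * rs Q) * lenI Q" by simp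
 finally show ?thesis using p by (simp add: rs_mult)
qed

end

locale tree_dens = tree_pair D T \<Phi> PP \<Psi> \<gamma> B m c
 for D :: "tritile set" and T :: tritile and \<Phi> :: "tritile => real => complex"
  and PP :: "tritile set" and \<Psi> :: "tritile => real => complex" and \<gamma> :: "tritile => complex"
  and B :: real and m :: nat and c :: real +
 fixes \<xi> \<delta> :: real
 assumes osc: "\<And>Q x y. Q \<in> D ==> norm (cis (- 2 * pi * \<xi> * x) * \<Phi> Q x - cis (- 2 * pi * \<xi> * y) * \<Phi> Q y)
   <= B * rs Q * (\<bar>x - y\<bar> / lenI Q) * (1 + \<bar>x - y\<bar> / lenI Q) ^ 5 * chiI Q y ^ 5"
  and \<delta>0: "0 < \<delta>" and \<delta>c: "108 * \<delta> <= c"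
  and dns: "\<And>Q I. Q \<in> D ==> in_D 0 I ==> setI Q \<subseteq> ivl_set I ==> dens PP I <= \<delta>"
begin

definition rho :: "real => real" where
 "rho x = Min ((\<lambda>Q. lenI Q + \<bar>x - ctrI Q\<bar>) ` D)"

lemma rho_le: "Q \<in> D ==> rho x <= lenI Q + \<bar>x - ctrI Q\<bar>"
 unfolding rho_def using finQ by (intro Min_le) simp_all

lemma rho_att: "\<exists>Q\<in>D. rho x = lenI Q + \<bar>x - ctrI Q\<bar>"
proof -
 have "rho x \<in> (\<lambda>Q. lenI Q + \<bar>x - ctrI Q\<bar>) ` D"
  unfolding rho_def using finQ D0 by (intro Min_in) simp_all
 then show ?thesis by blast
qed

lemma rho_pos: "0 < rho x"
proof -
 obtain Q where "Q \<in> D" "rho x = lenI Q + \<bar>x - ctrI Q\<bar>" using rho_att by blast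
 then show ?thesis using posQ[of Q] by simp
qed

lemma rho_lip: "rho x <= rho y + \<bar>x - y\<bar>"
proof -
 obtain Q where Q: "Q \<in> D" "rho y = lenI Q + \<bar>y - ctrI Q\<bar>" using rho_att by blast
 show ?thesis using rho_le[OF Q(1), of x] Q(2) by simp
qed

lemma dens_ball: "(\<Sum>P\<in>{P\<in>PP. \<bar>ctrI P - y\<bar> <= rho y / 3}. lenI P) <= 54 * \<delta> * rho y"
proof -
 obtain Q where Q: "Q \<in> D" "rho y = lenI Q + \<bar>y - ctrI Q\<bar>" using rho_att by blast
 have "lenI Q <= rho y" using Q by simp
 then obtain I where I: "in_D 0 I" "rho y <= len I" "len I < 2 * rho y" "setI Q \<subseteq> ivl_set I"
  using dyadic_anc_len[OF familyD(2)[OF famQ Q(1)]] by metis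
 have lI: "0 < len I" using I(1) in_D_pos by blast
 have cI: "\<bar>ctr I - ctrI Q\<bar> <= (len I - lenI Q) / 2" using iv_subset_ctr[OF posQ[OF Q(1)]] I(4) by simp
 have "(\<Sum>P\<in>{P\<in>PP. \<bar>ctrI P - y\<bar> <= rho y / 3}. lenI P) <= (\<Sum>P\<in>{P\<in>PP. \<bar>ctrI P - y\<bar> <= rho y / 3}. 27 * (lenI P * chi I (ctrI P) ^ 3))"
 proof (rule sum_mono)
  fix P assume P: "P \<in> {P\<in>PP. \<bar>ctrI P - y\<bar> <= rho y / 3}"
  have "\<bar>ctrI P - ctr I\<bar> <= 2 * len I"
  proof -
   have "\<bar>ctrI P - ctr I\<bar> <= \<bar>ctrI P - y\<bar> + \<bar>y - ctrI Q\<bar> + \<bar>ctr I - ctrI Q\<bar>" by simp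
   also have "... <= rho y / 3 + rho y + len I / 2"
   proof -
    have "\<bar>ctrI P - y\<bar> <= rho y / 3" using P by simp
    then show ?thesis using cI Q(2) posQ[OF Q(1)] by argo
   qed
   finally show ?thesis using I(2) lI by simp
  qed
  then have "1 + \<bar>ctrI P - ctr I\<bar> / len I <= 3" using lI by (simp add: field_simps)
  then have "1 / 3 <= chi I (ctrI P)" unfolding chi_def using lI by (intro divide_left_mono) (auto intro: add_pos_nonneg)
  then have "(1 / 3) ^ 3 <= chi I (ctrI P) ^ 3" by (intro power_mono) simp_all
  then have "1 <= 27 * chi I (ctrI P) ^ 3" by (simp add: power_divide)
  then have "lenI P * 1 <= lenI P * (27 * chi I (ctrI P) ^ 3)" using posP[of P] P by (intro mult_left_mono) simp_all
  then show "lenI P <= 27 * (lenI P * chi I (ctrI P) ^ 3)" by simp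
 qed
 also have "... <= (\<Sum>P\<in>PP. 27 * (lenI P * chi I (ctrI P) ^ 3))"
 proof (rule sum_mono2)
  fix P assume "P \<in> PP - {P\<in>PP. \<bar>ctrI P - y\<bar> <= rho y / 3}"
  then show "0 <= 27 * (lenI P * chi I (ctrI P) ^ 3)"
   using posP[of P] chi_nonneg[of I "ctrI P"] lI by simp
 qed (use finP in simp_all)
 also have "... = 27 * (dens PP I * len I)" using lI by (simp add: dens_def sum_distrib_left)
 also have "... <= 27 * (\<delta> * (2 * rho y))"
  using dns[OF Q(1) I(1,4)] I(3) \<delta>0 lI by (intro mult_left_mono mult_mono) simp_all
 finally show ?thesis by simp
qed

lemma len_rho: "P \<in> PP ==> lenI P <= c * rho (ctrI P) / 2"
proof -
 assume P: "P \<in> PP"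
 have "lenI P = (\<Sum>P\<in>{P}. lenI P)" by simp
 also have "... <= (\<Sum>P'\<in>{P'\<in>PP. \<bar>ctrI P' - ctrI P\<bar> <= rho (ctrI P) / 3}. lenI P')"
  using P finP rho_pos[of "ctrI P"] posP by (intro sum_mono2) (simp_all add: less_imp_le)
 also have "... <= 54 * \<delta> * rho (ctrI P)" by (rule dens_ball)
 also have "... <= c / 2 * rho (ctrI P)" using \<delta>c rho_pos[of "ctrI P"] by (intro mult_right_mono) simp_all
 finally show ?thesis by simp
qed

lemma bc\<delta>: "Q \<in> D ==> norm (bc Q) * rs Q <= 4 * B\<^sup>2 * \<delta>"
 using bc_le_dens[of Q] dns[OF _ familyD(2)[OF famQ], of Q Q]
 by (meson mult_left_mono order_trans subset_refl zero_le_mult_iff zero_le_numeral zero_le_power2)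

lemma bc\<delta>_mult:
 assumes "Q \<in> D" "0 <= z"
 shows "norm (bc Q) * (rs Q * z) <= 4 * B\<^sup>2 * \<delta> * z"
 using mult_right_mono[OF bc\<delta>[OF assms(1)] assms(2)] by (simp only: mult.assoc)

definition G :: "real => complex" where "G x = (\<Sum>Q\<in>D. bc Q * \<Phi> Q x)"

lemma chiT_near:
 assumes "\<bar>y - ctrI P\<bar> <= rho (ctrI P) / 4"
 shows "chiI T y ^ 3 <= 4 * chiI T (ctrI P) ^ 3"
proof -
 define u where "u = \<bar>ctrI P - ctrI T\<bar>"
 define v where "v = \<bar>y - ctrI T\<bar>"
 obtain Q where Q: "Q \<in> D" using D0 by blast
 have "rho (ctrI P) <= lenI Q + \<bar>ctrI P - ctrI Q\<bar>" by (rule rho_le[OF Q])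
 also have "... <= l + (u + l / 2)"
 proof -
  have "\<bar>ctrI P - ctrI Q\<bar> <= u + \<bar>ctrI Q - ctrI T\<bar>" unfolding u_def by simp
  then show ?thesis using ctrQT[OF Q] lenQT[OF Q] by simp
 qed
 finally have r: "rho (ctrI P) <= u + 3/2 * l" by simp
 have "u <= v + \<bar>y - ctrI P\<bar>" unfolding u_def v_def by simp
 then have "u <= v + (u + 3/2 * l) / 4" using assms r by argo
 then have "u <= 4/3 * v + l / 2" by argo
 then have "u / l <= (4/3 * v + l / 2) / l" using lT by (intro divide_right_mono) simp_all
 also have "... = 4/3 * (v / l) + 1/2" using lT by (simp add: field_simps)
 finally have "u / l <= 4/3 * (v / l) + 1/2" .
 moreover have "0 <= v / l" using lT by (simp add: v_def)
 ultimately have "1 + u / l <= 3/2 * (1 + v / l)" by argo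
 moreover have "0 < 1 + u / l" "0 < 1 + v / l" using lT by (auto simp: u_def v_def intro: add_pos_nonneg)
 ultimately have "1 / (1 + v / l) <= 3/2 * (1 / (1 + u / l))" by (simp add: divide_simps mult.commute)
 then have "chiI T y <= 3/2 * chiI T (ctrI P)" by (simp add: chi_def u_def v_def)
 then have "chiI T y ^ 3 <= (3/2 * chiI T (ctrI P)) ^ 3" using chi_nonneg[of "tI T" y] lT by (intro power_mono) simp_all
 also have "... = 27/8 * chiI T (ctrI P) ^ 3" by (simp add: power_mult_distrib power_divide)
 also have "... <= 4 * chiI T (ctrI P) ^ 3" using chi_nonneg[of "tI T" "ctrI P"] lT by (intro mult_right_mono) simp_all
 finally show ?thesis .
qed

definition KK :: real where "KK = 4 * B + 200000 * B\<^sup>2 * (4 * B\<^sup>2)"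

text \<open>For y near the centre of P the truncated sum is controlled by \<open>G(y)\<close>: after demodulation by \<open>\<xi>\<close> the large Q
 are nearly constant on the ball, the small Q are far away, and Q meeting an edge occur at one scale only.\<close>

lemma main_pt:
 assumes P: "P \<in> PP" and y: "\<bar>y - ctrI P\<bar> <= rho (ctrI P) / 4"
 shows "norm (\<gamma> P) * norm (\<Sum>Q\<in>{Q\<in>D. rel Q P}. cnj (bc Q) * ip P Q)
   <= KK * lenI P * (norm (G y) + \<delta> * chiI T (ctrI P) ^ 3)"
proof -
 define r where "r = rho (ctrI P)"
 have r0: "0 < r" unfolding r_def by (rule rho_pos)
 define a where "a = 4 * B\<^sup>2 * \<delta>"
 have a0: "0 <= a" using \<delta>0 by (simp add: a_def)
 have ab: "norm (bc Q) * (rs Q * z) <= a * z" if "Q \<in> D" "0 <= z" for Q z unfolding a_def by (rule bc\<delta>_mult[OF that])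
 define X where "X = chiI T (ctrI P) ^ 3"
 have X0: "0 <= X" unfolding X_def using chi_nonneg lT by simp
 define lP where "lP = lenI P"
 have lP: "0 < lP" using posP[OF P] by (simp add: lP_def)
 define Db where "Db = {Q\<in>D. r / 2 < lenI Q}"
 define Ds where "Ds = {Q\<in>D. \<not> r / 2 < lenI Q}"
 have DbD: "Db \<subseteq> D" and DsD: "Ds \<subseteq> D" by (auto simp: Db_def Ds_def)
 have finb: "finite Db" and fins: "finite Ds" using finQ by (simp_all add: Db_def Ds_def)
 have cr: "c * r <= r" using c1 r0 by (simp add: mult_left_le_one_le c0 less_imp_le)
 have lPr: "lP <= c * r / 2" using len_rho[OF P] by (simp add: r_def lP_def)
 have lPr': "lP <= r" using lPr cr r0 by linarith
 have big: "lenw Q 3 <= c * lenw P 2" if "Q \<in> Db" for Q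
 proof -
  have Q: "Q \<in> D" "r / 2 < lenI Q" using that by (simp_all add: Db_def)
  have "c * (r / 2) <= c * lenI Q" using Q(2) c0 by (intro mult_left_mono) simp_all
  then have "lenI P <= c * lenI Q" using lPr by (simp add: lP_def)
  then show ?thesis unfolding lenQ[OF Q(1)] lenP[OF P] using posQ[OF Q(1)] posP[OF P] by (simp add: field_simps)
 qed
 define t where "t Q = cnj (bc Q) * ip P Q" for Q
 have tle: "norm (\<gamma> P) * norm (t Q) <= 4 * B\<^sup>2 * a * lP * chiI Q (ctrI P) ^ 6"
  if "Q \<in> D" "lenw Q 3 <= c * lenw P 2" for Q
 proof -
  have z0: "0 <= 4 * B\<^sup>2 * lP * chiI Q (ctrI P) ^ 6" using chi_nonneg[of "tI Q"] posQ[OF that(1)] lP by simp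
  have "norm (\<gamma> P) * norm (t Q) = norm (bc Q) * (norm (\<gamma> P) * norm (ip P Q))" by (simp add: t_def norm_mult)
  also have "... <= norm (bc Q) * (4 * B\<^sup>2 * rs Q * lP * chiI Q (ctrI P) ^ 6)"
   using term_le2[OF P that] by (intro mult_left_mono) (simp_all add: lP_def)
  also have "... = norm (bc Q) * (rs Q * (4 * B\<^sup>2 * lP * chiI Q (ctrI P) ^ 6))" by simp
  also have "... <= a * (4 * B\<^sup>2 * lP * chiI Q (ctrI P) ^ 6)" by (rule ab[OF that(1) z0])
  finally show ?thesis by (simp add: mult_ac)
 qed
 have a4: "0 <= 4 * B\<^sup>2 * a * lP" using a0 lP by simp
 have s1: "norm (\<gamma> P) * norm (\<Sum>Q\<in>{Q\<in>Ds. rel Q P}. t Q) <= 4 * B\<^sup>2 * a * lP * (216 * X)"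
 proof -
  have "norm (\<gamma> P) * norm (\<Sum>Q\<in>{Q\<in>Ds. rel Q P}. t Q) <= (\<Sum>Q\<in>{Q\<in>Ds. rel Q P}. norm (\<gamma> P) * norm (t Q))"
   unfolding sum_distrib_left[symmetric] by (intro mult_left_mono norm_sum) simp
  also have "... <= (\<Sum>Q\<in>{Q\<in>Ds. rel Q P}. 4 * B\<^sup>2 * a * lP * chiI Q (ctrI P) ^ 6)"
   by (intro sum_mono tle) (simp_all add: Ds_def rel_def cc_sub_def)
  also have "... = 4 * B\<^sup>2 * a * lP * (\<Sum>Q\<in>{Q\<in>Ds. rel Q P}. chiI Q (ctrI P) ^ 6)" by (simp only: sum_distrib_left)
  also have "... <= 4 * B\<^sup>2 * a * lP * (216 * X)"
   unfolding X_def
  proof (intro mult_left_mono a4 sum_small[where r = r])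
   show "{Q\<in>Ds. rel Q P} \<subseteq> D" using DsD by blast
   fix Q assume "Q \<in> {Q\<in>Ds. rel Q P}"
   then have Q: "Q \<in> D" "lenI Q <= r / 2" by (simp_all add: Ds_def)
   show "lenI Q <= r / 2" by (rule Q(2))
   show "r / 4 <= \<bar>ctrI P - ctrI Q\<bar>" using rho_le[OF Q(1), of "ctrI P"] Q(2) r0 unfolding r_def by linarith
  qed (use r0 in simp_all)
  finally show ?thesis .
 qed
 have s2: "norm (\<gamma> P) * norm (\<Sum>Q\<in>{Q\<in>Db. \<not> rel Q P}. t Q) <= 4 * B\<^sup>2 * a * lP * (108 * X)"
 proof -
  have each: "(\<Sum>Q\<in>bad2 s P \<inter> Db. norm (\<gamma> P) * norm (t Q)) <= 4 * B\<^sup>2 * a * lP * (54 * X)" for s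
  proof (cases "bad2 s P \<inter> Db = {}")
   case True then show ?thesis using a4 X0 by simp
  next
   case False
   then obtain Q0 where Q0: "Q0 \<in> bad2 s P" "Q0 \<in> Db" by blast
   have "(\<Sum>Q\<in>bad2 s P \<inter> Db. norm (\<gamma> P) * norm (t Q)) <= (\<Sum>Q\<in>bad2 s P \<inter> Db. 4 * B\<^sup>2 * a * lP * chiI Q (ctrI P) ^ 5)"
   proof (rule sum_mono)
    fix Q assume "Q \<in> bad2 s P \<inter> Db"
    then have Q: "Q \<in> D" "Q \<in> Db" using DbD by blast+
    have "norm (\<gamma> P) * norm (t Q) <= 4 * B\<^sup>2 * a * lP * chiI Q (ctrI P) ^ 6" by (rule tle[OF Q(1) big[OF Q(2)]])
    also have "... <= 4 * B\<^sup>2 * a * lP * chiI Q (ctrI P) ^ 5"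
     by (intro mult_left_mono a4 chi_pow_mono posQ[OF Q(1)]) simp
    finally show "norm (\<gamma> P) * norm (t Q) <= 4 * B\<^sup>2 * a * lP * chiI Q (ctrI P) ^ 5" .
   qed
   also have "... = 4 * B\<^sup>2 * a * lP * (\<Sum>Q\<in>bad2 s P \<inter> Db. chiI Q (ctrI P) ^ 5)" by (simp only: sum_distrib_left)
   also have "... <= 4 * B\<^sup>2 * a * lP * (54 * X)"
    unfolding X_def
   proof (intro mult_left_mono a4 sum_scale[where r = "lenI Q0"])
    show "bad2 s P \<inter> Db \<subseteq> D" using DbD by blast
    show "0 < lenI Q0" using posQ Q0 DbD by blast
    fix Q assume Q: "Q \<in> bad2 s P \<inter> Db"
    have QD: "Q \<in> D" "Q0 \<in> D" using Q Q0 DbD by blast+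
    have "edge s (tw P 2) \<in> setw Q 3 \<inter> setw Q0 3" using Q Q0 by (simp add: bad2_def)
    then have "tw Q 3 = tw Q0 3" by (intro same_w QD) blast
    then have "1 / lenI Q = 1 / lenI Q0" using lenQ[OF QD(1)] lenQ[OF QD(2)] by simp
    then show "lenI Q = lenI Q0" by simp
   qed
   finally show ?thesis .
  qed
  have "norm (\<gamma> P) * norm (\<Sum>Q\<in>{Q\<in>Db. \<not> rel Q P}. t Q) <= (\<Sum>Q\<in>{Q\<in>Db. \<not> rel Q P}. norm (\<gamma> P) * norm (t Q))"
   unfolding sum_distrib_left[symmetric] by (intro mult_left_mono norm_sum) simp
  also have "... = (\<Sum>Q\<in>{Q\<in>Db. \<not> rel Q P \<and> ip P Q \<noteq> 0}. norm (\<gamma> P) * norm (t Q))"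
   using finb by (intro sum.mono_neutral_right) (auto simp: t_def)
  also have "... <= (\<Sum>Q\<in>(bad2 (-1) P \<inter> Db) \<union> (bad2 1 P \<inter> Db). norm (\<gamma> P) * norm (t Q))"
  proof (rule sum_mono2)
   show "{Q\<in>Db. \<not> rel Q P \<and> ip P Q \<noteq> 0} \<subseteq> (bad2 (-1) P \<inter> Db) \<union> (bad2 1 P \<inter> Db)"
   proof
    fix Q assume Q: "Q \<in> {Q\<in>Db. \<not> rel Q P \<and> ip P Q \<noteq> 0}"
    then have Q': "Q \<in> D" "\<not> rel Q P" "ip P Q \<noteq> 0" "Q \<in> Db" using DbD by blast+
    from bad_cases[OF P Q'(1-3)] show "Q \<in> (bad2 (-1) P \<inter> Db) \<union> (bad2 1 P \<inter> Db)"
    proof cases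
     case 1 then show ?thesis using big[OF Q'(4)] by simp
    next
     case (2 s)
     then have "Q \<in> bad2 s P" using Q'(1) by (simp add: bad2_def)
     then show ?thesis using 2(1) Q'(4) by blast
    qed
   qed
  qed (use finb in simp_all)
  also have "... <= (\<Sum>Q\<in>bad2 (-1) P \<inter> Db. norm (\<gamma> P) * norm (t Q)) + (\<Sum>Q\<in>bad2 1 P \<inter> Db. norm (\<gamma> P) * norm (t Q))"
  proof -
   have "0 <= (\<Sum>Q\<in>(bad2 (-1) P \<inter> Db) \<inter> (bad2 1 P \<inter> Db). norm (\<gamma> P) * norm (t Q))" by (intro sum_nonneg) simp
   then show ?thesis using sum.union_inter[of "bad2 (-1) P \<inter> Db" "bad2 1 P \<inter> Db" "\<lambda>Q. norm (\<gamma> P) * norm (t Q)"] finb by simp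
  qed
  also have "... <= 4 * B\<^sup>2 * a * lP * (54 * X) + 4 * B\<^sup>2 * a * lP * (54 * X)" by (intro add_mono each)
  also have "... = 4 * B\<^sup>2 * a * lP * (108 * X)" by simp
  finally show ?thesis .
 qed
 define Gb where "Gb x = (\<Sum>Q\<in>Db. bc Q * \<Phi> Q x)" for x
 have chy: "chiI T y ^ 3 <= 4 * X" unfolding X_def by (rule chiT_near[OF y])
 have Gby: "norm (Gb y) <= norm (G y) + a * B * (864 * X)"
 proof -
  have "D = Db \<union> Ds" by (auto simp: Db_def Ds_def)
  moreover have "Db \<inter> Ds = {}" by (auto simp: Db_def Ds_def)
  ultimately have "G y = Gb y + (\<Sum>Q\<in>Ds. bc Q * \<Phi> Q y)"
   unfolding G_def Gb_def using finb fins by (simp only: sum.union_disjoint)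
  then have "Gb y = G y - (\<Sum>Q\<in>Ds. bc Q * \<Phi> Q y)" by simp
  then have "norm (Gb y) <= norm (G y) + norm (\<Sum>Q\<in>Ds. bc Q * \<Phi> Q y)"
   by (simp only: norm_triangle_ineq4)
  moreover have "norm (\<Sum>Q\<in>Ds. bc Q * \<Phi> Q y) <= (\<Sum>Q\<in>Ds. a * B * chiI Q y ^ 8)"
  proof (rule order_trans[OF norm_sum sum_mono])
   fix Q assume "Q \<in> Ds"
   then have Q: "Q \<in> D" using DsD by blast
   have "norm (bc Q * \<Phi> Q y) <= norm (bc Q) * (B * lenI Q powr (-1/2) * chiI Q y ^ 8)"
    unfolding norm_mult by (intro mult_left_mono wpk_bound8[OF wQ[OF Q] m8 posQ[OF Q] B0]) simp
   also have "... = norm (bc Q) * (rs Q * (B * chiI Q y ^ 8))" by (simp add: rs_def)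
   also have "... <= a * (B * chiI Q y ^ 8)" using B0 chi_nonneg[of "tI Q" y] posQ[OF Q] by (intro ab[OF Q]) simp
   finally show "norm (bc Q * \<Phi> Q y) <= a * B * chiI Q y ^ 8" by simp
  qed
  moreover have "(\<Sum>Q\<in>Ds. a * B * chiI Q y ^ 8) <= a * B * (216 * chiI T y ^ 3)"
   unfolding sum_distrib_left[symmetric]
  proof (intro mult_left_mono sum_small[where r = r])
   fix Q assume "Q \<in> Ds"
   then have Q: "Q \<in> D" "lenI Q <= r / 2" by (simp_all add: Ds_def)
   show "lenI Q <= r / 2" by (rule Q(2))
   have "\<bar>ctrI P - ctrI Q\<bar> <= \<bar>y - ctrI P\<bar> + \<bar>y - ctrI Q\<bar>" by simp
   then show "r / 4 <= \<bar>y - ctrI Q\<bar>" using rho_le[OF Q(1), of "ctrI P"] Q(2) r0 y unfolding r_def by linarith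
  qed (use DsD r0 a0 B0 in simp_all)
  moreover have "a * B * (216 * chiI T y ^ 3) <= a * B * (216 * (4 * X))"
   using chy a0 B0 by (intro mult_left_mono) simp_all
  moreover have "a * B * (216 * (4 * X)) = a * B * (864 * X)" by simp
  ultimately show ?thesis by linarith
 qed
 have Gbx: "norm (Gb x) <= (norm (Gb y) + 32 * B * a * (864 * X)) * inverse (chiI P x) ^ 6" for x
 proof -
  define q where "q = 1 + \<bar>x - ctrI P\<bar> / lP"
  have q1: "1 <= q" using lP by (simp add: q_def)
  have qi: "inverse (chiI P x) = q" using chi_inv[OF posP[OF P]] by (simp add: q_def lP_def)
  define g where "g Q z = cis (- 2 * pi * \<xi> * z) * \<Phi> Q z" for Q z
  have ng: "norm (Gb z) = norm (\<Sum>Q\<in>Db. bc Q * g Q z)" for z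
  proof -
   have "(\<Sum>Q\<in>Db. bc Q * g Q z) = cis (- 2 * pi * \<xi> * z) * Gb z"
    unfolding g_def Gb_def sum_distrib_left by (rule sum.cong[OF refl]) (simp only: mult.left_commute)
   then show ?thesis by (simp add: norm_mult)
  qed
  have "(\<Sum>Q\<in>Db. bc Q * g Q x) = (\<Sum>Q\<in>Db. bc Q * g Q y) + (\<Sum>Q\<in>Db. bc Q * (g Q x - g Q y))"
   by (simp add: sum.distrib[symmetric] algebra_simps)
  then have "norm (Gb x) <= norm (Gb y) + norm (\<Sum>Q\<in>Db. bc Q * (g Q x - g Q y))"
   unfolding ng by (simp only: norm_triangle_ineq)
  also have "norm (\<Sum>Q\<in>Db. bc Q * (g Q x - g Q y)) <= (\<Sum>Q\<in>Db. 32 * B * a * q ^ 6 * (r / lenI Q * chiI Q y ^ 5))"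
  proof (rule order_trans[OF norm_sum sum_mono])
   fix Q assume QDb: "Q \<in> Db"
   then have Q: "Q \<in> D" "r / 2 < lenI Q" by (simp_all add: Db_def)
   define lq where "lq = lenI Q"
   have lq: "0 < lq" "r / 2 < lq" using posQ[OF Q(1)] Q(2) by (simp_all add: lq_def)
   have xy: "\<bar>x - y\<bar> <= \<bar>x - ctrI P\<bar> + r / 4" using y unfolding r_def by argo
   have xP: "\<bar>x - ctrI P\<bar> <= r * (q - 1)"
   proof -
    have "lP * (q - 1) <= r * (q - 1)" using lPr' q1 by (intro mult_right_mono) simp_all
    then show ?thesis using lP by (simp add: q_def)
   qed
   have "\<bar>x - y\<bar> <= r * (q - 1) + r / 4" using xy xP by linarith
   also have "... <= r * q" using r0 by (simp add: algebra_simps)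
   finally have e1: "\<bar>x - y\<bar> <= r * q" .
   have e1': "\<bar>x - y\<bar> / lq <= r / lq * q" using divide_right_mono[OF e1, of lq] lq by simp
   have e2: "1 + \<bar>x - y\<bar> / lq <= 2 * q"
   proof -
    have "\<bar>x - y\<bar> / lq <= (r * (q - 1) + r / 4) / lq" using xy xP lq by (intro divide_right_mono) linarith+
    also have "... <= (r * (q - 1) + r / 4) / (r / 2)" using lq r0 q1 by (intro divide_left_mono) simp_all
    also have "... = 2 * (q - 1) + 1/2" using r0 by (simp add: field_simps)
    finally show ?thesis by simp
   qed
   have "norm (g Q x - g Q y) <= B * rs Q * (\<bar>x - y\<bar> / lq) * (1 + \<bar>x - y\<bar> / lq) ^ 5 * chiI Q y ^ 5"
    unfolding g_def lq_def by (rule osc[OF Q(1)])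
   also have "... <= B * rs Q * (r / lq * q) * (2 * q) ^ 5 * chiI Q y ^ 5"
    using e1' e2 B0 rs_pos[OF posQ[OF Q(1)]] chi_nonneg[of "tI Q" y] posQ[OF Q(1)] lq r0 q1
    by (intro mult_mono power_mono) simp_all
   also have "... = rs Q * (32 * B * q ^ 6 * (r / lq * chiI Q y ^ 5))"
    by (simp add: power_mult_distrib power_numeral_reduce)
   finally have "norm (bc Q * (g Q x - g Q y)) <= norm (bc Q) * (rs Q * (32 * B * q ^ 6 * (r / lq * chiI Q y ^ 5)))"
    unfolding norm_mult by (intro mult_left_mono) simp_all
   also have "... <= a * (32 * B * q ^ 6 * (r / lq * chiI Q y ^ 5))"
    using B0 q1 r0 lq chi_nonneg[of "tI Q" y] posQ[OF Q(1)] by (intro ab[OF Q(1)]) simp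
   finally show "norm (bc Q * (g Q x - g Q y)) <= 32 * B * a * q ^ 6 * (r / lenI Q * chiI Q y ^ 5)"
    by (simp add: lq_def mult_ac)
  qed
  also have "... = 32 * B * a * q ^ 6 * (\<Sum>Q\<in>Db. r / lenI Q * chiI Q y ^ 5)" by (simp only: sum_distrib_left)
  also have "... <= 32 * B * a * q ^ 6 * (216 * (4 * X))"
  proof (rule mult_left_mono)
   have "(\<Sum>Q\<in>Db. r / lenI Q * chiI Q y ^ 5) <= 216 * chiI T y ^ 3"
    by (intro sum_big DbD r0) (simp add: Db_def)
   then show "(\<Sum>Q\<in>Db. r / lenI Q * chiI Q y ^ 5) <= 216 * (4 * X)" using chy by linarith
  qed (use B0 a0 q1 in simp)
  finally have 1: "norm (Gb x) <= norm (Gb y) + 32 * B * a * q ^ 6 * (216 * (4 * X))" by simp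
  have "norm (Gb y) * 1 <= norm (Gb y) * q ^ 6" using q1 by (intro mult_left_mono one_le_power) simp_all
  then show ?thesis unfolding qi using 1 by (simp add: algebra_simps)
 qed
 have s3: "norm (\<gamma> P) * norm (\<Sum>Q\<in>Db. t Q) <= 4 * B * lP * (norm (Gb y) + 32 * B * a * (864 * X))"
 proof -
  define M where "M = norm (Gb y) + 32 * B * a * (864 * X)"
  have M0: "0 <= M" using B0 a0 X0 by (simp add: M_def)
  have "(\<Sum>Q\<in>Db. t Q) = (\<Sum>Q\<in>Db. LINT x|lborel. cnj (bc Q) * (\<Psi> P x * cnj (\<Phi> Q x)))"
   unfolding t_def ip_def by (simp only: integral_mult_right_zero)
  also have "... = (LINT x|lborel. (\<Sum>Q\<in>Db. cnj (bc Q) * (\<Psi> P x * cnj (\<Phi> Q x))))"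
   using integrable_ip[OF P] DbD by (intro Bochner_Integration.integral_sum[symmetric] integrable_mult_right) blast
  also have "... = (LINT x|lborel. \<Psi> P x * cnj (Gb x))"
   unfolding Gb_def by (rule Bochner_Integration.integral_cong[OF refl]) (simp add: sum_distrib_left mult_ac)
  finally have "norm (\<Sum>Q\<in>Db. t Q) <= (LINT x|lborel. norm (\<Psi> P x * cnj (Gb x)))" using integral_norm_bound by simp
  also have "... <= (LINT x|lborel. B * rs P * M * (chiI P x)\<^sup>2)"
  proof (rule integral_mono_AE')
   show "integrable lborel (\<lambda>x. B * rs P * M * (chiI P x)\<^sup>2)" using posP[OF P] by (intro integrable_mult_right integrable_chi) simp_all
   have "norm (\<Psi> P x * cnj (Gb x)) <= B * rs P * M * (chiI P x)\<^sup>2" for x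
   proof -
    have k0: "0 < chiI P x" using chi_pos posP[OF P] by blast
    have "norm (\<Psi> P x * cnj (Gb x)) <= (B * rs P * chiI P x ^ 8) * (M * inverse (chiI P x) ^ 6)"
     unfolding norm_mult complex_mod_cnj using wpk_bound8[OF wP[OF P] m8 posP[OF P] B0, of x] Gbx[of x] B0 rs_pos[OF posP[OF P]] k0
     by (intro mult_mono) (simp_all add: M_def rs_def)
    also have "... = B * rs P * M * (chiI P x ^ 8 * inverse (chiI P x) ^ 6)" by (simp only: mult_ac)
    also have "chiI P x ^ 8 * inverse (chiI P x) ^ 6 = (chiI P x)\<^sup>2"
     using k0 by (simp add: power_inverse field_simps power_add[symmetric])
    finally show ?thesis .
   qed
   then show "AE x in lborel. norm (\<Psi> P x * cnj (Gb x)) <= B * rs P * M * (chiI P x)\<^sup>2" by (intro AE_I2)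
   show "AE x in lborel. 0 <= B * rs P * M * (chiI P x)\<^sup>2" using B0 rs_pos[OF posP[OF P]] M0 by (intro AE_I2) simp
  qed
  also have "... = B * rs P * M * (LINT x|lborel. (chiI P x)\<^sup>2)" by simp
  also have "... <= B * rs P * M * (4 * lP)"
   using integral_chi_le[of "tI P" 2] posP[OF P] B0 rs_pos[OF posP[OF P]] M0 by (intro mult_left_mono) (simp_all add: lP_def)
  finally have "norm (\<gamma> P) * norm (\<Sum>Q\<in>Db. t Q) <= norm (\<gamma> P) * (B * rs P * M * (4 * lP))" by (intro mult_left_mono) simp_all
  also have "... = (norm (\<gamma> P) * rs P) * (4 * B * lP * M)" by (simp only: mult_ac)
  also have "... <= 1 * (4 * B * lP * M)" using \<gamma>1[OF P] B0 lP M0 by (intro mult_right_mono) simp_all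
  finally show ?thesis by (simp add: M_def)
 qed
 have split: "(\<Sum>Q\<in>{Q\<in>D. rel Q P}. t Q) = (\<Sum>Q\<in>Db. t Q) - (\<Sum>Q\<in>{Q\<in>Db. \<not> rel Q P}. t Q) + (\<Sum>Q\<in>{Q\<in>Ds. rel Q P}. t Q)"
 proof -
  have "{Q\<in>D. rel Q P} = {Q\<in>Db. rel Q P} \<union> {Q\<in>Ds. rel Q P}" by (auto simp: Db_def Ds_def)
  moreover have "{Q\<in>Db. rel Q P} \<inter> {Q\<in>Ds. rel Q P} = {}" by (auto simp: Db_def Ds_def)
  ultimately have 1: "(\<Sum>Q\<in>{Q\<in>D. rel Q P}. t Q) = (\<Sum>Q\<in>{Q\<in>Db. rel Q P}. t Q) + (\<Sum>Q\<in>{Q\<in>Ds. rel Q P}. t Q)"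
   using finb fins by (simp add: sum.union_disjoint)
  have "Db = {Q\<in>Db. rel Q P} \<union> {Q\<in>Db. \<not> rel Q P}" "{Q\<in>Db. rel Q P} \<inter> {Q\<in>Db. \<not> rel Q P} = {}" by blast+
  then have "(\<Sum>Q\<in>Db. t Q) = (\<Sum>Q\<in>{Q\<in>Db. rel Q P}. t Q) + (\<Sum>Q\<in>{Q\<in>Db. \<not> rel Q P}. t Q)"
   using sum.union_disjoint[of "{Q\<in>Db. rel Q P}" "{Q\<in>Db. \<not> rel Q P}" t] finb by simp
  then show ?thesis using 1 by simp
 qed
 have "norm (\<Sum>Q\<in>{Q\<in>D. rel Q P}. t Q) <= norm (\<Sum>Q\<in>Db. t Q) + norm (\<Sum>Q\<in>{Q\<in>Db. \<not> rel Q P}. t Q) + norm (\<Sum>Q\<in>{Q\<in>Ds. rel Q P}. t Q)"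
  unfolding split by (intro order_trans[OF norm_triangle_ineq] add_mono norm_triangle_ineq4 order_refl)
 then have "norm (\<gamma> P) * norm (\<Sum>Q\<in>{Q\<in>D. rel Q P}. t Q) <= norm (\<gamma> P) * (norm (\<Sum>Q\<in>Db. t Q) + norm (\<Sum>Q\<in>{Q\<in>Db. \<not> rel Q P}. t Q) + norm (\<Sum>Q\<in>{Q\<in>Ds. rel Q P}. t Q))"
  by (intro mult_left_mono) simp_all
 also have "... = norm (\<gamma> P) * norm (\<Sum>Q\<in>Db. t Q) + norm (\<gamma> P) * norm (\<Sum>Q\<in>{Q\<in>Db. \<not> rel Q P}. t Q) + norm (\<gamma> P) * norm (\<Sum>Q\<in>{Q\<in>Ds. rel Q P}. t Q)"
  by (simp only: distrib_left)
 also have "... <= 4 * B * lP * (norm (Gb y) + 32 * B * a * (864 * X)) + 4 * B\<^sup>2 * a * lP * (108 * X) + 4 * B\<^sup>2 * a * lP * (216 * X)"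
  by (intro add_mono s1 s2 s3)
 also have "... <= 4 * B * lP * ((norm (G y) + a * B * (864 * X)) + 32 * B * a * (864 * X)) + 4 * B\<^sup>2 * a * lP * (108 * X) + 4 * B\<^sup>2 * a * lP * (216 * X)"
  using Gby B0 lP by (intro add_mono mult_left_mono order_refl) simp_all
 also have "... = 4 * B * lP * norm (G y) + 115344 * (B\<^sup>2 * a * lP * X)" by (simp add: power2_eq_square algebra_simps)
 also have "... <= KK * lP * norm (G y) + KK * lP * (\<delta> * X)"
 proof (rule add_mono)
  have "0 <= 200000 * B\<^sup>2 * (4 * B\<^sup>2)" by simp
  then have "4 * B <= KK" unfolding KK_def by linarith
  then show "4 * B * lP * norm (G y) <= KK * lP * norm (G y)" using lP by (intro mult_right_mono) simp_all
  have "115344 * (B\<^sup>2 * a * lP * X) <= 200000 * (B\<^sup>2 * a * lP * X)" using a0 lP X0 by (intro mult_right_mono) simp_all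
  also have "... = 200000 * B\<^sup>2 * (4 * B\<^sup>2) * (lP * (\<delta> * X))" by (simp add: a_def)
  also have "... <= KK * (lP * (\<delta> * X))" using lP \<delta>0 X0 B0 by (intro mult_right_mono) (simp_all add: KK_def)
  finally show "115344 * (B\<^sup>2 * a * lP * X) <= KK * lP * (\<delta> * X)" by (simp only: mult.assoc)
 qed
 also have "... = KK * lP * (norm (G y) + \<delta> * X)" by (simp add: distrib_left)
 finally show ?thesis unfolding t_def lP_def X_def .
qed

definition C0 :: real where "C0 = 131072 * (B\<^sup>2 + 1)"

definition CB :: real where "CB = 4 * (135 * KK)\<^sup>2 * C0 + (4 * B\<^sup>2)\<^sup>2 + 2 * KK"

lemma energyB: "(\<Sum>Q\<in>D. (norm (bc Q))\<^sup>2) <= CB * \<delta>\<^sup>2 * l"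
proof -
 define X where "X = (\<Sum>Q\<in>D. (norm (bc Q))\<^sup>2)"
 define a where "a = 4 * B\<^sup>2 * \<delta>"
 have K0: "0 <= KK" using B0 by (simp add: KK_def)
 have C0p: "0 < C0" by (simp add: C0_def add_nonneg_pos)
 have X0: "0 <= X" unfolding X_def by (intro sum_nonneg) simp
 define V where "V P = norm (\<gamma> P) * norm (\<Sum>Q\<in>{Q\<in>D. rel Q P}. cnj (bc Q) * ip P Q)" for P
 define r where "r P = rho (ctrI P)" for P
 have r0: "0 < r P" for P unfolding r_def by (rule rho_pos)
 define Bl where "Bl P = {ctrI P - r P / 4 .. ctrI P + r P / 4}" for P
 define y where "y P = chiI T (ctrI P) ^ 3" for P
 have decG: "continuous_on UNIV G" unfolding G_def
  using wQ by (intro continuous_intros) (simp add: wpk_def)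
 have Gi: "integrable lborel G"
  unfolding G_def
 proof (intro Bochner_Integration.integrable_sum integrable_mult_right)
  fix Q assume Q: "Q \<in> D"
  have "2 <= m" using m8 by simp
  then show "integrable lborel (\<Phi> Q)" by (rule decays_integrable[OF wpk_decays[OF wQ[OF Q]] posQ[OF Q]])
 qed
 have GN: "integrable lborel (\<lambda>x. norm (G x))" using Gi by (rule integrable_norm)
 have XV: "X <= (\<Sum>P\<in>PP. V P)"
 proof -
  have "complex_of_real X = (\<Sum>Q\<in>D. bc Q * cnj (bc Q))"
   unfolding X_def of_real_sum by (rule sum.cong[OF refl]) (rule complex_norm_square)
  also have "... = (\<Sum>Q\<in>D. \<Sum>P\<in>{P\<in>PP. rel Q P}. \<gamma> P * (cnj (bc Q) * ip P Q))"
  proof (rule sum.cong[OF refl])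
   fix Q
   have "bc Q * cnj (bc Q) = (\<Sum>P\<in>{P\<in>PP. rel Q P}. \<gamma> P * ip P Q) * cnj (bc Q)" by (simp only: bc_def)
   also have "... = (\<Sum>P\<in>{P\<in>PP. rel Q P}. \<gamma> P * (cnj (bc Q) * ip P Q))"
    unfolding sum_distrib_right by (rule sum.cong[OF refl]) (simp only: mult_ac)
   finally show "bc Q * cnj (bc Q) = (\<Sum>P\<in>{P\<in>PP. rel Q P}. \<gamma> P * (cnj (bc Q) * ip P Q))" .
  qed
  also have "... = (\<Sum>P\<in>PP. \<Sum>Q\<in>{Q\<in>D. rel Q P}. \<gamma> P * (cnj (bc Q) * ip P Q))"
   by (rule sum.swap_restrict[OF finQ finP])
  finally have e: "complex_of_real X = (\<Sum>P\<in>PP. \<gamma> P * (\<Sum>Q\<in>{Q\<in>D. rel Q P}. cnj (bc Q) * ip P Q))"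
   by (simp only: sum_distrib_left)
  have "X = norm (complex_of_real X)" using X0 by simp
  also have "... <= (\<Sum>P\<in>PP. V P)" unfolding e V_def norm_mult[symmetric] by (rule norm_sum)
  finally show ?thesis .
 qed
 have Vle: "V P <= KK * ((2 * lenI P / r P) * (LINT x|lborel. indicator (Bl P) x * norm (G x)) + \<delta> * (lenI P * y P))"
  if P: "P \<in> PP" for P
 proof -
  have lB: "(LINT x|lborel. indicator (Bl P) x * (k::real)) = r P / 2 * k" for k
   using r0[of P] by (simp add: Bl_def)
  have iB: "integrable lborel (\<lambda>x. indicator (Bl P) x * (k::real))" for k
   unfolding Bl_def by (intro integrable_mult_left integrable_real_indicator) (simp_all add: emeasure_lborel_Icc_eq)
  have iG: "integrable lborel (\<lambda>x. indicator (Bl P) x * norm (G x))"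
   using GN unfolding Bl_def by (intro integrable_indicator_mult) simp_all
  have "r P / 2 * V P = (LINT x|lborel. indicator (Bl P) x * V P)" by (rule lB[symmetric])
  also have "... <= (LINT x|lborel. KK * lenI P * (indicator (Bl P) x * norm (G x)) + indicator (Bl P) x * (KK * lenI P * (\<delta> * y P)))"
  proof (rule integral_mono[OF iB])
   show "integrable lborel (\<lambda>x. KK * lenI P * (indicator (Bl P) x * norm (G x)) + indicator (Bl P) x * (KK * lenI P * (\<delta> * y P)))"
    by (intro Bochner_Integration.integrable_add integrable_mult_right iG iB)
   fix x
   show "indicator (Bl P) x * V P <= KK * lenI P * (indicator (Bl P) x * norm (G x)) + indicator (Bl P) x * (KK * lenI P * (\<delta> * y P))"
   proof (cases "x \<in> Bl P")
    case True
    then have "\<bar>x - ctrI P\<bar> <= rho (ctrI P) / 4" unfolding Bl_def r_def abs_le_iff by simp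
    from main_pt[OF P this] show ?thesis using True by (simp add: V_def y_def distrib_left)
   qed simp
  qed
  also have "... = KK * lenI P * (LINT x|lborel. indicator (Bl P) x * norm (G x)) + r P / 2 * (KK * lenI P * (\<delta> * y P))"
   using iG iB lB by simp
  finally have "2 / r P * (r P / 2 * V P) <= 2 / r P * (KK * lenI P * (LINT x|lborel. indicator (Bl P) x * norm (G x)) + r P / 2 * (KK * lenI P * (\<delta> * y P)))"
   using r0[of P] by (intro mult_left_mono) simp_all
  then show ?thesis using r0[of P] by (simp add: algebra_simps)
 qed
 have "(\<Sum>P\<in>PP. V P) <= (\<Sum>P\<in>PP. KK * ((2 * lenI P / r P) * (LINT x|lborel. indicator (Bl P) x * norm (G x)) + \<delta> * (lenI P * y P)))"
  using Vle by (rule sum_mono)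
 also have "... = KK * ((\<Sum>P\<in>PP. (2 * lenI P / r P) * (LINT x|lborel. indicator (Bl P) x * norm (G x))) + \<delta> * (\<Sum>P\<in>PP. lenI P * y P))"
  by (simp only: sum_distrib_left sum.distrib distrib_left)
 finally have 1: "X <= KK * ((\<Sum>P\<in>PP. (2 * lenI P / r P) * (LINT x|lborel. indicator (Bl P) x * norm (G x))) + \<delta> * (\<Sum>P\<in>PP. lenI P * y P))"
  using XV by linarith
 have 2: "(\<Sum>P\<in>PP. lenI P * y P) <= \<delta> * l"
 proof -
  obtain Q where Q: "Q \<in> D" using D0 by blast
  have "dens PP (tI T) <= \<delta>" using dns[OF Q _ subT[OF Q]] familyD(3)[OF famQ Q] by simp
  then show ?thesis using lT by (simp add: dens_def y_def field_simps)
 qed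
 have 3: "(\<Sum>P\<in>PP. (2 * lenI P / r P) * (LINT x|lborel. indicator (Bl P) x * norm (G x))) <= 135 * \<delta> * (LINT x|lborel. norm (G x))"
 proof -
  have iG: "integrable lborel (\<lambda>x. indicator (Bl P) x * norm (G x))" for P
   using GN unfolding Bl_def by (intro integrable_indicator_mult) simp_all
  have "(\<Sum>P\<in>PP. (2 * lenI P / r P) * (LINT x|lborel. indicator (Bl P) x * norm (G x)))
    = (LINT x|lborel. (\<Sum>P\<in>PP. (2 * lenI P / r P) * (indicator (Bl P) x * norm (G x))))"
   using iG by (subst Bochner_Integration.integral_sum) simp_all
  also have "... <= (LINT x|lborel. 135 * \<delta> * norm (G x))"
  proof (rule integral_mono)
   show "integrable lborel (\<lambda>x. \<Sum>P\<in>PP. (2 * lenI P / r P) * (indicator (Bl P) x * norm (G x)))"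
    by (intro Bochner_Integration.integrable_sum integrable_mult_right iG)
   show "integrable lborel (\<lambda>x. 135 * \<delta> * norm (G x))" using GN by (rule integrable_mult_right)
   fix x
   have "(\<Sum>P\<in>PP. (2 * lenI P / r P) * indicator (Bl P) x) <= 135 * \<delta>"
   proof -
    have "(\<Sum>P\<in>PP. (2 * lenI P / r P) * indicator (Bl P) x) = (\<Sum>P\<in>{P\<in>PP. x \<in> Bl P}. 2 * lenI P / r P)"
     using finP by (intro sum.mono_neutral_cong_right) simp_all
    also have "... <= (\<Sum>P\<in>{P\<in>PP. x \<in> Bl P}. 5 / (2 * rho x) * lenI P)"
    proof (rule sum_mono)
     fix P assume P: "P \<in> {P\<in>PP. x \<in> Bl P}"
     then have "\<bar>x - ctrI P\<bar> <= r P / 4" unfolding Bl_def abs_le_iff by simp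
     then have "rho x <= 5/4 * r P" using rho_lip[of x "ctrI P"] unfolding r_def by linarith
     then have "1 / r P <= 5 / (4 * rho x)" using r0[of P] rho_pos[of x] by (simp add: field_simps)
     then have "2 * lenI P * (1 / r P) <= 2 * lenI P * (5 / (4 * rho x))" using posP[of P] P by (intro mult_left_mono) simp_all
     then show "2 * lenI P / r P <= 5 / (2 * rho x) * lenI P" by simp
    qed
    also have "... <= (\<Sum>P\<in>{P\<in>PP. \<bar>ctrI P - x\<bar> <= rho x / 3}. 5 / (2 * rho x) * lenI P)"
    proof (rule sum_mono2)
     show "{P\<in>PP. x \<in> Bl P} \<subseteq> {P\<in>PP. \<bar>ctrI P - x\<bar> <= rho x / 3}"
     proof
      fix P assume P: "P \<in> {P\<in>PP. x \<in> Bl P}"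
      then have h: "\<bar>ctrI P - x\<bar> <= r P / 4" unfolding Bl_def abs_le_iff by simp
      then have "r P <= rho x + r P / 4" using rho_lip[of "ctrI P" x] unfolding r_def by linarith
      then have "\<bar>ctrI P - x\<bar> <= rho x / 3" using h by linarith
      then show "P \<in> {P\<in>PP. \<bar>ctrI P - x\<bar> <= rho x / 3}" using P by blast
     qed
     fix P assume "P \<in> {P\<in>PP. \<bar>ctrI P - x\<bar> <= rho x / 3} - {P\<in>PP. x \<in> Bl P}"
     then show "0 <= 5 / (2 * rho x) * lenI P" using posP[of P] rho_pos[of x] by simp
    qed (use finP in simp)
    also have "... = 5 / (2 * rho x) * (\<Sum>P\<in>{P\<in>PP. \<bar>ctrI P - x\<bar> <= rho x / 3}. lenI P)" by (simp only: sum_distrib_left)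
    also have "... <= 5 / (2 * rho x) * (54 * \<delta> * rho x)" using dens_ball[of x] rho_pos[of x] by (intro mult_left_mono) simp_all
    also have "... = 135 * \<delta>" using rho_pos[of x] by simp
    finally show ?thesis .
   qed
   then have "(\<Sum>P\<in>PP. (2 * lenI P / r P) * indicator (Bl P) x) * norm (G x) <= 135 * \<delta> * norm (G x)" by (intro mult_right_mono) simp_all
   then show "(\<Sum>P\<in>PP. (2 * lenI P / r P) * (indicator (Bl P) x * norm (G x))) <= 135 * \<delta> * norm (G x)"
    by (simp only: sum_distrib_right mult.assoc)
  qed
  finally show ?thesis by simp
 qed
 define k where "k = 135 * KK * \<delta>"
 have k0: "0 <= k" using K0 \<delta>0 by (simp add: k_def)
 have XG: "X <= k * (LINT x|lborel. norm (G x)) + KK * \<delta>\<^sup>2 * l"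
 proof -
  have "X <= KK * (135 * \<delta> * (LINT x|lborel. norm (G x)) + \<delta> * (\<delta> * l))"
  proof (rule order_trans[OF 1 mult_left_mono[OF add_mono[OF 3 mult_left_mono[OF 2]] K0]])
   show "0 <= \<delta>" using \<delta>0 by simp
  qed
  then show ?thesis by (simp add: k_def power2_eq_square algebra_simps)
 qed
 have near1: "1 / l * lenI Q <= 1" "1 / l * \<bar>ctrI Q - ctrI T\<bar> <= 1" if "Q \<in> D" for Q
  using lenQT[OF that] ctrQT[OF that] lT by (simp_all add: field_simps)
 have aux: "\<And>Q. Q \<in> D ==> norm (bc Q) * rs Q <= a" unfolding a_def by (rule bc\<delta>)
 define W where "W = wgt (1 / l) (ctrI T)"
 have tT: "(\<lambda>_. T) ` D = {T}" using D0 by blast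
 have dG: "(LINT x|lborel. (W x)\<^sup>2 * (norm (G x))\<^sup>2) <= 131072 * B\<^sup>2 * (X + a\<^sup>2 * l)"
  unfolding W_def G_def X_def using dual_le(1)[OF famQ wQ m8 B0 _ near1 aux] lT by (simp add: tT)
 have dG2: "integrable lborel (\<lambda>x. (W x)\<^sup>2 * (norm (G x))\<^sup>2)"
  unfolding W_def G_def using dual_le(2)[OF famQ wQ m8 B0 _ near1 aux] lT by simp
 have W1: "1 <= W x" for x unfolding W_def by (rule wgt_ge1)
 have Wi: "inverse (1 + ((x - ctrI T) / l)\<^sup>2) = inverse (W x)" for x by (simp add: W_def wgt_def)
 have iW: "integrable lborel (\<lambda>x. inverse (W x))" using integrable_cauchy[OF lT, of "ctrI T"] unfolding Wi .
 have iW4: "(LINT x|lborel. inverse (W x)) <= 4 * l"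
  using integral_cauchy[OF lT, of "ctrI T"] pi_less_4 lT unfolding Wi by simp
 have cs: "k * (LINT x|lborel. norm (G x)) <= k\<^sup>2 * C0 / 2 * (4 * l) + (X + a\<^sup>2 * l) / 2"
 proof -
  have "k * (LINT x|lborel. norm (G x)) = (LINT x|lborel. k * norm (G x))" by simp
  also have "... <= (LINT x|lborel. k\<^sup>2 * C0 / 2 * inverse (W x) + 1 / (2 * C0) * ((W x)\<^sup>2 * (norm (G x))\<^sup>2))"
  proof (rule integral_mono)
   show "integrable lborel (\<lambda>x. k * norm (G x))" using GN by (rule integrable_mult_right)
   show "integrable lborel (\<lambda>x. k\<^sup>2 * C0 / 2 * inverse (W x) + 1 / (2 * C0) * ((W x)\<^sup>2 * (norm (G x))\<^sup>2))"
    by (intro Bochner_Integration.integrable_add integrable_mult_right iW dG2)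
   fix x
   define u where "u = inverse (W x)"
   define v where "v = W x * norm (G x)"
   have W0: "0 < W x" using W1[of x] by linarith
   have u: "0 <= u" "u <= 1" using W1[of x] W0 by (simp_all add: u_def inverse_le_1_iff)
   have "k * norm (G x) = k * (u * v)" using W0 by (simp add: u_def v_def)
   also have "... <= k\<^sup>2 * C0 / 2 * u\<^sup>2 + 1 / (2 * C0) * v\<^sup>2"
   proof -
    have "0 <= (C0 * k * u - v)\<^sup>2" by simp
    then have "2 * C0 * (k * (u * v)) <= 2 * C0 * (k\<^sup>2 * C0 / 2 * u\<^sup>2) + v\<^sup>2" by (simp add: power2_eq_square algebra_simps)
    then show ?thesis using C0p by (simp add: field_simps)
   qed
   also have "... <= k\<^sup>2 * C0 / 2 * u + 1 / (2 * C0) * v\<^sup>2"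
   proof -
    have "u\<^sup>2 <= u" using u by (simp add: power2_eq_square mult_left_le_one_le)
    then show ?thesis using C0p by (intro add_right_mono mult_left_mono) simp_all
   qed
   finally show "k * norm (G x) <= k\<^sup>2 * C0 / 2 * inverse (W x) + 1 / (2 * C0) * ((W x)\<^sup>2 * (norm (G x))\<^sup>2)"
    by (simp add: u_def v_def power_mult_distrib)
  qed
  also have "... = k\<^sup>2 * C0 / 2 * (LINT x|lborel. inverse (W x)) + 1 / (2 * C0) * (LINT x|lborel. (W x)\<^sup>2 * (norm (G x))\<^sup>2)"
   using iW dG2 by simp
  also have "... <= k\<^sup>2 * C0 / 2 * (4 * l) + 1 / (2 * C0) * (C0 * (X + a\<^sup>2 * l))"
  proof (intro add_mono mult_left_mono iW4)
   have "131072 * B\<^sup>2 * (X + a\<^sup>2 * l) <= C0 * (X + a\<^sup>2 * l)" using X0 lT by (intro mult_right_mono) (simp_all add: C0_def)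
   then show "(LINT x|lborel. (W x)\<^sup>2 * (norm (G x))\<^sup>2) <= C0 * (X + a\<^sup>2 * l)" using dG by linarith
  qed (use C0p in simp_all)
  also have "... = k\<^sup>2 * C0 / 2 * (4 * l) + (X + a\<^sup>2 * l) / 2" using C0p by simp
  finally show ?thesis .
 qed
 have "X <= k\<^sup>2 * C0 / 2 * (4 * l) + (X + a\<^sup>2 * l) / 2 + KK * \<delta>\<^sup>2 * l" using XG cs by linarith
 then have "X <= k\<^sup>2 * C0 * 4 * l + a\<^sup>2 * l + 2 * (KK * \<delta>\<^sup>2 * l)" by (simp add: field_simps)
 also have "... = CB * \<delta>\<^sup>2 * l" by (simp add: k_def a_def CB_def power_mult_distrib algebra_simps)
 finally show ?thesis unfolding X_def .
qed

end

context tree_pair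
begin

definition far :: "tritile set" where "far = {P\<in>R. 2 * l < \<bar>ctrI P - ctrI T\<bar>}"
definition nearby :: "tritile set" where "nearby = {P\<in>R. \<not> 2 * l < \<bar>ctrI P - ctrI T\<bar>}"

lemma R_sub: "R \<subseteq> PP" by (auto simp: R_def)

lemma far_sum:
 assumes Q: "Q \<in> D"
 shows "norm (\<Sum>P\<in>{P\<in>far. rel Q P}. \<gamma> P * ip P Q) * rs Q <= 512 * B\<^sup>2 * (lenI Q / l)"
proof -
 have p: "0 < lenI Q" using posQ[OF Q] .
 have sub: "far \<subseteq> PP" using R_sub by (auto simp: far_def)
 have "norm (\<Sum>P\<in>{P\<in>far. rel Q P}. \<gamma> P * ip P Q) <= (\<Sum>P\<in>{P\<in>far. rel Q P}. norm (\<gamma> P) * norm (ip P Q))"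
  by (rule order_trans[OF norm_sum]) (simp add: norm_mult)
 also have "... <= (\<Sum>P\<in>{P\<in>far. rel Q P}. 4 * B\<^sup>2 * rs Q * (lenI Q / l) * (lenI P * chiI Q (ctrI P) ^ 5))"
 proof (rule sum_mono)
  fix P assume P: "P \<in> {P\<in>far. rel Q P}"
  then have P': "P \<in> PP" "lenw Q 3 <= c * lenw P 2" "2 * l < \<bar>ctrI P - ctrI T\<bar>"
   using sub by (auto simp: rel_def cc_sub_def far_def)
  have d: "l <= \<bar>ctrI P - ctrI Q\<bar>" using P'(3) ctrQT[OF Q] lT by argo
  have "chiI Q (ctrI P) <= 1 / (\<bar>ctrI P - ctrI Q\<bar> / lenI Q)"
  proof -
   have "0 < \<bar>ctrI P - ctrI Q\<bar>" using d lT by linarith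
   then have "0 < \<bar>ctrI P - ctrI Q\<bar> / lenI Q" using p by (rule divide_pos_pos)
   then show ?thesis unfolding chi_def by (intro divide_left_mono mult_pos_pos) linarith+
  qed
  also have "... = lenI Q / \<bar>ctrI P - ctrI Q\<bar>" by simp
  also have "... <= lenI Q / l" using d lT p by (intro divide_left_mono mult_pos_pos) linarith+
  finally have c6: "chiI Q (ctrI P) * chiI Q (ctrI P) ^ 5 <= lenI Q / l * chiI Q (ctrI P) ^ 5"
   using chi_nonneg[of "tI Q"] p by (intro mult_right_mono) simp_all
  have "norm (\<gamma> P) * norm (ip P Q) <= 4 * B\<^sup>2 * rs Q * lenI P * chiI Q (ctrI P) ^ 6"
   by (rule term_le2[OF P'(1) Q P'(2)])
  also have "... = 4 * B\<^sup>2 * rs Q * lenI P * (chiI Q (ctrI P) * chiI Q (ctrI P) ^ 5)"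
   by (simp add: power_numeral_reduce)
  also have "... <= 4 * B\<^sup>2 * rs Q * lenI P * (lenI Q / l * chiI Q (ctrI P) ^ 5)"
   using c6 rs_pos[OF p] posP[OF P'(1)] by (intro mult_left_mono) simp_all
  finally show "norm (\<gamma> P) * norm (ip P Q) <= 4 * B\<^sup>2 * rs Q * (lenI Q / l) * (lenI P * chiI Q (ctrI P) ^ 5)"
   by (simp only: mult_ac)
 qed
 also have "... = 4 * B\<^sup>2 * rs Q * (lenI Q / l) * (\<Sum>P\<in>{P\<in>far. rel Q P}. lenI P * chiI Q (ctrI P) ^ 5)" by (simp only: sum_distrib_left)
 also have "... <= 4 * B\<^sup>2 * rs Q * (lenI Q / l) * (128 * lenI Q)"
 proof (rule mult_left_mono)
  have "(\<Sum>P\<in>{P\<in>far. rel Q P}. lenI P * chiI Q (ctrI P) ^ 5) <= (1 + 1) ^ 5 * (LINT x|lborel. indicator UNIV x * chiI Q x ^ 5)"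
  proof (rule sum_kap_disjoint(2))
   fix P P' assume "P \<in> {P\<in>far. rel Q P}" "P' \<in> {P\<in>far. rel Q P}" "P \<noteq> P'"
   then show "setI P \<inter> setI P' = {}" by (intro R_disjoint) (simp_all add: far_def)
  next
   fix P assume P: "P \<in> {P\<in>far. rel Q P}"
   then have P': "P \<in> PP" "lenw Q 3 <= c * lenw P 2" using sub by (auto simp: rel_def cc_sub_def)
   show "lenI P <= 1 * lenI Q" using len_I_le1[OF P'(1) Q P'(2)] by simp
   show "0 < lenI P" using posP[OF P'(1)] .
  next
   show "finite {P\<in>far. rel Q P}" using finP sub by (simp add: finite_subset)
  qed (use p in simp_all)
  also have "... <= 32 * (4 * lenI Q)" using integral_chi_le[of "tI Q" 5] p by simp
  finally show "(\<Sum>P\<in>{P\<in>far. rel Q P}. lenI P * chiI Q (ctrI P) ^ 5) <= 128 * lenI Q" by simp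
 qed (use rs_pos[OF p] p lT in simp)
 finally have "norm (\<Sum>P\<in>{P\<in>far. rel Q P}. \<gamma> P * ip P Q) * rs Q <= 4 * B\<^sup>2 * rs Q * (lenI Q / l) * (128 * lenI Q) * rs Q"
  using rs_pos[OF p] by (intro mult_right_mono) simp_all
 also have "... = 512 * B\<^sup>2 * (lenI Q / l) * ((rs Q * rs Q) * lenI Q)" by simp
 also have "(rs Q * rs Q) * lenI Q = 1" using p by (simp add: rs_mult)
 finally show ?thesis by simp
qed

lemma sum_len_le: "(\<Sum>Q\<in>D. lenI Q * (lenI Q / l)\<^sup>2) <= 72 * l"
proof -
 have one: "(\<Sum>Q\<in>{Q\<in>D. lenI Q = s}. lenI Q) <= 36 * l" for s
 proof -
  have "(\<Sum>Q\<in>{Q\<in>D. lenI Q = s}. lenI Q) <= (\<Sum>Q\<in>{Q\<in>D. lenI Q = s}. 9/4 * (lenI Q * chiI T (ctrI Q) ^ 2))"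
  proof (rule sum_mono)
   fix Q assume "Q \<in> {Q\<in>D. lenI Q = s}"
   then have Q: "Q \<in> D" by simp
   have "1 + \<bar>ctrI Q - ctrI T\<bar> / l <= 3/2" using ctrQT[OF Q] lT by (simp add: field_simps)
   then have "1 / (3/2) <= chiI T (ctrI Q)" unfolding chi_def using lT by (intro divide_left_mono mult_pos_pos add_pos_nonneg) simp_all
   then have "(2/3)\<^sup>2 <= (chiI T (ctrI Q))\<^sup>2" by (intro power_mono) simp_all
   then have "lenI Q * 1 <= lenI Q * (9/4 * (chiI T (ctrI Q))\<^sup>2)" using posQ[OF Q] by (intro mult_left_mono) (simp_all add: power_divide)
   then show "lenI Q <= 9/4 * (lenI Q * chiI T (ctrI Q) ^ 2)" by simp
  qed
  also have "... = 9/4 * (\<Sum>Q\<in>{Q\<in>D. lenI Q = s}. lenI Q * chiI T (ctrI Q) ^ 2)" by (simp only: sum_distrib_left)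
  also have "... <= 9/4 * ((1 + 1) ^ 2 * (LINT x|lborel. indicator UNIV x * chiI T x ^ 2))"
  proof (intro mult_left_mono sum_kap_disjoint(2))
   show "setI Q \<inter> setI Q' = {}" if "Q \<in> {Q\<in>D. lenI Q = s}" "Q' \<in> {Q\<in>D. lenI Q = s}" "Q \<noteq> Q'" for Q Q'
    using dis_scale[of Q Q'] that by simp
   show "lenI Q <= 1 * l" "0 < lenI Q" if "Q \<in> {Q\<in>D. lenI Q = s}" for Q using lenQT[of Q] posQ[of Q] that by simp_all
  qed (use finQ lT in simp_all)
  also have "... <= 9/4 * (4 * (4 * l))" using integral_chi_le[of "tI T" 2] lT by simp
  finally show ?thesis by simp
 qed
 define L where "L = (\<lambda>Q. lenI Q) ` D"
 have "(\<Sum>Q\<in>D. lenI Q * (lenI Q / l)\<^sup>2) = (\<Sum>s\<in>L. \<Sum>Q\<in>{Q\<in>D. lenI Q = s}. lenI Q * (lenI Q / l)\<^sup>2)"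
  unfolding L_def by (rule sum.image_gen[OF finQ])
 also have "... <= (\<Sum>s\<in>L. 36 * s)"
 proof (rule sum_mono)
  fix s assume s: "s \<in> L"
  have s1: "0 < s" "s <= l" using s posQ lenQT unfolding L_def by blast+
  have "(\<Sum>Q\<in>{Q\<in>D. lenI Q = s}. lenI Q * (lenI Q / l)\<^sup>2) = (s / l)\<^sup>2 * (\<Sum>Q\<in>{Q\<in>D. lenI Q = s}. lenI Q)"
   unfolding sum_distrib_left by (rule sum.cong) simp_all
  also have "... <= (s / l)\<^sup>2 * (36 * l)" using one[of s] by (intro mult_left_mono) simp_all
  also have "... = 36 * s * (s / l)" using lT by (simp add: power2_eq_square)
  also have "... <= 36 * s * 1" using s1 lT by (intro mult_left_mono) simp_all
  finally show "(\<Sum>Q\<in>{Q\<in>D. lenI Q = s}. lenI Q * (lenI Q / l)\<^sup>2) <= 36 * s" by simp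
 qed
 also have "... = 36 * (\<Sum>s\<in>L. s)" by (simp only: sum_distrib_left)
 also have "... <= 36 * (2 * l)"
 proof (intro mult_left_mono sum_pow2_le)
  show "x <= l" if "x \<in> L" for x using that lenQT unfolding L_def by blast
  show "finite L" "\<And>x. x \<in> L ==> 0 < x" "\<And>x y. x \<in> L ==> y \<in> L ==> x < y ==> 2 * x <= y"
   unfolding L_def using scales_facts[OF subset_refl] by blast+
 qed (use lT in simp_all)
 finally show ?thesis by simp
qed

definition CA :: real where
 "CA = 2 * (C3 * (1 + 1024 * B\<^sup>2) * 144 + (1024 * B\<^sup>2)\<^sup>2 / 2) + 2 * ((512 * B\<^sup>2)\<^sup>2 * 72)"

lemma energyA: "(\<Sum>Q\<in>D. (norm (bc Q))\<^sup>2) <= CA * l"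
proof -
 let ?f = "\<lambda>Q. \<Sum>P\<in>{P\<in>far. rel Q P}. \<gamma> P * ip P Q"
 have sub: "nearby \<subseteq> PP" using R_sub by (auto simp: nearby_def)
 interpret N: tree_pair D T \<Phi> nearby \<Psi> \<gamma> B m c
 proof
  show "family 2 nearby (\<lambda>P. P)" by (rule family_subset[OF famP sub])
  show "\<And>P. P \<in> nearby ==> wpk B m (tI P) (tw P 2) (\<Psi> P)" "\<And>P. P \<in> nearby ==> norm (\<gamma> P) * rs P <= 1"
   using wP \<gamma>1 sub by blast+
 qed (fact famQ wQ m8 B0 c0 c1 cs D0 near)+
 have eq: "bc Q = N.bc Q + ?f Q" if Q: "Q \<in> D" for Q
 proof -
  have fin: "finite {P\<in>nearby. rel Q P}" "finite {P\<in>far. rel Q P}"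
   using finP R_sub by (auto simp: nearby_def far_def R_def)
  have "{P\<in>PP. rel Q P} = {P\<in>nearby. rel Q P} \<union> {P\<in>far. rel Q P}" "{P\<in>nearby. rel Q P} \<inter> {P\<in>far. rel Q P} = {}"
   using Q by (auto simp: nearby_def far_def R_def)
  then show ?thesis unfolding bc_def N.bc_def N.rel_def[abs_def] rel_def[abs_def] N.ip_def[abs_def] ip_def[abs_def]
   using fin unfolding rel_def by (simp only: sum.union_disjoint)
 qed
 have N1: "(\<Sum>Q\<in>D. (norm (N.bc Q))\<^sup>2) <= C3 * (1 + 1024 * B\<^sup>2) * (144 * l) + (1024 * B\<^sup>2)\<^sup>2 * l / 2"
 proof -
  have "(\<lambda>_. T) ` D = {T}" using D0 by blast
  then have "(\<Sum>Q\<in>D. (norm (N.bc Q))\<^sup>2) <= C3 * (1 + 1024 * B\<^sup>2) * N.SP + (1024 * B\<^sup>2)\<^sup>2 * l / 2"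
   using N.energy3[OF N.bc_le_const] by (simp add: N.C3_def C3_def)
  moreover have "N.SP <= 144 * l"
  proof -
   have "N.SP <= (\<Sum>P\<in>nearby. 9 * (lenI P * chiI T (ctrI P) ^ 2))"
    unfolding N.SP_def
   proof (rule sum_mono)
    fix P assume P: "P \<in> nearby"
    then have "1 + \<bar>ctrI P - ctrI T\<bar> / l <= 3" using lT by (simp add: nearby_def field_simps)
    then have "1 / 3 <= chiI T (ctrI P)" unfolding chi_def using lT by (intro divide_left_mono mult_pos_pos add_pos_nonneg) simp_all
    then have "(1/3)\<^sup>2 <= (chiI T (ctrI P))\<^sup>2" by (intro power_mono) simp_all
    then have "lenI P * 1 <= lenI P * (9 * (chiI T (ctrI P))\<^sup>2)" using N.posP[OF P] by (intro mult_left_mono) (simp_all add: power_divide)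
    then show "lenI P <= 9 * (lenI P * chiI T (ctrI P) ^ 2)" by simp
   qed
   also have "... = 9 * (\<Sum>P\<in>nearby. lenI P * chiI T (ctrI P) ^ 2)" by (simp only: sum_distrib_left)
   also have "... <= 9 * ((1 + 1) ^ 2 * (LINT x|lborel. indicator UNIV x * chiI T x ^ 2))"
   proof (intro mult_left_mono sum_kap_disjoint(2))
    show "setI P \<inter> setI P' = {}" if "P \<in> nearby" "P' \<in> nearby" "P \<noteq> P'" for P P'
     using that by (intro R_disjoint) (simp_all add: nearby_def)
    show "lenI P <= 1 * l" "0 < lenI P" if "P \<in> nearby" for P
     using R_len[of P] N.posP[OF that] that by (simp_all add: nearby_def)
   qed (use N.finP lT in simp_all)
   also have "... <= 9 * (4 * (4 * l))" using integral_chi_le[of "tI T" 2] lT by simp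
   finally show ?thesis by simp
  qed
  moreover have "0 <= C3 * (1 + 1024 * B\<^sup>2)"
   unfolding C3_def using c0 by (intro mult_nonneg_nonneg add_nonneg_nonneg zero_le_power of_nat_0_le_iff B0) simp_all
  ultimately show ?thesis by (meson add_right_mono mult_left_mono order_trans)
 qed
 have N2: "(\<Sum>Q\<in>D. (norm (?f Q))\<^sup>2) <= (512 * B\<^sup>2)\<^sup>2 * (72 * l)"
 proof -
  have "(\<Sum>Q\<in>D. (norm (?f Q))\<^sup>2) <= (\<Sum>Q\<in>D. (512 * B\<^sup>2)\<^sup>2 * (lenI Q * (lenI Q / l)\<^sup>2))"
  proof (rule sum_mono)
   fix Q assume Q: "Q \<in> D"
   have "(norm (?f Q) * rs Q)\<^sup>2 <= (512 * B\<^sup>2 * (lenI Q / l))\<^sup>2"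
    using far_sum[OF Q] rs_pos[OF posQ[OF Q]] by (intro power_mono) simp_all
   then have "lenI Q * (norm (?f Q) * rs Q)\<^sup>2 <= lenI Q * (512 * B\<^sup>2 * (lenI Q / l))\<^sup>2"
    using posQ[OF Q] by (intro mult_left_mono) simp_all
   moreover have "lenI Q * (norm (?f Q) * rs Q)\<^sup>2 = (norm (?f Q))\<^sup>2"
    using posQ[OF Q] by (simp add: power_mult_distrib rs_sq)
   ultimately show "(norm (?f Q))\<^sup>2 <= (512 * B\<^sup>2)\<^sup>2 * (lenI Q * (lenI Q / l)\<^sup>2)"
    unfolding power_mult_distrib[of "512 * B\<^sup>2"] by (simp only: mult.left_commute)
  qed
  also have "... = (512 * B\<^sup>2)\<^sup>2 * (\<Sum>Q\<in>D. lenI Q * (lenI Q / l)\<^sup>2)" by (simp only: sum_distrib_left)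
  also have "... <= (512 * B\<^sup>2)\<^sup>2 * (72 * l)" using sum_len_le by (intro mult_left_mono) simp_all
  finally show ?thesis .
 qed
 have "(\<Sum>Q\<in>D. (norm (bc Q))\<^sup>2) <= (\<Sum>Q\<in>D. 2 * (norm (N.bc Q))\<^sup>2 + 2 * (norm (?f Q))\<^sup>2)"
 proof (rule sum_mono)
  fix Q assume Q: "Q \<in> D"
  define u where "u = norm (N.bc Q)"
  define v where "v = norm (?f Q)"
  have "norm (bc Q) <= u + v" unfolding eq[OF Q] u_def v_def by (rule norm_triangle_ineq)
  then have "(norm (bc Q))\<^sup>2 <= (u + v)\<^sup>2" by (intro power_mono) simp_all
  also have "... <= 2 * u\<^sup>2 + 2 * v\<^sup>2"
  proof -
   have "0 <= (u - v)\<^sup>2" by simp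
   then show ?thesis by (simp add: power2_eq_square algebra_simps)
  qed
  finally show "(norm (bc Q))\<^sup>2 <= 2 * (norm (N.bc Q))\<^sup>2 + 2 * (norm (?f Q))\<^sup>2"
   by (simp only: u_def v_def)
 qed
 also have "... = 2 * (\<Sum>Q\<in>D. (norm (N.bc Q))\<^sup>2) + 2 * (\<Sum>Q\<in>D. (norm (?f Q))\<^sup>2)"
  by (simp only: sum.distrib sum_distrib_left)
 also have "... <= 2 * (C3 * (1 + 1024 * B\<^sup>2) * (144 * l) + (1024 * B\<^sup>2)\<^sup>2 * l / 2) + 2 * ((512 * B\<^sup>2)\<^sup>2 * (72 * l))"
  using N1 N2 by (intro add_mono mult_left_mono) simp_all
 also have "... = CA * l" by (simp add: CA_def algebra_simps)
 finally show ?thesis .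
qed

end

subsection \<open>Trees in a rank-1 collection\<close>

definition three :: "nat set" where "three = {1, 2, 3}"

lemma fcube_eqD:
 assumes "fcube T = fcube T'" "\<And>i. i \<in> three ==> 0 < lenw T i" "\<And>i. i \<in> three ==> 0 < lenw T' i" "i \<in> three"
 shows "tw T i = tw T' i"
proof -
 have ne: "setw S i \<noteq> {}" if "0 < lenw S i" for S i using ctr_mem[OF that] by blast
 have e: "setw T 1 \<times> setw T 2 \<times> setw T 3 = setw T' 1 \<times> setw T' 2 \<times> setw T' 3"
  using assms(1) by (simp add: fcube_def)
 have n: "setw T 1 \<noteq> {}" "setw T 2 \<noteq> {}" "setw T 3 \<noteq> {}" "setw T' 1 \<noteq> {}" "setw T' 2 \<noteq> {}" "setw T' 3 \<noteq> {}"
  by (intro ne assms(2,3); simp add: three_def)+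
 have "setw T 1 = setw T' 1 \<and> setw T 2 = setw T' 2 \<and> setw T 3 = setw T' 3"
  using e n by (simp add: times_eq_iff)
 then have "setw T i = setw T' i" using assms(4) by (auto simp: three_def)
 then show ?thesis using ivl_eq_iv[OF assms(2)[OF assms(4)] assms(3)[OF assms(4)]] by simp
qed

lemma iv_psubset_ctr:
 assumes "0 < len I" "ivl_set I \<subset> ivl_set J"
 shows "\<bar>ctr J - ctr I\<bar> <= (len J - len I) / 2" "len I < len J"
proof -
 show c: "\<bar>ctr J - ctr I\<bar> <= (len J - len I) / 2" using assms(2) iv_subset_ctr[OF assms(1)] by blast
 have "len I <= len J" using c abs_ge_zero[of "ctr J - ctr I"] by argo
 moreover have "len I \<noteq> len J"
 proof
  assume e: "len I = len J"
  then have "ctr J = ctr I" using c by simp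
  then have "I = J" using e by (intro ivl_eqI) (simp_all add: fst_eq_ctr)
  then show False using assms(2) by simp
 qed
 ultimately show "len I < len J" by simp
qed

locale rank1_coll =
 fixes QQ :: "tritile set"
 assumes fin: "finite QQ" and tri: "\<And>T. T \<in> QQ ==> is_tritile T" and r1: "rank1 QQ" and sp: "sparse QQ"
begin

lemma tile: "T \<in> QQ ==> i \<in> three ==> is_tile (comp T i)"
 using tri[of T] by (auto simp: is_tritile_def three_def)

lemma dy: "T \<in> QQ ==> in_D 0 (tI T)"
 using tile[of T 1] by (simp add: is_tile_def comp_def three_def)

lemma lI: "T \<in> QQ ==> 0 < lenI T" using dy in_D_pos by blast

lemma lw: "T \<in> QQ ==> i \<in> three ==> lenI T * lenw T i = 1"
 using tile[of T i] by (simp add: is_tile_def comp_def)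

lemma lwe: "T \<in> QQ ==> i \<in> three ==> lenw T i = 1 / lenI T"
 using lw[of T i] lI[of T] by (simp add: field_simps)

lemma lwp: "T \<in> QQ ==> i \<in> three ==> 0 < lenw T i"
 using lwe[of T i] lI[of T] by simp

lemma shift_ex: "i \<in> three ==> \<exists>\<sigma>\<in>shifts. \<forall>T\<in>QQ. in_D \<sigma> (tw T i)"
 using sp unfolding sparse_def three_def by blast

lemma comp_inj: "T \<in> QQ ==> T' \<in> QQ ==> i \<in> three ==> comp T i = comp T' i ==> T = T'"
 using r1 unfolding rank1_def three_def by blast

lemma sparse_len:
 assumes "T \<in> QQ" "T' \<in> QQ" "i \<in> three" "lenw T i < lenw T' i"
 shows "1000000000 * lenw T i < lenw T' i"
proof -
 have e: "lenw S i = lenw S 1" if "S \<in> QQ" for S using lwe[OF that assms(3)] lwe[OF that, of 1] by (simp add: three_def)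
 have "fcube T \<noteq> fcube T'"
 proof
  assume "fcube T = fcube T'"
  then have "tw T i = tw T' i" using fcube_eqD[OF _ _ _ assms(3)] lwp assms(1,2) by blast
  then show False using assms(4) by simp
 qed
 then show ?thesis using sp assms e[OF assms(1)] e[OF assms(2)] unfolding sparse_def by simp
qed

lemma tree_facts:
 assumes "Q \<in> QQ" "T \<in> QQ" "Q \<noteq> T" "j \<in> three" "tile_le (comp Q j) (comp T j)"
 shows "setI Q \<subset> setI T" "1000000000 * lenI Q < lenI T"
  "i \<in> three ==> \<bar>ctrw Q i - ctrw T i\<bar> <= 5000000 * (lenw Q i - lenw T i)"
  "i \<in> three ==> i \<noteq> j ==> 3 / 2 * (lenw Q i - lenw T i) < \<bar>ctrw Q i - ctrw T i\<bar>"
proof -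
 have "comp Q j \<noteq> comp T j" using comp_inj assms by blast
 then show 1: "setI Q \<subset> setI T" using assms(5) unfolding tile_le_def by (metis comp_def fst_conv)
 have "fst (tI T) <= fst (tI Q) \<and> fst (tI Q) + lenI Q <= fst (tI T) + lenI T"
  using 1 iv_subset_iff[OF lI[OF assms(1)]] by blast
 moreover have "tI Q \<noteq> tI T" using 1 by auto
 ultimately have l: "lenI Q < lenI T" using ivl_eqI[of "tI Q" "tI T"] by linarith
 have t1: "(1::nat) \<in> three" by (simp add: three_def)
 have "lenw T 1 < lenw Q 1" unfolding lwe[OF assms(1) t1] lwe[OF assms(2) t1] using l lI assms by (simp add: frac_less2)
 then have "1000000000 * lenw T 1 < lenw Q 1" by (rule sparse_len[OF assms(2,1) t1])
 then show 2: "1000000000 * lenI Q < lenI T"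
  unfolding lwe[OF assms(1) t1] lwe[OF assms(2) t1] using lI[OF assms(1)] lI[OF assms(2)] by (simp add: field_simps)
 have rk: "(\<forall>i\<in>{1,2,3}. tile_lesssim (comp Q i) (comp T i)) \<and>
    (lenI T > 10^9 * lenI Q \<longrightarrow> (\<forall>i\<in>{1,2,3}. i \<noteq> j \<longrightarrow> tile_lesssim' (comp Q i) (comp T i)))"
  using r1 assms unfolding rank1_def three_def by blast
 show "\<bar>ctrw Q i - ctrw T i\<bar> <= 5000000 * (lenw Q i - lenw T i)" if i: "i \<in> three"
 proof -
  have "ivl_set (dil (10^7) (tw T i)) \<subseteq> ivl_set (dil (10^7) (tw Q i))"
   using rk i unfolding tile_lesssim_def three_def by (simp add: comp_def) blast
  then have "\<bar>ctrw Q i - ctrw T i\<bar> <= (10^7 * lenw Q i - 10^7 * lenw T i) / 2"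
   using iv_subset_ctr[of "dil (10^7) (tw T i)" "dil (10^7) (tw Q i)"] lwp[OF assms(2) i] by simp
  then show ?thesis by (simp add: algebra_simps)
 qed
 show "3 / 2 * (lenw Q i - lenw T i) < \<bar>ctrw Q i - ctrw T i\<bar>" if i: "i \<in> three" "i \<noteq> j"
 proof -
  have "10^9 * lenI Q < lenI T" using 2 by simp
  then have "\<not> tile_le (comp Q i) (comp T i)" using rk i unfolding tile_lesssim'_def three_def by blast
  then have "\<not> ivl_set (dil 3 (tw T i)) \<subseteq> ivl_set (dil 3 (tw Q i))" using 1 unfolding tile_le_def by (simp add: comp_def)
  then have "\<not> \<bar>ctrw Q i - ctrw T i\<bar> <= (3 * lenw Q i - 3 * lenw T i) / 2"
   using iv_subset_ctr[of "dil 3 (tw T i)" "dil 3 (tw Q i)"] lwp[OF assms(2) i(1)] by simp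
  then show ?thesis by (simp add: algebra_simps)
 qed
qed

lemma tree_same_scale:
 assumes "Q \<in> QQ" "Q' \<in> QQ" "T \<in> QQ" "Q \<noteq> T" "Q' \<noteq> T" "j \<in> three"
  "tile_le (comp Q j) (comp T j)" "tile_le (comp Q' j) (comp T j)" "lenI Q = lenI Q'" "i \<in> three"
 shows "tw Q i = tw Q' i"
proof -
 have t1: "(1::nat) \<in> three" by (simp add: three_def)
 have mem: "ctrw T k \<in> ivl_set (dil (10^9) (tw S k))" if "S \<in> QQ" "S \<noteq> T" "tile_le (comp S j) (comp T j)" "k \<in> three" for S k
 proof -
  have "\<bar>ctrw S k - ctrw T k\<bar> <= 5000000 * (lenw S k - lenw T k)"
   by (rule tree_facts(3)[OF that(1) assms(3) that(2) assms(6) that(3,4)])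
  then show ?thesis unfolding mem_iv_ctr dil_simps using lwp[OF that(1,4)] lwp[OF assms(3) that(4)] by (simp add: abs_le_iff)
 qed
 have "(ctrw T 1, ctrw T 2, ctrw T 3) \<in> dil_fcube (10^9) Q \<inter> dil_fcube (10^9) Q'"
  unfolding dil_fcube_def using mem[OF assms(1,4,7)] mem[OF assms(2,5,8)] by (simp add: three_def)
 then have ne: "dil_fcube (10^9) Q \<inter> dil_fcube (10^9) Q' \<noteq> {}" by blast
 have "lenw Q 1 = lenw Q' 1" using lwe[OF assms(1) t1] lwe[OF assms(2) t1] assms(9) by simp
 then have "fcube Q = fcube Q'" using ne sp assms(1,2) unfolding sparse_def by blast
 then show ?thesis using fcube_eqD[OF _ _ _ assms(10)] lwp assms(1,2) by blast
qed

definition TR :: "nat => tritile => tritile set" where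
 "TR j T = {Q\<in>QQ. Q \<noteq> T \<and> tile_le (comp Q j) (comp T j)}"

definition LT :: "nat => nat => real => tritile => tritile set" where
 "LT i j s T = {Q\<in>TR j T. 0 < s * (ctrw Q i - ctrw T i)}"

definition AllT :: "tritile => tritile set" where
 "AllT T = {Q\<in>QQ. \<exists>j\<in>three. tile_le (comp Q j) (comp T j)}"

lemma LT_sub: "LT i j s T \<subseteq> TR j T" by (auto simp: LT_def)

lemma TR_split:
 assumes "T \<in> QQ" "i \<in> three" "j \<in> three" "i \<noteq> j"
 shows "TR j T = LT i j 1 T \<union> LT i j (-1) T" "LT i j 1 T \<inter> LT i j (-1) T = {}"
proof -
 have "ctrw Q i \<noteq> ctrw T i" if "Q \<in> TR j T" for Q
 proof
  assume e: "ctrw Q i = ctrw T i"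
  have Q: "Q \<in> QQ" "Q \<noteq> T" "tile_le (comp Q j) (comp T j)" using that by (simp_all add: TR_def)
  have "3 / 2 * (lenw Q i - lenw T i) < 0" using tree_facts(4)[OF Q(1) assms(1) Q(2) assms(3) Q(3) assms(2,4)] e by simp
  moreover have "lenw T i < lenw Q i"
   using tree_facts(2)[OF Q(1) assms(1) Q(2) assms(3) Q(3)] lI[OF Q(1)] lI[OF assms(1)] unfolding lwe[OF Q(1) assms(2)] lwe[OF assms(1,2)]
   by (simp add: frac_less2)
  ultimately show False by simp
 qed
 then show "TR j T = LT i j 1 T \<union> LT i j (-1) T" unfolding LT_def by (auto simp: not_less_iff_gr_or_eq)
 show "LT i j 1 T \<inter> LT i j (-1) T = {}" unfolding LT_def by auto
qed

lemma tree_no_nest: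
 assumes T: "T \<in> QQ" and i: "i \<in> three" and j: "j \<in> three" and ij: "i \<noteq> j" and Q: "Q \<in> TR j T" and Q': "Q' \<in> TR j T"
 shows "\<not> setw Q i \<subset> setw Q' i"
proof
 assume s: "setw Q i \<subset> setw Q' i"
 have Qf: "Q \<in> QQ" "Q \<noteq> T" "tile_le (comp Q j) (comp T j)" and Qf': "Q' \<in> QQ" "Q' \<noteq> T" "tile_le (comp Q' j) (comp T j)"
  using Q Q' by (simp_all add: TR_def)
 note c = iv_psubset_ctr[OF lwp[OF Qf(1) i] s]
 have "1000000000 * lenw Q i < lenw Q' i" by (rule sparse_len[OF Qf(1) Qf'(1) i c(2)])
 moreover have "\<bar>ctrw Q i - ctrw T i\<bar> <= 5000000 * (lenw Q i - lenw T i)"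
  by (rule tree_facts(3)[OF Qf(1) T Qf(2) j Qf(3) i])
 moreover have "3 / 2 * (lenw Q' i - lenw T i) < \<bar>ctrw Q' i - ctrw T i\<bar>"
  by (rule tree_facts(4)[OF Qf'(1) T Qf'(2) j Qf'(3) i ij])
 moreover have "lenw T i <= lenw Q i"
  using tree_facts(2)[OF Qf(1) T Qf(2) j Qf(3)] lI[OF Qf(1)] lI[OF T] unfolding lwe[OF Qf(1) i] lwe[OF T i]
  by (simp add: frac_le)
 moreover have "0 < lenw T i" using lwp[OF T i] .
 moreover have "\<bar>ctrw Q' i - ctrw T i\<bar> <= \<bar>ctrw Q' i - ctrw Q i\<bar> + \<bar>ctrw Q i - ctrw T i\<bar>" by simp
 ultimately show False using c(1) by argo
qed

lemma family_tree:
 assumes T: "T \<in> QQ" and i: "i \<in> three" and j: "j \<in> three" and ij: "i \<noteq> j" and D: "D \<subseteq> TR j T"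
 shows "family i D (\<lambda>_. T)"
 unfolding family_def
proof (intro conjI ballI impI)
 have DQ: "D \<subseteq> QQ" using D by (auto simp: TR_def)
 show "finite D" using DQ fin finite_subset by blast
 show "\<exists>\<sigma>\<in>shifts. \<forall>Q\<in>D. in_D \<sigma> (tw Q i)" using shift_ex[OF i] DQ by blast
 show "inj_on (\<lambda>Q. comp Q i) D" using comp_inj[OF _ _ i] DQ unfolding inj_on_def by blast
 show "in_D 0 (tI T)" using dy[OF T] .
 fix Q assume Q: "Q \<in> D"
 show "in_D 0 (tI Q)" "lenI Q * lenw Q i = 1" using dy lw i Q DQ by blast+
 have Qf: "Q \<in> QQ" "Q \<noteq> T" "tile_le (comp Q j) (comp T j)" using Q D by (auto simp: TR_def)
 show "setI Q \<subseteq> setI T" using tree_facts(1)[OF Qf(1) T Qf(2) j Qf(3)] by blast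
 fix Q' assume Q': "Q' \<in> D"
 show "setI Q' \<inter> setI T = {}" if "setw Q i \<subset> setw Q' i"
  using tree_no_nest[OF T i j ij, of Q Q'] Q Q' D that by blast
 show "Q = Q'" if "T = T \<and> tI Q = tI Q'"
 proof -
  have Qf': "Q' \<in> QQ" "Q' \<noteq> T" "tile_le (comp Q' j) (comp T j)" using Q' D by (auto simp: TR_def)
  have "tw Q i = tw Q' i" using that by (intro tree_same_scale[OF Qf(1) Qf'(1) T Qf(2) Qf'(2) j Qf(3) Qf'(3) _ i]) simp
  then show ?thesis using that by (intro comp_inj[OF Qf(1) Qf'(1) i]) (simp add: comp_def)
 qed
qed

lemma dil3_nested:
 assumes "Q' \<in> QQ" "T \<in> QQ" "i \<in> three" "setI Q' \<subset> setI T"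
  "\<bar>ctrw Q' i - ctrw T i\<bar> <= 3 / 2 * (lenw Q' i - lenw T i)"
 shows "Q' \<in> AllT T"
proof -
 have "ivl_set (dil 3 (tw T i)) \<subseteq> ivl_set (dil 3 (tw Q' i))"
  using iv_subset_ctr[of "dil 3 (tw T i)" "dil 3 (tw Q' i)"] lwp[OF assms(2,3)] assms(5) by (simp add: algebra_simps)
 then have "tile_le (comp Q' i) (comp T i)" using assms(4) by (simp add: tile_le_def comp_def)
 then show ?thesis using assms by (auto simp: AllT_def)
qed

text \<open>If a small frequency interval of a selected half-tree sits inside a large one of another, the top of
 the first tree lies on the far side of the top of the second, hence was selected earlier.\<close>

lemma side_order:
 assumes T: "T \<in> QQ" "T' \<in> QQ" and i: "i \<in> three" and j: "j \<in> three" "j' \<in> three" "i \<noteq> j" "i \<noteq> j'"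
  and s: "s = 1 \<or> s = (-1::real)"
  and Q: "Q \<in> LT i j s T" "Q' \<in> LT i j' s T'" and ss: "setw Q i \<subset> setw Q' i"
 shows "s * ctrw T' i < s * ctrw T i" "setI Q' \<inter> setI T \<noteq> {} ==> Q' \<in> AllT T"
proof -
 have Qf: "Q \<in> QQ" "Q \<noteq> T" "tile_le (comp Q j) (comp T j)" and Qf': "Q' \<in> QQ" "Q' \<noteq> T'" "tile_le (comp Q' j') (comp T' j')"
  and sd: "0 < s * (ctrw Q' i - ctrw T' i)"
  using Q by (simp_all add: LT_def TR_def)
 note c = iv_psubset_ctr(1)[OF lwp[OF Qf(1) i] ss] and lt = iv_psubset_ctr(2)[OF lwp[OF Qf(1) i] ss]
 have big: "1000000000 * lenw Q i < lenw Q' i" by (rule sparse_len[OF Qf(1) Qf'(1) i lt])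
 have a: "\<bar>ctrw Q i - ctrw T i\<bar> <= 5000000 * (lenw Q i - lenw T i)"
  by (rule tree_facts(3)[OF Qf(1) T(1) Qf(2) j(1) Qf(3) i])
 have b: "3 / 2 * (lenw Q' i - lenw T' i) < \<bar>ctrw Q' i - ctrw T' i\<bar>"
  by (rule tree_facts(4)[OF Qf'(1) T(2) Qf'(2) j(2) Qf'(3) i j(4)])
 have lt': "1000000000 * lenw T' i < lenw Q' i"
  using tree_facts(2)[OF Qf'(1) T(2) Qf'(2) j(2) Qf'(3)] lI[OF Qf'(1)] lI[OF T(2)] unfolding lwe[OF Qf'(1) i] lwe[OF T(2) i]
  by (simp add: field_simps)
 have ltT: "1000000000 * lenw T i < lenw Q i"
  using tree_facts(2)[OF Qf(1) T(1) Qf(2) j(1) Qf(3)] lI[OF Qf(1)] lI[OF T(1)] unfolding lwe[OF Qf(1) i] lwe[OF T(1) i]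
  by (simp add: field_simps)
 have p: "0 < lenw T i" "0 < lenw T' i" using lwp i T by blast+
 have near: "\<bar>ctrw Q' i - ctrw T i\<bar> <= 3/5 * lenw Q' i"
 proof -
  have "\<bar>ctrw Q' i - ctrw T i\<bar> <= \<bar>ctrw Q' i - ctrw Q i\<bar> + \<bar>ctrw Q i - ctrw T i\<bar>" by simp
  then show ?thesis using c a big p ltT by argo
 qed
 show "s * ctrw T' i < s * ctrw T i"
 proof (cases "s = 1")
  case True
  then have "0 < ctrw Q' i - ctrw T' i" using sd by simp
  then have "ctrw T' i < ctrw T i" using near b lt' p big by argo
  then show ?thesis using True by simp
 next
  case False
  then have s1: "s = -1" using s by simp
  then have "0 < ctrw T' i - ctrw Q' i" using sd by simp
  then have "ctrw T i < ctrw T' i" using near b lt' p big by argo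
  then show ?thesis using s1 by simp
 qed
 assume "setI Q' \<inter> setI T \<noteq> {}"
 moreover have len: "lenI Q' < lenI Q"
  using lt lI[OF Qf(1)] lI[OF Qf'(1)] unfolding lwe[OF Qf(1) i] lwe[OF Qf'(1) i] by (simp add: field_simps)
 moreover have lenT: "lenI Q < lenI T" using tree_facts(2)[OF Qf(1) T(1) Qf(2) j(1) Qf(3)] lI[OF Qf(1)] by linarith
 ultimately have "setI Q' \<subseteq> setI T"
  using grid_nest[OF zero_shift dy[OF Qf'(1)] dy[OF T(1)]] by simp
 moreover have "setI Q' \<noteq> setI T" using len lenT ivl_eq_iv[OF lI[OF Qf'(1)] lI[OF T(1)]] by auto
 ultimately have "setI Q' \<subset> setI T" by blast
 then show "Q' \<in> AllT T"
  using near p big ltT by (intro dil3_nested[OF Qf'(1) T(1) i]) argo+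
qed

end

definition greedy_ok :: "('a set => 'a => bool) => ('a => real) => ('a => 'a set) => 'a set => 'a set => ('a => 'a set) => 'a set => bool" where
 "greedy_ok viol key rm C \<T> cur R \<longleftrightarrow> \<T> \<subseteq> C \<and> R \<subseteq> C \<and> C \<subseteq> R \<union> (\<Union>T\<in>\<T>. rm T) \<and> (\<forall>T\<in>R. \<not> viol R T) \<and>
   (\<forall>T\<in>\<T>. T \<in> cur T \<and> cur T \<subseteq> C \<and> viol (cur T) T) \<and>
   (\<forall>T\<in>\<T>. \<forall>T'\<in>\<T>. T \<noteq> T' \<longrightarrow> (cur T' \<inter> rm T = {} \<or> cur T \<inter> rm T' = {}) \<and> (key T' < key T \<longrightarrow> cur T' \<inter> rm T = {}))"

lemma greedy_okD:
 assumes "greedy_ok viol key rm C \<T> cur R"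
 shows "\<T> \<subseteq> C" "R \<subseteq> C" "C \<subseteq> R \<union> (\<Union>T\<in>\<T>. rm T)" "T \<in> R ==> \<not> viol R T"
  "T \<in> \<T> ==> T \<in> cur T" "T \<in> \<T> ==> cur T \<subseteq> C" "T \<in> \<T> ==> viol (cur T) T"
  "T \<in> \<T> ==> T' \<in> \<T> ==> T \<noteq> T' ==> cur T' \<inter> rm T = {} \<or> cur T \<inter> rm T' = {}"
  "T \<in> \<T> ==> T' \<in> \<T> ==> key T' < key T ==> cur T' \<inter> rm T = {}"
proof -
 note a = assms[unfolded greedy_ok_def]
 show "\<T> \<subseteq> C" "R \<subseteq> C" "C \<subseteq> R \<union> (\<Union>T\<in>\<T>. rm T)" "T \<in> R ==> \<not> viol R T" using a by simp_all
 show "T \<in> cur T" "cur T \<subseteq> C" "viol (cur T) T" if "T \<in> \<T>" using a that by simp_all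
 show "cur T' \<inter> rm T = {} \<or> cur T \<inter> rm T' = {}" if "T \<in> \<T>" "T' \<in> \<T>" "T \<noteq> T'" using a that by simp
 show "cur T' \<inter> rm T = {}" if "T \<in> \<T>" "T' \<in> \<T>" "key T' < key T"
 proof -
  have "T \<noteq> T'" using that(3) by blast
  then show ?thesis using a that by simp
 qed
qed

lemma greedy:
 fixes viol :: "'a set => 'a => bool" and key :: "'a => real" and rm :: "'a => 'a set"
 assumes "finite C" and mono: "\<And>A A' T. A \<subseteq> A' ==> A' \<subseteq> C ==> viol A T ==> viol A' T" and self: "\<And>T. T \<in> C ==> T \<in> rm T"
 shows "\<exists>\<T> cur R. greedy_ok viol key rm C \<T> cur R"
 using assms
proof (induction "card C" arbitrary: C rule: less_induct)
 case less
 show ?case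
 proof (cases "\<exists>T\<in>C. viol C T")
  case False
  then have "greedy_ok viol key rm C {} (\<lambda>_. {}) C" unfolding greedy_ok_def by blast
  then show ?thesis by blast
 next
  case True
  define V where "V = {T\<in>C. viol C T}"
  have V: "finite V" "V \<noteq> {}" using less.prems(1) True by (auto simp: V_def)
  have "Max (key ` V) \<in> key ` V" using V by (intro Max_in) simp_all
  then obtain T where T: "T \<in> V" "key T = Max (key ` V)" by auto
  have Tmax: "key T' <= key T" if "T' \<in> V" for T' using T(2) V(1) that by (simp add: Max_ge)
  have TC: "T \<in> C" "viol C T" using T(1) by (simp_all add: V_def)
  have Tr: "T \<in> rm T" by (rule less.prems(3)[OF TC(1)])
  define C' where "C' = C - rm T"
  have C'C: "C' \<subseteq> C" by (auto simp: C'_def)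
  have 1: "card C' < card C" using less.prems(1) TC Tr unfolding C'_def by (intro psubset_card_mono) blast+
  have 2: "finite C'" using less.prems(1) C'C by (rule finite_subset[rotated])
  have 3: "\<And>A A' T. A \<subseteq> A' ==> A' \<subseteq> C' ==> viol A T ==> viol A' T" using less.prems(2) C'C by blast
  have 4: "\<And>T. T \<in> C' ==> T \<in> rm T" using less.prems(3) C'C by blast
  have "\<exists>\<T> cur R. greedy_ok viol key rm C' \<T> cur R"
  proof (rule less.hyps[OF 1 2])
   show "viol A' T" if h: "A \<subseteq> A'" "A' \<subseteq> C'" "viol A T" for A A' T using 3 h by blast
   show "T \<in> rm T" if h: "T \<in> C'" for T using 4 h by blast
  qed
  then obtain \<T> cur R where G: "greedy_ok viol key rm C' \<T> cur R" by blast
  note IH = greedy_okD[OF G]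
  have nT: "T \<notin> \<T>" using IH(1) Tr by (auto simp: C'_def)
  define cur' where "cur' = cur(T := C)"
  have c1: "cur' T = C" by (simp add: cur'_def)
  have c2: "cur' S = cur S" if "S \<in> \<T>" for S using that nT by (auto simp: cur'_def)
  have dis: "cur' S \<inter> rm T = {}" if "S \<in> \<T>" for S using c2[OF that] IH(6)[OF that] by (auto simp: C'_def)
  have keyS: "\<not> key T < key S" if "S \<in> \<T>" for S
  proof -
   have "viol C S" using less.prems(2)[of "cur S" C S] IH(6,7)[OF that] C'C by blast
   moreover have "S \<in> C" using IH(1) that C'C by blast
   ultimately show ?thesis using Tmax[of S] by (simp add: V_def not_less)
  qed
  have "greedy_ok viol key rm C (insert T \<T>) cur' R"
   unfolding greedy_ok_def
  proof (intro conjI)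
   show "insert T \<T> \<subseteq> C" "R \<subseteq> C" using IH(1,2) TC C'C by blast+
   show "C \<subseteq> R \<union> (\<Union>T\<in>insert T \<T>. rm T)" using IH(3) unfolding C'_def by blast
   show "\<forall>T\<in>R. \<not> viol R T" using IH(4) by blast
   show "\<forall>S\<in>insert T \<T>. S \<in> cur' S \<and> cur' S \<subseteq> C \<and> viol (cur' S) S"
   proof
    fix S assume "S \<in> insert T \<T>"
    then consider "S = T" | "S \<in> \<T>" by blast
    then show "S \<in> cur' S \<and> cur' S \<subseteq> C \<and> viol (cur' S) S"
    proof cases
     case 1 then show ?thesis using c1 TC by simp
    next
     case 2 then show ?thesis using c2 IH(5-7) C'C by (metis order_trans)
    qed
   qed
   show "\<forall>S\<in>insert T \<T>. \<forall>S'\<in>insert T \<T>. S \<noteq> S' \<longrightarrow> (cur' S' \<inter> rm S = {} \<or> cur' S \<inter> rm S' = {}) \<and> (key S' < key S \<longrightarrow> cur' S' \<inter> rm S = {})"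
   proof (intro ballI impI)
    fix S S' assume S: "S \<in> insert T \<T>" "S' \<in> insert T \<T>" "S \<noteq> S'"
    consider "S = T" "S' \<in> \<T>" | "S' = T" "S \<in> \<T>" | "S \<in> \<T>" "S' \<in> \<T>" using S by blast
    then show "(cur' S' \<inter> rm S = {} \<or> cur' S \<inter> rm S' = {}) \<and> (key S' < key S \<longrightarrow> cur' S' \<inter> rm S = {})"
    proof cases
     case 1 then show ?thesis using dis[of S'] by simp
    next
     case 2 then show ?thesis using dis[of S] keyS[of S] by simp
    next
     case 3 then show ?thesis using IH(8)[OF 3 S(3)] IH(9)[OF 3] c2 by simp
    qed
   qed
  qed
  then show ?thesis by blast
 qed
qed

subsection \<open>Sizes and the selection of trees\<close>

context rank1_coll
begin

definition S1 :: "(tritile => real) => real => tritile set => bool" where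
 "S1 a A C \<longleftrightarrow> (\<forall>Q\<in>C. (a Q)\<^sup>2 <= A\<^sup>2 * lenI Q)"

definition S2 :: "nat => real => (tritile => real) => real => tritile set => bool" where
 "S2 i s a A C \<longleftrightarrow> (\<forall>T\<in>C. \<forall>j\<in>three - {i}. (\<Sum>Q\<in>C \<inter> LT i j s T. (a Q)\<^sup>2) <= A\<^sup>2 * lenI T)"

definition size_le :: "nat => (tritile => real) => real => tritile set => bool" where
 "size_le i a A C \<longleftrightarrow> S1 a A C \<and> S2 i 1 a A C \<and> S2 i (-1) a A C"

text \<open>The energy estimates carry an error of half of \<open>(5/4 A)\<^sup>2\<close> times the total length of the tops; the ratio
 5/4 of consecutive size levels is small enough for it to be absorbed (\<open>25/32 < 1\<close>).\<close>

definition EN :: "nat => (tritile => real) => real => tritile set => bool" where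
 "EN i a E C \<longleftrightarrow> (\<forall>D \<tau> A. family i D \<tau> \<and> D \<subseteq> C \<and> \<tau> ` D \<subseteq> C \<and> 0 < A \<and> (\<forall>Q\<in>D. (a Q)\<^sup>2 <= (5/4 * A)\<^sup>2 * lenI Q) \<and>
   A\<^sup>2 * (\<Sum>T\<in>\<tau> ` D. lenI T) <= (\<Sum>Q\<in>D. (a Q)\<^sup>2) \<longrightarrow> A\<^sup>2 * (\<Sum>T\<in>\<tau> ` D. lenI T) <= E)"

lemma S1_sub: "S1 a A C ==> C' \<subseteq> C ==> S1 a A C'" unfolding S1_def by blast

lemma S2_sub: "S2 i s a A C ==> C' \<subseteq> C ==> finite C ==> S2 i s a A C'"
 unfolding S2_def
proof (intro ballI)
 fix T j assume a: "\<forall>T\<in>C. \<forall>j\<in>three - {i}. (\<Sum>Q\<in>C \<inter> LT i j s T. (a Q)\<^sup>2) <= A\<^sup>2 * lenI T" "C' \<subseteq> C" "finite C" "T \<in> C'" "j \<in> three - {i}"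
 have "(\<Sum>Q\<in>C' \<inter> LT i j s T. (a Q)\<^sup>2) <= (\<Sum>Q\<in>C \<inter> LT i j s T. (a Q)\<^sup>2)"
  using a(2,3) by (intro sum_mono2) auto
 also have "... <= A\<^sup>2 * lenI T" using a by blast
 finally show "(\<Sum>Q\<in>C' \<inter> LT i j s T. (a Q)\<^sup>2) <= A\<^sup>2 * lenI T" .
qed

lemma AllT_self: "T \<in> QQ ==> T \<in> AllT T"
 by (auto simp: AllT_def three_def tile_le_def)

lemma LT_All: "j \<in> three ==> LT i j s T \<subseteq> AllT T"
 by (auto simp: LT_def TR_def AllT_def)

lemma select1:
 assumes C: "C \<subseteq> QQ" and i: "i \<in> three" and A: "0 < A" and s1: "S1 a (5/4 * A) C" and E: "EN i a E C"
 shows "\<exists>\<T> R. \<T> \<subseteq> C \<and> R \<subseteq> C \<and> C \<subseteq> R \<union> (\<Union>T\<in>\<T>. AllT T) \<and> S1 a A R \<and> A\<^sup>2 * (\<Sum>T\<in>\<T>. lenI T) <= E"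
proof -
 define viol where "viol (D::tritile set) T \<longleftrightarrow> A\<^sup>2 * lenI T < (a T)\<^sup>2" for D T
 have finC: "finite C" using C fin finite_subset by blast
 have "\<exists>\<T> cur R. greedy_ok viol (\<lambda>T. lenI T) AllT C \<T> cur R"
 proof (rule greedy[OF finC])
  show "viol D' T" if h: "D \<subseteq> D'" "D' \<subseteq> C" "viol D T" for D D' T using h(3) by (simp add: viol_def)
  show "T \<in> AllT T" if h: "T \<in> C" for T using AllT_self C h by blast
 qed
 then obtain \<T> cur R where G: "greedy_ok viol (\<lambda>T. lenI T) AllT C \<T> cur R" by blast
 note g = greedy_okD[OF G]
 have TQ: "T \<in> QQ" if "T \<in> \<T>" for T using that g(1) C by blast
 have fam: "family i \<T> (\<lambda>T. T)"
  unfolding family_def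
 proof (intro conjI ballI impI)
  show "finite \<T>" using g(1) finC finite_subset by blast
  show "\<exists>\<sigma>\<in>shifts. \<forall>Q\<in>\<T>. in_D \<sigma> (tw Q i)" using shift_ex[OF i] TQ by blast
  show "inj_on (\<lambda>Q. comp Q i) \<T>" using comp_inj[OF _ _ i] TQ unfolding inj_on_def by blast
  fix Q assume Q: "Q \<in> \<T>"
  show "in_D 0 (tI Q)" "lenI Q * lenw Q i = 1" using dy lw i TQ[OF Q] by blast+
  show "in_D 0 (tI Q)" by fact
  show "setI Q \<subseteq> setI Q" by simp
  fix Q' assume Q': "Q' \<in> \<T>"
  show "Q = Q'" if "Q = Q' \<and> tI Q = tI Q'" using that by blast
  show "setI Q' \<inter> setI Q = {}" if ss: "setw Q i \<subset> setw Q' i"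
  proof (rule ccontr)
   assume ne: "setI Q' \<inter> setI Q \<noteq> {}"
   note c = iv_psubset_ctr(1)[OF lwp[OF TQ[OF Q] i] ss] and lt = iv_psubset_ctr(2)[OF lwp[OF TQ[OF Q] i] ss]
   have len: "lenI Q' < lenI Q"
    using lt lI[OF TQ[OF Q]] lI[OF TQ[OF Q']] unfolding lwe[OF TQ[OF Q] i] lwe[OF TQ[OF Q'] i] by (simp add: field_simps)
   have "setI Q' \<subseteq> setI Q"
    using grid_nest[OF zero_shift dy[OF TQ[OF Q']] dy[OF TQ[OF Q]]] ne len by simp
   moreover have "setI Q' \<noteq> setI Q" using len ivl_eq_iv[OF lI[OF TQ[OF Q']] lI[OF TQ[OF Q]]] by auto
   ultimately have "setI Q' \<subset> setI Q" by blast
   then have "Q' \<in> AllT Q" using c lt by (intro dil3_nested[OF TQ[OF Q'] TQ[OF Q] i]) argo+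
   then show False using g(9)[OF Q Q'] g(5)[OF Q'] len by blast
  qed
 qed
 have gt: "A\<^sup>2 * lenI T <= (a T)\<^sup>2" if "T \<in> \<T>" for T using g(7)[OF that] by (simp add: viol_def less_imp_le)
 have "A\<^sup>2 * (\<Sum>T\<in>(\<lambda>T. T) ` \<T>. lenI T) <= E"
 proof -
  have "A\<^sup>2 * (\<Sum>T\<in>(\<lambda>T. T) ` \<T>. lenI T) <= (\<Sum>Q\<in>\<T>. (a Q)\<^sup>2)"
   unfolding image_ident sum_distrib_left using gt by (rule sum_mono)
  moreover have "\<forall>Q\<in>\<T>. (a Q)\<^sup>2 <= (5/4 * A)\<^sup>2 * lenI Q" using s1 g(1) unfolding S1_def by blast
  moreover have "(\<lambda>T. T) ` \<T> \<subseteq> C" using g(1) by simp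
  ultimately show ?thesis using E fam g(1) A unfolding EN_def by blast
 qed
 moreover have "S1 a A R" unfolding S1_def using g(4) by (auto simp: viol_def not_less)
 ultimately show ?thesis using g(1-3) by (intro exI[of _ \<T>] exI[of _ R]) simp
qed

end

context rank1_coll
begin

lemma select2:
 assumes C: "C \<subseteq> QQ" and i: "i \<in> three" and A: "0 < A" and s1: "S1 a (5/4 * A) C" and E: "EN i a E C"
  and s: "s = 1 \<or> s = (-1::real)"
 shows "\<exists>\<T> R. \<T> \<subseteq> C \<and> R \<subseteq> C \<and> C \<subseteq> R \<union> (\<Union>T\<in>\<T>. AllT T) \<and> S2 i s a A R \<and> A\<^sup>2 * (\<Sum>T\<in>\<T>. lenI T) <= E"
proof -
 define viol where "viol D T \<longleftrightarrow> (\<exists>j\<in>three - {i}. A\<^sup>2 * lenI T < (\<Sum>Q\<in>D \<inter> LT i j s T. (a Q)\<^sup>2))" for D T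
 have finC: "finite C" using C fin finite_subset by blast
 have "\<exists>\<T> cur R. greedy_ok viol (\<lambda>T. s * ctrw T i) AllT C \<T> cur R"
 proof (rule greedy[OF finC])
  show "viol D' T" if h: "D \<subseteq> D'" "D' \<subseteq> C" "viol D T" for D D' T
  proof -
   obtain j where j: "j \<in> three - {i}" "A\<^sup>2 * lenI T < (\<Sum>Q\<in>D \<inter> LT i j s T. (a Q)\<^sup>2)"
    using h(3) unfolding viol_def by blast
   have "finite D'" using h(2) finC finite_subset by blast
   then have "(\<Sum>Q\<in>D \<inter> LT i j s T. (a Q)\<^sup>2) <= (\<Sum>Q\<in>D' \<inter> LT i j s T. (a Q)\<^sup>2)"
    using h(1) by (intro sum_mono2) (blast, blast, simp)
   then have "A\<^sup>2 * lenI T < (\<Sum>Q\<in>D' \<inter> LT i j s T. (a Q)\<^sup>2)" using j(2) by linarith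
   then show ?thesis unfolding viol_def using j(1) by blast
  qed
  show "T \<in> AllT T" if h: "T \<in> C" for T using AllT_self C h by blast
 qed
 then obtain \<T> cur R where G: "greedy_ok viol (\<lambda>T. s * ctrw T i) AllT C \<T> cur R" by blast
 note g = greedy_okD[OF G]
 have TQ: "T \<in> QQ" if "T \<in> \<T>" for T using that g(1) C by blast
 have "\<exists>j. T \<in> \<T> \<longrightarrow> j \<in> three - {i} \<and> A\<^sup>2 * lenI T < (\<Sum>Q\<in>cur T \<inter> LT i j s T. (a Q)\<^sup>2)" for T
  using g(7)[of T] unfolding viol_def by blast
 then obtain jj where jj: "\<And>T. T \<in> \<T> ==> jj T \<in> three - {i}" "\<And>T. T \<in> \<T> ==> A\<^sup>2 * lenI T < (\<Sum>Q\<in>cur T \<inter> LT i (jj T) s T. (a Q)\<^sup>2)"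
  by metis
 define DT where "DT T = cur T \<inter> LT i (jj T) s T" for T
 define D where "D = (\<Union>T\<in>\<T>. DT T)"
 have jT: "jj T \<in> three" "i \<noteq> jj T" if "T \<in> \<T>" for T using jj(1)[OF that] by blast+
 have DTC: "DT T \<subseteq> C" if "T \<in> \<T>" for T using g(6)[OF that] unfolding DT_def by blast
 have DTA: "DT T \<subseteq> AllT T" if "T \<in> \<T>" for T using LT_All[OF jT(1)[OF that], of i s] unfolding DT_def by blast
 have dis: "T = T'" if "T \<in> \<T>" "T' \<in> \<T>" "Q \<in> DT T" "Q \<in> DT T'" for T T' Q
 proof (rule ccontr)
  assume "T \<noteq> T'"
  then have "cur T' \<inter> AllT T = {} \<or> cur T \<inter> AllT T' = {}" using g(8)[OF that(1,2)] by blast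
  then show False using that DTA[OF that(1)] DTA[OF that(2)] unfolding DT_def by blast
 qed
 define \<tau> where "\<tau> Q = (THE T. T \<in> \<T> \<and> Q \<in> DT T)" for Q
 have \<tau>: "\<tau> Q = T" if "T \<in> \<T>" "Q \<in> DT T" for Q T
  unfolding \<tau>_def using that dis[OF that(1)] by (intro the_equality conjI) (simp_all, blast)
 have Df: "\<tau> Q \<in> \<T> \<and> Q \<in> DT (\<tau> Q)" if h: "Q \<in> D" for Q
 proof -
  obtain T where "T \<in> \<T>" "Q \<in> DT T" using h unfolding D_def by (rule UN_E)
  then show ?thesis using \<tau>[of T Q] by simp
 qed
 have DQ: "Q \<in> QQ" if "Q \<in> D" for Q using subsetD[OF DTC] Df[OF that] C by blast
 have DL: "Q \<in> LT i (jj (\<tau> Q)) s (\<tau> Q)" if "Q \<in> D" for Q using Df[OF that] by (simp add: DT_def)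
 have DTR: "Q \<in> TR (jj (\<tau> Q)) (\<tau> Q)" if "Q \<in> D" for Q using subsetD[OF LT_sub DL[OF that]] .
 have fam: "family i D \<tau>"
  unfolding family_def
 proof (intro conjI ballI impI)
  have DQ': "D \<subseteq> QQ" using DQ by (rule subsetI)
  show "finite D" using fin DQ' by (rule finite_subset[rotated])
  show "\<exists>\<sigma>\<in>shifts. \<forall>Q\<in>D. in_D \<sigma> (tw Q i)" using shift_ex[OF i] DQ' by blast
  show "inj_on (\<lambda>Q. comp Q i) D" using comp_inj[OF DQ DQ i] by (rule inj_onI)
  fix Q assume Q: "Q \<in> D"
  have T: "\<tau> Q \<in> \<T>" "\<tau> Q \<in> QQ" using Df[OF Q] TQ by blast+
  have Qf: "Q \<noteq> \<tau> Q" "tile_le (comp Q (jj (\<tau> Q))) (comp (\<tau> Q) (jj (\<tau> Q)))" using DTR[OF Q] by (simp_all add: TR_def)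
  show "in_D 0 (tI Q)" "lenI Q * lenw Q i = 1" "in_D 0 (tI (\<tau> Q))" using dy lw i DQ[OF Q] T by blast+
  show "setI Q \<subseteq> setI (\<tau> Q)" using tree_facts(1)[OF DQ[OF Q] T(2) Qf(1) jT(1)[OF T(1)] Qf(2)] by blast
  fix Q' assume Q': "Q' \<in> D"
  have T': "\<tau> Q' \<in> \<T>" "\<tau> Q' \<in> QQ" using Df[OF Q'] TQ by blast+
  show "setI Q' \<inter> setI (\<tau> Q) = {}" if ss: "setw Q i \<subset> setw Q' i"
  proof (rule ccontr)
   assume ne: "setI Q' \<inter> setI (\<tau> Q) \<noteq> {}"
   note so = side_order[OF T(2) T'(2) i jT(1)[OF T(1)] jT(1)[OF T'(1)] jT(2)[OF T(1)] jT(2)[OF T'(1)] s DL[OF Q] DL[OF Q'] ss]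
   have "cur (\<tau> Q') \<inter> AllT (\<tau> Q) = {}" by (rule g(9)[OF T(1) T'(1) so(1)])
   then show False using so(2)[OF ne] Df[OF Q'] unfolding DT_def by blast
  qed
  show "Q = Q'" if e: "\<tau> Q = \<tau> Q' \<and> tI Q = tI Q'"
  proof -
   have Qf': "Q' \<noteq> \<tau> Q" "tile_le (comp Q' (jj (\<tau> Q))) (comp (\<tau> Q) (jj (\<tau> Q)))" using DTR[OF Q'] e by (simp_all add: TR_def)
   have "tw Q i = tw Q' i" using e by (intro tree_same_scale[OF DQ[OF Q] DQ[OF Q'] T(2) Qf(1) Qf'(1) jT(1)[OF T(1)] Qf(2) Qf'(2) _ i]) simp
   then show ?thesis using e by (intro comp_inj[OF DQ[OF Q] DQ[OF Q'] i]) (simp add: comp_def)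
  qed
 qed
 have gt: "A\<^sup>2 * lenI T <= (\<Sum>Q\<in>DT T. (a Q)\<^sup>2)" if "T \<in> \<T>" for T using jj(2)[OF that] by (simp add: DT_def)
 have ne: "DT T \<noteq> {}" if "T \<in> \<T>" for T
 proof
  assume "DT T = {}"
  then have "A\<^sup>2 * lenI T < 0" using jj(2)[OF that] by (simp add: DT_def)
  then show False using lI[OF TQ[OF that]] by (simp add: mult_less_0_iff)
 qed
 have img: "\<tau> ` D = \<T>"
 proof
  show "\<tau> ` D \<subseteq> \<T>" using Df by blast
  show "\<T> \<subseteq> \<tau> ` D"
  proof
   fix T assume T: "T \<in> \<T>"
   then obtain Q where "Q \<in> DT T" using ne by blast
   then have "\<tau> Q = T" "Q \<in> D" using \<tau>[OF T] T unfolding D_def by blast+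
   then show "T \<in> \<tau> ` D" by blast
  qed
 qed
 have finT: "finite \<T>" using g(1) finC finite_subset by blast
 have sumD: "(\<Sum>Q\<in>D. (a Q)\<^sup>2) = (\<Sum>T\<in>\<T>. \<Sum>Q\<in>DT T. (a Q)\<^sup>2)"
  unfolding D_def
 proof (rule sum.UNION_disjoint[OF finT])
  show "\<forall>T\<in>\<T>. finite (DT T)" using DTC finC finite_subset by blast
  show "\<forall>T\<in>\<T>. \<forall>T'\<in>\<T>. T \<noteq> T' \<longrightarrow> DT T \<inter> DT T' = {}" using dis by blast
 qed
 have "A\<^sup>2 * (\<Sum>T\<in>\<T>. lenI T) <= E"
 proof -
  have "A\<^sup>2 * (\<Sum>T\<in>\<T>. lenI T) <= (\<Sum>Q\<in>D. (a Q)\<^sup>2)"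
   unfolding sumD sum_distrib_left using gt by (rule sum_mono)
  moreover have "D \<subseteq> C" using DTC unfolding D_def by blast
  moreover from this have "\<forall>Q\<in>D. (a Q)\<^sup>2 <= (5/4 * A)\<^sup>2 * lenI Q" using s1 unfolding S1_def by blast
  ultimately show ?thesis using E fam g(1) A img unfolding EN_def by metis
 qed
 moreover have "S2 i s a A R" unfolding S2_def
 proof (intro ballI)
  fix T j assume "T \<in> R" "j \<in> three - {i}"
  then show "(\<Sum>Q\<in>R \<inter> LT i j s T. (a Q)\<^sup>2) <= A\<^sup>2 * lenI T" using g(4)[of T] unfolding viol_def by (meson not_less)
 qed
 ultimately show ?thesis using g(1-3) by (intro exI[of _ \<T>] exI[of _ R]) simp
qed

lemma EN_sub: "EN i a E C ==> C' \<subseteq> C ==> EN i a E C'"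
 unfolding EN_def by (meson order_trans)

lemma sum_tops_Un:
 assumes "finite \<T>" "finite \<T>'" "\<T> \<subseteq> QQ" "\<T>' \<subseteq> QQ"
 shows "(\<Sum>T\<in>\<T> \<union> \<T>'. lenI T) <= (\<Sum>T\<in>\<T>. lenI T) + (\<Sum>T\<in>\<T>'. lenI T)"
proof -
 have "0 <= (\<Sum>T\<in>\<T> \<inter> \<T>'. lenI T)"
 proof (rule sum_nonneg)
  fix T assume "T \<in> \<T> \<inter> \<T>'"
  then show "0 <= lenI T" using lI[of T] assms(3) by auto
 qed
 then show ?thesis using sum.union_inter[OF assms(1,2), of "\<lambda>T. lenI T"] by simp
qed

lemma select:
 assumes C: "C \<subseteq> QQ" and i: "i \<in> three" and A: "0 < A" and s1: "S1 a (5/4 * A) C" and E: "EN i a E C"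
 shows "\<exists>\<T> R. \<T> \<subseteq> C \<and> R \<subseteq> C \<and> C \<subseteq> R \<union> (\<Union>T\<in>\<T>. AllT T) \<and> size_le i a A R \<and> A\<^sup>2 * (\<Sum>T\<in>\<T>. lenI T) <= 3 * E"
proof -
 have finC: "finite C" using C fin finite_subset by blast
 obtain T1 R1 where 1: "T1 \<subseteq> C" "R1 \<subseteq> C" "C \<subseteq> R1 \<union> (\<Union>T\<in>T1. AllT T)" "S1 a A R1" "A\<^sup>2 * (\<Sum>T\<in>T1. lenI T) <= E"
  using select1[OF C i A s1 E] by blast
 obtain T2 R2 where 2: "T2 \<subseteq> R1" "R2 \<subseteq> R1" "R1 \<subseteq> R2 \<union> (\<Union>T\<in>T2. AllT T)" "S2 i 1 a A R2" "A\<^sup>2 * (\<Sum>T\<in>T2. lenI T) <= E"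
  using select2[OF subset_trans[OF 1(2) C] i A S1_sub[OF s1 1(2)] EN_sub[OF E 1(2)], of 1] by blast
 have R2C: "R2 \<subseteq> C" using 1 2 by blast
 obtain T3 R3 where 3: "T3 \<subseteq> R2" "R3 \<subseteq> R2" "R2 \<subseteq> R3 \<union> (\<Union>T\<in>T3. AllT T)" "S2 i (-1) a A R3" "A\<^sup>2 * (\<Sum>T\<in>T3. lenI T) <= E"
  using select2[OF subset_trans[OF R2C C] i A S1_sub[OF s1 R2C] EN_sub[OF E R2C], of "-1"] by blast
 have sub: "T1 \<subseteq> QQ" "T2 \<subseteq> QQ" "T3 \<subseteq> QQ" using C 1 2 3 by blast+
 then have f: "finite T1" "finite T2" "finite T3" using fin finite_subset by blast+
 have "size_le i a A R3" unfolding size_le_def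
  using S1_sub[OF 1(4), of R3] S2_sub[OF 2(4) 3(2)] 3 2 finC finite_subset[OF R2C finC] by blast
 moreover have "A\<^sup>2 * (\<Sum>T\<in>T1 \<union> (T2 \<union> T3). lenI T) <= 3 * E"
 proof -
  have "(\<Sum>T\<in>T1 \<union> (T2 \<union> T3). lenI T) <= (\<Sum>T\<in>T1. lenI T) + ((\<Sum>T\<in>T2. lenI T) + (\<Sum>T\<in>T3. lenI T))"
   using sum_tops_Un[of T1 "T2 \<union> T3"] sum_tops_Un[of T2 T3] f sub by simp
  then have "A\<^sup>2 * (\<Sum>T\<in>T1 \<union> (T2 \<union> T3). lenI T) <= A\<^sup>2 * ((\<Sum>T\<in>T1. lenI T) + ((\<Sum>T\<in>T2. lenI T) + (\<Sum>T\<in>T3. lenI T)))"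
   by (intro mult_left_mono) simp_all
  then show ?thesis using 1(5) 2(5) 3(5) by (simp add: distrib_left)
 qed
 moreover have "T1 \<union> (T2 \<union> T3) \<subseteq> C" "R3 \<subseteq> C" using 1 2 3 by blast+
 moreover have "C \<subseteq> R3 \<union> (\<Union>T\<in>T1 \<union> (T2 \<union> T3). AllT T)" using 1(3) 2(3) 3(3) by blast
 ultimately show ?thesis by blast
qed

end

lemma sum_min_geom_aux:
 fixes y q :: real
 assumes "0 < y" "0 < q" "q < 1"
 shows "(1 < y * q ^ M \<longrightarrow> (\<Sum>n<M. min (y * q ^ n) (1 / (y * q ^ n))) <= q / (1 - q) / (y * q ^ M)) \<and>
  (y * q ^ M <= 1 \<longrightarrow> (\<Sum>n<M. min (y * q ^ n) (1 / (y * q ^ n))) <= (2 - y * q ^ M) / (1 - q))"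
proof (induction M)
 case 0
 then show ?case using assms by simp
next
 case (Suc M)
 define z where "z = y * q ^ M"
 define s where "s = (\<Sum>n<M. min (y * q ^ n) (1 / (y * q ^ n)))"
 have z0: "0 < z" using assms by (simp add: z_def)
 have zS: "y * q ^ Suc M = q * z" by (simp add: z_def)
 have sS: "(\<Sum>n<Suc M. min (y * q ^ n) (1 / (y * q ^ n))) = s + min z (1 / z)" by (simp add: s_def z_def)
 have IH: "1 < z ==> s <= q / (1 - q) / z" "z <= 1 ==> s <= (2 - z) / (1 - q)" using Suc by (simp_all add: z_def s_def)
 show ?case unfolding sS zS
 proof (cases "1 < z")
  case True
  have "s + min z (1 / z) <= q / (1 - q) / z + 1 / z" using IH(1)[OF True] by simp
  also have "... = 1 / ((1 - q) * z)" using assms z0 by (simp add: field_simps)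
  finally have a: "s + min z (1 / z) <= 1 / ((1 - q) * z)" .
  have b: "1 / ((1 - q) * z) = q / (1 - q) / (q * z)" using assms z0 by (simp add: field_simps)
  have c: "1 / ((1 - q) * z) <= (2 - q * z) / (1 - q)" if "q * z <= 1"
  proof -
   have "0 <= (z - 1) * (1 - q * z)" using that True by simp
   moreover have "q * z <= z" using assms z0 by (simp add: mult_left_le_one_le)
   moreover have "(z - 1) * (1 - q * z) = z - q * z * z - 1 + q * z" by (simp add: algebra_simps)
   ultimately have "1 <= z * (2 - q * z)" by (simp add: algebra_simps)
   then have "1 / z <= 2 - q * z" using z0 by (simp add: field_simps)
   then have "1 / z / (1 - q) <= (2 - q * z) / (1 - q)" using assms by (intro divide_right_mono) auto
   then show ?thesis by (simp add: mult.commute)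
  qed
  show "(1 < q * z \<longrightarrow> s + min z (1 / z) <= q / (1 - q) / (q * z)) \<and> (q * z <= 1 \<longrightarrow> s + min z (1 / z) <= (2 - q * z) / (1 - q))"
   using a b c by (auto intro: order_trans)
 next
  case False
  then have z1: "z <= 1" by simp
  have "q * z < 1" using assms z0 z1 by (smt (verit) mult_le_cancel_left1 mult_less_cancel_right2)
  moreover have "s + min z (1 / z) <= (2 - z) / (1 - q) + z" using IH(2)[OF z1] by simp
  moreover have "(2 - z) / (1 - q) + z = (2 - q * z) / (1 - q)" using assms by (simp add: field_simps)
  ultimately show "(1 < q * z \<longrightarrow> s + min z (1 / z) <= q / (1 - q) / (q * z)) \<and> (q * z <= 1 \<longrightarrow> s + min z (1 / z) <= (2 - q * z) / (1 - q))"
   by simp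
 qed
qed

lemma sum_min_geom:
 fixes y q :: real
 assumes "0 < y" "0 < q" "q < 1"
 shows "(\<Sum>n<M. min (y * q ^ n) (1 / (y * q ^ n))) <= 2 / (1 - q)"
proof (cases "1 < y * q ^ M")
 case True
 have "(\<Sum>n<M. min (y * q ^ n) (1 / (y * q ^ n))) <= q / (1 - q) / (y * q ^ M)" using sum_min_geom_aux[OF assms, of M] True by blast
 also have "... <= q / (1 - q) / 1" using True assms by (intro divide_left_mono) auto
 also have "... <= 2 / (1 - q)" using assms by (simp add: divide_right_mono)
 finally show ?thesis .
next
 case False
 then have "(\<Sum>n<M. min (y * q ^ n) (1 / (y * q ^ n))) <= (2 - y * q ^ M) / (1 - q)" using sum_min_geom_aux[OF assms, of M] by simp
 also have "... <= 2 / (1 - q)" using assms by (intro divide_right_mono) simp_all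
 finally show ?thesis .
qed

lemma min_le_powr:
 fixes x B \<theta> :: real
 assumes "0 < x" "0 < B" "0 <= \<theta>" "\<theta> <= 1"
 shows "min x B <= x powr (1 - \<theta>) * B powr \<theta>"
proof -
 have m: "0 < min x B" using assms by simp
 have "min x B = min x B powr (1 - \<theta>) * min x B powr \<theta>" using m by (simp add: powr_add[symmetric])
 also have "... <= x powr (1 - \<theta>) * B powr \<theta>" using m assms by (intro mult_mono powr_mono2) auto
 finally show ?thesis .
qed

text \<open>The exponents \<open>1 - 4 \<tau>\<close> and 1 for the third factor give geometric decay on the two sides of \<open>v = B3 / e3\<close>.\<close>

lemma prod_min_le:
 fixes v e1 e2 e3 B1 B2 B3 \<tau> :: real
 assumes p: "0 < v" "0 < e1" "0 < e2" "0 < e3" "0 < B1" "0 < B2" "0 < B3" and t: "0 < \<tau>" "\<tau> <= 1/4"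
 shows "min (v * e1) B1 * min (v * e2) B2 * min (v * e3) B3 / v\<^sup>2 \<le>
  (e1 * e2) powr (1 - \<tau>) * (B1 * B2) powr \<tau> * (e3 powr (2 * \<tau>) * B3 powr (1 - 2 * \<tau>)) *
   min ((v * e3 / B3) powr (2 * \<tau>)) (1 / (v * e3 / B3) powr (2 * \<tau>))"
proof -
 define y where "y = (v * e3 / B3) powr (2 * \<tau>)"
 have y0: "0 < y" using p by (simp add: y_def)
 have key: "min (v * e1) B1 * min (v * e2) B2 * min (v * e3) B3 / v\<^sup>2 \<le>
   (e1 * e2) powr (1 - \<tau>) * (B1 * B2) powr \<tau> * (e3 powr (2 * \<tau>) * B3 powr (1 - 2 * \<tau>)) * z"
  if th: "0 <= \<theta>" "\<theta> <= 1" and z: "z = v powr (1 - 2 * \<tau> - \<theta>) * e3 powr (1 - 2 * \<tau> - \<theta>) * B3 powr (\<theta> + 2 * \<tau> - 1)" for \<theta> z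
 proof -
  have "min (v * e1) B1 * min (v * e2) B2 * min (v * e3) B3 \<le>
   ((v * e1) powr (1 - \<tau>) * B1 powr \<tau>) * ((v * e2) powr (1 - \<tau>) * B2 powr \<tau>) * ((v * e3) powr (1 - \<theta>) * B3 powr \<theta>)"
   using p t th by (intro mult_mono min_le_powr) (auto intro!: mult_nonneg_nonneg)
  also have "... = v powr (1 - \<tau> + (1 - \<tau>) + (1 - \<theta>)) * ((e1 * e2) powr (1 - \<tau>) * (B1 * B2) powr \<tau> * (e3 powr (1 - \<theta>) * B3 powr \<theta>))"
   unfolding powr_mult powr_add[of v "1 - \<tau> + (1 - \<tau>)"] powr_add[of v "1 - \<tau>" "1 - \<tau>"] by (simp only: mult_ac)
  also have "v powr (1 - \<tau> + (1 - \<tau>) + (1 - \<theta>)) = v powr (1 - 2 * \<tau> - \<theta>) * v\<^sup>2"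
  proof -
   have "v\<^sup>2 = v powr 2" using p by (simp add: powr_numeral)
   then show ?thesis by (simp add: powr_add[symmetric])
  qed
  also have "e3 powr (1 - \<theta>) = e3 powr (2 * \<tau>) * e3 powr (1 - 2 * \<tau> - \<theta>)" by (simp add: powr_add[symmetric])
  also have "B3 powr \<theta> = B3 powr (1 - 2 * \<tau>) * B3 powr (\<theta> + 2 * \<tau> - 1)" by (simp add: powr_add[symmetric])
  finally have "min (v * e1) B1 * min (v * e2) B2 * min (v * e3) B3 \<le>
    ((e1 * e2) powr (1 - \<tau>) * (B1 * B2) powr \<tau> * (e3 powr (2 * \<tau>) * B3 powr (1 - 2 * \<tau>)) * z) * v\<^sup>2"
   unfolding z by (simp only: mult_ac)
  then show ?thesis using p by (simp add: divide_le_eq)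
 qed
 have 1: "y = v powr (1 - 2 * \<tau> - (1 - 4 * \<tau>)) * e3 powr (1 - 2 * \<tau> - (1 - 4 * \<tau>)) * B3 powr ((1 - 4 * \<tau>) + 2 * \<tau> - 1)"
  unfolding y_def using p by (simp add: powr_mult powr_divide powr_minus field_simps)
 have 2: "1 / y = v powr (1 - 2 * \<tau> - 1) * e3 powr (1 - 2 * \<tau> - 1) * B3 powr (1 + 2 * \<tau> - 1)"
  unfolding y_def using p by (simp add: powr_mult powr_divide powr_minus field_simps)
 show ?thesis
  using key[OF _ _ 1] key[OF _ _ 2] t unfolding y_def[symmetric] min_def by auto
qed

lemma level_sum_le:
 fixes u e1 e2 e3 B1 B2 B3 \<tau> r :: real
 assumes p: "0 < u" "0 < e1" "0 < e2" "0 < e3" "0 < B1" "0 < B2" "0 < B3" and t: "0 < \<tau>" "\<tau> <= 1/4" and r: "0 < r" "r < 1"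
 shows "(\<Sum>n<M. min (u * r ^ n * e1) B1 * min (u * r ^ n * e2) B2 * min (u * r ^ n * e3) B3 / (u * r ^ n)\<^sup>2) \<le>
  2 / (1 - r powr (2 * \<tau>)) * ((e1 * e2) powr (1 - \<tau>) * (B1 * B2) powr \<tau> * (e3 powr (2 * \<tau>) * B3 powr (1 - 2 * \<tau>)))"
proof -
 define P where "P = (e1 * e2) powr (1 - \<tau>) * (B1 * B2) powr \<tau> * (e3 powr (2 * \<tau>) * B3 powr (1 - 2 * \<tau>))"
 define q where "q = r powr (2 * \<tau>)"
 define y where "y = (u * e3 / B3) powr (2 * \<tau>)"
 have q: "0 < q" "q < 1" using r t powr_less_mono2[of "2 * \<tau>" r 1] by (simp_all add: q_def)
 have y: "0 < y" using p by (simp add: y_def)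
 have P0: "0 <= P" by (simp add: P_def)
 have e: "(u * r ^ n * e3 / B3) powr (2 * \<tau>) = y * q ^ n" for n
 proof -
  have "u * r ^ n * e3 / B3 = (u * e3 / B3) * r ^ n" by simp
  moreover have "(r ^ n) powr (2 * \<tau>) = q ^ n"
   using r by (simp add: q_def powr_realpow[symmetric] powr_powr mult.commute)
  ultimately show ?thesis unfolding y_def by (simp only: powr_mult)
 qed
 have "(\<Sum>n<M. min (u * r ^ n * e1) B1 * min (u * r ^ n * e2) B2 * min (u * r ^ n * e3) B3 / (u * r ^ n)\<^sup>2)
   <= (\<Sum>n<M. P * min (y * q ^ n) (1 / (y * q ^ n)))"
 proof (rule sum_mono)
  fix n
  have "0 < u * r ^ n" using p r by simp
  from prod_min_le[OF this p(2-7) t]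
  show "min (u * r ^ n * e1) B1 * min (u * r ^ n * e2) B2 * min (u * r ^ n * e3) B3 / (u * r ^ n)\<^sup>2 <= P * min (y * q ^ n) (1 / (y * q ^ n))"
   unfolding e P_def .
 qed
 also have "... <= P * (2 / (1 - q))" unfolding sum_distrib_left[symmetric] using P0 by (intro mult_left_mono sum_min_geom y q)
 finally show ?thesis unfolding P_def q_def by (simp add: mult.commute)
qed

lemma sum_UN_bound:
 fixes F :: "'a => real"
 assumes "finite I" "\<And>i. i \<in> I ==> finite (X i)" "\<And>i x. i \<in> I ==> x \<in> X i ==> 0 <= F x"
 shows "sum F (\<Union>i\<in>I. X i) <= (\<Sum>i\<in>I. sum F (X i))"
 using assms
proof (induction I rule: finite_induct)
 case (insert j I)
 have f: "finite (X j)" "finite (\<Union>i\<in>I. X i)" using insert by simp_all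
 have "0 <= sum F (X j \<inter> (\<Union>i\<in>I. X i))" using insert.prems(2) by (intro sum_nonneg) blast
 then have "sum F (X j \<union> (\<Union>i\<in>I. X i)) <= sum F (X j) + sum F (\<Union>i\<in>I. X i)" using sum.union_inter[OF f, of F] by simp
 also have "... <= sum F (X j) + (\<Sum>i\<in>I. sum F (X i))" using insert by (intro add_left_mono insert.IH) blast+
 finally show ?case using insert.hyps by simp
qed simp

context rank1_coll
begin

definition Lam :: "(nat => tritile => real) => tritile set => real" where
 "Lam a C = (\<Sum>Q\<in>C. rs Q * (a 1 Q * a 2 Q * a 3 Q))"

lemma S1_rs:
 assumes "S1 a A C" "Q \<in> C" "C \<subseteq> QQ" "0 <= A"
 shows "a Q * rs Q <= A"
proof -
 have l: "0 < lenI Q" using lI assms by blast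
 have "(a Q * rs Q)\<^sup>2 <= A\<^sup>2 * lenI Q * (rs Q)\<^sup>2"
  unfolding power_mult_distrib using assms by (intro mult_right_mono) (simp_all add: S1_def)
 also have "... = A\<^sup>2" using l by (simp add: rs_sq)
 finally show ?thesis using assms(4) by (rule power2_le_imp_le)
qed

lemma size_LT:
 assumes C: "C \<subseteq> QQ" and T: "T \<in> C" and k: "k \<in> three" "j \<in> three" "k \<noteq> j" and s: "size_le k a A C"
 shows "(\<Sum>Q\<in>C \<inter> TR j T. (a Q)\<^sup>2) <= 2 * A\<^sup>2 * lenI T"
proof -
 have TQ: "T \<in> QQ" using C T by blast
 have f: "finite C" using C fin finite_subset by blast
 have "(\<Sum>Q\<in>C \<inter> TR j T. (a Q)\<^sup>2) = (\<Sum>Q\<in>(C \<inter> LT k j 1 T) \<union> (C \<inter> LT k j (-1) T). (a Q)\<^sup>2)"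
  unfolding TR_split(1)[OF TQ k] by (simp only: Int_Un_distrib)
 also have "... = (\<Sum>Q\<in>C \<inter> LT k j 1 T. (a Q)\<^sup>2) + (\<Sum>Q\<in>C \<inter> LT k j (-1) T. (a Q)\<^sup>2)"
  using TR_split(2)[OF TQ k] f by (intro sum.union_disjoint) (simp, simp, blast)
 also have "... <= A\<^sup>2 * lenI T + A\<^sup>2 * lenI T"
  using s T k unfolding size_le_def S2_def by (intro add_mono) blast+
 also have "... = 2 * A\<^sup>2 * lenI T" by simp
 finally show ?thesis .
qed

lemma tree_j:
 assumes C: "C \<subseteq> QQ" and T: "T \<in> C" and k: "j \<in> three" "k \<in> three" "l \<in> three" "k \<noteq> j" "l \<noteq> j"
  and s: "\<And>i. i \<in> three ==> size_le i (a i) (A i) C" and A: "\<And>i. i \<in> three ==> 0 <= A i" and a: "\<And>i Q. 0 <= a i Q"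
 shows "(\<Sum>Q\<in>C \<inter> TR j T. rs Q * (a j Q * a k Q * a l Q)) <= 2 * (A j * A k * A l) * lenI T"
proof -
 have l0: "0 < lenI T" using lI C T by blast
 have "(\<Sum>Q\<in>C \<inter> TR j T. rs Q * (a j Q * a k Q * a l Q)) <= (\<Sum>Q\<in>C \<inter> TR j T. A j * (a k Q * a l Q))"
 proof (rule sum_mono)
  fix Q assume Q: "Q \<in> C \<inter> TR j T"
  have "a j Q * rs Q <= A j" using s[OF k(1)] Q C A[OF k(1)] by (intro S1_rs[of _ _ C]) (simp_all add: size_le_def)
  then have "a j Q * rs Q * (a k Q * a l Q) <= A j * (a k Q * a l Q)" using a by (intro mult_right_mono) simp_all
  then show "rs Q * (a j Q * a k Q * a l Q) <= A j * (a k Q * a l Q)" by (simp only: mult_ac)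
 qed
 also have "... = A j * (\<Sum>Q\<in>C \<inter> TR j T. a k Q * a l Q)" by (simp only: sum_distrib_left)
 also have "... <= A j * (2 * (A k * A l) * lenI T)"
 proof (rule mult_left_mono[OF _ A[OF k(1)]])
  have "(\<Sum>Q\<in>C \<inter> TR j T. a k Q * a l Q)\<^sup>2 <= (\<Sum>Q\<in>C \<inter> TR j T. (a k Q)\<^sup>2) * (\<Sum>Q\<in>C \<inter> TR j T. (a l Q)\<^sup>2)"
   by (rule Cauchy_Schwarz_ineq_sum)
  also have "... <= (2 * (A k)\<^sup>2 * lenI T) * (2 * (A l)\<^sup>2 * lenI T)"
  proof (rule mult_mono)
   show "(\<Sum>Q\<in>C \<inter> TR j T. (a k Q)\<^sup>2) <= 2 * (A k)\<^sup>2 * lenI T" by (rule size_LT[OF C T k(2,1,4) s[OF k(2)]])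
   show "(\<Sum>Q\<in>C \<inter> TR j T. (a l Q)\<^sup>2) <= 2 * (A l)\<^sup>2 * lenI T" by (rule size_LT[OF C T k(3,1,5) s[OF k(3)]])
   show "0 <= 2 * (A k)\<^sup>2 * lenI T" using l0 by simp
   show "0 <= (\<Sum>Q\<in>C \<inter> TR j T. (a l Q)\<^sup>2)" by (rule sum_nonneg) simp
  qed
  also have "... = (2 * (A k * A l) * lenI T)\<^sup>2" by (simp only: power2_eq_square mult_ac)
  finally have "(\<Sum>Q\<in>C \<inter> TR j T. a k Q * a l Q)\<^sup>2 <= (2 * (A k * A l) * lenI T)\<^sup>2" .
  moreover have "0 <= 2 * (A k * A l) * lenI T" using l0 A[OF k(2)] A[OF k(3)] by (intro mult_nonneg_nonneg) simp_all
  ultimately show "(\<Sum>Q\<in>C \<inter> TR j T. a k Q * a l Q) <= 2 * (A k * A l) * lenI T" by (rule power2_le_imp_le)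
 qed
 finally show ?thesis by (simp only: mult_ac)
qed

lemma tree_est:
 assumes C: "C \<subseteq> QQ" and T: "T \<in> C"
  and s: "\<And>i. i \<in> three ==> size_le i (a i) (A i) C" and A: "\<And>i. i \<in> three ==> 0 <= A i" and a: "\<And>i Q. 0 <= a i Q"
 shows "Lam a (C \<inter> AllT T) <= 7 * (A 1 * A 2 * A 3) * lenI T"
proof -
 define F where "F Q = rs Q * (a 1 Q * a 2 Q * a 3 Q)" for Q
 have TQ: "T \<in> QQ" using C T by blast
 have l0: "0 < lenI T" using lI C T by blast
 have f: "finite C" using C fin finite_subset by blast
 have F0: "0 <= F Q" if "Q \<in> C" for Q unfolding F_def
  by (intro mult_nonneg_nonneg a less_imp_le[OF rs_pos[OF lI[OF subsetD[OF C that]]]])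
 have t: "1 \<in> three" "2 \<in> three" "3 \<in> three" by (simp_all add: three_def)
 have "C \<inter> AllT T \<subseteq> {T} \<union> (C \<inter> TR 1 T \<union> (C \<inter> TR 2 T \<union> C \<inter> TR 3 T))"
  unfolding AllT_def TR_def three_def by blast
 then have "Lam a (C \<inter> AllT T) <= sum F ({T} \<union> (C \<inter> TR 1 T \<union> (C \<inter> TR 2 T \<union> C \<inter> TR 3 T)))"
  unfolding Lam_def F_def[symmetric] using f F0 T by (intro sum_mono2) (simp, assumption, blast)
 also have "... <= F T + (sum F (C \<inter> TR 1 T) + (sum F (C \<inter> TR 2 T) + sum F (C \<inter> TR 3 T)))"
 proof -
  have U: "sum F (X \<union> Y) <= sum F X + sum F Y" if "X \<subseteq> C" "Y \<subseteq> C" for X Y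
  proof -
   have "finite X" "finite Y" using that f finite_subset by blast+
   moreover have "0 <= sum F (X \<inter> Y)" using F0 that by (intro sum_nonneg) blast
   ultimately show ?thesis using sum.union_inter[of X Y F] by simp
  qed
  show ?thesis
   using U[of "{T}" "C \<inter> TR 1 T \<union> (C \<inter> TR 2 T \<union> C \<inter> TR 3 T)"] U[of "C \<inter> TR 1 T" "C \<inter> TR 2 T \<union> C \<inter> TR 3 T"]
    U[of "C \<inter> TR 2 T" "C \<inter> TR 3 T"] T by (simp add: le_sup_iff)
 qed
 also have "... <= (A 1 * A 2 * A 3) * lenI T + (2 * (A 1 * A 2 * A 3) * lenI T + (2 * (A 2 * A 1 * A 3) * lenI T + 2 * (A 3 * A 1 * A 2) * lenI T))"
 proof (intro add_mono)
  have a1: "a i T * rs T <= A i" if "i \<in> three" for i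
   using s[OF that] T C A[OF that] by (intro S1_rs[of _ _ C]) (simp_all add: size_le_def)
  have r: "rs T * rs T * lenI T = 1" using l0 by (simp add: rs_mult)
  have "F T = (a 1 T * rs T) * (a 2 T * rs T) * (a 3 T * rs T) * lenI T"
  proof -
   have "(a 1 T * rs T) * (a 2 T * rs T) * (a 3 T * rs T) * lenI T = F T * (rs T * rs T * lenI T)"
    unfolding F_def by (simp only: mult_ac)
   then show ?thesis unfolding r mult_1_right by (rule sym)
  qed
  also have "... <= (A 1 * A 2 * A 3) * lenI T"
   using l0 rs_pos[OF l0] a A t by (intro mult_right_mono mult_mono a1 mult_nonneg_nonneg) (simp_all add: less_imp_le)
  finally show "F T <= (A 1 * A 2 * A 3) * lenI T" .
  show "sum F (C \<inter> TR 1 T) <= 2 * (A 1 * A 2 * A 3) * lenI T"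
   unfolding F_def by (rule tree_j[OF C T t _ _ s A a]) simp_all
  have "sum F (C \<inter> TR 2 T) = (\<Sum>Q\<in>C \<inter> TR 2 T. rs Q * (a 2 Q * a 1 Q * a 3 Q))" unfolding F_def by (simp only: mult_ac)
  also have "... <= 2 * (A 2 * A 1 * A 3) * lenI T" by (rule tree_j[OF C T t(2,1,3) _ _ s A a]) simp_all
  finally show "sum F (C \<inter> TR 2 T) <= 2 * (A 2 * A 1 * A 3) * lenI T" .
  have "sum F (C \<inter> TR 3 T) = (\<Sum>Q\<in>C \<inter> TR 3 T. rs Q * (a 3 Q * a 1 Q * a 2 Q))" unfolding F_def by (simp only: mult_ac)
  also have "... <= 2 * (A 3 * A 1 * A 2) * lenI T" by (rule tree_j[OF C T t(3,1,2) _ _ s A a]) simp_all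
  finally show "sum F (C \<inter> TR 3 T) <= 2 * (A 3 * A 1 * A 2) * lenI T" .
 qed
 also have "... = 7 * (A 1 * A 2 * A 3) * lenI T" by (simp add: algebra_simps)
 finally show ?thesis .
qed

lemma size_sub: "size_le i a A C ==> C' \<subseteq> C ==> C \<subseteq> QQ ==> size_le i a A C'"
 unfolding size_le_def
 by (intro conjI; elim conjE) (rule S1_sub, assumption+, (rule S2_sub, assumption+, rule finite_subset[OF _ fin], assumption)+)

lemma level_step:
 assumes C: "C \<subseteq> QQ" and u: "0 < u" and e: "\<And>i. i \<in> three ==> 0 < e i" and B: "\<And>i. i \<in> three ==> 0 < B i"
  and a: "\<And>i Q. 0 <= a i Q" and E: "\<And>i. i \<in> three ==> EN i (a i) ((e i)\<^sup>2) C"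
  and s: "\<And>i. i \<in> three ==> size_le i (a i) (u * e i) C" and sB: "\<And>i. i \<in> three ==> size_le i (a i) (B i) C"
 shows "\<exists>R\<subseteq>C. (\<forall>i\<in>three. size_le i (a i) (u * (4/5) * e i) R) \<and>
  Lam a C <= Lam a R + 105 * (min (u * e 1) (B 1) * min (u * e 2) (B 2) * min (u * e 3) (B 3) / u\<^sup>2)"
proof -
 have t: "1 \<in> three" "2 \<in> three" "3 \<in> three" by (simp_all add: three_def)
 have sel: "\<exists>\<T> R. \<T> \<subseteq> D \<and> R \<subseteq> D \<and> D \<subseteq> R \<union> (\<Union>T\<in>\<T>. AllT T) \<and> size_le i (a i) (u * (4/5) * e i) R \<and> u\<^sup>2 * (\<Sum>T\<in>\<T>. lenI T) <= 5"
  if i: "i \<in> three" and D: "D \<subseteq> C" for i D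
 proof -
  have "S1 (a i) (u * e i) D" using s[OF i] S1_sub[OF _ D] by (simp add: size_le_def)
  then have "S1 (a i) (5/4 * (u * (4/5) * e i)) D" by simp
  then obtain \<T> R where h: "\<T> \<subseteq> D" "R \<subseteq> D" "D \<subseteq> R \<union> (\<Union>T\<in>\<T>. AllT T)" "size_le i (a i) (u * (4/5) * e i) R"
   "(u * (4/5) * e i)\<^sup>2 * (\<Sum>T\<in>\<T>. lenI T) <= 3 * (e i)\<^sup>2"
   using select[OF subset_trans[OF D C] i _ _ EN_sub[OF E[OF i] D], of "u * (4/5) * e i"] u e[OF i] by auto
  have "(e i)\<^sup>2 * (16/25 * (u\<^sup>2 * (\<Sum>T\<in>\<T>. lenI T))) <= (e i)\<^sup>2 * 3"
   using h(5) by (simp add: power_mult_distrib power2_eq_square mult_ac)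
  then have "16/25 * (u\<^sup>2 * (\<Sum>T\<in>\<T>. lenI T)) <= 3" using e[OF i] by (simp only: mult_le_cancel_left_pos zero_less_power)
  then have "u\<^sup>2 * (\<Sum>T\<in>\<T>. lenI T) <= 5" by simp
  then show ?thesis using h by blast
 qed
 obtain T1 R1 where 1: "T1 \<subseteq> C" "R1 \<subseteq> C" "C \<subseteq> R1 \<union> (\<Union>T\<in>T1. AllT T)" "size_le 1 (a 1) (u * (4/5) * e 1) R1" "u\<^sup>2 * (\<Sum>T\<in>T1. lenI T) <= 5"
  using sel[OF t(1) order_refl] by (elim exE conjE)
 obtain T2 R2 where 2: "T2 \<subseteq> R1" "R2 \<subseteq> R1" "R1 \<subseteq> R2 \<union> (\<Union>T\<in>T2. AllT T)" "size_le 2 (a 2) (u * (4/5) * e 2) R2" "u\<^sup>2 * (\<Sum>T\<in>T2. lenI T) <= 5"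
  using sel[OF t(2) 1(2)] by (elim exE conjE)
 obtain T3 R where 3: "T3 \<subseteq> R2" "R \<subseteq> R2" "R2 \<subseteq> R \<union> (\<Union>T\<in>T3. AllT T)" "size_le 3 (a 3) (u * (4/5) * e 3) R" "u\<^sup>2 * (\<Sum>T\<in>T3. lenI T) <= 5"
  using sel[OF t(3) subset_trans[OF 2(2) 1(2)]] by (elim exE conjE)
 define \<T> where "\<T> = T1 \<union> (T2 \<union> T3)"
 have RC: "R \<subseteq> C" "R1 \<subseteq> QQ" "R2 \<subseteq> QQ" "R \<subseteq> R1" using 1 2 3 C by blast+
 have TC: "\<T> \<subseteq> C" unfolding \<T>_def using 1 2 3 by blast
 have sub: "T1 \<subseteq> QQ" "T2 \<subseteq> QQ" "T3 \<subseteq> QQ" using C TC unfolding \<T>_def by blast+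
 then have f: "finite T1" "finite T2" "finite T3" "finite C" using fin C finite_subset by blast+
 have fT: "finite \<T>" using f by (simp add: \<T>_def)
 have sR: "\<forall>i\<in>three. size_le i (a i) (u * (4/5) * e i) R"
  using size_sub[OF 1(4) RC(4,2)] size_sub[OF 2(4) 3(2) RC(3)] 3(4) by (simp add: three_def)
 have sumT: "u\<^sup>2 * (\<Sum>T\<in>\<T>. lenI T) <= 15"
 proof -
  have "(\<Sum>T\<in>\<T>. lenI T) <= (\<Sum>T\<in>T1. lenI T) + ((\<Sum>T\<in>T2. lenI T) + (\<Sum>T\<in>T3. lenI T))"
   unfolding \<T>_def using sum_tops_Un[of T1 "T2 \<union> T3"] sum_tops_Un[of T2 T3] f sub by simp
  then have "u\<^sup>2 * (\<Sum>T\<in>\<T>. lenI T) <= u\<^sup>2 * ((\<Sum>T\<in>T1. lenI T) + ((\<Sum>T\<in>T2. lenI T) + (\<Sum>T\<in>T3. lenI T)))"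
   by (intro mult_left_mono) simp_all
  then show ?thesis using 1(5) 2(5) 3(5) by (simp add: distrib_left)
 qed
 define m where "m i = min (u * e i) (B i)" for i
 have m: "size_le i (a i) (m i) C" "0 <= m i" if "i \<in> three" for i
  using s[OF that] sB[OF that] e[OF that] B[OF that] u by (simp_all add: m_def min_def)
 define M where "M = m 1 * m 2 * m 3"
 have M0: "0 <= M" using m(2) t by (simp add: M_def)
 define F where "F Q = rs Q * (a 1 Q * a 2 Q * a 3 Q)" for Q
 have F0: "0 <= F Q" if "Q \<in> C" for Q unfolding F_def
  by (intro mult_nonneg_nonneg a less_imp_le[OF rs_pos[OF lI[OF subsetD[OF C that]]]])
 have "C \<subseteq> R \<union> (\<Union>T\<in>\<T>. C \<inter> AllT T)" using 1(3) 2(3) 3(3) unfolding \<T>_def by blast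
 then have "Lam a C <= sum F (R \<union> (\<Union>T\<in>\<T>. C \<inter> AllT T))"
  unfolding Lam_def F_def[symmetric] using RC f F0 fT finite_subset[OF RC(1)] by (intro sum_mono2) (simp, assumption, blast)
 also have "... <= sum F R + sum F (\<Union>T\<in>\<T>. C \<inter> AllT T)"
 proof -
  have "finite R" "finite (\<Union>T\<in>\<T>. C \<inter> AllT T)" using f(4) fT finite_subset[OF RC(1)] by simp_all
  moreover have "0 <= sum F (R \<inter> (\<Union>T\<in>\<T>. C \<inter> AllT T))" using F0 by (intro sum_nonneg) blast
  ultimately show ?thesis using sum.union_inter[of R "\<Union>T\<in>\<T>. C \<inter> AllT T" F] by simp
 qed
 also have "sum F (\<Union>T\<in>\<T>. C \<inter> AllT T) <= (\<Sum>T\<in>\<T>. sum F (C \<inter> AllT T))"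
  using fT f(4) F0 by (intro sum_UN_bound) blast+
 also have "... <= (\<Sum>T\<in>\<T>. 7 * M * lenI T)"
 proof (rule sum_mono)
  fix T assume "T \<in> \<T>"
  then have "T \<in> C" using TC by blast
  from tree_est[OF C this m a] show "sum F (C \<inter> AllT T) <= 7 * M * lenI T" by (simp add: Lam_def F_def M_def)
 qed
 also have "... = 7 * M * (\<Sum>T\<in>\<T>. lenI T)" by (simp only: sum_distrib_left)
 also have "... = 7 * M / u\<^sup>2 * (u\<^sup>2 * (\<Sum>T\<in>\<T>. lenI T))" using u by simp
 also have "... <= 7 * M / u\<^sup>2 * 15" using M0 by (intro mult_left_mono sumT) simp
 finally have "Lam a C <= Lam a R + 105 * (M / u\<^sup>2)" by (simp add: Lam_def F_def)
 then show ?thesis using RC(1) sR unfolding M_def m_def by blast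
qed

lemma level_iter:
 assumes C: "C \<subseteq> QQ" and u: "0 < u" and e: "\<And>i. i \<in> three ==> 0 < e i" and B: "\<And>i. i \<in> three ==> 0 < B i"
  and a: "\<And>i Q. 0 <= a i Q" and E: "\<And>i. i \<in> three ==> EN i (a i) ((e i)\<^sup>2) C"
  and s: "\<And>i. i \<in> three ==> size_le i (a i) (u * e i) C" and sB: "\<And>i. i \<in> three ==> size_le i (a i) (B i) C"
 shows "\<exists>R\<subseteq>C. (\<forall>i\<in>three. size_le i (a i) (u * (4/5) ^ M * e i) R) \<and>
  Lam a C <= Lam a R + 105 * (\<Sum>n<M. min (u * (4/5) ^ n * e 1) (B 1) * min (u * (4/5) ^ n * e 2) (B 2) * min (u * (4/5) ^ n * e 3) (B 3) / (u * (4/5) ^ n)\<^sup>2)"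
proof (induction M)
 case 0
 then show ?case using s by (intro exI[of _ C]) simp
next
 case (Suc M)
 let ?t = "\<lambda>n. min (u * (4/5) ^ n * e 1) (B 1) * min (u * (4/5) ^ n * e 2) (B 2) * min (u * (4/5) ^ n * e 3) (B 3) / (u * (4/5) ^ n)\<^sup>2"
 from Suc obtain R where R: "R \<subseteq> C" "\<And>i. i \<in> three ==> size_le i (a i) (u * (4/5) ^ M * e i) R" "Lam a C <= Lam a R + 105 * sum ?t {..<M}"
  by blast
 have "\<exists>R'\<subseteq>R. (\<forall>i\<in>three. size_le i (a i) (u * (4/5) ^ M * (4/5) * e i) R') \<and> Lam a R <= Lam a R' + 105 * ?t M"
  using u by (intro level_step[OF subset_trans[OF R(1) C] _ e B a EN_sub[OF E R(1)] R(2) size_sub[OF sB R(1) C]]) simp_all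
 then obtain R' where R': "R' \<subseteq> R" "\<forall>i\<in>three. size_le i (a i) (u * (4/5) ^ M * (4/5) * e i) R'" "Lam a R <= Lam a R' + 105 * ?t M"
  by blast
 have eq: "u * (4/5) ^ M * (4/5) = u * (4/5) ^ Suc M" by simp
 have "sum ?t {..<Suc M} = sum ?t {..<M} + ?t M" by (rule sum.lessThan_Suc)
 then have "Lam a C <= Lam a R' + 105 * sum ?t {..<Suc M}" using R(3) R'(3) by linarith
 then show ?case using R'(1,2) R(1) unfolding eq by blast
qed

lemma Lam_size:
 assumes C: "C \<subseteq> QQ" and R: "R \<subseteq> C" and e: "\<And>i. i \<in> three ==> 0 < e i" and u: "0 < u" and a: "\<And>i Q. 0 <= a i Q"
  and s: "\<And>i. i \<in> three ==> size_le i (a i) (u * e i) R"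
 shows "Lam a R <= u ^ 3 * (e 1 * e 2 * e 3) * (\<Sum>Q\<in>C. lenI Q)"
proof -
 have t: "1 \<in> three" "2 \<in> three" "3 \<in> three" by (simp_all add: three_def)
 have f: "finite C" using C fin finite_subset by blast
 have RQ: "R \<subseteq> QQ" using C R by blast
 have "Lam a R <= (\<Sum>Q\<in>R. u ^ 3 * (e 1 * e 2 * e 3) * lenI Q)"
  unfolding Lam_def
 proof (rule sum_mono)
  fix Q assume Q: "Q \<in> R"
  have l0: "0 < lenI Q" using lI RQ Q by blast
  have a1: "a i Q * rs Q <= u * e i" if "i \<in> three" for i
   using s[OF that] Q RQ e[OF that] u by (intro S1_rs[of _ _ R]) (simp_all add: size_le_def)
  have r: "rs Q * rs Q * lenI Q = 1" using l0 by (simp add: rs_mult)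
  have "(a 1 Q * rs Q) * (a 2 Q * rs Q) * (a 3 Q * rs Q) * lenI Q = rs Q * (a 1 Q * a 2 Q * a 3 Q) * (rs Q * rs Q * lenI Q)"
   by (simp only: mult_ac)
  then have "rs Q * (a 1 Q * a 2 Q * a 3 Q) = (a 1 Q * rs Q) * (a 2 Q * rs Q) * (a 3 Q * rs Q) * lenI Q" unfolding r mult_1_right by (rule sym)
  also have "... <= ((u * e 1) * (u * e 2) * (u * e 3)) * lenI Q"
   using l0 rs_pos[OF l0] a e u t by (intro mult_right_mono mult_mono a1 mult_nonneg_nonneg) (simp_all add: less_imp_le)
  finally show "rs Q * (a 1 Q * a 2 Q * a 3 Q) <= u ^ 3 * (e 1 * e 2 * e 3) * lenI Q" by (simp add: power3_eq_cube mult_ac)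
 qed
 also have "... = u ^ 3 * (e 1 * e 2 * e 3) * (\<Sum>Q\<in>R. lenI Q)" by (simp only: sum_distrib_left)
 also have "... <= u ^ 3 * (e 1 * e 2 * e 3) * (\<Sum>Q\<in>C. lenI Q)"
 proof (intro mult_left_mono sum_mono2 f R)
  show "0 <= lenI Q" if "Q \<in> C - R" for Q using less_imp_le[OF lI[OF subsetD[OF C]], of Q] that by blast
  show "0 <= u ^ 3 * (e 1 * e 2 * e 3)" using u e[OF t(1)] e[OF t(2)] e[OF t(3)] by simp
 qed
 finally show ?thesis .
qed

lemma Lam_le:
 assumes C: "C \<subseteq> QQ" and e: "\<And>i. i \<in> three ==> 0 < e i" and B: "\<And>i. i \<in> three ==> 0 < B i"
  and a: "\<And>i Q. 0 <= a i Q" and E: "\<And>i. i \<in> three ==> EN i (a i) ((e i)\<^sup>2) C"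
  and sB: "\<And>i. i \<in> three ==> size_le i (a i) (B i) C" and t: "0 < \<tau>" "\<tau> <= 1/4"
 shows "Lam a C <= 210 / (1 - (4/5) powr (2 * \<tau>)) * ((e 1 * e 2) powr (1 - \<tau>) * (B 1 * B 2) powr \<tau> * (e 3 powr (2 * \<tau>) * B 3 powr (1 - 2 * \<tau>)))"
  (is "_ <= ?K")
proof (rule field_le_epsilon)
 fix \<eta> :: real assume \<eta>: "0 < \<eta>"
 have th: "1 \<in> three" "2 \<in> three" "3 \<in> three" by (simp_all add: three_def)
 define u where "u = B 1 / e 1 + B 2 / e 2 + B 3 / e 3"
 have pos: "0 < B 1 / e 1" "0 < B 2 / e 2" "0 < B 3 / e 3" using e B th by simp_all
 then have u: "0 < u" by (simp add: u_def)
 have s: "size_le i (a i) (u * e i) C" if i: "i \<in> three" for i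
 proof -
  have "B i / e i <= u" using i pos by (auto simp: u_def three_def)
  then have le: "B i <= u * e i" using e[OF i] by (simp add: field_simps)
  then have sq: "(B i)\<^sup>2 <= (u * e i)\<^sup>2" using B[OF i] by (intro power_mono) simp_all
  have l: "(B i)\<^sup>2 * lenI Q <= (u * e i)\<^sup>2 * lenI Q" if "Q \<in> C" for Q
   by (rule mult_right_mono[OF sq less_imp_le[OF lI[OF subsetD[OF C that]]]])
  show ?thesis using sB[OF i] l unfolding size_le_def S1_def S2_def by (meson order_trans)
 qed
 define W where "W = u ^ 3 * (e 1 * e 2 * e 3) * (\<Sum>Q\<in>C. lenI Q)"
 have "0 <= (\<Sum>Q\<in>C. lenI Q)" by (intro sum_nonneg) (rule less_imp_le[OF lI[OF subsetD[OF C]]])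
 then have W0: "0 <= W" using u e th by (simp add: W_def less_imp_le)
 obtain M where M: "(4/5::real) ^ M < \<eta> / (W + 1)" using real_arch_pow_inv[of "\<eta> / (W + 1)" "4/5"] \<eta> W0 by auto
 obtain R where R: "R \<subseteq> C" "\<And>i. i \<in> three ==> size_le i (a i) (u * (4/5) ^ M * e i) R"
  "Lam a C <= Lam a R + 105 * (\<Sum>n<M. min (u * (4/5) ^ n * e 1) (B 1) * min (u * (4/5) ^ n * e 2) (B 2) * min (u * (4/5) ^ n * e 3) (B 3) / (u * (4/5) ^ n)\<^sup>2)"
  using level_iter[OF C u e B a E s sB, of M] by blast
 have "Lam a R <= (u * (4/5) ^ M) ^ 3 * (e 1 * e 2 * e 3) * (\<Sum>Q\<in>C. lenI Q)"
  using u by (intro Lam_size[OF C R(1) e _ a R(2)]) simp_all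
 also have "... = W * ((4/5) ^ M) ^ 3" unfolding W_def power_mult_distrib by (simp only: mult_ac)
 also have "... <= W * (4/5) ^ M"
 proof (rule mult_left_mono[OF _ W0])
  show "((4/5) ^ M) ^ 3 <= (4/5::real) ^ M" using power_decreasing[of 1 3 "(4/5::real) ^ M"] by (simp add: power_le_one)
 qed
 also have "... <= (W + 1) * (4/5) ^ M" by (simp add: distrib_right)
 also have "... <= \<eta>" using M W0 by (simp add: field_simps)
 finally have 1: "Lam a R <= \<eta>" .
 have "(\<Sum>n<M. min (u * (4/5) ^ n * e 1) (B 1) * min (u * (4/5) ^ n * e 2) (B 2) * min (u * (4/5) ^ n * e 3) (B 3) / (u * (4/5) ^ n)\<^sup>2) \<le>
  2 / (1 - (4/5) powr (2 * \<tau>)) * ((e 1 * e 2) powr (1 - \<tau>) * (B 1 * B 2) powr \<tau> * (e 3 powr (2 * \<tau>) * B 3 powr (1 - 2 * \<tau>)))"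
  using e B th by (intro level_sum_le u t) simp_all
 then have "Lam a C <= \<eta> + 105 * (2 / (1 - (4/5) powr (2 * \<tau>)) * ((e 1 * e 2) powr (1 - \<tau>) * (B 1 * B 2) powr \<tau> * (e 3 powr (2 * \<tau>) * B 3 powr (1 - 2 * \<tau>))))"
  using R(3) 1 by linarith
 then show "Lam a C <= ?K + \<eta>" by (simp add: mult.assoc)
qed

end

subsection \<open>Sizes and energies of the model coefficients\<close>

lemma wpk_mono:
 assumes "wpk B m I w \<Phi>" "B <= B'" "0 < len I"
 shows "wpk B' m I w \<Phi>"
proof -
 have "B * len I powr (-1/2) * chi I x ^ m <= B' * len I powr (-1/2) * chi I x ^ m" for x
  using assms chi_nonneg[of I x] by (intro mult_right_mono) simp_all
 then show ?thesis using assms(1) unfolding wpk_def by (meson order_trans)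
qed

lemma integral_inv_wgt_le:
 fixes c l :: real
 assumes "0 < l"
 shows "integrable lborel (\<lambda>x. inverse (1 + ((x - c) / l)\<^sup>2))" "(LINT x|lborel. inverse (1 + ((x - c) / l)\<^sup>2)) <= 4 * l"
proof -
 show "integrable lborel (\<lambda>x. inverse (1 + ((x - c) / l)\<^sup>2))" by (rule integrable_cauchy[OF assms])
 show "(LINT x|lborel. inverse (1 + ((x - c) / l)\<^sup>2)) <= 4 * l"
  unfolding integral_cauchy[OF assms] using assms pi_less_4 by (intro mult_right_mono) simp_all
qed

lemma wgt_bound_le:
 assumes "norm (z::complex) <= 1"
 shows "(norm z)\<^sup>2 / (wgt (1 / l) c x)\<^sup>2 <= inverse (1 + ((x - c) / l)\<^sup>2)"
proof -
 define w where "w = wgt (1 / l) c x"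
 have w: "1 <= w" unfolding w_def by (rule wgt_ge1)
 have "(norm z)\<^sup>2 <= 1" using assms by (simp add: power_le_one)
 then have "(norm z)\<^sup>2 / w\<^sup>2 <= 1 / w\<^sup>2" using w by (intro divide_right_mono) simp_all
 also have "... <= 1 / w" using w power_increasing[of 1 2 w] by (intro divide_left_mono) simp_all
 also have "... = inverse (1 + ((x - c) / l)\<^sup>2)" by (simp add: w_def wgt_def inverse_eq_divide)
 finally show ?thesis unfolding w_def .
qed

lemma inner_le:
 assumes w: "wpk B m (tI Q) w \<Phi>" and m: "2 <= m" and B: "0 <= B" and l: "0 < lenI Q"
  and f: "f \<in> borel_measurable lebesgue" "\<And>x. norm (f x) <= 1"
 shows "norm (inner_L2 f \<Phi>) * rs Q <= 4 * B"
proof -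
 define g where "g x = B * rs Q * chiI Q x ^ m" for x
 have g0: "0 <= g x" for x unfolding g_def using B rs_pos[OF l] chi_nonneg[of "tI Q" x] l by simp
 have gm: "g \<in> borel_measurable borel" unfolding g_def by measurable
 have gi: "integrable lborel g" unfolding g_def by (intro integrable_mult_right integrable_chi l m)
 have "norm (inner_L2 f \<Phi>) <= (LINT x|lebesgue. norm (f x * cnj (\<Phi> x)))" unfolding inner_L2_def by (rule integral_norm_bound)
 also have "... <= (LINT x|lebesgue. g x)"
 proof (rule integral_mono_AE')
  show "integrable lebesgue g" using gi integrable_lebesgue_lborel[OF gm] by simp
  have "norm (f x * cnj (\<Phi> x)) <= g x" for x
  proof -
   have "norm (f x * cnj (\<Phi> x)) <= 1 * norm (\<Phi> x)" unfolding norm_mult complex_mod_cnj using f(2) by (intro mult_right_mono) simp_all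
   also have "... <= g x" using w by (simp add: wpk_def g_def rs_def)
   finally show ?thesis .
  qed
  then show "AE x in lebesgue. norm (f x * cnj (\<Phi> x)) <= g x" by (intro AE_I2)
  show "AE x in lebesgue. 0 <= g x" using g0 by (intro AE_I2)
 qed
 also have "... = (LINT x|lborel. g x)" by (rule integral_lebesgue_lborel[OF gm])
 also have "... = B * rs Q * (LINT x|lborel. chiI Q x ^ m)" unfolding g_def by simp
 also have "... <= B * rs Q * (4 * lenI Q)" using B rs_pos[OF l] by (intro mult_left_mono integral_chi_le l m) simp
 finally have "norm (inner_L2 f \<Phi>) * rs Q <= B * rs Q * (4 * lenI Q) * rs Q" using rs_pos[OF l] by (intro mult_right_mono) simp_all
 also have "... = 4 * B * (rs Q * rs Q * lenI Q)" by (simp only: mult_ac)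
 also have "... = 4 * B" using l by (simp add: rs_mult)
 finally show ?thesis .
qed

definition Bw :: "(nat => real) => real" where
 "Bw Ck = 4 * 10^7 * \<bar>Ck 0\<bar> + \<bar>Ck 1\<bar>"

lemma Bw_ge: "0 <= Bw Ck" "\<bar>Ck 0\<bar> <= Bw Ck" by (simp_all add: Bw_def)

definition K12 :: "real => real" where "K12 B = sqrt (2000000 * (B\<^sup>2 + 1))"

definition K3 :: "real => real => real" where
 "K3 B c = 4 * B\<^sup>2 + sqrt \<bar>tree_dens.CB B\<bar> + (1024 * B\<^sup>2 + sqrt \<bar>tree_pair.CA B c\<bar>) * (108 / c) + 1"

locale pairing = rank1_coll QQ
 for QQ :: "tritile set" +
 fixes F :: "nat => real => complex" and E :: "nat => real set" and \<Phi> :: "nat => tritile => real => complex"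
  and PP :: "tritile set" and \<Psi> :: "tritile => real => complex" and \<gamma> :: "tritile => complex"
  and K L :: nat and Ck :: "nat => real" and c :: real
 assumes famP: "family 2 PP (\<lambda>P. P)" and PP0: "PP \<noteq> {}"
  and wpQ: "\<And>T k. T \<in> QQ ==> k \<in> three ==> wave_packet K L Ck (comp T k) (\<Phi> k T)"
  and wpP: "\<And>P. P \<in> PP ==> wave_packet K L Ck (comp P 2) (\<Psi> P)"
  and K1: "1 <= K" and L8: "8 <= L" and c0: "0 < c" and c1: "c <= 1 / 10^9"
  and \<gamma>1: "\<And>P. P \<in> PP ==> norm (\<gamma> P) * rs P <= 1"
  and Fm: "\<And>i. i \<in> {1, 2} ==> F i \<in> borel_measurable lebesgue"
  and FE: "\<And>i x. i \<in> {1, 2} ==> norm (F i x) <= indicator (E i) x"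
  and Em: "\<And>i. i \<in> {1, 2} ==> E i \<in> sets lebesgue"
  and Ef: "\<And>i. i \<in> {1, 2} ==> emeasure lebesgue (E i) < \<infinity>"
begin

abbreviation "B \<equiv> Bw Ck"

definition S :: real where "S = (\<Sum>P\<in>PP. lenI P)"

definition bq :: "tritile => complex" where "bq Q = model_pair.bc (\<Phi> 3) PP \<Psi> \<gamma> c Q"

definition co :: "nat => tritile => real" where
 "co i Q = (if i = 3 then norm (bq Q) else norm (inner_L2 (F i) (\<Phi> i Q)))"

lemma co_nonneg: "0 <= co i Q" by (simp add: co_def)

lemma finP: "finite PP" using familyD(1)[OF famP] .

lemma lP: "P \<in> PP ==> 0 < lenI P" using familyD(6)[OF famP] .

lemma S_pos: "0 < S" unfolding S_def using finP PP0 lP by (rule sum_pos)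

lemma wQ: "T \<in> QQ ==> k \<in> three ==> wpk B 8 (tI T) (tw T k) (\<Phi> k T)"
 using wave_packet_wpk[OF wpQ[unfolded comp_def] K1 L8 lI] wpk_mono[OF _ Bw_ge(2) lI] by blast

lemma wP: "P \<in> PP ==> wpk B 8 (tI P) (tw P 2) (\<Psi> P)"
 using wave_packet_wpk[OF wpP[unfolded comp_def] K1 L8 lP] wpk_mono[OF _ Bw_ge(2) lP] by blast

lemma F1: "i \<in> {1, 2} ==> norm (F i x) <= 1"
 using FE[of i x] by (rule order_trans) (simp_all add: indicator_def)

lemma three3: "(3::nat) \<in> three" by (simp add: three_def)

lemma model:
 assumes "family 3 D \<tau>" "D \<subseteq> QQ"
 shows "model_pair D \<tau> (\<Phi> 3) PP \<Psi> \<gamma> B 8 c"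
proof
 show "wpk B 8 (tI Q) (tw Q 3) (\<Phi> 3 Q)" if "Q \<in> D" for Q using wQ[OF subsetD[OF assms(2) that] three3] .
 show "c <= 1 / 20" using c1 by simp
qed (use assms(1) famP wP c0 \<gamma>1 Bw_ge in simp_all)

lemma tpair:
 assumes "family 3 D (\<lambda>_. T)" "D \<subseteq> QQ" "D \<noteq> {}" "\<And>Q. Q \<in> D ==> \<bar>ctrw Q 3 - ctrw T 3\<bar> <= 10^7 / 2 * lenw Q 3"
 shows "tree_pair D T (\<Phi> 3) PP \<Psi> \<gamma> B 8 c"
proof -
 interpret M: model_pair D "\<lambda>_. T" "\<Phi> 3" PP \<Psi> \<gamma> B 8 c by (rule model[OF assms(1,2)])
 show ?thesis using assms(3,4) c1 by unfold_locales simp_all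
qed

lemma tdens:
 assumes "family 3 D (\<lambda>_. T)" "D \<subseteq> QQ" "D \<noteq> {}" "\<And>Q. Q \<in> D ==> \<bar>ctrw Q 3 - ctrw T 3\<bar> <= 10^7 / 2 * lenw Q 3"
  and "0 < \<delta>" "108 * \<delta> <= c" "\<And>Q I. Q \<in> D ==> in_D 0 I ==> setI Q \<subseteq> ivl_set I ==> dens PP I <= \<delta>"
 shows "tree_dens D T (\<Phi> 3) PP \<Psi> \<gamma> B 8 c (ctrw T 3) \<delta>"
proof -
 interpret M: tree_pair D T "\<Phi> 3" PP \<Psi> \<gamma> B 8 c by (rule tpair[OF assms(1-4)])
 show ?thesis
 proof
  fix Q x y assume Q: "Q \<in> D"
  then have QQ: "Q \<in> QQ" using assms(2) by blast
  have "norm (cis (- 2 * pi * ctrw T 3 * x) * \<Phi> 3 Q x - cis (- 2 * pi * ctrw T 3 * y) * \<Phi> 3 Q y)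
   <= (4 * 10^7 * \<bar>Ck 0\<bar> + \<bar>Ck 1\<bar>) * lenI Q powr (-1/2) * (\<bar>x - y\<bar> / lenI Q) * (1 + \<bar>x - y\<bar> / lenI Q) ^ 5 * chiI Q y ^ 5"
   using L8 by (intro wave_packet_osc[OF wpQ[OF QQ three3, unfolded comp_def] K1 _ lI[OF QQ] lw[OF QQ three3] assms(4)[OF Q]]) simp
  then show "norm (cis (- 2 * pi * ctrw T 3 * x) * \<Phi> 3 Q x - cis (- 2 * pi * ctrw T 3 * y) * \<Phi> 3 Q y)
   <= B * rs Q * (\<bar>x - y\<bar> / lenI Q) * (1 + \<bar>x - y\<bar> / lenI Q) ^ 5 * chiI Q y ^ 5"
   by (simp only: Bw_def rs_def)
 qed (use assms(5-7) in blast)+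
qed

lemma family_single:
 assumes "Q \<in> QQ" "i \<in> three"
 shows "family i {Q} (\<lambda>_. Q)"
 using shift_ex[OF assms(2)] dy[OF assms(1)] lw[OF assms] assms(1) unfolding family_def by blast

lemma co3_le:
 assumes Q: "Q \<in> QQ"
 shows "co 3 Q * rs Q <= 1024 * B\<^sup>2" "co 3 Q * rs Q <= 4 * B\<^sup>2 * dens PP (tI Q)"
proof -
 have t: "tree_pair {Q} Q (\<Phi> 3) PP \<Psi> \<gamma> B 8 c"
  by (rule tpair[OF family_single[OF Q three3]]) (use Q lwp[OF Q three3] in simp_all)
 show "co 3 Q * rs Q <= 1024 * B\<^sup>2" using tree_pair.bc_le_const[OF t, of Q] by (simp add: co_def bq_def)
 show "co 3 Q * rs Q <= 4 * B\<^sup>2 * dens PP (tI Q)" using tree_pair.bc_le_dens[OF t, of Q] by (simp add: co_def bq_def)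
qed

lemma S1_I:
 assumes "\<And>Q. Q \<in> C ==> a Q * rs Q <= A" "C \<subseteq> QQ" "\<And>Q. 0 <= a Q"
 shows "S1 a A C"
 unfolding S1_def
proof
 fix Q assume Q: "Q \<in> C"
 have l: "0 < lenI Q" using lI assms(2) Q by blast
 have "(a Q * rs Q)\<^sup>2 <= A\<^sup>2" using assms(1)[OF Q] assms(3) rs_pos[OF l] by (intro power_mono) simp_all
 then have "(a Q)\<^sup>2 * (rs Q)\<^sup>2 * lenI Q <= A\<^sup>2 * lenI Q" using l unfolding power_mult_distrib by (intro mult_right_mono) simp_all
 then show "(a Q)\<^sup>2 <= A\<^sup>2 * lenI Q" using l by (simp add: rs_sq)
qed

lemma S2_I:
 assumes "\<And>T j D. T \<in> C ==> j \<in> three ==> i \<noteq> j ==> D \<subseteq> C ==> D \<subseteq> TR j T ==> D \<noteq> {} ==> (\<Sum>Q\<in>D. (a Q)\<^sup>2) <= A\<^sup>2 * lenI T"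
  and C: "C \<subseteq> QQ"
 shows "S2 i s a A C"
 unfolding S2_def
proof (intro ballI)
 fix T j assume T: "T \<in> C" "j \<in> three - {i}"
 show "(\<Sum>Q\<in>C \<inter> LT i j s T. (a Q)\<^sup>2) <= A\<^sup>2 * lenI T"
 proof (cases "C \<inter> LT i j s T = {}")
  case True
  then show ?thesis using less_imp_le[OF lI[OF subsetD[OF C T(1)]]] by simp
 next
  case False
  then show ?thesis using T LT_sub[of i j s T] by (intro assms(1)[OF T(1)]) (blast+)
 qed
qed

lemma size12:
 assumes i: "i \<in> {1, 2}"
 shows "size_le i (co i) (K12 B) QQ"
proof -
 have i3: "i \<in> three" using i by (auto simp: three_def)
 have co: "co i Q = norm (inner_L2 (F i) (\<Phi> i Q))" for Q using i by (auto simp: co_def)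
 have K: "(K12 B)\<^sup>2 = 2000000 * (B\<^sup>2 + 1)" unfolding K12_def by (simp add: add_nonneg_nonneg)
 have K0: "0 <= K12 B" by (simp add: K12_def)
 have in1: "norm (inner_L2 (F i) (\<Phi> i Q)) * rs Q <= 4 * B" if Q: "Q \<in> QQ" for Q
  by (rule inner_le[OF wQ[OF Q i3] _ Bw_ge(1) lI[OF Q] Fm[OF i] F1[OF i]]) simp
 have "4 * B <= K12 B"
  by (rule power2_le_imp_le[OF _ K0]) (simp add: K power_mult_distrib)
 then have 1: "S1 (co i) (K12 B) QQ"
  by (intro S1_I co_nonneg order_refl) (rule order_trans[OF in1[folded co]])
 have 2: "S2 i s (co i) (K12 B) QQ" for s
 proof (rule S2_I)
  fix T j D assume T: "T \<in> QQ" "j \<in> three" "i \<noteq> j" "D \<subseteq> QQ" "D \<subseteq> TR j T" "D \<noteq> {}"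
  define l where "l = lenI T"
  have l: "0 < l" unfolding l_def by (rule lI[OF T(1)])
  have fam: "family i D (\<lambda>_. T)" by (rule family_tree[OF T(1) i3 T(2,3,5)])
  define H where "H x = inverse (1 + ((x - ctrI T) / l)\<^sup>2)" for x
  have Hm: "H \<in> borel_measurable borel" unfolding H_def by measurable
  have H: "integrable lebesgue H" "(LINT x|lebesgue. H x) <= 4 * l"
   using integral_inv_wgt_le[OF l, of "ctrI T", folded H_def] integrable_lebesgue_lborel[OF Hm] integral_lebesgue_lborel[OF Hm] by simp_all
  have "(\<Sum>Q\<in>D. (norm (inner_L2 (F i) (\<Phi> i Q)))\<^sup>2)
   <= 262144 * (B\<^sup>2 + 1) * (LINT x|lebesgue. H x) + (4 * B)\<^sup>2 * (\<Sum>T\<in>(\<lambda>_. T) ` D. lenI T) / 2"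
  proof (rule energy_le[OF fam, where m = 8 and \<beta> = "1 / l" and c = "ctrI T"])
   fix Q assume Q: "Q \<in> D"
   have sub: "setI Q \<subseteq> setI T" using familyD(5)[OF fam Q] .
   have lQ: "0 < lenI Q" using familyD(6)[OF fam Q] .
   have c: "\<bar>ctrI T - ctrI Q\<bar> <= (l - lenI Q) / 2" using sub iv_subset_ctr[OF lQ] by (simp add: l_def)
   then have "lenI Q <= l" using abs_ge_zero[of "ctrI T - ctrI Q"] by argo
   then show "1 / l * lenI Q <= 1" using l by simp
   have "\<bar>ctrI Q - ctrI T\<bar> <= l" using c lQ l by argo
   then show "1 / l * \<bar>ctrI Q - ctrI T\<bar> <= 1" using l by simp
   show "wpk B 8 (tI Q) (tw Q i) (\<Phi> i Q)" using Q T(4) i3 wQ by blast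
   show "norm (inner_L2 (F i) (\<Phi> i Q)) * rs Q <= 4 * B" using Q T(4) in1 by blast
  next
   show "(norm (F i x))\<^sup>2 / (wgt (1 / l) (ctrI T) x)\<^sup>2 <= H x" for x
    unfolding H_def by (rule wgt_bound_le[OF F1[OF i]])
  qed (use Bw_ge l Fm[OF i] F1[OF i] H in simp_all)
  also have "... <= 262144 * (B\<^sup>2 + 1) * (4 * l) + (4 * B)\<^sup>2 * l / 2"
  proof -
   have "(\<lambda>_. T) ` D = {T}" using T(6) by auto
   then show ?thesis using H(2) by (intro add_mono mult_left_mono) (simp_all add: l_def)
  qed
  also have "... <= 2000000 * (B\<^sup>2 + 1) * l"
  proof -
   have "262144 * (B\<^sup>2 + 1) * (4 * l) + (4 * B)\<^sup>2 * l / 2 = (1048576 * (B\<^sup>2 + 1) + 8 * B\<^sup>2) * l" by (simp add: power_mult_distrib algebra_simps)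
   also have "... <= 2000000 * (B\<^sup>2 + 1) * l" using l by (intro mult_right_mono) simp_all
   finally show ?thesis .
  qed
  finally show "(\<Sum>Q\<in>D. (co i Q)\<^sup>2) <= (K12 B)\<^sup>2 * lenI T" by (simp add: co K l_def)
 qed simp
 show ?thesis unfolding size_le_def using 1 2 by blast
qed

lemma near3:
 assumes T: "T \<in> QQ" and j: "j \<in> three" and Q: "Q \<in> TR j T"
 shows "\<bar>ctrw Q 3 - ctrw T 3\<bar> <= 10^7 / 2 * lenw Q 3"
proof -
 have Qf: "Q \<in> QQ" "Q \<noteq> T" "tile_le (comp Q j) (comp T j)" using Q by (simp_all add: TR_def)
 have "\<bar>ctrw Q 3 - ctrw T 3\<bar> <= 5000000 * (lenw Q 3 - lenw T 3)"
  by (rule tree_facts(3)[OF Qf(1) T Qf(2) j Qf(3) three3])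
 then show ?thesis using lwp[OF T three3] by simp
qed

lemma size3:
 assumes C: "C \<subseteq> QQ" and \<delta>: "0 < \<delta>"
  and dn: "108 * \<delta> <= c ==> (\<And>Q I. Q \<in> C ==> in_D 0 I ==> setI Q \<subseteq> ivl_set I ==> dens PP I <= \<delta>)"
 shows "size_le 3 (co 3) (K3 B c * \<delta>) C"
proof -
 define U where "U = (if 108 * \<delta> <= c then 4 * B\<^sup>2 * \<delta> else 1024 * B\<^sup>2)"
 define V where "V = (if 108 * \<delta> <= c then \<bar>tree_dens.CB B\<bar> * \<delta>\<^sup>2 else \<bar>tree_pair.CA B c\<bar>)"
 have p: "0 <= 4 * B\<^sup>2" "0 <= sqrt \<bar>tree_dens.CB B\<bar>" "0 <= 1024 * B\<^sup>2 * (108 / c)" "0 <= sqrt \<bar>tree_pair.CA B c\<bar> * (108 / c)"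
  using c0 by simp_all
 have K3e: "K3 B c = 4 * B\<^sup>2 + sqrt \<bar>tree_dens.CB B\<bar> + 1024 * B\<^sup>2 * (108 / c) + sqrt \<bar>tree_pair.CA B c\<bar> * (108 / c) + 1"
  by (simp add: K3_def distrib_right add_divide_distrib)
 have K0: "0 <= K3 B c * \<delta>" using p \<delta> unfolding K3e by simp
 have big: "x <= x * (108 / c) * \<delta>" if "0 <= x" "\<not> 108 * \<delta> <= c" for x
 proof -
  have "1 <= 108 / c * \<delta>" using that(2) c0 by (simp add: field_simps)
  then have "x * 1 <= x * (108 / c * \<delta>)" using that(1) by (rule mult_left_mono)
  then show ?thesis by simp
 qed
 have U: "U <= K3 B c * \<delta>"
 proof (cases "108 * \<delta> <= c")
  case True
  have "4 * B\<^sup>2 * \<delta> <= K3 B c * \<delta>" using p \<delta> unfolding K3e by (intro mult_right_mono) linarith+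
  then show ?thesis using True by (simp add: U_def)
 next
  case False
  have "1024 * B\<^sup>2 <= 1024 * B\<^sup>2 * (108 / c) * \<delta>" using False by (intro big) simp_all
  also have "... <= K3 B c * \<delta>" using p \<delta> unfolding K3e by (intro mult_right_mono) linarith+
  finally show ?thesis using False by (simp add: U_def)
 qed
 have V: "V <= (K3 B c * \<delta>)\<^sup>2"
 proof (cases "108 * \<delta> <= c")
  case True
  have "sqrt \<bar>tree_dens.CB B\<bar> * \<delta> <= K3 B c * \<delta>" using p \<delta> unfolding K3e by (intro mult_right_mono) linarith+
  then have "(sqrt \<bar>tree_dens.CB B\<bar> * \<delta>)\<^sup>2 <= (K3 B c * \<delta>)\<^sup>2" using p \<delta> by (intro power_mono) simp_all
  then show ?thesis using True by (simp add: V_def power_mult_distrib)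
 next
  case False
  have "sqrt \<bar>tree_pair.CA B c\<bar> <= sqrt \<bar>tree_pair.CA B c\<bar> * (108 / c) * \<delta>" using False by (intro big) simp_all
  also have "... <= K3 B c * \<delta>" using p \<delta> unfolding K3e by (intro mult_right_mono) linarith+
  finally have "(sqrt \<bar>tree_pair.CA B c\<bar>)\<^sup>2 <= (K3 B c * \<delta>)\<^sup>2" by (intro power_mono) simp_all
  then show ?thesis using False by (simp add: V_def)
 qed
 have c3: "co 3 Q * rs Q <= U" if Q: "Q \<in> C" for Q
 proof (cases "108 * \<delta> <= c")
  case True
  have QQ: "Q \<in> QQ" using C Q by blast
  have "dens PP (tI Q) <= \<delta>" using dn[OF True Q dy[OF QQ]] by simp
  then have "4 * B\<^sup>2 * dens PP (tI Q) <= 4 * B\<^sup>2 * \<delta>" by (intro mult_left_mono) simp_all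
  then show ?thesis using co3_le(2)[OF QQ] True by (simp add: U_def)
 next
  case False
  then show ?thesis using co3_le(1)[of Q] C Q by (simp add: U_def subsetD)
 qed
 have 1: "S1 (co 3) (K3 B c * \<delta>) C"
  using order_trans[OF c3 U] by (intro S1_I C co_nonneg)
 have 2: "S2 3 s (co 3) (K3 B c * \<delta>) C" for s
 proof (rule S2_I[OF _ C])
  fix T j D assume T: "T \<in> C" "j \<in> three" "3 \<noteq> j" "D \<subseteq> C" "D \<subseteq> TR j T" "D \<noteq> {}"
  have TQ: "T \<in> QQ" and DQ: "D \<subseteq> QQ" using T C by blast+
  have lT: "0 < lenI T" using lI[OF TQ] .
  have fam: "family 3 D (\<lambda>_. T)" by (rule family_tree[OF TQ three3 T(2,3,5)])
  have nr: "\<bar>ctrw Q 3 - ctrw T 3\<bar> <= 10^7 / 2 * lenw Q 3" if "Q \<in> D" for Q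
   using near3[OF TQ T(2)] that T(5) by blast
  have "(\<Sum>Q\<in>D. (co 3 Q)\<^sup>2) <= V * lenI T"
  proof (cases "108 * \<delta> <= c")
   case True
   have "tree_dens D T (\<Phi> 3) PP \<Psi> \<gamma> B 8 c (ctrw T 3) \<delta>"
    by (rule tdens[OF fam DQ T(6) nr \<delta> True]) (use dn[OF True] T(4) in blast)+
   from tree_dens.energyB[OF this]
   have "(\<Sum>Q\<in>D. (co 3 Q)\<^sup>2) <= tree_dens.CB B * \<delta>\<^sup>2 * lenI T" by (simp add: co_def bq_def)
   also have "... <= \<bar>tree_dens.CB B\<bar> * \<delta>\<^sup>2 * lenI T" using lT by (intro mult_right_mono) simp_all
   finally show ?thesis using True by (simp add: V_def)
  next
   case False
   from tree_pair.energyA[OF tpair[OF fam DQ T(6) nr]]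
   have "(\<Sum>Q\<in>D. (co 3 Q)\<^sup>2) <= tree_pair.CA B c * lenI T" by (simp add: co_def bq_def)
   also have "... <= \<bar>tree_pair.CA B c\<bar> * lenI T" using lT by (intro mult_right_mono) simp_all
   finally show ?thesis using False by (simp add: V_def)
  qed
  also have "... <= (K3 B c * \<delta>)\<^sup>2 * lenI T" using V lT by (intro mult_right_mono) simp_all
  finally show "(\<Sum>Q\<in>D. (co 3 Q)\<^sup>2) <= (K3 B c * \<delta>)\<^sup>2 * lenI T" .
 qed
 show ?thesis unfolding size_le_def using 1 2 by blast
qed

lemma absorb:
 fixes A Z X Y :: real
 assumes "A\<^sup>2 * Z <= X" "X <= Y + (5/4 * A)\<^sup>2 * Z / 2" "0 <= Y"
 shows "A\<^sup>2 * Z <= 5 * Y"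
proof -
 have "(5/4 * A)\<^sup>2 * Z / 2 = 25/32 * (A\<^sup>2 * Z)" by (simp add: power_mult_distrib power2_eq_square)
 then show ?thesis using assms by linarith
qed

lemma rs_le_of_sq:
 assumes "(a::real)\<^sup>2 <= A\<^sup>2 * lenI Q" "0 < lenI Q" "0 <= A"
 shows "a * rs Q <= A"
proof -
 have "(a * rs Q)\<^sup>2 <= A\<^sup>2 * lenI Q * (rs Q)\<^sup>2" unfolding power_mult_distrib using assms by (intro mult_right_mono) simp_all
 also have "... = A\<^sup>2" using assms by (simp add: rs_sq)
 finally show ?thesis using assms(3) by (rule power2_le_imp_le)
qed

lemma EN3: "EN 3 (co 3) (5 * (\<bar>model_pair.C3 B c\<bar> * (1 + 1024 * B\<^sup>2) * S)) QQ"
 unfolding EN_def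
proof (intro allI impI; elim conjE)
 fix D \<tau> A assume fam: "family 3 D \<tau>" and D: "D \<subseteq> QQ" "\<tau> ` D \<subseteq> QQ" and A: "0 < A"
  and a: "\<forall>Q\<in>D. (co 3 Q)\<^sup>2 <= (5/4 * A)\<^sup>2 * lenI Q" and Z: "A\<^sup>2 * (\<Sum>T\<in>\<tau> ` D. lenI T) <= (\<Sum>Q\<in>D. (co 3 Q)\<^sup>2)"
 interpret M: model_pair D \<tau> "\<Phi> 3" PP \<Psi> \<gamma> B 8 c by (rule model[OF fam D(1)])
 have SP: "M.SP = S" by (simp add: M.SP_def S_def)
 define A' where "A' = min (5/4 * A) (1024 * B\<^sup>2)"
 have A': "0 <= A'" using A by (simp add: A'_def)
 have Z0: "0 <= (\<Sum>T\<in>\<tau> ` D. lenI T)" using lI D(2) by (intro sum_nonneg) (simp add: less_imp_le subsetD)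
 have "(\<Sum>Q\<in>D. (norm (M.bc Q))\<^sup>2) <= M.C3 * (1 + A') * M.SP + A'\<^sup>2 * (\<Sum>T\<in>\<tau> ` D. lenI T) / 2"
 proof (rule M.energy3[OF _ A'])
  fix Q assume Q: "Q \<in> D"
  then have QQ: "Q \<in> QQ" using D by blast
  have "co 3 Q * rs Q <= 5/4 * A" using a Q A by (intro rs_le_of_sq lI[OF QQ]) simp_all
  then show "norm (M.bc Q) * rs Q <= A'" using co3_le(1)[OF QQ] by (simp add: A'_def co_def bq_def)
 qed
 also have "... <= \<bar>M.C3\<bar> * (1 + 1024 * B\<^sup>2) * S + (5/4 * A)\<^sup>2 * (\<Sum>T\<in>\<tau> ` D. lenI T) / 2"
 proof (rule add_mono)
  show "M.C3 * (1 + A') * M.SP <= \<bar>M.C3\<bar> * (1 + 1024 * B\<^sup>2) * S"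
   unfolding SP using S_pos A' by (intro mult_mono) (simp_all add: A'_def)
  have "A'\<^sup>2 <= (5/4 * A)\<^sup>2" using A' by (intro power_mono) (simp_all add: A'_def)
  then show "A'\<^sup>2 * (\<Sum>T\<in>\<tau> ` D. lenI T) / 2 <= (5/4 * A)\<^sup>2 * (\<Sum>T\<in>\<tau> ` D. lenI T) / 2"
   using Z0 by (intro divide_right_mono mult_right_mono) simp_all
 qed
 finally have X: "(\<Sum>Q\<in>D. (co 3 Q)\<^sup>2) <= \<bar>M.C3\<bar> * (1 + 1024 * B\<^sup>2) * S + (5/4 * A)\<^sup>2 * (\<Sum>T\<in>\<tau> ` D. lenI T) / 2"
  by (simp add: co_def bq_def)
 show "A\<^sup>2 * (\<Sum>T\<in>\<tau> ` D. lenI T) <= 5 * (\<bar>M.C3\<bar> * (1 + 1024 * B\<^sup>2) * S)"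
  by (rule absorb[OF Z X]) (use S_pos in simp)
qed

lemma EN12_global:
 assumes i: "i \<in> {1, 2}"
 shows "EN i (co i) (5 * (262144 * (B\<^sup>2 + 1) * measure lebesgue (E i))) QQ"
 unfolding EN_def
proof (intro allI impI; elim conjE)
 fix D \<tau> A assume fam: "family i D \<tau>" and D: "D \<subseteq> QQ" "\<tau> ` D \<subseteq> QQ" and A: "0 < A"
  and a: "\<forall>Q\<in>D. (co i Q)\<^sup>2 <= (5/4 * A)\<^sup>2 * lenI Q" and Z: "A\<^sup>2 * (\<Sum>T\<in>\<tau> ` D. lenI T) <= (\<Sum>Q\<in>D. (co i Q)\<^sup>2)"
 have i3: "i \<in> three" using i by (auto simp: three_def)
 have co: "co i Q = norm (inner_L2 (F i) (\<Phi> i Q))" for Q using i by (auto simp: co_def)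
 have "(\<Sum>Q\<in>D. (norm (inner_L2 (F i) (\<Phi> i Q)))\<^sup>2)
   <= 262144 * (B\<^sup>2 + 1) * (LINT x|lebesgue. indicator (E i) x) + (5/4 * A)\<^sup>2 * (\<Sum>T\<in>\<tau> ` D. lenI T) / 2"
 proof (rule energy_le[OF fam, where m = 8 and \<beta> = 0 and c = 0])
  fix Q assume Q: "Q \<in> D"
  then have QQ: "Q \<in> QQ" using D by blast
  show "wpk B 8 (tI Q) (tw Q i) (\<Phi> i Q)" by (rule wQ[OF QQ i3])
  show "norm (inner_L2 (F i) (\<Phi> i Q)) * rs Q <= 5/4 * A"
   using a Q A unfolding co[symmetric] by (intro rs_le_of_sq lI[OF QQ]) simp_all
 next
  fix x
  have "(norm (F i x))\<^sup>2 <= (indicator (E i) x)\<^sup>2" using FE[OF i, of x] by (intro power_mono) simp_all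
  moreover have "(indicator (E i) x)\<^sup>2 = (indicator (E i) x :: real)" by (simp add: indicator_def)
  ultimately show "(norm (F i x))\<^sup>2 / (wgt 0 0 x)\<^sup>2 <= indicator (E i) x" by (simp add: wgt_def)
 next
  show "integrable lebesgue (indicator (E i) :: real => real)" using Em[OF i] Ef[OF i] by (simp add: integrable_real_indicator)
 qed (use Bw_ge Fm[OF i] F1[OF i] in simp_all)
 then have X: "(\<Sum>Q\<in>D. (co i Q)\<^sup>2) <= 262144 * (B\<^sup>2 + 1) * measure lebesgue (E i) + (5/4 * A)\<^sup>2 * (\<Sum>T\<in>\<tau> ` D. lenI T) / 2"
  using Em[OF i] by (simp add: co)
 show "A\<^sup>2 * (\<Sum>T\<in>\<tau> ` D. lenI T) <= 5 * (262144 * (B\<^sup>2 + 1) * measure lebesgue (E i))"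
  by (rule absorb[OF Z X]) simp
qed

end

subsection \<open>Density levels\<close>

lemma dens_ball:
 assumes fin: "finite PP" and l: "\<And>P. P \<in> PP ==> 0 <= lenI P" and J: "0 < len J" and \<delta>: "0 <= \<delta>" "\<delta> < dens PP J"
 shows "\<exists>r\<ge>len J. \<delta> / 16 * r <= (\<Sum>P\<in>{P\<in>PP. \<bar>ctrI P - ctr J\<bar> <= r}. lenI P)"
proof (rule ccontr)
 assume "\<not> ?thesis"
 then have no: "(\<Sum>P\<in>{P\<in>PP. \<bar>ctrI P - ctr J\<bar> <= r}. lenI P) <= \<delta> / 16 * r" if "len J <= r" for r
  using that by (meson linear)
 define \<kappa> where "\<kappa> P = (LEAST k. \<bar>ctrI P - ctr J\<bar> <= 2 ^ k * len J)" for P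
 have ex: "\<exists>k. \<bar>ctrI P - ctr J\<bar> <= 2 ^ k * len J" for P
 proof -
  obtain k where "\<bar>ctrI P - ctr J\<bar> / len J < 2 ^ k" using real_arch_pow[of 2 "\<bar>ctrI P - ctr J\<bar> / len J"] by auto
  then show ?thesis using J by (intro exI[of _ k]) (simp add: field_simps)
 qed
 have \<kappa>: "\<bar>ctrI P - ctr J\<bar> <= 2 ^ \<kappa> P * len J" for P unfolding \<kappa>_def using ex by (rule LeastI_ex)
 have chi: "chi J (ctrI P) <= 2 * (1/2) ^ \<kappa> P" for P
 proof (cases "\<kappa> P")
  case 0
  then show ?thesis using chi_le1[of J "ctrI P"] J by simp
 next
  case (Suc k)
  have "\<not> \<bar>ctrI P - ctr J\<bar> <= 2 ^ k * len J" using Suc unfolding \<kappa>_def by (intro not_less_Least) simp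
  then have "2 ^ k <= 1 + \<bar>ctrI P - ctr J\<bar> / len J" using J by (simp add: field_simps)
  then have "chi J (ctrI P) <= 1 / 2 ^ k" unfolding chi_def by (intro divide_left_mono) (simp_all add: add_pos_nonneg J less_imp_le)
  then show ?thesis using Suc by (simp add: power_one_over)
 qed
 have "(\<Sum>P\<in>PP. lenI P * chi J (ctrI P) ^ 3) <= (\<Sum>P\<in>PP. 8 * (1/8) ^ \<kappa> P * lenI P)"
 proof (rule sum_mono)
  fix P assume P: "P \<in> PP"
  have "chi J (ctrI P) ^ 3 <= (2 * (1/2) ^ \<kappa> P) ^ 3" using chi_nonneg[of J] J by (intro power_mono chi) simp_all
  also have "... = 8 * (1/8) ^ \<kappa> P"
  proof -
   have "((1/2::real) ^ \<kappa> P) ^ 3 = ((1/2) ^ 3) ^ \<kappa> P" by (simp only: power_mult[symmetric] mult.commute)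
   then show ?thesis unfolding power_mult_distrib by (simp add: power_one_over)
  qed
  finally show "lenI P * chi J (ctrI P) ^ 3 <= 8 * (1/8) ^ \<kappa> P * lenI P"
   using l[OF P] by (simp add: mult.commute mult_left_mono)
 qed
 also have "... = (\<Sum>k\<in>\<kappa> ` PP. \<Sum>P\<in>{P\<in>PP. \<kappa> P = k}. 8 * (1/8) ^ \<kappa> P * lenI P)" by (rule sum.image_gen[OF fin])
 also have "... <= (\<Sum>k\<in>\<kappa> ` PP. \<delta> * len J / 2 * (1/4) ^ k)"
 proof (rule sum_mono)
  fix k
  have "(\<Sum>P\<in>{P\<in>PP. \<kappa> P = k}. 8 * (1/8) ^ \<kappa> P * lenI P) = 8 * (1/8) ^ k * (\<Sum>P\<in>{P\<in>PP. \<kappa> P = k}. lenI P)"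
   by (simp add: sum_distrib_left)
  also have "... <= 8 * (1/8) ^ k * (\<Sum>P\<in>{P\<in>PP. \<bar>ctrI P - ctr J\<bar> <= 2 ^ k * len J}. lenI P)"
  proof (intro mult_left_mono sum_mono2)
   show "{P\<in>PP. \<kappa> P = k} \<subseteq> {P\<in>PP. \<bar>ctrI P - ctr J\<bar> <= 2 ^ k * len J}" using \<kappa> by blast
   show "0 <= lenI P" if "P \<in> {P\<in>PP. \<bar>ctrI P - ctr J\<bar> <= 2 ^ k * len J} - {P\<in>PP. \<kappa> P = k}" for P
    using that by (intro l) blast
  qed (use fin in simp_all)
  also have "... <= 8 * (1/8) ^ k * (\<delta> / 16 * (2 ^ k * len J))"
   using J by (intro mult_left_mono no) simp_all
  also have "... = \<delta> * len J / 2 * ((1/8) ^ k * 2 ^ k)" by simp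
  also have "(1/8::real) ^ k * 2 ^ k = (1/4) ^ k" unfolding power_mult_distrib[symmetric] by simp
  finally show "(\<Sum>P\<in>{P\<in>PP. \<kappa> P = k}. 8 * (1/8) ^ \<kappa> P * lenI P) <= \<delta> * len J / 2 * (1/4) ^ k" .
 qed
 also have "... = \<delta> * len J / 2 * (\<Sum>k\<in>\<kappa> ` PP. (1/4) ^ k)" by (simp only: sum_distrib_left)
 also have "... <= \<delta> * len J / 2 * (\<Sum>k. (1/4) ^ k)"
  using fin \<delta> J by (intro mult_left_mono sum_le_suminf) (simp_all add: summable_geometric)
 also have "... = \<delta> * len J * (2/3)" by (simp add: suminf_geometric)
 also have "... <= \<delta> * len J * 1" using \<delta> J by (intro mult_left_mono) simp_all
 finally have "dens PP J <= \<delta>" unfolding dens_def using J by (simp add: divide_le_eq)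
 then show False using \<delta>(2) by simp
qed

definition KE :: "real => real" where "KE B = 5 * (262144 * (B\<^sup>2 + 1) * 2560)"

definition KS :: "real => real => real" where "KS B c = 5 * (\<bar>model_pair.C3 B c\<bar> * (1 + 1024 * B\<^sup>2)) + 1"

definition KF :: "real => real => real => real" where
 "KF B c t = 210 / (1 - (4/5) powr (2 * t)) * (KE B powr (1 - t) * (K12 B * K12 B) powr t * (KS B c powr t * K3 B c powr (1 - 2 * t)))"

lemma KE_pos: "0 < KE B" by (simp add: KE_def add_nonneg_pos)
lemma KS_pos: "0 < KS B c" by (simp add: KS_def add_nonneg_pos)
lemma K12_pos: "0 < K12 B" by (simp add: K12_def add_nonneg_pos)
lemma K3_pos: "0 < c ==> 0 < K3 B c" by (simp add: K3_def add_nonneg_pos)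

lemma min_le_powr2:
 fixes x y :: real
 assumes "0 < x" "0 < y" "0 <= \<mu>" "\<mu> <= 1"
 shows "min x y <= x powr \<mu> * y powr (1 - \<mu>)"
 using min_le_powr[of x y "1 - \<mu>"] assms by simp

context pairing
begin

lemma dens_pos: "0 < len I ==> 0 < dens PP I"
 unfolding dens_def using finP PP0 lP chi_pos by (intro divide_pos_pos sum_pos) simp_all

lemma EN_mono: "EN i a X C ==> X <= Y ==> EN i a Y C"
 unfolding EN_def by (meson order_trans)

lemma EN_min: "EN i a X C ==> EN i a Y C ==> EN i a (min X Y) C"
 unfolding EN_def by simp

lemma EN12_local:
 assumes i: "i \<in> {1, 2}" and C: "C \<subseteq> QQ" and \<delta>: "0 < \<delta>"
  and dn: "\<And>Q. Q \<in> C ==> \<exists>I. in_D 0 I \<and> setI Q \<subseteq> ivl_set I \<and> \<delta> / 2 < dens PP I"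
 shows "EN i (co i) (KE B * (S / \<delta>)) C"
proof -
 define mass where "mass x r = (\<Sum>P\<in>{P\<in>PP. \<bar>ctrI P - x\<bar> <= r}. lenI P)" for x r
 have massS: "mass x r <= S" for x r
  unfolding mass_def S_def using finP lP by (intro sum_mono2) (auto intro: less_imp_le)
 have "\<exists>p. Q \<in> C \<longrightarrow> 0 < snd p \<and> setI Q \<subseteq> cball (fst p) (snd p) \<and> \<delta> / 32 * snd p <= mass (fst p) (snd p)" for Q
 proof (cases "Q \<in> C")
  case True
  then obtain I where I: "in_D 0 I" "setI Q \<subseteq> ivl_set I" "\<delta> / 2 < dens PP I" using dn by blast
  have lI': "0 < len I" using in_D_pos[OF I(1)] .
  have "\<exists>r\<ge>len I. \<delta> / 2 / 16 * r <= (\<Sum>P\<in>{P\<in>PP. \<bar>ctrI P - ctr I\<bar> <= r}. lenI P)"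
   by (rule dens_ball[OF finP less_imp_le[OF lP] lI' _ I(3)]) (use \<delta> in simp_all)
  then obtain r where r: "len I <= r" "\<delta> / 2 / 16 * r <= mass (ctr I) r" unfolding mass_def by blast
  have "ivl_set I \<subseteq> cball (ctr I) r"
  proof
   fix x assume "x \<in> ivl_set I"
   then have "\<bar>ctr I - x\<bar> <= len I / 2" unfolding mem_iv_ctr by argo
   then show "x \<in> cball (ctr I) r" using r(1) lI' by (simp add: dist_real_def)
  qed
  then show ?thesis using r I(2) lI' by (intro exI[of _ "(ctr I, r)"]) auto
 qed auto
 then obtain p where p: "\<And>Q. Q \<in> C ==> 0 < snd (p Q) \<and> setI Q \<subseteq> cball (fst (p Q)) (snd (p Q)) \<and> \<delta> / 32 * snd (p Q) <= mass (fst (p Q)) (snd (p Q))"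
  by metis
 define x where "x Q = fst (p Q)" for Q
 define r where "r Q = snd (p Q)" for Q
 have r0: "0 < r Q" and sub: "setI Q \<subseteq> cball (x Q) (r Q)" and ms: "\<delta> / 32 * r Q <= mass (x Q) (r Q)" if "Q \<in> C" for Q
  using p[OF that] by (simp_all add: x_def r_def)
 have bd: "0 < r Q \<and> r Q <= 32 * S / \<delta>" if "Q \<in> C" for Q
  using r0[OF that] order_trans[OF ms[OF that] massS] \<delta> by (simp add: field_simps)
 obtain C' where C': "C' \<subseteq> C" "pairwise (\<lambda>i j. disjnt (cball (x i) (r i)) (cball (x j) (r j))) C'"
  "\<And>Q. Q \<in> C ==> \<exists>j. j \<in> C' \<and> \<not> disjnt (cball (x Q) (r Q)) (cball (x j) (r j)) \<and> cball (x Q) (r Q) \<subseteq> ball (x j) (5 * r j)"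
 proof (rule Vitali_covering_lemma_cballs_balls[of C r _ x, OF bd])
  fix Ca assume a: "Ca \<subseteq> C" "pairwise (\<lambda>i j. disjnt (cball (x i) (r i)) (cball (x j) (r j))) Ca"
   "\<And>Q. Q \<in> C ==> \<exists>j. j \<in> Ca \<and> \<not> disjnt (cball (x Q) (r Q)) (cball (x j) (r j)) \<and> cball (x Q) (r Q) \<subseteq> ball (x j) (5 * r j)"
  show thesis by (rule that[OF a])
 qed
 then obtain jf where jf: "\<And>Q. Q \<in> C ==> jf Q \<in> C' \<and> cball (x Q) (r Q) \<subseteq> ball (x (jf Q)) (5 * r (jf Q))" by metis
 have i3: "i \<in> three" using i by (auto simp: three_def)
 have co: "co i Q = norm (inner_L2 (F i) (\<Phi> i Q))" for Q using i by (auto simp: co_def)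
 show ?thesis
  unfolding EN_def
 proof (intro allI impI; elim conjE)
  fix D \<tau> A assume fam: "family i D \<tau>" and D: "D \<subseteq> C" "\<tau> ` D \<subseteq> C" and A: "0 < A"
   and a: "\<forall>Q\<in>D. (co i Q)\<^sup>2 <= (5/4 * A)\<^sup>2 * lenI Q" and Z: "A\<^sup>2 * (\<Sum>T\<in>\<tau> ` D. lenI T) <= (\<Sum>Q\<in>D. (co i Q)\<^sup>2)"
  have finD: "finite D" using familyD(1)[OF fam] .
  have tC: "\<tau> Q \<in> C" if "Q \<in> D" for Q using D(2) that by blast
  define J where "J = jf ` \<tau> ` D"
  have finJ: "finite J" using finD by (simp add: J_def)
  have JC: "J \<subseteq> C'" unfolding J_def using D(2) jf by blast
  define Dj where "Dj j = {Q\<in>D. jf (\<tau> Q) = j}" for j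
  define W where "W j = (\<Sum>T\<in>\<tau> ` Dj j. lenI T)" for j
  have Xj: "(\<Sum>Q\<in>Dj j. (co i Q)\<^sup>2) <= 262144 * (B\<^sup>2 + 1) * (80 * r j) + (5/4 * A)\<^sup>2 * W j / 2" if j: "j \<in> J" for j
  proof -
   have rj: "0 < r j" using r0 j JC C'(1) by blast
   define l where "l = 20 * r j"
   have l: "0 < l" using rj by (simp add: l_def)
   define H where "H y = inverse (1 + ((y - x j) / l)\<^sup>2)" for y
   have Hm: "H \<in> borel_measurable borel" unfolding H_def by measurable
   have H: "integrable lebesgue H" "(LINT x|lebesgue. H x) <= 4 * l"
    using integral_inv_wgt_le[OF l, of "x j", folded H_def] integrable_lebesgue_lborel[OF Hm] integral_lebesgue_lborel[OF Hm] by simp_all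
   have "(\<Sum>Q\<in>Dj j. (norm (inner_L2 (F i) (\<Phi> i Q)))\<^sup>2)
    <= 262144 * (B\<^sup>2 + 1) * (LINT x|lebesgue. H x) + (5/4 * A)\<^sup>2 * (\<Sum>T\<in>\<tau> ` Dj j. lenI T) / 2"
   proof (rule energy_le[where i = i and m = 8 and \<beta> = "1 / l" and c = "x j"])
    show "family i (Dj j) \<tau>" by (rule family_subset[OF fam]) (auto simp: Dj_def)
    fix Q assume Q: "Q \<in> Dj j"
    then have QD: "Q \<in> D" and jQ: "jf (\<tau> Q) = j" by (simp_all add: Dj_def)
    have QQ: "Q \<in> QQ" using QD D(1) C by blast
    show "wpk B 8 (tI Q) (tw Q i) (\<Phi> i Q)" by (rule wQ[OF QQ i3])
    have lQ: "0 < lenI Q" by (rule lI[OF QQ])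
    show "norm (inner_L2 (F i) (\<Phi> i Q)) * rs Q <= 5/4 * A"
     using a QD A lQ unfolding co[symmetric] by (intro rs_le_of_sq) simp_all
    have "setI Q \<subseteq> ball (x j) (5 * r j)"
     using familyD(5)[OF fam QD] sub[OF tC[OF QD]] jf[OF tC[OF QD]] unfolding jQ by blast
    moreover have "ctrI Q \<in> setI Q" using lQ by (rule ctr_mem)
    moreover have "fst (tI Q) \<in> setI Q" using lQ by (simp add: mem_iv)
    ultimately have m: "\<bar>x j - ctrI Q\<bar> < 5 * r j" "\<bar>x j - (ctrI Q - lenI Q / 2)\<bar> < 5 * r j"
     unfolding fst_eq_ctr[symmetric] by (auto simp: subset_iff dist_real_def)
    have "lenI Q <= l" using m unfolding l_def by argo
    then show "1 / l * lenI Q <= 1" using l by simp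
    have "\<bar>ctrI Q - x j\<bar> <= l" using m(1) rj unfolding l_def by argo
    then show "1 / l * \<bar>ctrI Q - x j\<bar> <= 1" using l by simp
   next
    show "(norm (F i y))\<^sup>2 / (wgt (1 / l) (x j) y)\<^sup>2 <= H y" for y unfolding H_def by (rule wgt_bound_le[OF F1[OF i]])
   qed (use Bw_ge l Fm[OF i] F1[OF i] H in simp_all)
   also have "... <= 262144 * (B\<^sup>2 + 1) * (4 * l) + (5/4 * A)\<^sup>2 * (\<Sum>T\<in>\<tau> ` Dj j. lenI T) / 2"
    using H(2) by (intro add_right_mono mult_left_mono) simp_all
   finally show ?thesis by (simp add: co W_def l_def)
  qed
  have sumr: "(\<Sum>j\<in>J. r j) <= 32 * S / \<delta>"
  proof -
   define PJ where "PJ j = {P\<in>PP. \<bar>ctrI P - x j\<bar> <= r j}" for j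
   have "(\<Sum>j\<in>J. r j) <= (\<Sum>j\<in>J. 32 / \<delta> * mass (x j) (r j))"
   proof (rule sum_mono)
    fix j assume "j \<in> J"
    then have "j \<in> C" using JC C'(1) by blast
    from ms[OF this] show "r j <= 32 / \<delta> * mass (x j) (r j)" using \<delta> by (simp add: field_simps)
   qed
   also have "... = 32 / \<delta> * (\<Sum>j\<in>J. \<Sum>P\<in>PJ j. lenI P)" by (simp only: sum_distrib_left mass_def PJ_def)
   also have "(\<Sum>j\<in>J. \<Sum>P\<in>PJ j. lenI P) = (\<Sum>P\<in>(\<Union>j\<in>J. PJ j). lenI P)"
   proof (rule sum.UNION_disjoint[symmetric, OF finJ])
    show "\<forall>j\<in>J. finite (PJ j)" using finP by (simp add: PJ_def)
    show "\<forall>j\<in>J. \<forall>k\<in>J. j \<noteq> k \<longrightarrow> PJ j \<inter> PJ k = {}"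
    proof (intro ballI impI, rule ccontr)
     fix j k assume jk: "j \<in> J" "k \<in> J" "j \<noteq> k" and "PJ j \<inter> PJ k \<noteq> {}"
     then obtain P where "P \<in> PJ j" "P \<in> PJ k" by blast
     then have "ctrI P \<in> cball (x j) (r j) \<inter> cball (x k) (r k)" by (simp add: PJ_def dist_real_def abs_minus_commute)
     moreover have "disjnt (cball (x j) (r j)) (cball (x k) (r k))" using C'(2) jk JC unfolding pairwise_def by blast
     ultimately show False by (auto simp: disjnt_def)
    qed
   qed
   also have "... <= S" unfolding S_def PJ_def
   proof (rule sum_mono2[OF finP])
    show "0 <= lenI P" if "P \<in> PP - (\<Union>j\<in>J. {P\<in>PP. \<bar>ctrI P - x j\<bar> <= r j})" for P
     using that by (intro less_imp_le[OF lP]) blast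
   qed blast
   finally show ?thesis using \<delta> by (simp add: mult_left_mono divide_right_mono)
  qed
  have "(\<Sum>Q\<in>D. (co i Q)\<^sup>2) = (\<Sum>j\<in>J. \<Sum>Q\<in>Dj j. (co i Q)\<^sup>2)"
   unfolding J_def Dj_def image_image by (rule sum.image_gen[OF finD])
  also have "... <= (\<Sum>j\<in>J. 262144 * (B\<^sup>2 + 1) * (80 * r j) + (5/4 * A)\<^sup>2 * W j / 2)" by (rule sum_mono) (rule Xj)
  also have "... = 262144 * (B\<^sup>2 + 1) * 80 * (\<Sum>j\<in>J. r j) + (5/4 * A)\<^sup>2 * (\<Sum>j\<in>J. W j) / 2"
   by (simp only: sum.distrib sum_distrib_left sum_divide_distrib mult.assoc)
  also have "(\<Sum>j\<in>J. W j) = (\<Sum>T\<in>\<tau> ` D. lenI T)"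
  proof -
   have "\<tau> ` Dj j = {T\<in>\<tau> ` D. jf T = j}" for j by (auto simp: Dj_def)
   then show ?thesis unfolding W_def J_def using sum.image_gen[of "\<tau> ` D" "\<lambda>T. lenI T" jf] finD by simp
  qed
  also have "262144 * (B\<^sup>2 + 1) * 80 * (\<Sum>j\<in>J. r j) <= 262144 * (B\<^sup>2 + 1) * 80 * (32 * S / \<delta>)"
   using sumr by (intro mult_left_mono) simp_all
  finally have X: "(\<Sum>Q\<in>D. (co i Q)\<^sup>2) <= 262144 * (B\<^sup>2 + 1) * 80 * (32 * S / \<delta>) + (5/4 * A)\<^sup>2 * (\<Sum>T\<in>\<tau> ` D. lenI T) / 2" by simp
  have "A\<^sup>2 * (\<Sum>T\<in>\<tau> ` D. lenI T) <= 5 * (262144 * (B\<^sup>2 + 1) * 80 * (32 * S / \<delta>))"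
   by (rule absorb[OF Z X]) (use S_pos \<delta> in simp)
  also have "... = KE B * (S / \<delta>)" by (simp add: KE_def)
  finally show "A\<^sup>2 * (\<Sum>T\<in>\<tau> ` D. lenI T) <= KE B * (S / \<delta>)" .
 qed
qed

lemma Lam_level:
 assumes C: "C \<subseteq> QQ" and \<delta>: "0 < \<delta>"
  and dn: "\<And>Q. Q \<in> C ==> \<exists>I. in_D 0 I \<and> setI Q \<subseteq> ivl_set I \<and> \<delta> / 2 < dens PP I"
  and up: "108 * \<delta> <= c ==> (\<And>Q I. Q \<in> C ==> in_D 0 I ==> setI Q \<subseteq> ivl_set I ==> dens PP I <= \<delta>)"
  and m: "\<And>i. i \<in> {1, 2} ==> 0 < measure lebesgue (E i)"
  and t: "0 < t" "t <= 1/4" "t <= \<theta>" "\<theta> < 1"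
 shows "Lam co C <= KF B c t * ((measure lebesgue (E 1) * measure lebesgue (E 2)) powr ((1 - \<theta>) / 2) * S powr \<theta>) * \<delta> powr (1 - \<theta> - t)"
proof -
 define M where "M i = measure lebesgue (E i)" for i
 have M: "0 < M 1" "0 < M 2" using m by (simp_all add: M_def)
 define e where "e i = sqrt (if i = 3 then KS B c * S else KE B * min (M i) (S / \<delta>))" for i :: nat
 define Bs where "Bs i = (if i = 3 then K3 B c * \<delta> else K12 B)" for i :: nat
 have Sd: "0 < S / \<delta>" using S_pos \<delta> by simp
 have c3: "i \<in> {1, 2} \<or> i = 3" if "i \<in> three" for i using that by (auto simp: three_def)
 have e0: "0 < e i" if i: "i \<in> three" for i
  using c3[OF i] M Sd KE_pos KS_pos S_pos by (auto simp: e_def)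
 have ee: "(e i)\<^sup>2 = (if i = 3 then KS B c * S else KE B * min (M i) (S / \<delta>))" if i: "i \<in> three" for i
  using e0[OF i] unfolding e_def by simp
 have B0: "0 < Bs i" for i using K3_pos[OF c0] K12_pos \<delta> by (simp add: Bs_def)
 have EN: "EN i (co i) ((e i)\<^sup>2) C" if i: "i \<in> three" for i
  using c3[OF i]
 proof
  assume i12: "i \<in> {1, 2}"
  have "EN i (co i) (KE B * M i) C"
   using EN_sub[OF EN12_global[OF i12] C]       unfolding M_def
   by (rule EN_mono) (simp only: mult.assoc[symmetric] KE_def, rule mult_right_mono, simp_all)
  then have "EN i (co i) (min (KE B * M i) (KE B * (S / \<delta>))) C" by (rule EN_min[OF _ EN12_local[OF i12 C \<delta> dn]])
  moreover have "min (KE B * M i) (KE B * (S / \<delta>)) = (e i)\<^sup>2"     proof -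
   have "i \<noteq> 3" using i12 by auto
   then show ?thesis unfolding ee[OF i] using KE_pos[of B] by (simp add: min_mult_distrib_left del: times_divide_eq_right)
  qed
  ultimately show ?thesis by simp
 next
  assume "i = 3"
  then show ?thesis unfolding ee[OF i] using EN_sub[OF EN3 C] S_pos by (auto simp: KS_def algebra_simps intro: EN_mono)
 qed
 have sz: "size_le i (co i) (Bs i) C" if i: "i \<in> three" for i
  using c3[OF i]
 proof
  assume i12: "i \<in> {1, 2}"
  then show ?thesis using size_sub[OF size12[OF i12] C order_refl] by (auto simp: Bs_def)
 next
  assume "i = 3"
  then show ?thesis using size3[OF C \<delta> up] by (simp add: Bs_def)
 qed
 define \<mu> where "\<mu> = (1 - \<theta>) / (1 - t)"
 have \<mu>: "0 <= \<mu>" "\<mu> <= 1" using t by (simp_all add: \<mu>_def)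
 have \<mu>1: "\<mu> / 2 * (1 - t) = (1 - \<theta>) / 2" "(1 - \<mu>) * (1 - t) = \<theta> - t" using t by (simp_all add: \<mu>_def field_simps)
 have L: "Lam co C <= 210 / (1 - (4/5) powr (2 * t)) * ((e 1 * e 2) powr (1 - t) * (Bs 1 * Bs 2) powr t * (e 3 powr (2 * t) * Bs 3 powr (1 - 2 * t)))"
  by (rule Lam_le[OF C e0 B0 co_nonneg EN sz t(1,2)])
 have q: "(4/5::real) powr (2 * t) < 1" using powr_less_mono2[of "2 * t" "4/5" 1] t by simp
 have "e 1 * e 2 = sqrt ((KE B * min (M 1) (S / \<delta>)) * (KE B * min (M 2) (S / \<delta>)))" by (simp add: e_def real_sqrt_mult)
 also have "... <= sqrt ((KE B * (M 1 powr \<mu> * (S / \<delta>) powr (1 - \<mu>))) * (KE B * (M 2 powr \<mu> * (S / \<delta>) powr (1 - \<mu>))))"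
  using M Sd \<mu> KE_pos[of B] by (intro real_sqrt_le_mono mult_mono mult_left_mono min_le_powr2 mult_nonneg_nonneg) (simp_all add: less_imp_le)
 also have "... = sqrt ((KE B * ((M 1 * M 2) powr (\<mu> / 2) * (S / \<delta>) powr (1 - \<mu>)))\<^sup>2)"
 proof -
  have "(x powr (\<mu> / 2))\<^sup>2 = x powr \<mu>" for x :: real by (simp add: power2_eq_square powr_add[symmetric])
  then show ?thesis unfolding power_mult_distrib by (simp add: powr_mult power2_eq_square mult_ac)
 qed
 also have "... = KE B * ((M 1 * M 2) powr (\<mu> / 2) * (S / \<delta>) powr (1 - \<mu>))" using KE_pos[of B] by simp
 finally have e12: "e 1 * e 2 <= KE B * ((M 1 * M 2) powr (\<mu> / 2) * (S / \<delta>) powr (1 - \<mu>))" .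
 have "(e 1 * e 2) powr (1 - t) <= (KE B * ((M 1 * M 2) powr (\<mu> / 2) * (S / \<delta>) powr (1 - \<mu>))) powr (1 - t)"
  using e12 e0[of 1] e0[of 2] t by (intro powr_mono2) (simp_all add: three_def)
 also have "... = KE B powr (1 - t) * ((M 1 * M 2) powr ((1 - \<theta>) / 2) * (S / \<delta>) powr (\<theta> - t))"
  by (simp only: powr_mult powr_powr \<mu>1)
 also have "(S / \<delta>) powr (\<theta> - t) = S powr (\<theta> - t) * \<delta> powr (t - \<theta>)"
  using S_pos \<delta> by (simp add: powr_divide powr_diff)
 finally have 1: "(e 1 * e 2) powr (1 - t) <= KE B powr (1 - t) * ((M 1 * M 2) powr ((1 - \<theta>) / 2) * (S powr (\<theta> - t) * \<delta> powr (t - \<theta>)))" .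
 have 2: "e 3 powr (2 * t) = KS B c powr t * S powr t"
 proof -
  have "e 3 powr (2 * t) = ((e 3) powr 2) powr t" by (simp add: powr_powr)
  also have "e 3 powr 2 = KS B c * S" using e0[OF three3] ee[OF three3] by (simp add: powr_numeral)
  finally show ?thesis by (simp add: powr_mult)
 qed
 have "Lam co C <= 210 / (1 - (4/5) powr (2 * t)) * ((KE B powr (1 - t) * ((M 1 * M 2) powr ((1 - \<theta>) / 2) * (S powr (\<theta> - t) * \<delta> powr (t - \<theta>)))) *
   (Bs 1 * Bs 2) powr t * (e 3 powr (2 * t) * Bs 3 powr (1 - 2 * t)))"
  using q by (intro order_trans[OF L] mult_left_mono mult_right_mono 1) simp_all
 also have "... = 210 / (1 - (4/5) powr (2 * t)) * ((KE B powr (1 - t) * ((M 1 * M 2) powr ((1 - \<theta>) / 2) * (S powr (\<theta> - t) * \<delta> powr (t - \<theta>)))) *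
   (K12 B * K12 B) powr t * ((KS B c powr t * S powr t) * (K3 B c powr (1 - 2 * t) * \<delta> powr (1 - 2 * t))))"
  unfolding 2 Bs_def by (simp add: powr_mult)
 also have "... = KF B c t * ((M 1 * M 2) powr ((1 - \<theta>) / 2) * (S powr (\<theta> - t) * S powr t)) * (\<delta> powr (t - \<theta>) * \<delta> powr (1 - 2 * t))"
  unfolding KF_def by (simp only: mult_ac)
 also have "S powr (\<theta> - t) * S powr t = S powr \<theta>" by (simp add: powr_add[symmetric])
 also have "\<delta> powr (t - \<theta>) * \<delta> powr (1 - 2 * t) = \<delta> powr (1 - \<theta> - t)" by (simp add: powr_add[symmetric])
 finally show ?thesis unfolding M_def .
qed

lemma Lam_total:
 assumes m: "\<And>i. i \<in> {1, 2} ==> 0 < measure lebesgue (E i)" and t: "0 < t" "t <= 1/4" "t <= \<theta>" "\<theta> + t < 1"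
 shows "Lam co QQ <= KF B c t / (1 - (1/2) powr (1 - \<theta> - t)) * ((measure lebesgue (E 1) * measure lebesgue (E 2)) powr ((1 - \<theta>) / 2) * S powr \<theta>)"
proof -
 define lev where "lev Q = (LEAST d. \<exists>I. in_D 0 I \<and> setI Q \<subseteq> ivl_set I \<and> (1/2) ^ d / 2 < dens PP I)" for Q
 have ex: "\<exists>d I. in_D 0 I \<and> setI Q \<subseteq> ivl_set I \<and> (1/2) ^ d / 2 < dens PP I" if Q: "Q \<in> QQ" for Q
 proof -
  obtain d where "(1/2::real) ^ d < 2 * dens PP (tI Q)" using real_arch_pow_inv[of "2 * dens PP (tI Q)" "1/2"] dens_pos[OF lI[OF Q]] by auto
  then show ?thesis using dy[OF Q] by (intro exI[of _ d] exI[of _ "tI Q"]) simp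
 qed
 define W where "W = KF B c t * ((measure lebesgue (E 1) * measure lebesgue (E 2)) powr ((1 - \<theta>) / 2) * S powr \<theta>)"
 define q where "q = (1/2::real) powr (1 - \<theta> - t)"
 have q: "0 < q" "q < 1" using powr_less_mono2[of "1 - \<theta> - t" "1/2::real" 1] t by (simp_all add: q_def)
 have "(4/5::real) powr (2 * t) < 1" using powr_less_mono2[of "2 * t" "4/5" 1] t by simp
 then have W0: "0 <= W" unfolding W_def KF_def by (intro mult_nonneg_nonneg) simp_all
 have lv: "Lam co {Q\<in>QQ. lev Q = d} <= W * q ^ d" for d
 proof -
  have pw: "((1/2::real) ^ d) powr (1 - \<theta> - t) = q ^ d"
   unfolding q_def by (simp add: powr_realpow[symmetric] powr_powr mult.commute)
  have "Lam co {Q\<in>QQ. lev Q = d} <= W * ((1/2) ^ d) powr (1 - \<theta> - t)"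
   unfolding W_def
  proof (rule Lam_level)
   fix Q assume "Q \<in> {Q\<in>QQ. lev Q = d}"
   then have Q: "Q \<in> QQ" "lev Q = d" by simp_all
   show "\<exists>I. in_D 0 I \<and> setI Q \<subseteq> ivl_set I \<and> (1/2) ^ d / 2 < dens PP I"
    unfolding Q(2)[symmetric] unfolding lev_def by (rule LeastI_ex[OF ex[OF Q(1)]])
  next
   fix Q I assume d: "108 * (1/2::real) ^ d <= c" and "Q \<in> {Q\<in>QQ. lev Q = d}" and I: "in_D 0 I" "setI Q \<subseteq> ivl_set I"
   then have Q: "lev Q = d" by simp
   have "d \<noteq> 0" using d c1 by (intro notI) simp
   then obtain d' where d': "d = Suc d'" by (cases d) simp_all
   then have "\<not> (\<exists>I. in_D 0 I \<and> setI Q \<subseteq> ivl_set I \<and> (1/2) ^ d' / 2 < dens PP I)"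
    using Q unfolding lev_def by (intro not_less_Least) simp
   then have "\<not> (1/2) ^ d' / 2 < dens PP I" using I by blast
   then show "dens PP I <= (1/2) ^ d" unfolding d' by simp
  qed (use m t in simp_all)
  then show ?thesis by (simp only: pw)
 qed
 have "Lam co QQ = (\<Sum>d\<in>lev ` QQ. Lam co {Q\<in>QQ. lev Q = d})" unfolding Lam_def by (rule sum.image_gen[OF fin])
 also have "... <= (\<Sum>d\<in>lev ` QQ. W * q ^ d)" by (rule sum_mono) (rule lv)
 also have "... = W * (\<Sum>d\<in>lev ` QQ. q ^ d)" by (simp only: sum_distrib_left)
 also have "... <= W * (\<Sum>d. q ^ d)"
  using fin q W0 by (intro mult_left_mono sum_le_suminf) (simp_all add: summable_geometric)
 also have "... = W / (1 - q)" using q by (simp add: suminf_geometric)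
 finally show ?thesis unfolding W_def q_def by simp
qed

end

subsection \<open>Averaging in alpha and the level set estimate\<close>

lemma lebesgue_borel_rep:
 fixes f :: "real => complex"
 assumes "f \<in> borel_measurable lebesgue"
 obtains f' where "f' \<in> borel_measurable borel" "AE x in lebesgue. f x = f' x"
proof -
 have "(\<lambda>x. Re (f x)) \<in> borel_measurable (completion lborel)" "(\<lambda>x. Im (f x)) \<in> borel_measurable (completion lborel)"
  using assms by measurable
 then obtain g h where g: "g \<in> borel_measurable lborel" "AE x in lborel. Re (f x) = g x" and h: "h \<in> borel_measurable lborel" "AE x in lborel. Im (f x) = h x"
  using completion_ex_borel_measurable_real by metis
 show thesis
 proof
  show "(\<lambda>x. Complex (g x) (h x)) \<in> borel_measurable borel" using g(1) h(1) unfolding Complex_eq by simp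
  show "AE x in lebesgue. f x = Complex (g x) (h x)"
   using AE_completion[OF g(2)] AE_completion[OF h(2)] by eventually_elim (simp add: complex_eq_iff)
 qed
qed

lemma borel_measurable_cnj [measurable]:
 "f \<in> borel_measurable M ==> (\<lambda>x. cnj (f x)) \<in> borel_measurable M"
 by (erule measurable_compose) (intro borel_measurable_continuous_onI continuous_intros)

lemma inner_L2_measurable:
 assumes f: "f \<in> borel_measurable lebesgue" and \<Phi>: "(\<lambda>(\<alpha>, x). \<Phi> \<alpha> x) \<in> borel_measurable (borel :: (real \<times> real) measure)"
 shows "(\<lambda>\<alpha>. inner_L2 f (\<Phi> \<alpha>)) \<in> borel_measurable borel"
proof -
 obtain f' where f': "f' \<in> borel_measurable borel" "AE x in lebesgue. f x = f' x" by (rule lebesgue_borel_rep[OF f])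
 have [measurable]: "(\<lambda>(\<alpha>, x). \<Phi> \<alpha> x) \<in> borel_measurable (borel \<Otimes>\<^sub>M lborel)"
  using \<Phi> by (simp add: borel_prod[symmetric] cong: measurable_cong_sets sets_pair_measure_cong)
 have m: "\<Phi> \<alpha> \<in> borel_measurable borel" for \<alpha> using measurable_Pair2[of "\<lambda>(\<alpha>, x). \<Phi> \<alpha> x" borel borel borel \<alpha>] \<Phi> by (simp add: borel_prod)
 have "inner_L2 f (\<Phi> \<alpha>) = (LINT x|lborel. f' x * cnj (\<Phi> \<alpha> x))" for \<alpha>
 proof -
  have bm: "(\<lambda>x. f' x * cnj (\<Phi> \<alpha> x)) \<in> borel_measurable borel" using f'(1) m[of \<alpha>] by simp
  have "inner_L2 f (\<Phi> \<alpha>) = (LINT x|lebesgue. f' x * cnj (\<Phi> \<alpha> x))"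
   unfolding inner_L2_def
  proof (rule integral_cong_AE)
   show "(\<lambda>x. f' x * cnj (\<Phi> \<alpha> x)) \<in> borel_measurable lebesgue" using bm by (intro measurable_completion) simp
   have "(\<lambda>x. cnj (\<Phi> \<alpha> x)) \<in> borel_measurable lebesgue" using m[of \<alpha>] by (intro measurable_completion) simp
   then show "(\<lambda>x. f x * cnj (\<Phi> \<alpha> x)) \<in> borel_measurable lebesgue" using f by (rule borel_measurable_times[rotated])
   show "AE x in lebesgue. f x * cnj (\<Phi> \<alpha> x) = f' x * cnj (\<Phi> \<alpha> x)" using f'(2) by eventually_elim simp
  qed
  then show ?thesis using integral_lebesgue_lborel[OF bm] by simp
 qed
 moreover have [measurable]: "f' \<in> borel_measurable borel" "(\<lambda>(\<alpha>, x). \<Phi> \<alpha> x) \<in> borel_measurable (borel \<Otimes>\<^sub>M borel)"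
  using f'(1) \<Phi> by (simp_all add: borel_prod)
 moreover have "(\<lambda>\<alpha>. (LINT x|lborel. f' x * cnj (\<Phi> \<alpha> x))) \<in> borel_measurable borel"
  by (intro lborel.borel_measurable_lebesgue_integral) measurable
 ultimately show ?thesis by simp
qed

lemma fubini_unit:
 fixes h :: "real => complex" and \<Phi> :: "real => real => complex" and \<Psi> :: "real => complex"
 assumes h: "h \<in> borel_measurable borel" and \<Phi>: "(\<lambda>(\<alpha>, x). \<Phi> \<alpha> x) \<in> borel_measurable (borel :: (real \<times> real) measure)"
  and bd: "\<forall>\<alpha>\<in>{0..1}. \<forall>x. norm (h \<alpha> * \<Phi> \<alpha> x) <= M" and \<Psi>: "integrable lborel \<Psi>"
 shows "set_integrable lborel {0..1} (\<lambda>\<alpha>. h \<alpha> * \<Phi> \<alpha> x)"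
  "integrable lborel (\<lambda>x. (LINT \<alpha>:{0..1}|lborel. h \<alpha> * \<Phi> \<alpha> x) * cnj (\<Psi> x))"
  "(\<lambda>x. (LINT \<alpha>:{0..1}|lborel. h \<alpha> * \<Phi> \<alpha> x)) \<in> borel_measurable borel"
  "set_integrable lborel {0..1} (\<lambda>\<alpha>. h \<alpha> * (LINT x|lborel. \<Phi> \<alpha> x * cnj (\<Psi> x)))"
  "(LINT x|lborel. (LINT \<alpha>:{0..1}|lborel. h \<alpha> * \<Phi> \<alpha> x) * cnj (\<Psi> x)) = (LINT \<alpha>:{0..1}|lborel. h \<alpha> * (LINT x|lborel. \<Phi> \<alpha> x * cnj (\<Psi> x)))"
proof -
 note M = bd[rule_format]
 have M0: "0 <= M" using order_trans[OF norm_ge_zero M[of 0 0]] by simp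
 have [measurable]: "h \<in> borel_measurable borel" by fact
 have [measurable]: "\<Psi> \<in> borel_measurable borel" using borel_measurable_integrable[OF \<Psi>] by simp
 have [measurable]: "(\<lambda>(\<alpha>, x). \<Phi> \<alpha> x) \<in> borel_measurable (borel \<Otimes>\<^sub>M borel)" using \<Phi> by (simp add: borel_prod)
 have [measurable]: "(\<lambda>(\<alpha>, x). \<Phi> \<alpha> x) \<in> borel_measurable (lborel \<Otimes>\<^sub>M lborel)"
  using \<Phi> by (simp add: borel_prod[symmetric] cong: measurable_cong_sets sets_pair_measure_cong)
 define G where "G \<alpha> x = indicator {0..1} \<alpha> *\<^sub>R (h \<alpha> * \<Phi> \<alpha> x * cnj (\<Psi> x))" for \<alpha> x
 have G1: "G \<alpha> x = (indicator {0..1} \<alpha> *\<^sub>R (h \<alpha> * \<Phi> \<alpha> x)) * cnj (\<Psi> x)" for \<alpha> x by (simp add: G_def)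
 have G2: "G \<alpha> x = (indicator {0..1} \<alpha> *\<^sub>R h \<alpha>) * (\<Phi> \<alpha> x * cnj (\<Psi> x))" for \<alpha> x by (simp add: G_def)
 have Gb: "norm (G \<alpha> x) <= indicator {0..1} \<alpha> * (M * norm (\<Psi> x))" for \<alpha> x
  using mult_right_mono[OF M[of \<alpha> x], of "norm (\<Psi> x)"] by (cases "\<alpha> \<in> {0..1}") (simp_all add: G_def norm_mult)
 have Gm: "(\<lambda>(\<alpha>, x). G \<alpha> x) \<in> borel_measurable (lborel \<Otimes>\<^sub>M lborel)" unfolding G_def by measurable
 have Gx: "integrable lborel (G \<alpha>)" for \<alpha>
 proof (rule Bochner_Integration.integrable_bound[OF integrable_mult_right[OF integrable_norm[OF \<Psi>], of "indicator {0..1} \<alpha> * M"]])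
  show "G \<alpha> \<in> borel_measurable lborel" using measurable_Pair2[OF Gm, of \<alpha>] by simp
  show "AE x in lborel. norm (G \<alpha> x) <= norm (indicator {0..1} \<alpha> * M * norm (\<Psi> x))"
   using Gb[of \<alpha>] M0 by (intro AE_I2) (simp add: mult.assoc abs_mult)
 qed
 have Gi: "integrable (lborel \<Otimes>\<^sub>M lborel) (\<lambda>(\<alpha>, x). G \<alpha> x)"
 proof (rule lborel_pair.Fubini_integrable[OF Gm])
  define N where "N = (LINT x|lborel. norm (\<Psi> x))"
  have i01: "integrable lborel (\<lambda>\<alpha>::real. indicator {0..1} \<alpha> * (M * N))"
   by (intro integrable_mult_left integrable_real_indicator) simp_all
  show "integrable lborel (\<lambda>\<alpha>. LINT x|lborel. norm (case (\<alpha>, x) of (\<alpha>, x) => G \<alpha> x))"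
  proof (rule Bochner_Integration.integrable_bound[OF i01])
   show "(\<lambda>\<alpha>. LINT x|lborel. norm (case (\<alpha>, x) of (\<alpha>, x) => G \<alpha> x)) \<in> borel_measurable lborel"
    by (intro lborel.borel_measurable_lebesgue_integral) (use measurable_compose[OF Gm borel_measurable_norm] in \<open>simp add: case_prod_unfold\<close>)
   have "(LINT x|lborel. norm (G \<alpha> x)) <= indicator {0..1} \<alpha> * (M * N)" for \<alpha>
   proof -
    have "(LINT x|lborel. norm (G \<alpha> x)) <= (LINT x|lborel. indicator {0..1} \<alpha> * (M * norm (\<Psi> x)))"
     using Gb by (intro integral_mono integrable_norm Gx integrable_mult_right integrable_norm \<Psi>) simp
    then show ?thesis by (simp add: N_def)
   qed
   moreover have "0 <= (LINT x|lborel. norm (G \<alpha> x))" for \<alpha> by simp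
   ultimately show "AE \<alpha> in lborel. norm (LINT x|lborel. norm (case (\<alpha>, x) of (\<alpha>, x) => G \<alpha> x)) <= norm (indicator {0..1} \<alpha> * (M * N))"
    by (intro AE_I2) (simp, rule order_trans[OF _ abs_ge_self], assumption?)
  qed
  show "AE \<alpha> in lborel. integrable lborel (\<lambda>x. case (\<alpha>, x) of (\<alpha>, x) => G \<alpha> x)" using Gx by (intro AE_I2) simp
 qed
 have e1: "(LINT \<alpha>|lborel. G \<alpha> x) = (LINT \<alpha>:{0..1}|lborel. h \<alpha> * \<Phi> \<alpha> x) * cnj (\<Psi> x)" for x
  unfolding G1 set_lebesgue_integral_def by (rule integral_mult_left_zero)
 have e2: "(LINT x|lborel. G \<alpha> x) = indicator {0..1} \<alpha> *\<^sub>R (h \<alpha> * (LINT x|lborel. \<Phi> \<alpha> x * cnj (\<Psi> x)))" for \<alpha>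
  unfolding G2 integral_mult_right_zero by simp
 show "set_integrable lborel {0..1} (\<lambda>\<alpha>. h \<alpha> * \<Phi> \<alpha> x)"
  unfolding set_integrable_def
 proof (rule Bochner_Integration.integrable_bound)
  show "integrable lborel (\<lambda>\<alpha>::real. indicator {0..1} \<alpha> * M)" by (intro integrable_mult_left integrable_real_indicator) simp_all
  have [measurable]: "(\<lambda>\<alpha>. \<Phi> \<alpha> x) \<in> borel_measurable borel"
   using measurable_Pair1[of "\<lambda>(\<alpha>, x). \<Phi> \<alpha> x" borel borel borel x] \<Phi> by (simp add: borel_prod)
  show "(\<lambda>\<alpha>. indicator {0..1} \<alpha> *\<^sub>R (h \<alpha> * \<Phi> \<alpha> x)) \<in> borel_measurable lborel" by measurable
  show "AE \<alpha> in lborel. norm (indicator {0..1} \<alpha> *\<^sub>R (h \<alpha> * \<Phi> \<alpha> x)) <= norm (indicator {0..1} \<alpha> * M)"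
   using M M0 by (intro AE_I2) (simp add: indicator_def)
 qed
 show "integrable lborel (\<lambda>x. (LINT \<alpha>:{0..1}|lborel. h \<alpha> * \<Phi> \<alpha> x) * cnj (\<Psi> x))"
  using lborel_pair.integrable_snd[OF Gi] unfolding e1 .
 show "(\<lambda>x. (LINT \<alpha>:{0..1}|lborel. h \<alpha> * \<Phi> \<alpha> x)) \<in> borel_measurable borel"
 proof -
  have "(\<lambda>(x, \<alpha>). \<Phi> \<alpha> x) \<in> borel_measurable (borel \<Otimes>\<^sub>M lborel)"
   using measurable_compose[OF measurable_pair_swap', of _ borel borel, OF \<open>(\<lambda>(\<alpha>, x). \<Phi> \<alpha> x) \<in> borel_measurable (borel \<Otimes>\<^sub>M borel)\<close>]
   by (simp add: case_prod_unfold cong: measurable_cong_sets sets_pair_measure_cong)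
  then show ?thesis unfolding set_lebesgue_integral_def by (intro lborel.borel_measurable_lebesgue_integral) measurable
 qed
 show "set_integrable lborel {0..1} (\<lambda>\<alpha>. h \<alpha> * (LINT x|lborel. \<Phi> \<alpha> x * cnj (\<Psi> x)))"
  using lborel_pair.integrable_fst[OF Gi] unfolding e2 set_integrable_def .
 show "(LINT x|lborel. (LINT \<alpha>:{0..1}|lborel. h \<alpha> * \<Phi> \<alpha> x) * cnj (\<Psi> x)) = (LINT \<alpha>:{0..1}|lborel. h \<alpha> * (LINT x|lborel. \<Phi> \<alpha> x * cnj (\<Psi> x)))"
  using lborel_pair.Fubini_integral[OF Gi] unfolding e1 e2 set_lebesgue_integral_def .
qed

lemma set_lint_sum:
 fixes f :: "'a => 'b => complex"
 assumes "\<And>i. i \<in> I ==> set_integrable M A (f i)"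
 shows "(LINT x:A|M. \<Sum>i\<in>I. f i x) = (\<Sum>i\<in>I. LINT x:A|M. f i x)" "set_integrable M A (\<lambda>x. \<Sum>i\<in>I. f i x)"
proof -
 note a = assms[unfolded set_integrable_def]
 show "(LINT x:A|M. \<Sum>i\<in>I. f i x) = (\<Sum>i\<in>I. LINT x:A|M. f i x)"
  unfolding set_lebesgue_integral_def scaleR_sum_right using a by (rule Bochner_Integration.integral_sum)
 show "set_integrable M A (\<lambda>x. \<Sum>i\<in>I. f i x)"
  unfolding set_integrable_def scaleR_sum_right using a by (rule Bochner_Integration.integrable_sum)
qed

lemma duality_bound:
 fixes \<Phi> :: "real => nat => tritile => real => complex" and c :: real
 assumes finP: "finite PP" and finQ: "finite QQ" and lP: "\<And>P. P \<in> PP ==> 0 < lenI P" and lQ: "\<And>Q. Q \<in> QQ ==> 0 < lenI Q"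
  and B: "0 <= B" and wQ: "\<And>Q k \<alpha>. Q \<in> QQ ==> k \<in> three ==> \<alpha> \<in> {0..1} ==> wpk B 8 (tI Q) (tw Q k) (\<Phi> \<alpha> k Q)"
  and mQ: "\<And>Q k. Q \<in> QQ ==> k \<in> three ==> (\<lambda>(\<alpha>, x). \<Phi> \<alpha> k Q x) \<in> borel_measurable borel"
  and wP: "\<And>P. P \<in> PP ==> wpk B 8 (tI P) (tw P 2) (\<Psi> P)"
  and f2: "f2 \<in> borel_measurable lebesgue" "\<And>x. norm (f2 x) <= 1" and f3: "f3 \<in> borel_measurable lebesgue" "\<And>x. norm (f3 x) <= 1"
  and bd: "\<And>\<alpha> \<gamma>. \<alpha> \<in> {0..1} ==> (\<And>P. P \<in> PP ==> norm (\<gamma> P) * rs P <= 1) ==>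
    (\<Sum>Q\<in>QQ. rs Q * (norm (inner_L2 f2 (\<Phi> \<alpha> 1 Q)) * norm (inner_L2 f3 (\<Phi> \<alpha> 2 Q)) *
     norm (\<Sum>P\<in>{P\<in>PP. cc_sub c (tw Q 3) (tw P 2)}. \<gamma> P * (LINT x|lborel. \<Psi> P x * cnj (\<Phi> \<alpha> 3 Q x))))) <= V"
 shows "(\<Sum>P\<in>PP. sqrt (lenI P) * norm (inner_L2 (BHT_avg c QQ \<Phi> (tw P 2) f2 f3) (\<Psi> P))) <= V"
proof -
 have th: "1 \<in> three" "2 \<in> three" "3 \<in> three" by (simp_all add: three_def)
 define h where "h \<alpha> Q = complex_of_real (rs Q) * inner_L2 f2 (\<Phi> \<alpha> 1 Q) * inner_L2 f3 (\<Phi> \<alpha> 2 Q)" for \<alpha> Q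
 define J where "J \<alpha> Q P = (LINT x|lborel. \<Phi> \<alpha> 3 Q x * cnj (\<Psi> P x))" for \<alpha> Q P
 define RQ where "RQ P = {Q\<in>QQ. cc_sub c (tw Q 3) (tw P 2)}" for P
 define ii where "ii P = inner_L2 (BHT_avg c QQ \<Phi> (tw P 2) f2 f3) (\<Psi> P)" for P
 have \<Psi>i: "integrable lborel (\<Psi> P)" if "P \<in> PP" for P
  by (rule decays_integrable[OF wpk_decays[OF wP[OF that]] lP[OF that]]) simp
 have hm: "(\<lambda>\<alpha>. h \<alpha> Q) \<in> borel_measurable borel" if Q: "Q \<in> QQ" for Q
  unfolding h_def using inner_L2_measurable[OF f2(1) mQ[OF Q th(1)]] inner_L2_measurable[OF f3(1) mQ[OF Q th(2)]] by simp
 have hb: "\<exists>M. \<forall>\<alpha>\<in>{0..1}. \<forall>x. norm (h \<alpha> Q * \<Phi> \<alpha> 3 Q x) <= M" if Q: "Q \<in> QQ" for Q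
 proof -
  have r: "0 < rs Q" by (rule rs_pos[OF lQ[OF Q]])
  have "norm (h \<alpha> Q * \<Phi> \<alpha> 3 Q x) <= (rs Q * (4 * B / rs Q) * (4 * B / rs Q)) * (B * rs Q)" if \<alpha>: "\<alpha> \<in> {0..1}" for \<alpha> x
  proof -
   have 1: "norm (inner_L2 f2 (\<Phi> \<alpha> 1 Q)) <= 4 * B / rs Q" using inner_le[OF wQ[OF Q th(1) \<alpha>] _ B lQ[OF Q] f2] r by (simp add: field_simps)
   have 2: "norm (inner_L2 f3 (\<Phi> \<alpha> 2 Q)) <= 4 * B / rs Q" using inner_le[OF wQ[OF Q th(2) \<alpha>] _ B lQ[OF Q] f3] r by (simp add: field_simps)
   have "norm (\<Phi> \<alpha> 3 Q x) <= B * rs Q * chiI Q x ^ 8" using wQ[OF Q th(3) \<alpha>] by (simp add: wpk_def rs_def)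
   also have "... <= B * rs Q * 1"
    using B r chi_nonneg[of "tI Q" x] chi_le1[of "tI Q" x] lQ[OF Q] by (intro mult_left_mono power_le_one) simp_all
   finally have 3: "norm (\<Phi> \<alpha> 3 Q x) <= B * rs Q" by simp
   have "norm (h \<alpha> Q * \<Phi> \<alpha> 3 Q x) = rs Q * norm (inner_L2 f2 (\<Phi> \<alpha> 1 Q)) * norm (inner_L2 f3 (\<Phi> \<alpha> 2 Q)) * norm (\<Phi> \<alpha> 3 Q x)"
    unfolding h_def norm_mult using r by simp
   also have "... <= (rs Q * (4 * B / rs Q) * (4 * B / rs Q)) * (B * rs Q)"
    using r B by (intro mult_mono 1 2 3 mult_nonneg_nonneg order_refl) simp_all
   finally show ?thesis .
  qed
  then show ?thesis by blast
 qed
 obtain M where M: "\<And>Q. Q \<in> QQ ==> \<forall>\<alpha>\<in>{0..1}. \<forall>x. norm (h \<alpha> Q * \<Phi> \<alpha> 3 Q x) <= M Q"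
  using hb by metis
 note fub = fubini_unit[OF hm mQ[OF _ th(3)] M \<Psi>i, folded J_def]
 have finR: "finite (RQ P)" for P using finQ by (simp add: RQ_def)
 have RQ: "Q \<in> QQ" if "Q \<in> RQ P" for Q P using that by (simp add: RQ_def)
 have iiP: "ii P = (LINT \<alpha>:{0..1}|lborel. \<Sum>Q\<in>RQ P. h \<alpha> Q * J \<alpha> Q P)" if P: "P \<in> PP" for P
 proof -
  have avg: "BHT_avg c QQ \<Phi> (tw P 2) f2 f3 x = (\<Sum>Q\<in>RQ P. LINT \<alpha>:{0..1}|lborel. h \<alpha> Q * \<Phi> \<alpha> 3 Q x)" for x
  proof -
   have "BHT_avg c QQ \<Phi> (tw P 2) f2 f3 x = (LINT \<alpha>:{0..1}|lborel. \<Sum>Q\<in>RQ P. h \<alpha> Q * \<Phi> \<alpha> 3 Q x)"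
    by (simp add: BHT_avg_def BHT_def RQ_def h_def rs_def)
   also have "... = (\<Sum>Q\<in>RQ P. LINT \<alpha>:{0..1}|lborel. h \<alpha> Q * \<Phi> \<alpha> 3 Q x)"
    using fub(1)[OF RQ RQ RQ P] by (rule set_lint_sum(1))
   finally show ?thesis .
  qed
  have mm: "(\<lambda>x. (\<Sum>Q\<in>RQ P. LINT \<alpha>:{0..1}|lborel. h \<alpha> Q * \<Phi> \<alpha> 3 Q x) * cnj (\<Psi> P x)) \<in> borel_measurable borel"
  proof (rule borel_measurable_times)
   show "(\<lambda>x. \<Sum>Q\<in>RQ P. LINT \<alpha>:{0..1}|lborel. h \<alpha> Q * \<Phi> \<alpha> 3 Q x) \<in> borel_measurable borel"
    by (rule borel_measurable_sum) (rule fub(3)[OF RQ RQ RQ P])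
   show "(\<lambda>x. cnj (\<Psi> P x)) \<in> borel_measurable borel" using borel_measurable_integrable[OF \<Psi>i[OF P]] by simp
  qed
  have "ii P = (LINT x|lborel. (\<Sum>Q\<in>RQ P. LINT \<alpha>:{0..1}|lborel. h \<alpha> Q * \<Phi> \<alpha> 3 Q x) * cnj (\<Psi> P x))"
   unfolding ii_def inner_L2_def avg by (rule integral_lebesgue_lborel[OF mm])
  also have "... = (LINT x|lborel. (\<Sum>Q\<in>RQ P. (LINT \<alpha>:{0..1}|lborel. h \<alpha> Q * \<Phi> \<alpha> 3 Q x) * cnj (\<Psi> P x)))"
   by (simp only: sum_distrib_right)
  also have "... = (\<Sum>Q\<in>RQ P. LINT x|lborel. (LINT \<alpha>:{0..1}|lborel. h \<alpha> Q * \<Phi> \<alpha> 3 Q x) * cnj (\<Psi> P x))"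
   by (rule Bochner_Integration.integral_sum) (rule fub(2)[OF RQ RQ RQ P])
  also have "... = (\<Sum>Q\<in>RQ P. LINT \<alpha>:{0..1}|lborel. h \<alpha> Q * J \<alpha> Q P)"
   by (intro sum.cong refl fub(5)[OF RQ RQ RQ P])
  also have "... = (LINT \<alpha>:{0..1}|lborel. \<Sum>Q\<in>RQ P. h \<alpha> Q * J \<alpha> Q P)"
   by (rule set_lint_sum(1)[symmetric]) (rule fub(4)[OF RQ RQ RQ P])
  finally show ?thesis .
 qed
 have int1: "set_integrable lborel {0..1} (\<lambda>\<alpha>. \<Sum>Q\<in>RQ P. h \<alpha> Q * J \<alpha> Q P)" if P: "P \<in> PP" for P
  using fub(4)[OF RQ RQ RQ P] unfolding set_integrable_def scaleR_sum_right by (intro Bochner_Integration.integrable_sum)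
 define g where "g P = complex_of_real (sqrt (lenI P)) * cnj (sgn (ii P))" for P
 define \<gamma> where "\<gamma> P = cnj (g P)" for P
 define U where "U \<alpha> = (\<Sum>P\<in>PP. g P * (\<Sum>Q\<in>RQ P. h \<alpha> Q * J \<alpha> Q P))" for \<alpha>
 have gi: "g P * ii P = complex_of_real (sqrt (lenI P) * norm (ii P))" for P
 proof -
  have *: "cnj (sgn z) * z = complex_of_real (norm z)" for z :: complex
  proof (cases "z = 0")
   case False
   have "cnj (sgn z) * z = (z * cnj z) / norm z" by (simp add: sgn_div_norm scaleR_conv_of_real divide_inverse mult_ac)
   also have "z * cnj z = complex_of_real ((norm z)\<^sup>2)" by (simp only: complex_norm_square)
   finally show ?thesis using False by (simp add: power2_eq_square)
  qed simp
  show ?thesis unfolding g_def mult.assoc * of_real_mult ..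
 qed
 have \<gamma>1: "norm (\<gamma> P) * rs P <= 1" if P: "P \<in> PP" for P
 proof -
  define r where "r = sqrt (lenI P)"
  have r0: "0 < r" using lP[OF P] by (simp add: r_def)
  have "lenI P powr (1/2) = r" using lP[OF P] by (simp add: r_def powr_half_sqrt)
  then have rsP: "rs P = 1 / r" using powr_minus_divide[of "lenI P" "1/2"] by (simp add: rs_def)
  have n1: "norm (sgn (ii P)) <= 1" by (simp add: norm_sgn)
  have "norm (\<gamma> P) = r * norm (sgn (ii P))"
   unfolding \<gamma>_def g_def complex_mod_cnj norm_mult norm_of_real using r0 by (simp add: r_def)
  then show ?thesis using r0 n1 unfolding rsP by simp
 qed
 have Uint: "set_integrable lborel {0..1} U"
 proof -
  have "U = (\<lambda>\<alpha>. \<Sum>P\<in>PP. g P * (\<Sum>Q\<in>RQ P. h \<alpha> Q * J \<alpha> Q P))" by (simp add: U_def fun_eq_iff)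
  moreover have "set_integrable lborel {0..1} (\<lambda>\<alpha>. \<Sum>P\<in>PP. g P * (\<Sum>Q\<in>RQ P. h \<alpha> Q * J \<alpha> Q P))"
   by (rule set_lint_sum(2)) (intro set_integrable_mult_right int1)
  ultimately show ?thesis by simp
 qed
 have eqU: "complex_of_real (\<Sum>P\<in>PP. sqrt (lenI P) * norm (ii P)) = (LINT \<alpha>:{0..1}|lborel. U \<alpha>)"
 proof -
  have "complex_of_real (\<Sum>P\<in>PP. sqrt (lenI P) * norm (ii P)) = (\<Sum>P\<in>PP. g P * ii P)" unfolding of_real_sum gi ..
  also have "... = (\<Sum>P\<in>PP. LINT \<alpha>:{0..1}|lborel. g P * (\<Sum>Q\<in>RQ P. h \<alpha> Q * J \<alpha> Q P))"
   by (intro sum.cong refl) (simp only: iiP set_integral_mult_right)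
  also have "... = (LINT \<alpha>:{0..1}|lborel. U \<alpha>)" unfolding U_def
   by (rule set_lint_sum(1)[symmetric]) (intro set_integrable_mult_right int1)
  finally show ?thesis .
 qed
 have Ub: "norm (U \<alpha>) <= V" if \<alpha>: "\<alpha> \<in> {0..1}" for \<alpha>
 proof -
  define PQ where "PQ Q = {P\<in>PP. cc_sub c (tw Q 3) (tw P 2)}" for Q
  let ?z = "\<lambda>Q. \<Sum>P\<in>PQ Q. \<gamma> P * (LINT x|lborel. \<Psi> P x * cnj (\<Phi> \<alpha> 3 Q x))"
  have J: "J \<alpha> Q P = cnj (LINT x|lborel. \<Psi> P x * cnj (\<Phi> \<alpha> 3 Q x))" for Q P
   unfolding J_def by (simp add: Bochner_Integration.integral_cnj[symmetric] mult.commute)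
  have "U \<alpha> = (\<Sum>P\<in>PP. \<Sum>Q\<in>{Q\<in>QQ. cc_sub c (tw Q 3) (tw P 2)}. g P * (h \<alpha> Q * J \<alpha> Q P))"
   unfolding U_def RQ_def by (simp only: sum_distrib_left)
  also have "... = (\<Sum>Q\<in>QQ. \<Sum>P\<in>PQ Q. g P * (h \<alpha> Q * J \<alpha> Q P))" unfolding PQ_def by (rule sum.swap_restrict[OF finP finQ])
  also have "... = (\<Sum>Q\<in>QQ. h \<alpha> Q * cnj (?z Q))"
  proof (rule sum.cong[OF refl])
   fix Q
   have "(\<Sum>P\<in>PQ Q. g P * (h \<alpha> Q * J \<alpha> Q P)) = h \<alpha> Q * (\<Sum>P\<in>PQ Q. g P * J \<alpha> Q P)"
    by (simp only: sum_distrib_left mult_ac)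
   also have "(\<Sum>P\<in>PQ Q. g P * J \<alpha> Q P) = cnj (?z Q)"
    unfolding cnj_sum complex_cnj_mult J \<gamma>_def complex_cnj_cnj ..
   finally show "(\<Sum>P\<in>PQ Q. g P * (h \<alpha> Q * J \<alpha> Q P)) = h \<alpha> Q * cnj (?z Q)" .
  qed
  finally have "norm (U \<alpha>) <= (\<Sum>Q\<in>QQ. norm (h \<alpha> Q * cnj (?z Q)))"
   by (simp only: norm_sum)
  also have "... = (\<Sum>Q\<in>QQ. rs Q * (norm (inner_L2 f2 (\<Phi> \<alpha> 1 Q)) * norm (inner_L2 f3 (\<Phi> \<alpha> 2 Q)) *
     norm (?z Q)))"
  proof (rule sum.cong[OF refl])
   fix Q assume Q: "Q \<in> QQ"
   have r: "\<bar>rs Q\<bar> = rs Q" using rs_pos[OF lQ[OF Q]] by simp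
   show "norm (h \<alpha> Q * cnj (?z Q)) =
     rs Q * (norm (inner_L2 f2 (\<Phi> \<alpha> 1 Q)) * norm (inner_L2 f3 (\<Phi> \<alpha> 2 Q)) * norm (?z Q))"
    unfolding h_def norm_mult complex_mod_cnj norm_of_real r by (simp only: mult.assoc)
  qed
  also have "... <= V" unfolding PQ_def by (rule bd[OF \<alpha> \<gamma>1])
  finally show ?thesis .
 qed
 have V0: "0 <= V" using order_trans[OF norm_ge_zero Ub[of 0]] by simp
 have i01: "integrable lborel (\<lambda>\<alpha>::real. indicator {0..1} \<alpha> * V)" by (intro integrable_mult_left integrable_real_indicator) simp_all
 have "(\<Sum>P\<in>PP. sqrt (lenI P) * norm (ii P)) <= norm (LINT \<alpha>:{0..1}|lborel. U \<alpha>)" unfolding eqU[symmetric] norm_of_real by (rule abs_ge_self)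
 also have "... <= (LINT \<alpha>|lborel. norm (indicator {0..1} \<alpha> *\<^sub>R U \<alpha>))" unfolding set_lebesgue_integral_def by (rule integral_norm_bound)
 also have "... <= (LINT \<alpha>|lborel. indicator {0..1::real} \<alpha> * V)"
 proof (rule integral_mono_AE)
  show "integrable lborel (\<lambda>\<alpha>. norm (indicator {0..1} \<alpha> *\<^sub>R U \<alpha>))"
   using Uint unfolding set_integrable_def by (rule integrable_norm)
  have "norm (indicator {0..1} \<alpha> *\<^sub>R U \<alpha>) <= indicator {0..1} \<alpha> * V" for \<alpha> using Ub[of \<alpha>] by (cases "\<alpha> \<in> {0..1}") simp_all
  then show "AE \<alpha> in lborel. norm (indicator {0..1} \<alpha> *\<^sub>R U \<alpha>) <= indicator {0..1} \<alpha> * V" by (intro AE_I2)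
 qed (rule i01)
 also have "... = V" by simp
 finally show ?thesis unfolding ii_def .
qed

lemma tritile_eqI: "tI T = tI T' ==> tw T 1 = tw T' 1 ==> tw T 2 = tw T' 2 ==> tw T 3 = tw T' 3 ==> T = T'"
 by (cases T; cases T') (simp add: tI_def tw_def)

lemma adapted_P_bound:
 assumes T: "is_tritile T" "adapted a1 a2 Gamma_P T" and a: "0 <= a2"
 shows "\<bar>fst (tw T 1) + fst (tw T 2)\<bar> <= (2 * a2 + 4) * (1 / lenI T)" "\<bar>fst (tw T 3)\<bar> <= (a2 + 2) * (1 / lenI T)"
proof -
 define \<omega> where "\<omega> = 1 / lenI T"
 have lt: "is_tile (comp T k)" if "k \<in> three" for k using T(1) that by (auto simp: is_tritile_def three_def)
 have lI: "0 < lenI T" using lt[of 1] in_D_pos[of 0 "tI T"] by (simp add: is_tile_def comp_def three_def)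
 have lw: "lenw T k = \<omega>" if "k \<in> three" for k using lt[OF that] lI by (simp add: is_tile_def comp_def \<omega>_def field_simps)
 have \<omega>: "0 < \<omega>" using lI by (simp add: \<omega>_def)
 have ne: "fcube T \<noteq> {}" unfolding fcube_def using ctr_mem[of "tw T 1"] ctr_mem[of "tw T 2"] ctr_mem[of "tw T 3"] lw \<omega> by (auto simp: three_def)
 have ne2: "Gamma_P \<noteq> {}" by (auto simp: Gamma_P_def)
 have "setdist (fcube T) Gamma_P <= a2 * \<omega>" using T(2) by (simp add: adapted_def \<omega>_def)
 then have "\<not> (a2 + 1) * \<omega> <= setdist (fcube T) Gamma_P" using \<omega> by (simp add: algebra_simps)
 then obtain p q where pq: "p \<in> fcube T" "q \<in> Gamma_P" "dist p q < (a2 + 1) * \<omega>"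
  unfolding le_setdist_iff using ne ne2 by (auto simp: not_le)
 obtain x y z where p: "p = (x, y, z)" by (cases p) auto
 obtain v where q: "q = (- v, v, 0)" using pq(2) by (auto simp: Gamma_P_def)
 have "dist x (- v) <= dist p q" using dist_fst_le[of p q] by (simp add: p q)
 moreover have d: "dist (y, z) (v, 0) <= dist p q" using dist_snd_le[of p q] by (simp add: p q)
 moreover have "dist y v <= dist (y, z) (v, 0)" using dist_fst_le[of "(y, z)" "(v, 0)"] by simp
 moreover have "dist z 0 <= dist (y, z) (v, 0)" using dist_snd_le[of "(y, z)" "(v, 0)"] by simp
 ultimately have ds: "\<bar>x + v\<bar> < (a2 + 1) * \<omega>" "\<bar>y - v\<bar> < (a2 + 1) * \<omega>" "\<bar>z\<bar> < (a2 + 1) * \<omega>"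
  using pq(3) by (simp_all add: dist_real_def)
 have m: "x \<in> setw T 1" "y \<in> setw T 2" "z \<in> setw T 3" using pq(1) by (simp_all add: p fcube_def)
 have e: "(a2 + 1) * \<omega> = a2 * \<omega> + \<omega>" "(2 * a2 + 4) * \<omega> = 2 * (a2 * \<omega>) + 4 * \<omega>" "(a2 + 2) * \<omega> = a2 * \<omega> + 2 * \<omega>" by (simp_all add: algebra_simps)
 have m': "fst (tw T 1) <= x" "x < fst (tw T 1) + \<omega>" "fst (tw T 2) <= y" "y < fst (tw T 2) + \<omega>" "fst (tw T 3) <= z" "z < fst (tw T 3) + \<omega>"
  using m lw unfolding mem_iv by (simp_all add: three_def)
 show "\<bar>fst (tw T 1) + fst (tw T 2)\<bar> <= (2 * a2 + 4) * (1 / lenI T)" unfolding \<omega>_def[symmetric] using ds m' \<omega> unfolding e abs_less_iff abs_le_iff by linarith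
 show "\<bar>fst (tw T 3)\<bar> <= (a2 + 2) * (1 / lenI T)" unfolding \<omega>_def[symmetric] using ds m' \<omega> unfolding e abs_less_iff abs_le_iff by linarith
qed

lemma multiplicity:
 assumes P: "\<And>T. T \<in> PP ==> is_tritile T" "\<And>T. T \<in> PP ==> adapted a1 a2 Gamma_P T" and sp: "sparse PP" and a: "0 <= a2"
 shows "card {T\<in>PP. comp T 2 = t} <= (2 * nat \<lceil>4 * a2 + 8\<rceil> + 1)\<^sup>2"
proof (cases "{T\<in>PP. comp T 2 = t} = {}")
 case False
 then obtain T0 where T0: "T0 \<in> PP" "comp T0 2 = t" by blast
 define N where "N = \<lceil>4 * a2 + 8\<rceil>"
 have N0: "0 <= N" unfolding N_def using a by simp
 define \<omega> where "\<omega> = 1 / lenI T0"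
 have lt: "is_tile (comp T k)" if "T \<in> PP" "k \<in> three" for k T using P(1)[OF that(1)] that(2) by (auto simp: is_tritile_def three_def)
 have lI: "0 < lenI T" if "T \<in> PP" for T using lt[OF that, of 1] in_D_pos[of 0 "tI T"] by (simp add: is_tile_def comp_def three_def)
 have \<omega>: "0 < \<omega>" using lI[OF T0(1)] by (simp add: \<omega>_def)
 have same: "tI T = tI T0" "tw T 2 = tw T0 2" if "T \<in> {T\<in>PP. comp T 2 = t}" for T using that T0 unfolding comp_def by auto
 have lw: "lenw T k = \<omega>" if T: "T \<in> {T\<in>PP. comp T 2 = t}" and k: "k \<in> three" for T k
 proof -
  have "T \<in> PP" using T by simp
  then have "lenI T * lenw T k = 1" using lt[OF _ k] by (simp add: is_tile_def comp_def)
  then show ?thesis unfolding same(1)[OF T] \<omega>_def using lI[OF T0(1)] by (simp add: field_simps)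
 qed
 have T0': "T0 \<in> {T\<in>PP. comp T 2 = t}" using T0 by simp
 have z: "\<exists>z. fst (tw T k) = fst (tw T0 k) + \<omega> * real_of_int z \<and> \<bar>z\<bar> <= N" if T: "T \<in> {T\<in>PP. comp T 2 = t}" and k: "k \<in> {1, 3}" for T k
 proof -
  have k3: "k \<in> three" using k by (auto simp: three_def)
  have TP: "T \<in> PP" using T by simp
  obtain \<sigma> where \<sigma>: "\<sigma> \<in> shifts" "\<And>T. T \<in> PP ==> in_D \<sigma> (tw T k)" using sp k3 unfolding sparse_def three_def by blast
  have le: "lenw T0 k <= lenw T k" using lw[OF T k3] lw[OF T0' k3] by simp
  obtain z and n :: nat where "fst (tw T k) = fst (tw T0 k) + lenw T0 k * real_of_int z"
   using grid_rel[OF \<sigma>(1) \<sigma>(2)[OF T0(1)] \<sigma>(2)[OF TP] le] by metis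
  then have z: "fst (tw T k) = fst (tw T0 k) + \<omega> * real_of_int z" using lw[OF T0' k3] by simp
  have b: "\<bar>fst (tw T 1) + fst (tw T0 2)\<bar> <= (2 * a2 + 4) * \<omega>" "\<bar>fst (tw T 3)\<bar> <= (a2 + 2) * \<omega>"
   using adapted_P_bound[OF P(1)[OF TP] P(2)[OF TP] a] same[OF T] by (simp_all add: \<omega>_def)
  have b0: "\<bar>fst (tw T0 1) + fst (tw T0 2)\<bar> <= (2 * a2 + 4) * \<omega>" "\<bar>fst (tw T0 3)\<bar> <= (a2 + 2) * \<omega>"
   using adapted_P_bound[OF P(1)[OF T0(1)] P(2)[OF T0(1)] a] by (simp_all add: \<omega>_def)
  have e: "(2 * a2 + 4) * \<omega> = 2 * (a2 * \<omega>) + 4 * \<omega>" "(a2 + 2) * \<omega> = a2 * \<omega> + 2 * \<omega>" "(4 * a2 + 8) * \<omega> = 4 * (a2 * \<omega>) + 8 * \<omega>" by (simp_all add: algebra_simps)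
  have aw: "0 <= a2 * \<omega>" using a \<omega> by simp
  have "\<bar>fst (tw T k) - fst (tw T0 k)\<bar> <= (4 * a2 + 8) * \<omega>"
  proof (cases "k = 1")
   case True
   then show ?thesis using b(1) b0(1) aw \<omega> unfolding True e abs_le_iff by linarith
  next
   case False
   then have k: "k = 3" using k by simp
   show ?thesis using b(2) b0(2) aw \<omega> unfolding k e abs_le_iff by linarith
  qed
  then have "\<omega> * \<bar>real_of_int z\<bar> <= \<omega> * (4 * a2 + 8)" unfolding z using \<omega> by (simp add: abs_mult mult.commute)
  then have "\<bar>real_of_int z\<bar> <= 4 * a2 + 8" using \<omega> by (simp only: mult_le_cancel_left_pos)
  then have "\<bar>real_of_int z\<bar> <= real_of_int N" unfolding N_def using le_of_int_ceiling[of "4 * a2 + 8"] by linarith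
  then have "\<bar>z\<bar> <= N" by linarith
  then show ?thesis using z by blast
 qed
 define f where "f k T = (SOME z. fst (tw T k) = fst (tw T0 k) + \<omega> * real_of_int z \<and> \<bar>z\<bar> <= N)" for k T
 have f: "fst (tw T k) = fst (tw T0 k) + \<omega> * real_of_int (f k T)" "\<bar>f k T\<bar> <= N" if "T \<in> {T\<in>PP. comp T 2 = t}" "k \<in> {1, 3}" for T k
  using someI_ex[OF z[OF that]] unfolding f_def by blast+
 have "card {T\<in>PP. comp T 2 = t} <= card ({-N..N} \<times> {-N..N})"
 proof (rule card_inj_on_le)
  show "inj_on (\<lambda>T. (f 1 T, f 3 T)) {T\<in>PP. comp T 2 = t}"
  proof (rule inj_onI)
   fix T T' assume T: "T \<in> {T\<in>PP. comp T 2 = t}" and T': "T' \<in> {T\<in>PP. comp T 2 = t}" and e: "(f 1 T, f 3 T) = (f 1 T', f 3 T')"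
   have w: "tw T k = tw T' k" if k: "k \<in> {1, 3}" for k
   proof (rule ivl_eqI)
    have k3: "k \<in> three" using k by (auto simp: three_def)
    have "f k T = f k T'" using e k by auto
    then show "fst (tw T k) = fst (tw T' k)" using f(1)[OF T k] f(1)[OF T' k] by simp
    show "lenw T k = lenw T' k" using lw[OF T k3] lw[OF T' k3] by simp
   qed
   show "T = T'" using same[OF T] same[OF T'] w by (intro tritile_eqI) simp_all
  qed
  show "(\<lambda>T. (f 1 T, f 3 T)) ` {T\<in>PP. comp T 2 = t} \<subseteq> {-N..N} \<times> {-N..N}"
  proof (rule image_subsetI)
   fix T assume T: "T \<in> {T\<in>PP. comp T 2 = t}"
   show "(f 1 T, f 3 T) \<in> {-N..N} \<times> {-N..N}" using f(2)[OF T, of 1] f(2)[OF T, of 3] by (simp add: abs_le_iff)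
  qed
 qed simp
 also have "... = (2 * nat N + 1)\<^sup>2"
 proof -
  have "nat (N - - N + 1) = 2 * nat N + 1" using N0 by simp
  then show ?thesis unfolding card_cartesian_product card_atLeastAtMost_int power2_eq_square by (simp add: algebra_simps)
 qed
 finally show ?thesis unfolding N_def .
next
 case True
 show ?thesis unfolding True by simp
qed

lemma rank1_subset: "rank1 A ==> A' \<subseteq> A ==> rank1 A'"
 unfolding rank1_def by (meson subsetD)

lemma sparse_subset: "sparse A ==> A' \<subseteq> A ==> sparse A'"
 unfolding sparse_def by (meson subsetD)

lemma inner_L2_null:
 assumes "E \<in> sets lebesgue" "emeasure lebesgue E < \<infinity>" "measure lebesgue E = 0" "\<And>x. norm (f x) <= indicator E x"
 shows "inner_L2 f g = 0"
proof -
 have "emeasure lebesgue E = 0" using assms(2,3) by (simp add: emeasure_eq_ennreal_measure)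
 then have "E \<in> null_sets lebesgue" using assms(1) by (simp add: null_setsI)
 then have "AE x in lebesgue. x \<notin> E" by (rule AE_not_in)
 then have "AE x in lebesgue. f x * cnj (g x) = 0"
 proof eventually_elim
  case (elim x)
  then show ?case using assms(4)[of x] by simp
 qed
 then show ?thesis unfolding inner_L2_def by (rule integral_eq_zero_AE)
qed

lemma representatives:
 assumes fin: "finite A" and l: "\<And>T. T \<in> A ==> 0 <= lenI T" and M: "\<And>t. card {T\<in>A. comp T i = t} <= M"
 shows "\<exists>A'\<subseteq>A. inj_on (\<lambda>T. comp T i) A' \<and> (A' = {} \<longrightarrow> A = {}) \<and> (\<Sum>T\<in>A. lenI T) <= real M * (\<Sum>T\<in>A'. lenI T)"
proof -
 define f where "f = (\<lambda>T. comp T i)"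
 have ff: "fst (f T) = tI T" for T by (simp add: f_def comp_def)
 obtain A' where A': "A' \<subseteq> A" "inj_on f A'" "f ` A = f ` A'" using subset_image_inj[of "f ` A" f A] by blast
 have "(\<Sum>T\<in>A. lenI T) = (\<Sum>t\<in>f ` A. \<Sum>T\<in>{T\<in>A. f T = t}. lenI T)" by (rule sum.image_gen[OF fin])
 also have "... = (\<Sum>t\<in>f ` A. real (card {T\<in>A. f T = t}) * len (fst t))"
 proof (rule sum.cong[OF refl])
  fix t
  have "(\<Sum>T\<in>{T\<in>A. f T = t}. lenI T) = (\<Sum>T\<in>{T\<in>A. f T = t}. len (fst t))"
   by (rule sum.cong[OF refl]) (use ff in force)
  then show "(\<Sum>T\<in>{T\<in>A. f T = t}. lenI T) = real (card {T\<in>A. f T = t}) * len (fst t)" by simp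
 qed
 also have "... <= (\<Sum>t\<in>f ` A. real M * len (fst t))"
 proof (rule sum_mono)
  fix t assume "t \<in> f ` A"
  then have "0 <= len (fst t)" using l ff by force
  then show "real (card {T\<in>A. f T = t}) * len (fst t) <= real M * len (fst t)"
   using M[of t] unfolding f_def by (intro mult_right_mono) simp_all
 qed
 also have "... = real M * (\<Sum>t\<in>f ` A'. len (fst t))" by (simp only: sum_distrib_left A'(3))
 also have "(\<Sum>t\<in>f ` A'. len (fst t)) = (\<Sum>T\<in>A'. lenI T)" using sum.reindex[OF A'(2), of "\<lambda>t. len (fst t)"] by (simp add: ff)
 finally show ?thesis using A' unfolding f_def by blast
qed

lemma family_disjoint_tiles:
 assumes fin: "finite A" and t: "\<And>T. T \<in> A ==> is_tritile T" and sp: "sparse A" and inj: "inj_on (\<lambda>T. comp T 2) A"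
  and dj: "\<And>T T'. T \<in> A ==> T' \<in> A ==> comp T 2 \<noteq> comp T' 2 ==>
   (setI T \<times> setw T 2) \<inter> (setI T' \<times> setw T' 2) = {}"
 shows "family 2 A (\<lambda>P. P)"
 unfolding family_def
proof (intro conjI ballI impI)
 have tl: "is_tile (comp T 2)" if "T \<in> A" for T using t[OF that] unfolding is_tritile_def by blast
 show "finite A" by fact
 show "\<exists>\<sigma>\<in>shifts. \<forall>Q\<in>A. in_D \<sigma> (tw Q 2)" using sp unfolding sparse_def by blast
 show "inj_on (\<lambda>Q. comp Q 2) A" by fact
 fix Q assume Q: "Q \<in> A"
 show d: "in_D 0 (tI Q)" and d': "in_D 0 (tI Q)" and lw: "lenI Q * lenw Q 2 = 1" using tl[OF Q] by (simp_all add: is_tile_def comp_def)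
 show "setI Q \<subseteq> setI Q" by simp
 fix Q' assume Q': "Q' \<in> A"
 show "Q = Q'" if "Q = Q' \<and> tI Q = tI Q'" using that by blast
 show "setI Q' \<inter> setI Q = {}" if s: "setw Q 2 \<subset> setw Q' 2"
 proof -
  have lI: "0 < lenI Q" using in_D_pos[OF d] .
  have "0 < lenI Q * lenw Q 2" unfolding lw by simp
  then have "0 < lenw Q 2" using lI by (simp add: zero_less_mult_iff)
  then have "ctrw Q 2 \<in> setw Q 2 \<inter> setw Q' 2" using ctr_mem s by blast
  moreover have "comp Q 2 \<noteq> comp Q' 2" using s by (auto simp: comp_def)
  ultimately show ?thesis using dj[OF Q Q'] by blast
 qed
qed

lemma solve_power:
 fixes S X K :: real
 assumes "0 < S" "0 < K" "0 <= X" "0 < \<epsilon>" "\<epsilon> < 1" and h: "2 powr (- b - 1) * S <= K * (X powr ((1 - \<epsilon>) / 2) * S powr \<epsilon>)"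
 shows "S <= (2 * K) powr (1 / (1 - \<epsilon>)) * 2 powr (b / (1 - \<epsilon>)) * sqrt X"
proof -
 have Se: "S = S powr (1 - \<epsilon>) * S powr \<epsilon>" using assms(1) by (simp add: powr_add[symmetric])
 have pe: "0 < S powr \<epsilon>" using assms(1) by simp
 have "(2 powr (- b - 1) * S powr (1 - \<epsilon>)) * S powr \<epsilon> <= (K * X powr ((1 - \<epsilon>) / 2)) * S powr \<epsilon>"
  using h Se by (simp only: mult.assoc)
 then have a: "2 powr (- b - 1) * S powr (1 - \<epsilon>) <= K * X powr ((1 - \<epsilon>) / 2)" using pe by (simp only: mult_le_cancel_right_pos)
 have b: "2 powr (b + 1) * 2 powr (- b - 1) = (1::real)" by (simp add: powr_add[symmetric])
 have "S powr (1 - \<epsilon>) = 2 powr (b + 1) * (2 powr (- b - 1) * S powr (1 - \<epsilon>))" unfolding mult.assoc[symmetric] b by simp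
 also have "... <= 2 powr (b + 1) * (K * X powr ((1 - \<epsilon>) / 2))" by (rule mult_left_mono[OF a]) simp
 also have "... = (2 * K) * 2 powr b * X powr ((1 - \<epsilon>) / 2)" by (simp add: powr_add)
 finally have "(S powr (1 - \<epsilon>)) powr (1 / (1 - \<epsilon>)) <= ((2 * K) * 2 powr b * X powr ((1 - \<epsilon>) / 2)) powr (1 / (1 - \<epsilon>))"
  using assms by (intro powr_mono2) simp_all
 also have "... = (2 * K) powr (1 / (1 - \<epsilon>)) * 2 powr (b / (1 - \<epsilon>)) * X powr (1/2)"
 proof -
  have "(1 - \<epsilon>) / 2 * (1 / (1 - \<epsilon>)) = 1 / 2" using assms(5) by (simp add: field_simps)
  then show ?thesis by (simp only: powr_mult powr_powr) simp
 qed
 also have "X powr (1/2) = sqrt X" using assms(3) by (simp add: powr_half_sqrt)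
 also have "(S powr (1 - \<epsilon>)) powr (1 / (1 - \<epsilon>)) = S" using assms by (simp add: powr_powr)
 finally show ?thesis .
qed

definition Kmain :: "(nat => real) => real => real => real" where
 "Kmain Ck c \<epsilon> = \<bar>KF (Bw Ck) c (min \<epsilon> (1 - \<epsilon>) / 2) / (1 - (1/2) powr (1 - \<epsilon> - min \<epsilon> (1 - \<epsilon>) / 2))\<bar> + 1"

lemma Kmain_pos: "0 < Kmain Ck c \<epsilon>" by (simp add: Kmain_def add_nonneg_pos)

lemma restricted_type:
 fixes \<Phi> :: "nat => tritile => real => complex"
 assumes fin: "finite QQ" and tri: "\<And>T. T \<in> QQ ==> is_tritile T" and r1: "rank1 QQ" and sp: "sparse QQ"
  and famP: "family 2 PP (\<lambda>P. P)" and PP0: "PP \<noteq> {}"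
  and wpQ: "\<And>T k. T \<in> QQ ==> k \<in> three ==> wave_packet K L Ck (comp T k) (\<Phi> k T)"
  and wpP: "\<And>P. P \<in> PP ==> wave_packet K L Ck (comp P 2) (\<Psi> P)"
  and par: "1 <= K" "8 <= L" "0 < c" "c <= 1 / 10^9"
  and \<gamma>1: "\<And>P. P \<in> PP ==> norm (\<gamma> P) * rs P <= 1"
  and f2: "f2 \<in> borel_measurable lebesgue" "\<And>x. norm (f2 x) <= indicator E2 x"
  and f3: "f3 \<in> borel_measurable lebesgue" "\<And>x. norm (f3 x) <= indicator E3 x"
  and E2: "E2 \<in> sets lebesgue" "emeasure lebesgue E2 < \<infinity>" and E3: "E3 \<in> sets lebesgue" "emeasure lebesgue E3 < \<infinity>"
  and \<epsilon>: "0 < \<epsilon>" "\<epsilon> < 1"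
 shows "(\<Sum>Q\<in>QQ. rs Q * (norm (inner_L2 f2 (\<Phi> 1 Q)) * norm (inner_L2 f3 (\<Phi> 2 Q)) *
   norm (\<Sum>P\<in>{P\<in>PP. cc_sub c (tw Q 3) (tw P 2)}. \<gamma> P * (LINT x|lborel. \<Psi> P x * cnj (\<Phi> 3 Q x)))))
  <= Kmain Ck c \<epsilon> * ((measure lebesgue E2 * measure lebesgue E3) powr ((1 - \<epsilon>) / 2) * (\<Sum>P\<in>PP. lenI P) powr \<epsilon>)"
  (is "?lhs <= ?rhs")
proof (cases "measure lebesgue E2 = 0 \<or> measure lebesgue E3 = 0")
 case True
 then have "inner_L2 f2 (\<Phi> 1 Q) = 0 \<or> inner_L2 f3 (\<Phi> 2 Q) = 0" for Q
  using inner_L2_null[OF E2 _ f2(2)] inner_L2_null[OF E3 _ f3(2)] by blast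
 then have "norm (inner_L2 f2 (\<Phi> 1 Q)) * norm (inner_L2 f3 (\<Phi> 2 Q)) = 0" for Q by simp
 then have "?lhs = 0" by (intro sum.neutral ballI) (simp only: mult_zero_left mult_zero_right)
 moreover have "0 <= ?rhs" using Kmain_pos[of Ck c \<epsilon>] by simp
 ultimately show ?thesis by simp
next
 case False
 define F where "F = (\<lambda>i::nat. if i = 1 then f2 else f3)"
 define E where "E = (\<lambda>i::nat. if i = 1 then E2 else E3)"
 interpret R: rank1_coll QQ by (unfold_locales) (fact fin tri r1 sp)+
 interpret A: pairing QQ F E \<Phi> PP \<Psi> \<gamma> K L Ck c
 proof
  fix i :: nat assume "i \<in> {1, 2}"
  show "F i \<in> borel_measurable lebesgue" "E i \<in> sets lebesgue" "emeasure lebesgue (E i) < \<infinity>" "norm (F i x) <= indicator (E i) x" for x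
   using f2 f3 E2 E3 by (simp_all add: F_def E_def)
 qed (fact famP PP0 wpQ wpP par \<gamma>1)+
 define t where "t = min \<epsilon> (1 - \<epsilon>) / 2"
 have t: "0 < t" "t <= 1/4" "t <= \<epsilon>" "\<epsilon> + t < 1" using \<epsilon> unfolding t_def min_def by (simp_all add: field_simps)
 interpret M: model_pair "{}" "\<lambda>P. P" "\<Phi> 3" PP \<Psi> \<gamma> "Bw Ck" 8 c
  by (rule A.model) (use zero_shift in \<open>auto simp: family_def\<close>)
 have co: "A.co 1 Q = norm (inner_L2 f2 (\<Phi> 1 Q))" "A.co 2 Q = norm (inner_L2 f3 (\<Phi> 2 Q))"
  "A.co 3 Q = norm (\<Sum>P\<in>{P\<in>PP. cc_sub c (tw Q 3) (tw P 2)}. \<gamma> P * (LINT x|lborel. \<Psi> P x * cnj (\<Phi> 3 Q x)))" for Q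
  unfolding A.co_def A.bq_def M.bc_def M.rel_def M.ip_def by (simp_all add: F_def)
 have "?lhs = R.Lam A.co QQ" unfolding R.Lam_def co ..
 also have "... <= KF (Bw Ck) c t / (1 - (1/2) powr (1 - \<epsilon> - t)) * ((measure lebesgue (E 1) * measure lebesgue (E 2)) powr ((1 - \<epsilon>) / 2) * A.S powr \<epsilon>)"
 proof (rule A.Lam_total[OF _ t])
  fix i :: nat assume "i \<in> {1, 2}"
  show "0 < measure lebesgue (E i)" using False by (simp add: E_def less_le)
 qed
 also have "... <= Kmain Ck c \<epsilon> * ((measure lebesgue (E 1) * measure lebesgue (E 2)) powr ((1 - \<epsilon>) / 2) * A.S powr \<epsilon>)"
 proof (rule mult_right_mono)
  have "x <= \<bar>x\<bar> + 1" for x :: real by simp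
  then show "KF (Bw Ck) c t / (1 - (1/2) powr (1 - \<epsilon> - t)) <= Kmain Ck c \<epsilon>" unfolding Kmain_def t_def .
 qed simp
 finally show ?thesis by (simp add: E_def A.S_def)
qed

definition Cmain :: "(nat => real) => real => real => real => real" where
 "Cmain Ck c a2 \<epsilon> = real ((2 * nat \<lceil>4 * a2 + 8\<rceil> + 1)\<^sup>2) * (2 * Kmain Ck c \<epsilon>) powr (1 / (1 - \<epsilon>))"

lemma level_set_bound:
 fixes PhiQ :: "real => nat => tritile => real => complex" and b :: int and c :: real
 assumes K: "1 <= K" and L: "8 <= L" and c: "0 < c" "c <= 1 / 10^9" and a: "0 < a1" "a1 <= a2" and \<epsilon>: "0 < \<epsilon>" "\<epsilon> < 1"
  and E2: "E2 \<in> sets lebesgue" "emeasure lebesgue E2 < \<infinity>" and E3: "E3 \<in> sets lebesgue" "emeasure lebesgue E3 < \<infinity>"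
  and fm: "f2 \<in> borel_measurable lebesgue" "f3 \<in> borel_measurable lebesgue"
  and fE: "\<forall>x. norm (f2 x) <= indicator E2 x" "\<forall>x. norm (f3 x) <= indicator E3 x"
  and P: "finite P" "\<forall>T\<in>P. is_tritile T \<and> adapted a1 a2 Gamma_P T" "sparse P" "\<forall>T\<in>P. wave_packet K L Ck (comp T 2) (Phi0 T)"
  and Q: "finite Q" "\<forall>T\<in>Q. is_tritile T \<and> adapted a1 a2 Gamma_Q T" "rank1 Q" "sparse Q"
   "\<forall>T\<in>Q. \<forall>k\<in>{1,2,3}. \<forall>\<alpha>\<in>{0..1}. wave_packet K L Ck (comp T k) (PhiQ \<alpha> k T)"
   "\<forall>T\<in>Q. \<forall>k\<in>{1,2,3}. (\<lambda>(\<alpha>, x). PhiQ \<alpha> k T x) \<in> borel_measurable borel"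
  and P0: "P0 \<subseteq> P" "\<forall>T\<in>P0. \<forall>T'\<in>P0. comp T 2 \<noteq> comp T' 2 \<longrightarrow>
    (setI T \<times> setw T 2) \<inter> (setI T' \<times> setw T' 2) = {}"
  and Qt: "Qt \<subseteq> Q"
 shows "(\<Sum>T\<in>Pb c Qt PhiQ Phi0 f2 f3 P0 b. lenI T)
  <= Cmain Ck c a2 \<epsilon> * 2 powr (real_of_int b / (1 - \<epsilon>)) * sqrt (measure lebesgue E2) * sqrt (measure lebesgue E3)"
proof -
 define M where "M = (2 * nat \<lceil>4 * a2 + 8\<rceil> + 1)\<^sup>2"
 define KK where "KK = Kmain Ck c \<epsilon>"
 define X where "X = measure lebesgue E2 * measure lebesgue E3"
 define PB where "PB = Pb c Qt PhiQ Phi0 f2 f3 P0 b"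
 have PBs: "PB \<subseteq> P0" "PB \<subseteq> P" using P0(1) unfolding PB_def Pb_def by blast+
 have lP: "0 < lenI T" if "T \<in> P" for T
 proof -
  have "is_tile (comp T 2)" using P(2) that unfolding is_tritile_def by blast
  then show ?thesis using in_D_pos[of 0 "tI T"] by (simp add: is_tile_def comp_def)
 qed
 have lQ: "0 < lenI T" if "T \<in> Q" for T
 proof -
  have "is_tile (comp T 2)" using Q(2) that unfolding is_tritile_def by blast
  then show ?thesis using in_D_pos[of 0 "tI T"] by (simp add: is_tile_def comp_def)
 qed
 have cd: "card {T\<in>PB. comp T 2 = t} <= M" for t
  unfolding M_def
 proof (rule multiplicity)
  show "sparse PB" by (rule sparse_subset[OF P(3) PBs(2)])
  show "is_tritile T" "adapted a1 a2 Gamma_P T" if "T \<in> PB" for T using that P(2) PBs(2) by blast+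
 qed (use a in simp)
 have "\<exists>PP\<subseteq>PB. inj_on (\<lambda>T. comp T 2) PP \<and> (PP = {} \<longrightarrow> PB = {}) \<and> (\<Sum>T\<in>PB. lenI T) <= real M * (\<Sum>T\<in>PP. lenI T)"
 proof (rule representatives)
  show "finite PB" using P(1) PBs(2) by (rule finite_subset[rotated])
  show "0 <= lenI T" if "T \<in> PB" for T using lP[OF subsetD[OF PBs(2) that]] by simp
 qed (rule cd)
 then obtain PP where PP: "PP \<subseteq> PB" "inj_on (\<lambda>T. comp T 2) PP" "PP = {} \<longrightarrow> PB = {}" "(\<Sum>T\<in>PB. lenI T) <= real M * (\<Sum>T\<in>PP. lenI T)"
  by (elim exE conjE)
 have PPP: "PP \<subseteq> P" "PP \<subseteq> P0" using PP(1) PBs by blast+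
 define S where "S = (\<Sum>T\<in>PP. lenI T)"
 have "S <= (2 * KK) powr (1 / (1 - \<epsilon>)) * 2 powr (real_of_int b / (1 - \<epsilon>)) * sqrt X"
 proof (cases "PP = {}")
  case True
  then show ?thesis by (simp add: S_def X_def)
 next
  case False
  have finPP: "finite PP" using P(1) PPP(1) by (rule finite_subset[rotated])
  have finQ: "finite Qt" using Q(1) Qt by (rule finite_subset[rotated])
  have famP: "family 2 PP (\<lambda>P. P)"
  proof (rule family_disjoint_tiles[OF finPP _ sparse_subset[OF P(3) PPP(1)] PP(2)])
   show "is_tritile T" if "T \<in> PP" for T using P(2) subsetD[OF PPP(1) that] by simp
   show "(setI T \<times> setw T 2) \<inter> (setI T' \<times> setw T' 2) = {}"
    if "T \<in> PP" "T' \<in> PP" "comp T 2 \<noteq> comp T' 2" for T T'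
    using P0(2) subsetD[OF PPP(2) that(1)] subsetD[OF PPP(2) that(2)] that(3) by simp
  qed
  have lPP: "0 < lenI T" if "T \<in> PP" for T by (rule lP[OF subsetD[OF PPP(1) that]])
  have S0: "0 < S" unfolding S_def using finPP False lPP by (rule sum_pos)
  have f1: "norm (f2 x) <= 1" "norm (f3 x) <= 1" for x
   by (rule order_trans[OF fE(1)[rule_format] indicator_le_1], rule order_trans[OF fE(2)[rule_format] indicator_le_1])
  have wp: "wave_packet K L Ck (comp T k) (PhiQ \<alpha> k T)" if "T \<in> Qt" "k \<in> three" "\<alpha> \<in> {0..1}" for T k \<alpha>
   using Q(5) subsetD[OF Qt that(1)] that(2,3) unfolding three_def by blast
  define V where "V = KK * (X powr ((1 - \<epsilon>) / 2) * S powr \<epsilon>)"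
  have V: "(\<Sum>P\<in>PP. sqrt (lenI P) * norm (inner_L2 (BHT_avg c Qt PhiQ (tw P 2) f2 f3) (Phi0 P))) <= V"
  proof (rule duality_bound[OF finPP finQ lPP _ Bw_ge(1)[of Ck] _ _ _ fm(1) f1(1) fm(2) f1(2)])
   show "0 < lenI T" if "T \<in> Qt" for T by (rule lQ[OF subsetD[OF Qt that]])
   show "wpk (Bw Ck) 8 (tI T) (tw T k) (PhiQ \<alpha> k T)" if "T \<in> Qt" "k \<in> three" "\<alpha> \<in> {0..1}" for T k \<alpha>
    using wave_packet_wpk[OF wp[OF that, unfolded comp_def] K L lQ[OF subsetD[OF Qt that(1)]]]
    by (rule wpk_mono[OF _ Bw_ge(2) lQ[OF subsetD[OF Qt that(1)]]])
   show "(\<lambda>(\<alpha>, x). PhiQ \<alpha> k T x) \<in> borel_measurable borel" if "T \<in> Qt" "k \<in> three" for T k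
    using Q(6) subsetD[OF Qt that(1)] that(2) unfolding three_def by blast
   show "wpk (Bw Ck) 8 (tI T) (tw T 2) (Phi0 T)" if "T \<in> PP" for T
   proof -
    have "wave_packet K L Ck (tI T, tw T 2) (Phi0 T)" using P(4) subsetD[OF PPP(1) that] unfolding comp_def by simp
    from wave_packet_wpk[OF this K L lPP[OF that]] show ?thesis by (rule wpk_mono[OF _ Bw_ge(2) lPP[OF that]])
   qed
   fix \<alpha> :: real and \<gamma> :: "tritile => complex"
   assume \<alpha>: "\<alpha> \<in> {0..1}" and \<gamma>: "\<And>P. P \<in> PP ==> norm (\<gamma> P) * rs P <= 1"
   show "(\<Sum>Q\<in>Qt. rs Q * (norm (inner_L2 f2 (PhiQ \<alpha> 1 Q)) * norm (inner_L2 f3 (PhiQ \<alpha> 2 Q)) *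
    norm (\<Sum>P\<in>{P\<in>PP. cc_sub c (tw Q 3) (tw P 2)}. \<gamma> P * (LINT x|lborel. Phi0 P x * cnj (PhiQ \<alpha> 3 Q x))))) <= V"
    unfolding V_def KK_def X_def S_def
   proof (rule restricted_type[where \<Phi> = "PhiQ \<alpha>" and K = K and L = L])
    show "is_tritile T" if "T \<in> Qt" for T using Q(2) subsetD[OF Qt that] by simp
    show "rank1 Qt" "sparse Qt" by (rule rank1_subset[OF Q(3) Qt], rule sparse_subset[OF Q(4) Qt])
    show "wave_packet K L Ck (comp T 2) (Phi0 T)" if "T \<in> PP" for T using P(4) subsetD[OF PPP(1) that] by simp
    show "wave_packet K L Ck (comp T k) (PhiQ \<alpha> k T)" if "T \<in> Qt" "k \<in> three" for T k by (rule wp[OF that \<alpha>])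
   qed (use finQ famP False K L c \<gamma> fm fE E2 E3 \<epsilon> in simp_all)
  qed
  have "2 powr (- real_of_int b - 1) * S <= V"
  proof -
   have "2 powr (- real_of_int b - 1) * S = (\<Sum>T\<in>PP. 2 powr (- real_of_int b - 1) * lenI T)" unfolding S_def by (rule sum_distrib_left)
   also have "... <= (\<Sum>P\<in>PP. sqrt (lenI P) * norm (inner_L2 (BHT_avg c Qt PhiQ (tw P 2) f2 f3) (Phi0 P)))"
   proof (rule sum_mono)
    fix T assume T: "T \<in> PP"
    define r where "r = sqrt (lenI T)"
    define n where "n = norm (inner_L2 (BHT_avg c Qt PhiQ (tw T 2) f2 f3) (Phi0 T))"
    have r0: "0 < r" and rr: "lenI T = r * r" using lPP[OF T] by (simp_all add: r_def)
    have "lenI T powr (1/2) = r" using lPP[OF T] by (simp add: r_def powr_half_sqrt)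
    then have rr': "lenI T powr (- 1/2) = 1 / r" using powr_minus_divide[of "lenI T" "1/2"] by simp
    have "T \<in> PB" using T PP(1) by blast
    then have "2 powr (- real_of_int b - 1) < lenI T powr (- 1/2) * n" by (simp add: PB_def Pb_def Let_def n_def)
    then have "2 powr (- real_of_int b - 1) * (r * r) <= 1 / r * n * (r * r)" unfolding rr' using r0 by (intro mult_right_mono) simp_all
    then show "2 powr (- real_of_int b - 1) * lenI T <= sqrt (lenI T) * norm (inner_L2 (BHT_avg c Qt PhiQ (tw T 2) f2 f3) (Phi0 T))"
     unfolding r_def[symmetric] n_def[symmetric] unfolding rr using r0 by (simp add: mult.commute)
   qed
   also have "... <= V" by (rule V)
   finally show ?thesis .
  qed
  then show ?thesis unfolding V_def using S0 \<epsilon> Kmain_pos[of Ck c \<epsilon>]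
   by (intro solve_power) (simp_all add: KK_def X_def)
 qed
 then have "real M * S <= real M * ((2 * KK) powr (1 / (1 - \<epsilon>)) * 2 powr (real_of_int b / (1 - \<epsilon>)) * sqrt X)"
  by (rule mult_left_mono) simp
 then have "(\<Sum>T\<in>PB. lenI T) <= real M * ((2 * KK) powr (1 / (1 - \<epsilon>)) * 2 powr (real_of_int b / (1 - \<epsilon>)) * sqrt X)"
  using PP(4) unfolding S_def by linarith
 then show ?thesis unfolding Cmain_def M_def[symmetric] KK_def[symmetric] PB_def X_def real_sqrt_mult by (simp only: mult.assoc)
qed

theorem theorem4:
  "\<exists>K0 L0 :: nat. \<exists>c0 > 0. \<forall>K \<ge> K0. \<forall>L \<ge> L0. \<forall>c. 0 < c \<and> c \<le> c0 \<longrightarrow>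
   (\<forall>(Ck :: nat \<Rightarrow> real) (a1 :: real) (a2 :: real). 0 < a1 \<and> a1 \<le> a2 \<longrightarrow>
   (\<forall>\<epsilon> :: real. 0 < \<epsilon> \<and> \<epsilon> < 1 \<longrightarrow>
   (\<exists>C :: real. \<forall>(b :: int) (E2 :: real set) (E3 :: real set)
        (f2 :: real \<Rightarrow> complex) (f3 :: real \<Rightarrow> complex)
        (P :: tritile set) (Q :: tritile set) (P0 :: tritile set) (Qt :: tritile set)
        (Phi0 :: tritile \<Rightarrow> real \<Rightarrow> complex)
        (PhiQ :: real \<Rightarrow> nat \<Rightarrow> tritile \<Rightarrow> real \<Rightarrow> complex).
      E2 \<in> sets lebesgue \<and> emeasure lebesgue E2 < \<infinity> \<and>
      E3 \<in> sets lebesgue \<and> emeasure lebesgue E3 < \<infinity> \<and>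
      f2 \<in> borel_measurable lebesgue \<and> f3 \<in> borel_measurable lebesgue \<and>
      (\<forall>x. norm (f2 x) \<le> indicator E2 x) \<and> (\<forall>x. norm (f3 x) \<le> indicator E3 x) \<and>
      finite P \<and> (\<forall>T\<in>P. is_tritile T \<and> adapted a1 a2 Gamma_P T) \<and> sparse P \<and>
      (\<forall>T\<in>P. wave_packet K L Ck (comp T 2) (Phi0 T)) \<and>
      finite Q \<and> (\<forall>T\<in>Q. is_tritile T \<and> adapted a1 a2 Gamma_Q T) \<and> rank1 Q \<and> sparse Q \<and>
      (\<forall>T\<in>Q. \<forall>k\<in>{1,2,3}. \<forall>\<alpha>\<in>{0..1}. wave_packet K L Ck (comp T k) (PhiQ \<alpha> k T)) \<and>
      (\<forall>T\<in>Q. \<forall>k\<in>{1,2,3}. (\<lambda>(\<alpha>, x). PhiQ \<alpha> k T x) \<in> borel_measurable borel) \<and>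
      P0 \<subseteq> P \<and>
      (\<forall>T\<in>P0. \<forall>T'\<in>P0. comp T 2 \<noteq> comp T' 2 \<longrightarrow>
          (ivl_set (tI T) \<times> ivl_set (tw T 2)) \<inter> (ivl_set (tI T') \<times> ivl_set (tw T' 2)) = {}) \<and>
      Qt \<subseteq> Q
      \<longrightarrow>
      (\<Sum>T\<in>Pb c Qt PhiQ Phi0 f2 f3 P0 b. len (tI T))
        \<le> C * 2 powr (real_of_int b / (1 - \<epsilon>))
            * sqrt (measure lebesgue E2) * sqrt (measure lebesgue E3))))"
  apply (rule exI[of _ 1], rule exI[of _ 8], rule exI[of _ "1 / 10^9"], intro conjI allI impI)
   apply simp
  subgoal for K L c Ck a1 a2 \<epsilon>
    by (rule exI[of _ "Cmain Ck c a2 \<epsilon>"], intro allI impI, elim conjE, rule level_set_bound[of K L c a1 a2]; assumption)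
  done

end
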